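(* Let $\mu\in\mathbf{C}$. For any complex $\nu_1,\nu_2$ such that $\nu_2\notin(-\infty,0]\cup[2,+\infty)$ there exists a sufficiently small $0<r<1$ such that $PVI_\mu$ has a solution of the form $$y(x)=\wp\bigl(\nu_1\omega_1(x)+\nu_2\omega_2(x)+v(x);\omega_1(x),\omega_2(x)\bigr)+\frac{1+x}{3}$$ in the domain $$\mathcal{D}(r;\nu_1,\nu_2)=\left\{x\in\widetilde{\mathbf{C}_0}:\ |x|<r,\ \left|\frac{e^{-i\pi\nu_1}}{16^{2-\nu_2}}x^{2-\nu_2}\right|<r,\ \left|\frac{e^{i\pi\nu_1}}{16^{\nu_2}}x^{\nu_2}\right|<r\right\}.$$ The function $v(x)$ is holomorphic in $\mathcal{D}(r;\nu_1,\nu_2)$ and has there the convergent expansion $$v(x)=\sum_{n\ge1}a_nx^n+\sum_{n\ge0,\,m\ge1}b_{nm}x^n\left(\frac{e^{-i\pi\nu_1}}{16^{2-\nu_2}}x^{2-\nu_2}\right)^m+\sum_{n\ge0,\,m\ge1}c_{nm}x^n\left(\frac{e^{i\pi\nu_1}}{16^{\nu_2}}x^{\nu_2}\right)^m,$$ where $a_n,b_{nm},c_{nm}$ are certain rational functions of $\nu_2$. Moreover, there exists a constant $M(\nu_2)$ depending on $\nu_2$ such that $$|v(x)|\le M(\nu_2)\left(|x|+\left|\frac{e^{-i\pi\nu_1}}{16^{2-\nu_2}}x^{2-\nu_2}\right|+\left|\frac{e^{i\pi\nu_1}}{16^{\nu_2}}x^{\nu_2}\right|\right)\quad\text{in }\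mathcal{D}(r;\nu_1,\nu_2).$$
   Context: $PVI_\mu$ is $$\frac{d^2y}{dx^2}=\frac12\left[\frac1y+\frac1{y-1}+\frac1{y-x}\right]\left(\frac{dy}{dx}\right)^2-\left[\frac1x+\frac1{x-1}+\frac1{y-x}\right]\frac{dy}{dx}+\frac12\frac{y(y-1)(y-x)}{x^2(x-1)^2}\left[(2\mu-1)^2+\frac{x(x-1)}{(y-x)^2}\right].$$ $\widetilde{\mathbf{C}_0}$ is the universal covering of $\mathbf{C}\setminus\{0\}$ (so $\ln x=\ln|x|+i\arg x$ with arbitrary real $\arg x$, and $x^c=e^{c\ln x}$). $\wp(z;\omega_1,\omega_2)$ is the Weierstrass elliptic function with half-periods $\omega_1,\omega_2$. For $|x|<1$, $$\omega_1(x)=\frac\pi2F(x),\qquad\omega_2(x)=-\frac i2\bigl[F(x)\ln x+F_1(x)\bigr],$$ $$F(x)=\sum_{n\ge0}\frac{[(\frac12)_n]^2}{(n!)^2}x^n,\qquad F_1(x)=\sum_{n\ge0}\frac{[(\frac12)_n]^2}{(n!)^2}\,2\bigl[\psi(n+\tfrac12)-\psi(n+1)\bigr]x^n,\qquad\psi(z)=\frac{d}{dz}\ln\Gamma(z),$$ where $(c)_n=c(c+1)\cdots(c+n-1)$. *)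

theory Defs
  imports "HOL-Complex_Analysis.Complex_Analysis"
begin

text \<open>
  A point of the universal covering of the punctured plane is represented by its logarithm
  \<open>s = ln x\<close>: it lies over \<open>x = exp s\<close>, its argument is \<open>Im s\<close>, and \<open>x\<close> to the power \<open>c\<close>
  is \<open>exp (c * s)\<close>. The covering is thus all of \<^typ>\<open>complex\<close>, functions on it are functions
  of \<open>s\<close>, and a function is holomorphic on it iff it is holomorphic in \<open>s\<close>.
\<close>

text \<open>The derivative \<open>d/dx\<close> of a function on the covering, by the chain rule.\<close>

definition cover_deriv :: "(complex \<Rightarrow> complex) \<Rightarrow> complex \<Rightarrow> complex" where
  "cover_deriv f s = deriv f s / exp s"

text \<open>The half-periods are \<open>w1\<close> and \<open>w2\<close>, so the lattice is spanned by \<open>2 * w1\<close> and \<open>2 * w2\<close>.\<close>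

definition wp :: "complex \<Rightarrow> complex \<Rightarrow> complex \<Rightarrow> complex" where
  "wp z w1 w2 = 1 / z\<^sup>2 +
     (\<Sum>\<^sub>\<infinity>(m :: int, n :: int) \<in> UNIV - {(0, 0)}.
        1 / (z - (2 * of_int m * w1 + 2 * of_int n * w2))\<^sup>2 -
        1 / (2 * of_int m * w1 + 2 * of_int n * w2)\<^sup>2)"

definition F :: "complex \<Rightarrow> complex" where
  "F x = (\<Sum>n. (pochhammer (1/2) n)\<^sup>2 / (fact n)\<^sup>2 * x ^ n)"

definition F1 :: "complex \<Rightarrow> complex" where
  "F1 x = (\<Sum>n. (pochhammer (1/2) n)\<^sup>2 / (fact n)\<^sup>2 *
              (2 * (Digamma (of_nat n + 1/2) - Digamma (of_nat n + 1))) * x ^ n)"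

definition \<omega>1 :: "complex \<Rightarrow> complex" where
  "\<omega>1 s = of_real pi / 2 * F (exp s)"

definition \<omega>2 :: "complex \<Rightarrow> complex" where
  "\<omega>2 s = - (\<i> / 2) * (F (exp s) * s + F1 (exp s))"

definition PVI_rhs :: "complex \<Rightarrow> complex \<Rightarrow> complex \<Rightarrow> complex \<Rightarrow> complex" where
  "PVI_rhs \<mu> x y p =
     1/2 * (1/y + 1/(y - 1) + 1/(y - x)) * p\<^sup>2
     - (1/x + 1/(x - 1) + 1/(y - x)) * p
     + 1/2 * (y * (y - 1) * (y - x) / (x\<^sup>2 * (x - 1)\<^sup>2)) *
         ((2*\<mu> - 1)\<^sup>2 + x * (x - 1) / (y - x)\<^sup>2)"

text \<open>The equation at a point, multiplied by \<open>y (y - 1) (y - x)\<close>.\<close>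

definition PVI_cleared :: "complex \<Rightarrow> complex \<Rightarrow> complex \<Rightarrow> complex \<Rightarrow> complex \<Rightarrow> bool" where
  "PVI_cleared \<mu> x y p q \<longleftrightarrow>
     y * (y - 1) * (y - x) * q =
       1/2 * ((y - 1) * (y - x) + y * (y - x) + y * (y - 1)) * p\<^sup>2
       - ((1/x + 1/(x - 1)) * (y * (y - 1) * (y - x)) + y * (y - 1)) * p
       + 1/2 * (y\<^sup>2 * (y - 1)\<^sup>2 / (x\<^sup>2 * (x - 1)\<^sup>2)) *
           ((2*\<mu> - 1)\<^sup>2 * (y - x)\<^sup>2 + x * (x - 1))"

lemma PVI_cleared_iff:
  assumes "y \<noteq> 0" "y \<noteq> 1" "y \<noteq> x"
  shows "PVI_cleared \<mu> x y p q \<longleftrightarrow> q = PVI_rhs \<mu> x y p"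
proof -
  define d where "d = y * (y - 1) * (y - x)"
  define P where "P = 1 / (x\<^sup>2 * (x - 1)\<^sup>2)"
  define R where "R = 1/x + 1/(x - 1)"
  have nz: "y - 1 \<noteq> 0" "y - x \<noteq> 0" and d0: "d \<noteq> 0"
    using assms by (auto simp: d_def)
  have e1: "t * u * w * (1/t + 1/u + 1/w) = u * w + t * w + t * u"
    and e2: "t * u * w * (R + 1/w) = R * (t * u * w) + t * u"
    and e3: "t * u * w * (t * u * w * P * (C + k / w\<^sup>2)) = t\<^sup>2 * u\<^sup>2 * P * (C * w\<^sup>2 + k)"
    if "t \<noteq> 0" "u \<noteq> 0" "w \<noteq> 0" for t u w C k :: complex
    using that by (simp_all add: field_simps power2_eq_square)
  note e = e1[OF assms(1) nz] e2[OF assms(1) nz] e3[OF assms(1) nz]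
  have "d * PVI_rhs \<mu> x y p =
       1/2 * (d * (1/y + 1/(y - 1) + 1/(y - x))) * p\<^sup>2
       - d * (R + 1/(y - x)) * p
       + 1/2 * (d * (d * P * ((2*\<mu> - 1)\<^sup>2 + x * (x - 1) / (y - x)\<^sup>2)))"
  proof -
    have "PVI_rhs \<mu> x y p =
        1/2 * (1/y + 1/(y - 1) + 1/(y - x)) * p\<^sup>2 - (R + 1/(y - x)) * p
        + 1/2 * (d * P) * ((2*\<mu> - 1)\<^sup>2 + x * (x - 1) / (y - x)\<^sup>2)"
      by (simp add: PVI_rhs_def d_def P_def R_def)
    moreover have "d * (1/2 * S * p\<^sup>2 - T * p + 1/2 * (d * P) * U) =
        1/2 * (d * S) * p\<^sup>2 - d * T * p + 1/2 * (d * (d * P * U))" for S T U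
      by (simp add: right_diff_distrib distrib_left mult_ac)
    ultimately show ?thesis
      by metis
  qed
  also have "\<dots> =
       1/2 * ((y - 1) * (y - x) + y * (y - x) + y * (y - 1)) * p\<^sup>2
       - (R * d + y * (y - 1)) * p
       + 1/2 * (y\<^sup>2 * (y - 1)\<^sup>2 * P) * ((2*\<mu> - 1)\<^sup>2 * (y - x)\<^sup>2 + x * (x - 1))"
    unfolding d_def e by (simp only: mult.assoc)
  finally have "d * PVI_rhs \<mu> x y p =
       1/2 * ((y - 1) * (y - x) + y * (y - x) + y * (y - 1)) * p\<^sup>2
       - (R * d + y * (y - 1)) * p
       + 1/2 * (y\<^sup>2 * (y - 1)\<^sup>2 * P) * ((2*\<mu> - 1)\<^sup>2 * (y - x)\<^sup>2 + x * (x - 1))"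
    .
  then have "PVI_cleared \<mu> x y p q \<longleftrightarrow> d * q = d * PVI_rhs \<mu> x y p"
    by (simp add: PVI_cleared_def d_def R_def P_def)
  then show ?thesis
    using d0 by simp
qed

text \<open>
  A solution may take the values \<open>0\<close>, \<open>1\<close>, \<open>x\<close>, where the right-hand side is singular (and where
  division by zero would make the displayed equation meaningless): for instance, a solution
  can have double zeros. At such points the equation is read with denominators cleared.
\<close>

definition PVI_solution_on :: "complex \<Rightarrow> complex set \<Rightarrow> (complex \<Rightarrow> complex) \<Rightarrow> bool" where
  "PVI_solution_on \<mu> S y \<longleftrightarrow> y holomorphic_on S \<and>
     (\<forall>s\<in>S. (y s \<notin> {0, 1, exp s} \<longrightarrow>
               cover_deriv (cover_deriv y) s = PVI_rhs \<mu> (exp s) (y s) (cover_deriv y s)) \<and>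
            PVI_cleared \<mu> (exp s) (y s) (cover_deriv y s) (cover_deriv (cover_deriv y) s))"

definition A :: "complex \<Rightarrow> complex \<Rightarrow> complex \<Rightarrow> complex" where
  "A \<nu>1 \<nu>2 s = exp (- \<i> * of_real pi * \<nu>1) / 16 powr (2 - \<nu>2) * exp ((2 - \<nu>2) * s)"

definition B :: "complex \<Rightarrow> complex \<Rightarrow> complex \<Rightarrow> complex" where
  "B \<nu>1 \<nu>2 s = exp (\<i> * of_real pi * \<nu>1) / 16 powr \<nu>2 * exp (\<nu>2 * s)"

definition PVI_domain :: "real \<Rightarrow> complex \<Rightarrow> complex \<Rightarrow> complex set" where
  "PVI_domain r \<nu>1 \<nu>2 = {s. norm (exp s) < r \<and> norm (A \<nu>1 \<nu>2 s) < r \<and> norm (B \<nu>1 \<nu>2 s) < r}"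

definition admissible :: "complex set" where
  "admissible = - of_real ` ({..0} \<union> {2..})"

definition rational_function_on :: "complex set \<Rightarrow> (complex \<Rightarrow> complex) \<Rightarrow> bool" where
  "rational_function_on S f \<longleftrightarrow>
     (\<exists>p q :: complex poly. \<forall>z\<in>S. poly q z \<noteq> 0 \<and> f z = poly p z / poly q z)"

end

theory Submission
  imports Defs "HOL-Real_Asymp.Real_Asymp"
begin

text \<open>Write the argument of \<open>\<wp>\<close> as \<open>u\<close> and uniformise by the nome \<open>q = exp (\<i> * \<pi> * \<omega>2 / \<omega>1)\<close>, which is an
  analytic function of \<open>x\<close> near \<open>0\<close> with \<open>q = exp t\<close>, \<open>t = ln x + F1 / F\<close>. In the variable \<open>t\<close> the sixth Painleve
  equation becomes (in the form found by Fuchs and Painleve) \<open>d\<^sup>2(ln Z)/dt\<^sup>2 = \<kappa> * X\<close> with \<open>Z = exp (\<i> * \<pi> * u / \<omega>1)\<close>,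
  \<open>W = q\<^sup>2 / Z\<close>, \<open>\<kappa> = 2 * (2 * \<mu> - 1)\<^sup>2\<close> and \<open>X\<close> the Lambert series of the derivative of \<open>\<wp>\<close>, a power series in \<open>Z\<close> and \<open>W\<close>
  without constant term. Substituting \<open>ln Z = \<i> * \<pi> * \<nu>1 + \<nu>2 * t + V\<close>, one solves for \<open>V\<close> by a power series in
  \<open>exp (\<nu>2 * t)\<close> and \<open>exp ((2 - \<nu>2) * t)\<close>: the double integration divides the coefficients by
  \<open>(i * \<nu>2 + j * (2 - \<nu>2))\<^sup>2\<close>, which is bounded away from \<open>0\<close> exactly because \<open>\<nu>2\<close> avoids the two half-lines,
  and Picard iteration is bounded in a weighted \<open>l\<^sup>1\<close> norm. That the curve solves the Painleve equation reduces to the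
  Weierstrass differential equation and the Halphen system for the roots \<open>e\<^sub>i\<close>, both of which
  follow from Cauchy products of Lambert series.\<close>

text \<open>Two obstacles shape the set-up. The half-period \<omega>1 sits at Z = -1, on the
  boundary of the disc where the Lambert series converge; its root \<open>s1\<close> is therefore
  not a value of \<open>X\<close> but is recovered from the sum of the three roots, which is -
  \<open>lamb_\<alpha>\<close> / 4. And along the curve both the point and the nome move: the nome
  derivatives \<open>Y\<close> are eliminated by one quadratic identity for
  \<open>X 0 (- 1)\<close>, in substance the heat equation of the theta product, and by its
  successive derivatives at fixed nome. The number 16 in \<open>A\<close> and \<open>B\<close> is
  exp (4 ln 2). It comes from F1(0) / F(0) = - 4 ln 2, that is, from q = x / 16 + .... The Picard
  map is not treated as a contraction in norm: its iterates agree in more and more degrees, and the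
  estimates only have to keep them in a unit ball. These estimates see \<nu>1 only through the
  moduli of \<open>A\<close> and \<open>B\<close>, so the radius and the constant in the bound can
  be chosen before \<nu>1.\<close>

section \<open>Termwise differentiation and summability\<close>

text \<open>A locally uniform limit of holomorphic functions may be differentiated termwise, so a
  majorant of the functions alone controls everything; the convergence of the series of derivatives
  comes out as a conclusion.\<close>

lemma has_field_derivative_infsum:
  fixes f :: "'i \<Rightarrow> complex \<Rightarrow> complex"
  assumes "open S" "z0 \<in> S"
    and der: "\<And>k z. k \<in> I \<Longrightarrow> z \<in> S \<Longrightarrow> (f k has_field_derivative f' k z) (at z)"
    and le: "\<And>k z. k \<in> I \<Longrightarrow> z \<in> S \<Longrightarrow> norm (f k z) \<le> M k"
    and M: "M summable_on I"
  shows "((\<lambda>z. \<Sum>\<^sub>\<infinity>k\<in>I. f k z) has_field_derivative (\<Sum>\<^sub>\<infinity>k\<in>I. f' k z0)) (at z0)"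
    and "(\<lambda>k. f' k z0) summable_on I"
proof -
  from assms(1,2) obtain r where r: "r > 0" "cball z0 r \<subseteq> S"
    using open_contains_cball by blast
  have ulim: "uniform_limit (cball z0 r) (\<lambda>X y. \<Sum>k\<in>X. f k y) (\<lambda>y. \<Sum>\<^sub>\<infinity>k\<in>I. f k y) (finite_subsets_at_top I)"
    by (rule Weierstrass_m_test_general[where M = M]) (use le r M in auto)
  have near: "eventually (\<lambda>X. continuous_on (cball z0 r) (\<lambda>y. \<Sum>k\<in>X. f k y) \<and>
      (\<forall>w \<in> ball z0 r. ((\<lambda>y. \<Sum>k\<in>X. f k y) has_field_derivative (\<Sum>k\<in>X. f' k w)) (at w)))
      (finite_subsets_at_top I)"
  proof (rule eventually_mono[OF eventually_finite_subsets_at_top_weakI[of I "\<lambda>X. finite X \<and> X \<subseteq> I"]])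
    fix X assume X: "finite X \<and> X \<subseteq> I"
    have d: "((\<lambda>y. \<Sum>k\<in>X. f k y) has_field_derivative (\<Sum>k\<in>X. f' k w)) (at w)" if "w \<in> cball z0 r" for w
      by (intro DERIV_sum der) (use X r that in auto)
    then show "continuous_on (cball z0 r) (\<lambda>y. \<Sum>k\<in>X. f k y) \<and>
      (\<forall>w \<in> ball z0 r. ((\<lambda>y. \<Sum>k\<in>X. f k y) has_field_derivative (\<Sum>k\<in>X. f' k w)) (at w))"
      by (auto intro!: continuous_at_imp_continuous_on DERIV_isCont)
  qed auto
  \<comment> \<open>The limit theorem is applied to the net of finite subsets, so its statement
    about the derivatives is literally \<open>has_sum\<close>.\<close>
  obtain g' where g': "\<And>w. w \<in> ball z0 r \<Longrightarrow>
     ((\<lambda>y. \<Sum>\<^sub>\<infinity>k\<in>I. f k y) has_field_derivative (g' w)) (at w) \<and>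
     ((\<lambda>X. \<Sum>k\<in>X. f' k w) \<longlongrightarrow> g' w) (finite_subsets_at_top I)"
    using has_complex_derivative_uniform_limit[OF near ulim _ r(1)] by auto
  have hs: "((\<lambda>k. f' k z0) has_sum g' z0) I"
    using g'[of z0] r by (simp add: has_sum_def)
  then show "(\<lambda>k. f' k z0) summable_on I" by (rule has_sum_imp_summable)
  from hs g'[of z0] r show "((\<lambda>z. \<Sum>\<^sub>\<infinity>k\<in>I. f k z) has_field_derivative (\<Sum>\<^sub>\<infinity>k\<in>I. f' k z0)) (at z0)"
    by (simp add: infsumI)
qed

lemma summable_on_power_mult_geometric:
  fixes \<rho> :: real
  assumes "0 \<le> \<rho>" "\<rho> < 1"
  shows "(\<lambda>k. real k ^ m * \<rho> ^ k) summable_on I"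
proof -
  have "summable (\<lambda>k. real k ^ m * \<rho> ^ k)"
  proof (cases "\<rho> = 0")
    case True
    have "summable (\<lambda>k. real k ^ m * \<rho> ^ k)"
      by (rule summable_finite[of "{0}"]) (auto simp: True)
    then show ?thesis .
  next
    case False
    with assms have "(\<lambda>k. real k ^ m * \<rho> ^ k) \<in> O(\<lambda>k. 1 / real k ^ 2)"
      by real_asymp
    moreover have "summable (\<lambda>k. norm (1 / real k ^ 2))"
      using inverse_power_summable[of 2, where ?'a = real] by (simp add: field_simps)
    ultimately show ?thesis by (rule summable_comparison_test_bigo[rotated])
  qed
  then have "(\<lambda>k. real k ^ m * \<rho> ^ k) summable_on UNIV"
    using assms by (subst summable_on_UNIV_nonneg_real_iff) auto
  then show ?thesis by (rule summable_on_subset) auto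
qed

section \<open>Lambert series\<close>

text \<open>The Lambert-type series of the Weierstrass functions: with \<open>Z\<close> the exponential of the
  uniformising variable and \<open>W = q\<^sup>2 / Z\<close>, \<open>X 1 1\<close> is \<open>\<wp>\<close> up to scaling and an additive
  constant, \<open>X 0 (-1)\<close> plays the role of \<open>\<zeta>\<close>, and \<open>Y\<close> collects the derivatives in \<open>\<tau>\<close>.\<close>

definition Xt :: "nat \<Rightarrow> complex \<Rightarrow> complex \<Rightarrow> complex \<Rightarrow> nat \<Rightarrow> complex" where
  "Xt m e Z W k = of_nat k ^ m / (1 - (Z * W) ^ k) * (Z ^ k + e * W ^ k)"

definition Yt :: "nat \<Rightarrow> complex \<Rightarrow> complex \<Rightarrow> complex \<Rightarrow> nat \<Rightarrow> complex" where
  "Yt m e Z W k = of_nat k ^ m * (1 + (Z * W) ^ k) / (1 - (Z * W) ^ k)\<^sup>2 * (Z ^ k + e * W ^ k)"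

definition X :: "nat \<Rightarrow> complex \<Rightarrow> complex \<Rightarrow> complex \<Rightarrow> complex" where
  "X m e Z W = (\<Sum>\<^sub>\<infinity>k\<in>{1..}. Xt m e Z W k)"

definition Y :: "nat \<Rightarrow> complex \<Rightarrow> complex \<Rightarrow> complex \<Rightarrow> complex" where
  "Y m e Z W = (\<Sum>\<^sub>\<infinity>k\<in>{1..}. Yt m e Z W k)"

lemma norm_one_minus_power_ge:
  fixes p :: complex
  assumes "norm p \<le> \<rho>" "\<rho> < 1" "k \<ge> 1"
  shows "1 - \<rho> \<le> norm (1 - p ^ k)" "norm (p ^ k) \<le> \<rho>" "1 - p ^ k \<noteq> 0"
proof -
  have "0 \<le> \<rho>" using assms norm_ge_zero[of p] by linarith
  have "norm (p ^ k) = norm p ^ k" by (simp add: norm_power)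
  also have "\<dots> \<le> \<rho> ^ k" by (intro power_mono) (use assms in auto)
  also have "\<dots> \<le> \<rho> ^ 1" using assms \<open>0 \<le> \<rho>\<close> by (intro power_decreasing) auto
  finally show a: "norm (p ^ k) \<le> \<rho>" by simp
  have "norm (1::complex) - norm (p ^ k) \<le> norm (1 - p ^ k)" by (rule norm_triangle_ineq2)
  with a show b: "1 - \<rho> \<le> norm (1 - p ^ k)" by simp
  then show "1 - p ^ k \<noteq> 0" using assms by auto
qed

lemma norm_mult_le_bound:
  fixes Z W :: complex
  assumes "norm Z \<le> \<rho>" "norm W \<le> \<rho>" "\<rho> < 1"
  shows "norm (Z * W) \<le> \<rho>"
proof -
  have "norm Z * norm W \<le> \<rho> * 1" by (intro mult_mono) (use assms norm_ge_zero[of Z] norm_ge_zero[of W] in linarith)+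
  then show ?thesis by (simp add: norm_mult)
qed

lemma norm_power_sum_le:
  fixes Z W :: complex
  assumes "norm Z \<le> \<rho>" "norm W \<le> \<rho>" "norm e \<le> 1"
  shows "norm (Z ^ k + e * W ^ k) \<le> 2 * \<rho> ^ k"
proof -
  have "norm (Z ^ k + e * W ^ k) \<le> norm Z ^ k + norm e * norm W ^ k"
    by (metis norm_mult norm_power norm_triangle_ineq)
  also have "\<dots> \<le> \<rho> ^ k + 1 * \<rho> ^ k"
    by (intro add_mono mult_mono power_mono) (use assms in auto)
  finally show ?thesis by simp
qed

lemma norm_Xt_le:
  assumes "norm Z \<le> \<rho>" "norm W \<le> \<rho>" "\<rho> < 1" "norm e \<le> 1" "k \<ge> 1"
  shows "norm (Xt m e Z W k) \<le> 2 / (1 - \<rho>) * (real k ^ m * \<rho> ^ k)"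
proof -
  have "0 \<le> \<rho>" using assms norm_ge_zero[of Z] by linarith
  note p = norm_one_minus_power_ge[OF norm_mult_le_bound[OF assms(1,2,3)] assms(3) assms(5)]
  have "norm (Xt m e Z W k) = real k ^ m / norm (1 - (Z * W) ^ k) * norm (Z ^ k + e * W ^ k)"
    by (simp add: Xt_def norm_mult norm_divide norm_power)
  also have "\<dots> \<le> real k ^ m / (1 - \<rho>) * (2 * \<rho> ^ k)"
    by (intro mult_mono divide_left_mono norm_power_sum_le p assms divide_nonneg_nonneg mult_pos_pos)
       (use p assms \<open>0 \<le> \<rho>\<close> in auto)
  finally show ?thesis by (simp add: field_simps)
qed

lemma norm_Yt_le:
  assumes "norm Z \<le> \<rho>" "norm W \<le> \<rho>" "\<rho> < 1" "norm e \<le> 1" "k \<ge> 1"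
  shows "norm (Yt m e Z W k) \<le> 4 / (1 - \<rho>)\<^sup>2 * (real k ^ m * \<rho> ^ k)"
proof -
  have "0 \<le> \<rho>" using assms norm_ge_zero[of Z] by linarith
  note p = norm_one_minus_power_ge[OF norm_mult_le_bound[OF assms(1,2,3)] assms(3) assms(5)]
  have "norm (1 + (Z * W) ^ k) \<le> norm (1::complex) + norm ((Z * W) ^ k)" by (rule norm_triangle_ineq)
  also have "\<dots> \<le> 2" using p assms by simp
  finally have two: "norm (1 + (Z * W) ^ k) \<le> 2" .
  have "norm (Yt m e Z W k) = real k ^ m * norm (1 + (Z * W) ^ k) / (norm (1 - (Z * W) ^ k))\<^sup>2 * norm (Z ^ k + e * W ^ k)"
    by (simp add: Yt_def norm_mult norm_divide norm_power)
  also have "\<dots> \<le> real k ^ m * 2 / (1 - \<rho>)\<^sup>2 * (2 * \<rho> ^ k)"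
    by (intro mult_mono frac_le norm_power_sum_le two power_mono p(1) assms divide_nonneg_nonneg mult_nonneg_nonneg)
       (use p assms \<open>0 \<le> \<rho>\<close> in auto)
  finally show ?thesis by (simp add: field_simps)
qed

lemma Xt_summable:
  assumes "norm Z < 1" "norm W < 1" "norm e \<le> 1"
  shows "(\<lambda>k. Xt m e Z W k) summable_on {1..}" "(\<lambda>k. norm (Xt m e Z W k)) summable_on {1..}"
proof -
  define \<rho> where "\<rho> = max (norm Z) (norm W)"
  have \<rho>: "norm Z \<le> \<rho>" "norm W \<le> \<rho>" "\<rho> < 1" "0 \<le> \<rho>" using assms by (auto simp: \<rho>_def le_max_iff_disj)
  show "(\<lambda>k. norm (Xt m e Z W k)) summable_on {1..}"
    by (rule Infinite_Sum.abs_summable_on_comparison_test'[OF summable_on_cmult_right[OF summable_on_power_mult_geometric[OF \<rho>(4,3)]]])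
       (rule norm_Xt_le[OF \<rho>(1-3) assms(3)], simp)
  then show "(\<lambda>k. Xt m e Z W k) summable_on {1..}" by (rule abs_summable_summable)
qed

lemma Yt_summable:
  assumes "norm Z < 1" "norm W < 1" "norm e \<le> 1"
  shows "(\<lambda>k. Yt m e Z W k) summable_on {1..}"
proof -
  define \<rho> where "\<rho> = max (norm Z) (norm W)"
  have \<rho>: "norm Z \<le> \<rho>" "norm W \<le> \<rho>" "\<rho> < 1" "0 \<le> \<rho>" using assms by (auto simp: \<rho>_def le_max_iff_disj)
  have "(\<lambda>k. norm (Yt m e Z W k)) summable_on {1..}"
    by (rule Infinite_Sum.abs_summable_on_comparison_test'[OF summable_on_cmult_right[OF summable_on_power_mult_geometric[OF \<rho>(4,3)]]])
       (rule norm_Yt_le[OF \<rho>(1-3) assms(3)], simp)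
  then show ?thesis by (rule abs_summable_summable)
qed

lemma open_norm_less_nbhd:
  fixes Z W :: "complex \<Rightarrow> complex"
  assumes "isCont Z t0" "isCont W t0" "norm (Z t0) < 1" "norm (W t0) < 1"
  obtains \<rho> S where "open S" "t0 \<in> S" "\<rho> < 1" "0 \<le> \<rho>" "\<And>t. t \<in> S \<Longrightarrow> norm (Z t) \<le> \<rho>" "\<And>t. t \<in> S \<Longrightarrow> norm (W t) \<le> \<rho>"
proof -
  obtain \<rho> where \<rho>: "max (norm (Z t0)) (norm (W t0)) < \<rho>" "\<rho> < 1"
    using dense[of "max (norm (Z t0)) (norm (W t0))" 1] assms by auto
  have "\<forall>\<^sub>F t in at t0. norm (Z t) < \<rho>" "\<forall>\<^sub>F t in at t0. norm (W t) < \<rho>"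
    using \<rho> assms by (auto intro!: order_tendstoD(2) tendsto_norm simp: isCont_def)
  then have "\<forall>\<^sub>F t in nhds t0. norm (Z t) \<le> \<rho> \<and> norm (W t) \<le> \<rho>"
    unfolding eventually_at_filter
    by eventually_elim (use \<rho> in auto)
  then obtain S where "open S" "t0 \<in> S" "\<forall>t\<in>S. norm (Z t) \<le> \<rho> \<and> norm (W t) \<le> \<rho>"
    by (auto simp: eventually_nhds)
  moreover have "0 \<le> \<rho>" using \<rho> norm_ge_zero[of "Z t0"] by linarith
  ultimately show ?thesis using that \<rho> by blast
qed

text \<open>Derivatives are kept in the form f * c, with c the logarithmic derivative: a power then
  only multiplies c by k, which is how Z and W enter the Lambert terms.\<close>

lemma has_field_derivative_power_log:
  fixes f :: "complex \<Rightarrow> complex"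
  assumes "(f has_field_derivative f t * c) (at t)" "k \<ge> 1"
  shows "((\<lambda>t. f t ^ k) has_field_derivative of_nat k * f t ^ k * c) (at t)"
proof -
  obtain j where "k = Suc j" using assms by (cases k) auto
  then show ?thesis by (intro DERIV_cong[OF DERIV_power[OF assms(1)]]) (simp add: mult_ac)
qed

text \<open>The logarithmic derivatives c + d of Z and c - d of W split the motion in two. The part
  d moves the point at fixed nome Z W; it raises m and flips e. The part c moves the nome, Z W
  having logarithmic derivative 2 c, and produces the terms of \<open>Y\<close>.\<close>

lemma Xt_has_field_derivative:
  assumes Z: "(Z has_field_derivative Z t * (c + d)) (at t)"
    and W: "(W has_field_derivative W t * (c - d)) (at t)"
    and p: "1 - (Z t * W t) ^ k \<noteq> 0" "k \<ge> 1"
  shows "((\<lambda>t. Xt m e (Z t) (W t) k) has_field_derivative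
           (d * Xt (Suc m) (- e) (Z t) (W t) k + c * Yt (Suc m) e (Z t) (W t) k)) (at t)"
proof -
  note pw = has_field_derivative_power_log[OF _ p(2)]
  have ZW: "((\<lambda>t. (Z t * W t)) has_field_derivative (Z t * W t) * (2 * c)) (at t)"
    by (rule DERIV_cong[OF DERIV_mult[OF Z W]]) (simp add: algebra_simps)
  define P A B where "P = (Z t * W t) ^ k" and "A = Z t ^ k" and "B = W t ^ k"
  have P: "1 - P \<noteq> 0" using p by (simp add: P_def)
  have "((\<lambda>t. of_nat k ^ m / (1 - (Z t * W t) ^ k) * (Z t ^ k + e * W t ^ k)) has_field_derivative
     (of_nat k ^ m * (of_nat k * P * (2 * c)) / (1 - P)\<^sup>2 * (A + e * B) +
      of_nat k ^ m / (1 - P) * (of_nat k * A * (c + d) + e * (of_nat k * B * (c - d))))) (at t)"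
    unfolding P_def A_def B_def
    by (rule derivative_eq_intros pw[OF Z] pw[OF W] pw[OF ZW] p refl)+
       (simp_all add: power2_eq_square field_simps)
  moreover have "of_nat k ^ m * (of_nat k * P * (2 * c)) / (1 - P)\<^sup>2 * (A + e * B) +
      of_nat k ^ m / (1 - P) * (of_nat k * A * (c + d) + e * (of_nat k * B * (c - d)))
     = d * (of_nat k ^ Suc m / (1 - P) * (A + - e * B)) + c * (of_nat k ^ Suc m * (1 + P) / (1 - P)\<^sup>2 * (A + e * B))"
    using P by (simp add: divide_simps power2_eq_square) algebra
  ultimately show ?thesis unfolding Xt_def Yt_def P_def A_def B_def by simp
qed

lemma X_has_field_derivative:
  assumes "open S" "t0 \<in> S"
    and Z: "\<And>t. t \<in> S \<Longrightarrow> (Z has_field_derivative Z t * (c t + d t)) (at t)"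
    and W: "\<And>t. t \<in> S \<Longrightarrow> (W has_field_derivative W t * (c t - d t)) (at t)"
    and lt: "norm (Z t0) < 1" "norm (W t0) < 1" and e: "norm e \<le> 1"
  shows "((\<lambda>t. X m e (Z t) (W t)) has_field_derivative
           (d t0 * X (Suc m) (- e) (Z t0) (W t0) + c t0 * Y (Suc m) e (Z t0) (W t0))) (at t0)"
proof -
  have "isCont Z t0" "isCont W t0" using Z[OF assms(2)] W[OF assms(2)] by (auto intro: DERIV_isCont)
  then obtain \<rho> U where U: "open U" "t0 \<in> U" "\<rho> < 1" "0 \<le> \<rho>"
      "\<And>t. t \<in> U \<Longrightarrow> norm (Z t) \<le> \<rho>" "\<And>t. t \<in> U \<Longrightarrow> norm (W t) \<le> \<rho>"
    using open_norm_less_nbhd[where Z = Z and W = W, OF _ _ lt] by metis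
  have "((\<lambda>t. X m e (Z t) (W t)) has_field_derivative
     (\<Sum>\<^sub>\<infinity>k\<in>{1..}. d t0 * Xt (Suc m) (- e) (Z t0) (W t0) k + c t0 * Yt (Suc m) e (Z t0) (W t0) k)) (at t0)"
    unfolding X_def
  proof (rule has_field_derivative_infsum[of "S \<inter> U"])
    fix k :: nat and t assume "k \<in> {1..}" "t \<in> S \<inter> U"
    then have k: "k \<ge> 1" and t: "t \<in> S" "t \<in> U" by auto
    show "((\<lambda>t. Xt m e (Z t) (W t) k) has_field_derivative
           (d t * Xt (Suc m) (- e) (Z t) (W t) k + c t * Yt (Suc m) e (Z t) (W t) k)) (at t)"
      by (intro Xt_has_field_derivative Z W t k norm_one_minus_power_ge(3)[of _ \<rho>] norm_mult_le_bound U)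
    show "norm (Xt m e (Z t) (W t) k) \<le> 2 / (1 - \<rho>) * (real k ^ m * \<rho> ^ k)"
      by (intro norm_Xt_le U t e k)
  next
    show "(\<lambda>k. 2 / (1 - \<rho>) * (real k ^ m * \<rho> ^ k)) summable_on {1..}"
      by (intro summable_on_cmult_right summable_on_power_mult_geometric U)
  qed (use assms U in auto)
  also have "(\<Sum>\<^sub>\<infinity>k\<in>{1..}. d t0 * Xt (Suc m) (- e) (Z t0) (W t0) k + c t0 * Yt (Suc m) e (Z t0) (W t0) k)
     = d t0 * X (Suc m) (- e) (Z t0) (W t0) + c t0 * Y (Suc m) e (Z t0) (W t0)"
    unfolding X_def Y_def
    using Xt_summable(1)[OF lt, of "- e" "Suc m"] Yt_summable[OF lt e, of "Suc m"] e
    by (subst infsum_add) (auto intro!: summable_on_cmult_right simp: infsum_cmult_right')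
  finally show ?thesis .
qed

text \<open>With Z W constant, the factor in front of Z^k + e W^k is a constant and only the powers
  are differentiated.\<close>

lemma Y_has_field_derivative_fixed_nome:
  assumes Z: "\<And>t. t \<in> S \<Longrightarrow> (Z has_field_derivative Z t) (at t)"
    and W: "\<And>t. t \<in> S \<Longrightarrow> (W has_field_derivative - W t) (at t)"
    and S: "open S" "t0 \<in> S" and p: "\<And>t. t \<in> S \<Longrightarrow> Z t * W t = p"
    and lt: "norm (Z t0) < 1" "norm (W t0) < 1" and e: "norm e \<le> 1"
  shows "((\<lambda>t. Y m e (Z t) (W t)) has_field_derivative Y (Suc m) (- e) (Z t0) (W t0)) (at t0)"
proof -
  have "isCont Z t0" "isCont W t0" using Z[OF S(2)] W[OF S(2)] by (auto intro: DERIV_isCont)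
  then obtain \<rho> U where U: "open U" "t0 \<in> U" "\<rho> < 1" "0 \<le> \<rho>"
      "\<And>t. t \<in> U \<Longrightarrow> norm (Z t) \<le> \<rho>" "\<And>t. t \<in> U \<Longrightarrow> norm (W t) \<le> \<rho>"
    using open_norm_less_nbhd[where Z = Z and W = W, OF _ _ lt] by metis
  show ?thesis
    unfolding Y_def
  proof (rule has_field_derivative_infsum(1)[of "S \<inter> U"])
    fix k :: nat and t assume "k \<in> {1..}" "t \<in> S \<inter> U"
    then have k: "k \<ge> 1" and t: "t \<in> S" "t \<in> U" by auto
    have eq: "Yt m e (Z t) (W t) k = of_nat k ^ m * (1 + p ^ k) / (1 - p ^ k)\<^sup>2 * (Z t ^ k + e * W t ^ k)" if "t \<in> S" for t
      using p[of t] that by (simp add: Yt_def)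
    define C where "C = of_nat k ^ m * (1 + p ^ k) / (1 - p ^ k)\<^sup>2"
    have "((\<lambda>t. C * (Z t ^ k + e * W t ^ k)) has_field_derivative
        C * (of_nat k * Z t ^ k * 1 + e * (of_nat k * W t ^ k * (-1)))) (at t)"
      by (intro DERIV_cmult DERIV_add has_field_derivative_power_log k) (use Z W t in auto)
    also have "C * (of_nat k * Z t ^ k * 1 + e * (of_nat k * W t ^ k * (-1))) = Yt (Suc m) (- e) (Z t) (W t) k"
      using p[OF t(1)] by (simp add: Yt_def C_def algebra_simps)
    finally show "((\<lambda>t. Yt m e (Z t) (W t) k) has_field_derivative Yt (Suc m) (- e) (Z t) (W t) k) (at t)"
      by (rule has_field_derivative_transform_within_open[where S = "S \<inter> U"]) (use S U t eq in \<open>auto simp: C_def\<close>)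
    show "norm (Yt m e (Z t) (W t) k) \<le> 4 / (1 - \<rho>)\<^sup>2 * (real k ^ m * \<rho> ^ k)"
      by (intro norm_Yt_le U t e k)
  next
    show "(\<lambda>k. 4 / (1 - \<rho>)\<^sup>2 * (real k ^ m * \<rho> ^ k)) summable_on {1..}"
      by (intro summable_on_cmult_right summable_on_power_mult_geometric U)
  qed (use S U in auto)
qed

section \<open>Cauchy products and the Weierstrass equation\<close>

lemma has_sum_diff:
  fixes f :: "'a \<Rightarrow> complex"
  assumes "(f has_sum s) I" "(g has_sum t) I"
  shows "((\<lambda>x. f x - g x) has_sum (s - t)) I"
  using has_sum_add[OF assms(1) has_sum_uminusI[OF assms(2)]] by simp

lemma has_sum_times:
  fixes f :: "'a \<Rightarrow> complex" and g :: "'b \<Rightarrow> complex"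
  assumes f: "(\<lambda>x. norm (f x)) summable_on A'" and g: "(\<lambda>x. norm (g x)) summable_on B'"
  shows "(\<lambda>(x, y). norm (f x * g y)) summable_on A' \<times> B'"
    and "((\<lambda>(x, y). f x * g y) has_sum (infsum f A' * infsum g B')) (A' \<times> B')"
proof -
  show s: "(\<lambda>(x, y). norm (f x * g y)) summable_on A' \<times> B'"
  proof (rule summable_on_SigmaI)
    show "((\<lambda>y. case (x, y) of (x, y) \<Rightarrow> norm (f x * g y)) has_sum norm (f x) * (\<Sum>\<^sub>\<infinity>y\<in>B'. norm (g y))) B'" for x
      using g by (auto simp: norm_mult intro!: has_sum_cmult_right has_sum_infsum)
    show "(\<lambda>x. norm (f x) * (\<Sum>\<^sub>\<infinity>y\<in>B'. norm (g y))) summable_on A'"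
      by (intro summable_on_cmult_left f)
  qed auto
  have "(\<lambda>z. norm (case z of (x, y) \<Rightarrow> f x * g y)) summable_on A' \<times> B'"
    using s by (simp add: case_prod_unfold)
  then have s': "(\<lambda>(x, y). f x * g y) summable_on A' \<times> B'"
    by (rule abs_summable_summable)
  show "((\<lambda>(x, y). f x * g y) has_sum (infsum f A' * infsum g B')) (A' \<times> B')"
  proof (rule has_sum_SigmaI[OF _ _ s'])
    show "((\<lambda>y. case (x, y) of (x, y) \<Rightarrow> f x * g y) has_sum f x * infsum g B') B'" for x
      using abs_summable_summable[OF g] by (auto intro!: has_sum_cmult_right has_sum_infsum)
    show "((\<lambda>x. f x * infsum g B') has_sum (infsum f A' * infsum g B')) A'"
      using abs_summable_summable[OF f] by (auto intro!: has_sum_cmult_left has_sum_infsum)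
  qed
qed

text \<open>In the square, products of equal variables collect by i + j = k into a convolution.
  Mixed products Z^i W^j with i - j = k equal p^j Z^k and collect into a correlation. Because e^2 =
  1, both multiply the same Z^k + W^k; the diagonal i = j depends on p only and is moved to the
  other side.\<close>

lemma square_even_odd_series:
  fixes a :: "nat \<Rightarrow> complex" and Z W e :: complex
  assumes a: "(\<lambda>k. norm (a k) * \<rho> ^ k) summable_on {1..}"
    and le: "norm Z \<le> \<rho>" "norm W \<le> \<rho>" "\<rho> < 1" and e: "e\<^sup>2 = 1"
  defines "p \<equiv> Z * W"
  defines "H \<equiv> (\<Sum>\<^sub>\<infinity>k\<in>{1..}. a k * (Z ^ k + e * W ^ k))"
  shows "((\<lambda>k. (Z ^ k + W ^ k) * ((\<Sum>i\<in>{1..<k}. a i * a (k - i)) + 2 * e * (\<Sum>\<^sub>\<infinity>j\<in>{1..}. a j * a (j + k) * p ^ j)))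
           has_sum (H\<^sup>2 - 2 * e * (\<Sum>\<^sub>\<infinity>j\<in>{1..}. (a j)\<^sup>2 * p ^ j))) {1..}"
proof -
  define P :: "(nat \<times> nat) set" where "P = {1..} \<times> {1..}"
  have \<rho>0: "0 \<le> \<rho>" using le norm_ge_zero[of Z] by linarith
  have ne: "norm e = 1" using e by (metis norm_one norm_power power2_eq_1_iff norm_minus_cancel)
  \<comment> \<open>u holds the products of equal variables, v the mixed ones, which carry the
    factor e.\<close>
  define u where "u = (\<lambda>(i, j). a i * a j * (Z ^ (i + j) + W ^ (i + j)))"
  define v where "v = (\<lambda>(i, j). e * (a i * a j * (Z ^ i * W ^ j + W ^ i * Z ^ j)))"
  define b where "b = (\<lambda>(i, j). 2 * (norm (a i) * \<rho> ^ i * (norm (a j) * \<rho> ^ j)))"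
  have bs: "b summable_on P"
  proof -
    have n: "norm (a k * of_real \<rho> ^ k) = norm (a k) * \<rho> ^ k" for k
      using \<rho>0 by (simp add: norm_mult norm_power)
    have "(\<lambda>(x, y). norm ((a x * of_real \<rho> ^ x) * (a y * of_real \<rho> ^ y))) summable_on P"
      unfolding P_def by (rule has_sum_times(1)) (use a in \<open>simp_all add: n\<close>)
    then have "(\<lambda>z. 2 * (case z of (x, y) \<Rightarrow> norm ((a x * of_real \<rho> ^ x) * (a y * of_real \<rho> ^ y)))) summable_on P"
      by (rule summable_on_cmult_right)
    then show ?thesis unfolding b_def norm_mult[of "a _ * _"] n by (simp add: case_prod_unfold)
  qed
  have pw: "norm (x ^ i * y ^ j) \<le> \<rho> ^ i * \<rho> ^ j" if "norm x \<le> \<rho>" "norm y \<le> \<rho>" for x y :: complex and i j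
    unfolding norm_mult norm_power by (intro mult_mono power_mono) (use that \<rho>0 in auto)
  have two: "norm (x + y) \<le> 2 * c" if "norm x \<le> c" "norm y \<le> c" for x y :: complex and c
    using norm_triangle_ineq[of x y] that by linarith
  have ub: "norm (u z) \<le> b z" for z
  proof -
    obtain i j where z: "z = (i, j)" by (cases z)
    have "norm (u z) \<le> norm (a i) * norm (a j) * (2 * (\<rho> ^ i * \<rho> ^ j))"
      unfolding u_def z split norm_mult power_add by (intro mult_left_mono two pw le) auto
    then show ?thesis by (simp add: b_def z mult_ac)
  qed
  have vb: "norm (v z) \<le> b z" for z
  proof -
    obtain i j where z: "z = (i, j)" by (cases z)
    have "norm (v z) \<le> norm (a i) * norm (a j) * (2 * (\<rho> ^ i * \<rho> ^ j))"
      unfolding v_def z split norm_mult ne mult_1 by (intro mult_left_mono two pw le) auto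
    then show ?thesis by (simp add: b_def z mult_ac)
  qed
  have us: "u summable_on P" and vs: "v summable_on P"
    using ub vb by (auto intro!: abs_summable_summable Infinite_Sum.abs_summable_on_comparison_test'[OF bs])
  have Hs: "(\<lambda>k. norm (a k * (Z ^ k + e * W ^ k))) summable_on {1..}"
  proof (rule Infinite_Sum.abs_summable_on_comparison_test'[OF summable_on_cmult_right[OF a]])
    fix k show "norm (a k * (Z ^ k + e * W ^ k)) \<le> 2 * (norm (a k) * \<rho> ^ k)"
      using mult_left_mono[OF norm_power_sum_le[OF le(1,2), of e k], of "norm (a k)"] ne
      by (simp add: norm_mult mult_ac)
  qed
  have H2: "infsum u P + infsum v P = H\<^sup>2"
  proof -
    have uv: "(case z of (i, j) \<Rightarrow> a i * (Z ^ i + e * W ^ i) * (a j * (Z ^ j + e * W ^ j))) = u z + v z" for z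
    proof -
      obtain i j where z: "z = (i, j)" by (cases z)
      have "a i * (Z ^ i + e * W ^ i) * (a j * (Z ^ j + e * W ^ j)) =
         a i * a j * (Z ^ i * Z ^ j + e\<^sup>2 * (W ^ i * W ^ j)) + e * (a i * a j * (Z ^ i * W ^ j + W ^ i * Z ^ j))"
        by (simp add: algebra_simps power2_eq_square)
      then show ?thesis by (simp add: z u_def v_def e power_add)
    qed
    have "((\<lambda>z. u z + v z) has_sum (H * H)) P"
      using has_sum_times(2)[OF Hs Hs] unfolding uv[symmetric] H_def P_def by (simp add: case_prod_unfold)
    moreover have "((\<lambda>z. u z + v z) has_sum (infsum u P + infsum v P)) P"
      by (intro has_sum_add has_sum_infsum us vs)
    ultimately show ?thesis using has_sum_unique by (metis power2_eq_square)
  qed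
  have U: "((\<lambda>k. (Z ^ k + W ^ k) * (\<Sum>i\<in>{1..<k}. a i * a (k - i))) has_sum infsum u P) {1..}"
  proof (rule has_sum_SigmaD)
    show "((\<lambda>(k, i). a i * a (k - i) * (Z ^ k + W ^ k)) has_sum infsum u P) (SIGMA k:{1..}. {1..<k})"
      using has_sum_infsum[OF us]
      by (subst has_sum_reindex_bij_witness[where T = P and i = "\<lambda>(i, j). (i + j, i)" and j = "\<lambda>(k, i). (i, k - i)"
             and h = u and s' = "infsum u P"]) (auto simp: P_def u_def)
  next
    fix k :: nat
    show "((\<lambda>y. case (k, y) of (k, i) \<Rightarrow> a i * a (k - i) * (Z ^ k + W ^ k)) has_sum
        (Z ^ k + W ^ k) * (\<Sum>i\<in>{1..<k}. a i * a (k - i))) {1..<k}"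
      by (intro has_sum_finiteI) (auto simp: sum_distrib_left mult_ac)
  qed
  \<comment> \<open>The mixed terms are split by the sign of i - j. Off the diagonal both sides
    become the same family w when indexed by the difference k, whence the factor 2.\<close>
  define D U' L where "D = (\<lambda>j. (j, j)) ` {1::nat..}" and "U' = (\<lambda>(k, j). (j, j + k)) ` ({1::nat..} \<times> {1::nat..})"
    and "L = (\<lambda>(k, j). (j + k, j)) ` ({1::nat..} \<times> {1::nat..})"
  have PU: "P = D \<union> (U' \<union> L)"
  proof -
    have "(i, j) \<in> D \<union> (U' \<union> L)" if "(i, j) \<in> P" for i j
    proof (cases i j rule: linorder_cases)
      case less
      then have "(i, j) = (\<lambda>(k, j). (j, j + k)) (j - i, i)" "(j - i, i) \<in> {1..} \<times> {1..}" using that by (auto simp: P_def)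
      then show ?thesis unfolding U'_def by blast
    next
      case greater
      then have "(i, j) = (\<lambda>(k, j). (j + k, j)) (i - j, j)" "(i - j, j) \<in> {1..} \<times> {1..}" using that by (auto simp: P_def)
      then show ?thesis unfolding L_def by blast
    qed (use that in \<open>auto simp: P_def D_def\<close>)
    then show ?thesis by (auto simp: P_def D_def U'_def L_def)
  qed
  have sub: "v summable_on D" "v summable_on U'" "v summable_on L"
    using summable_on_subset[OF vs] PU by auto
  have dis: "D \<inter> (U' \<union> L) = {}" "U' \<inter> L = {}"
    by (auto simp: D_def U'_def L_def)
  have vP: "infsum v P = infsum v D + (infsum v U' + infsum v L)"
    unfolding PU using sub dis
    by (subst infsum_Un_disjoint) (auto intro!: summable_on_Un_disjoint simp: infsum_Un_disjoint)
  have vD: "infsum v D = 2 * e * (\<Sum>\<^sub>\<infinity>j\<in>{1..}. (a j)\<^sup>2 * p ^ j)"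
    unfolding D_def
    by (subst infsum_reindex)
       (auto simp: inj_on_def o_def v_def p_def power_mult_distrib power2_eq_square mult_ac
                   infsum_cmult_right'[symmetric] intro!: infsum_cong)
  define w where "w = (\<lambda>(k, j). e * (a j * a (j + k) * p ^ j) * (Z ^ k + W ^ k))"
  have iU: "inj_on (\<lambda>(k, j). (j, j + k)) ({1::nat..} \<times> {1::nat..})"
    and iL: "inj_on (\<lambda>(k, j). (j + k, j)) ({1::nat..} \<times> {1::nat..})" by (auto simp: inj_on_def)
  have vU: "v \<circ> (\<lambda>(k, j). (j, j + k)) = w" and vL: "v \<circ> (\<lambda>(k, j). (j + k, j)) = w"
    by (auto simp: fun_eq_iff v_def w_def p_def power_mult_distrib power_add algebra_simps)
  have ws: "w summable_on {1..} \<times> {1..}"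
    using sub(2) unfolding U'_def summable_on_reindex[OF iU] vU .
  have w2: "infsum v U' + infsum v L = 2 * infsum w ({1..} \<times> {1..})"
    unfolding U'_def L_def infsum_reindex[OF iU] infsum_reindex[OF iL] vU vL by simp
  have V: "((\<lambda>k. (Z ^ k + W ^ k) * (e * (\<Sum>\<^sub>\<infinity>j\<in>{1..}. a j * a (j + k) * p ^ j))) has_sum infsum w ({1..} \<times> {1..})) {1..}"
  proof (rule has_sum_SigmaD[OF has_sum_infsum[OF ws]])
    fix k :: nat assume k: "k \<in> {1..}"
    have s: "(\<lambda>j. norm (a j * a (j + k) * p ^ j)) summable_on {1..}"
    proof (rule summable_on_comparison_test)
      \<comment> \<open>Each term of the convergent series is at most its sum M, which bounds the
        shifted coefficient a (j + k) uniformly in j.\<close>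
      define M where "M = (\<Sum>\<^sub>\<infinity>j\<in>{1..}. norm (a j) * \<rho> ^ j)"
      show "(\<lambda>j. (norm (a j) * \<rho> ^ j) * (M / \<rho> ^ k)) summable_on {1..}"
        by (intro summable_on_cmult_left a)
      fix j :: nat assume j: "j \<in> {1..}"
      show "norm (a j * a (j + k) * p ^ j) \<le> (norm (a j) * \<rho> ^ j) * (M / \<rho> ^ k)"
      proof (cases "\<rho> = 0")
        case True
        then have "p = 0" using le by (simp add: p_def)
        then show ?thesis using True j by (simp add: power_0_left)
      next
        case False
        have "norm (a (j + k)) * \<rho> ^ (j + k) \<le> M"
          using finite_sum_le_infsum[OF a, of "{j + k}"] \<rho>0 j by (auto simp: M_def)
        then have 1: "norm (a (j + k)) * \<rho> ^ j \<le> M / \<rho> ^ k"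
          using False \<rho>0 by (simp add: field_simps power_add)
        have "norm (p ^ j) \<le> \<rho> ^ j * \<rho> ^ j"
          unfolding p_def power_mult_distrib by (rule pw[OF le(1,2)])
        then have "norm (a j * a (j + k) * p ^ j) \<le> norm (a j) * norm (a (j + k)) * (\<rho> ^ j * \<rho> ^ j)"
          unfolding norm_mult by (intro mult_left_mono) auto
        also have "\<dots> = (norm (a j) * \<rho> ^ j) * (norm (a (j + k)) * \<rho> ^ j)" by simp
        also have "\<dots> \<le> (norm (a j) * \<rho> ^ j) * (M / \<rho> ^ k)"
          by (intro mult_left_mono 1) (use \<rho>0 in auto)
        finally show ?thesis .
      qed
    qed auto
    have "((\<lambda>j. e * (a j * a (j + k) * p ^ j) * (Z ^ k + W ^ k)) has_sum
             (e * (\<Sum>\<^sub>\<infinity>j\<in>{1..}. a j * a (j + k) * p ^ j) * (Z ^ k + W ^ k))) {1..}"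
      by (rule has_sum_cmult_left[OF has_sum_cmult_right[OF has_sum_infsum[OF abs_summable_summable[OF s]]]])
    then show "((\<lambda>y. w (k, y)) has_sum (Z ^ k + W ^ k) * (e * (\<Sum>\<^sub>\<infinity>j\<in>{1..}. a j * a (j + k) * p ^ j))) {1..}"
      by (simp add: w_def mult_ac)
  qed
  have "H\<^sup>2 - 2 * e * (\<Sum>\<^sub>\<infinity>j\<in>{1..}. (a j)\<^sup>2 * p ^ j) = infsum u P + 2 * infsum w ({1..} \<times> {1..})"
    unfolding H2[symmetric] vP vD w2 by simp
  moreover have "((\<lambda>k. (Z ^ k + W ^ k) * (\<Sum>i\<in>{1..<k}. a i * a (k - i)) + 2 * ((Z ^ k + W ^ k) * (e * (\<Sum>\<^sub>\<infinity>j\<in>{1..}. a j * a (j + k) * p ^ j))))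
      has_sum (infsum u P + 2 * infsum w ({1..} \<times> {1..}))) {1..}"
    by (intro has_sum_add has_sum_cmult_right U V)
  ultimately show ?thesis by (simp add: algebra_simps)
qed

section \<open>Squares of Lambert series, coefficient by coefficient\<close>

text \<open>The quasimodular Eisenstein series E2 as a function of the squared nome p = q^2.\<close>

definition lamb_\<alpha> :: "complex \<Rightarrow> complex" where
  "lamb_\<alpha> p = 1 - 24 * (\<Sum>\<^sub>\<infinity>k\<in>{1..}. of_nat k * (p ^ k / (1 - p ^ k)))"

text \<open>Half of p times the derivative of \<open>lamb_\<alpha>\<close>; in Eisenstein series it
  is (E2^2 - E4) / 24.\<close>

definition lamb_\<beta> :: "complex \<Rightarrow> complex" where
  "lamb_\<beta> p = - 12 * (\<Sum>\<^sub>\<infinity>k\<in>{1..}. (of_nat k / (1 - p ^ k))\<^sup>2 * p ^ k)"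

lemma lambert_telescope:
  fixes g :: "nat \<Rightarrow> complex"
  assumes "g summable_on {1..}"
  shows "((\<lambda>j. g (j + k)) has_sum (infsum g {1..} - (\<Sum>j\<in>{1..k}. g j))) {1..}"
proof -
  have s: "g summable_on {k+1..}" using summable_on_subset[OF assms, of "{k+1..}"] by auto
  have "infsum g ({1..k} \<union> {k+1..}) = infsum g {1..k} + infsum g {k+1..}"
    by (rule infsum_Un_disjoint) (use s in auto)
  moreover have "{1..k} \<union> {k+1..} = {1..}" by auto
  ultimately have "infsum g {k+1..} = infsum g {1..} - (\<Sum>j\<in>{1..k}. g j)" by (simp add: infsum_finite)
  then have "(g has_sum (infsum g {1..} - (\<Sum>j\<in>{1..k}. g j))) {k+1..}" using s has_sum_infsum by metis
  then show ?thesis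
    by (subst has_sum_reindex_bij_witness[where T = "{k+1..}" and j = "\<lambda>j. j + k" and i = "\<lambda>j. j - k" and h = g]) auto
qed

text \<open>The parameter c is kept free for the induction on n. It is used with c = n, where the
  value is (n^3 - n) / 6, the origin of the k^3 and k in the Weierstrass equation.\<close>

lemma sum_int_parabola: "(\<Sum>i\<in>{1..<n}. of_nat i * (c - of_nat i)) =
    c * (of_nat n * (of_nat n - 1)) / 2 - of_nat n * (of_nat n - 1) * (2 * of_nat n - 1) / (6::complex)"
proof (induction n)
  case (Suc n)
  show ?case
  proof (cases "n = 0")
    case False
    then have "(\<Sum>i\<in>{1..<Suc n}. of_nat i * (c - of_nat i)) = (\<Sum>i\<in>{1..<n}. of_nat i * (c - of_nat i)) + of_nat n * (c - of_nat n)"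
      by (subst sum.atLeastLessThan_Suc) auto
    then show ?thesis using Suc.IH by (simp add: field_simps) 
  qed simp
qed simp

text \<open>Partial fractions that linearise a product of two Lambert kernels. With a = p^i, b = p^j
  the first handles a convolution; with a = p^j, b = p^k the second turns a correlation into
  differences that telescope in j.\<close>

lemma lambert_kernel_identities:
  fixes a b :: complex
  assumes "1 - a \<noteq> 0" "1 - b \<noteq> 0" "1 - a * b \<noteq> 0"
  shows "1 / (1 - a) * (1 / (1 - b)) = 1 / (1 - a * b) * (1 + a / (1 - a) + b / (1 - b))"
    and "1 / (1 - a) * (1 / (1 - a * b)) * a = 1 / (1 - b) * (a / (1 - a) - a * b / (1 - a * b))"
proof -
  show "1 / (1 - a) * (1 / (1 - b)) = 1 / (1 - a * b) * (1 + a / (1 - a) + b / (1 - b))"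
    using assms by (simp add: divide_simps) (simp add: algebra_simps)
  show "1 / (1 - a) * (1 / (1 - a * b)) * a = 1 / (1 - b) * (a / (1 - a) - a * b / (1 - a * b))"
    using assms by (simp add: divide_simps) (simp add: algebra_simps)
qed

lemma lambert_summable:
  fixes p :: complex
  assumes p: "norm p < 1"
  shows "(\<lambda>k. of_nat k ^ m * (p ^ k / (1 - p ^ k))) summable_on {1..}"
proof -
  have "(\<lambda>k. norm (of_nat k ^ m * (p ^ k / (1 - p ^ k)))) summable_on {1..}"
  proof (rule Infinite_Sum.abs_summable_on_comparison_test'[OF summable_on_cmult_right[OF summable_on_power_mult_geometric[of "norm p" m]]])
    fix k :: nat assume k: "k \<in> {1..}"
    have "norm (of_nat k ^ m * (p ^ k / (1 - p ^ k))) = real k ^ m * norm p ^ k / norm (1 - p ^ k)"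
      by (simp add: norm_mult norm_divide norm_power)
    also have "\<dots> \<le> real k ^ m * norm p ^ k / (1 - norm p)"
      using norm_one_minus_power_ge[of p "norm p" k] p k by (intro divide_left_mono mult_pos_pos) auto
    finally show "norm (of_nat k ^ m * (p ^ k / (1 - p ^ k))) \<le> 1 / (1 - norm p) * (real k ^ m * norm p ^ k)"
      by simp
  qed (use p in auto)
  then show ?thesis by (rule abs_summable_summable)
qed

context
  fixes Z W p :: complex
  assumes Z: "norm Z < 1" and W: "norm W < 1"
  defines "p \<equiv> Z * W"
begin

private definition "\<tau> k = 1 / (1 - p ^ k)"
private definition "L k = p ^ k / (1 - p ^ k)"

private lemma p_less: "norm p < 1"
proof -
  define \<rho> where "\<rho> = max (norm Z) (norm W)"
  have "norm p \<le> \<rho>" unfolding p_def by (rule norm_mult_le_bound) (use Z W in \<open>auto simp: \<rho>_def\<close>)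
  then show ?thesis using Z W by (simp add: \<rho>_def)
qed

private lemma nz: "k \<ge> 1 \<Longrightarrow> 1 - p ^ k \<noteq> 0"
  using norm_one_minus_power_ge(3)[of p "norm p" k] p_less by simp

private lemma \<tau>_mult: "i \<ge> 1 \<Longrightarrow> j \<ge> 1 \<Longrightarrow> \<tau> i * \<tau> j = \<tau> (i + j) * (1 + L i + L j)"
  unfolding \<tau>_def L_def power_add
  by (rule lambert_kernel_identities(1)) (use nz[of i] nz[of j] nz[of "i + j"] in \<open>auto simp: power_add\<close>)

private lemma \<tau>_mult': "k \<ge> 1 \<Longrightarrow> j \<ge> 1 \<Longrightarrow> \<tau> j * \<tau> (j + k) * p ^ j = \<tau> k * (L j - L (j + k))"
  unfolding \<tau>_def L_def power_add
  by (rule lambert_kernel_identities(2)) (use nz[of k] nz[of j] nz[of "j + k"] in \<open>auto simp: power_add\<close>)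

private lemma L_summable: "(\<lambda>k. of_nat k ^ m * L k) summable_on {1..}"
  unfolding L_def by (rule lambert_summable[OF p_less])

private lemma L_summable_quadratic: "(\<lambda>j. (a * of_nat j + b * of_nat j ^ 2) * L j) summable_on {1..}"
  using summable_on_add[OF summable_on_cmult_right[OF L_summable[of 1], of a] summable_on_cmult_right[OF L_summable[of 2], of b]]
  by (simp add: algebra_simps)

text \<open>Convolution and correlation both produce partial sums of \<open>L\<close>, up to k - 1
  and up to k; they cancel except for the last term, and \<tau> k (1 + 2 L k) is the coefficient
  that occurs in \<open>Y 0 1\<close>.\<close>

private lemma coeff_zeta: 
  assumes k: "k \<ge> 1"
  shows "(\<Sum>i\<in>{1..<k}. \<tau> i * \<tau> (k - i)) + 2 * (- 1) * (\<Sum>\<^sub>\<infinity>j\<in>{1..}. \<tau> j * \<tau> (j + k) * p ^ j)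
     = of_nat k * \<tau> k - (1 + p ^ k) / (1 - p ^ k)\<^sup>2"
proof -
  have "(\<Sum>i\<in>{1..<k}. \<tau> i * \<tau> (k - i)) = (\<Sum>i\<in>{1..<k}. \<tau> k * (1 + L i + L (k - i)))"
    by (intro sum.cong refl, subst \<tau>_mult) auto
  also have "\<dots> = \<tau> k * ((of_nat k - 1) + (\<Sum>i\<in>{1..<k}. L i) + (\<Sum>i\<in>{1..<k}. L (k - i)))"
    using k by (simp add: sum_distrib_left[symmetric] sum.distrib of_nat_diff)
  also have "(\<Sum>i\<in>{1..<k}. L (k - i)) = (\<Sum>i\<in>{1..<k}. L i)"
    by (rule sum.reindex_bij_witness[of _ "\<lambda>i. k - i" "\<lambda>i. k - i"]) auto
  finally have 1: "(\<Sum>i\<in>{1..<k}. \<tau> i * \<tau> (k - i)) = \<tau> k * (of_nat k - 1 + 2 * (\<Sum>i\<in>{1..<k}. L i))" by simp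
  have Ls: "L summable_on {1..}" using L_summable[of 0] by simp
  have "((\<lambda>j. L j - L (j + k)) has_sum (infsum L {1..} - (infsum L {1..} - (\<Sum>j\<in>{1..k}. L j)))) {1..}"
    by (intro has_sum_diff has_sum_infsum Ls lambert_telescope)
  then have "((\<lambda>j. \<tau> k * (L j - L (j + k))) has_sum (\<tau> k * (\<Sum>j\<in>{1..k}. L j))) {1..}"
    by (intro has_sum_cmult_right) simp
  also have "?this \<longleftrightarrow> ((\<lambda>j. \<tau> j * \<tau> (j + k) * p ^ j) has_sum (\<tau> k * (\<Sum>j\<in>{1..k}. L j))) {1..}"
    by (intro has_sum_cong) (use \<tau>_mult' k in auto)
  finally have 2: "(\<Sum>\<^sub>\<infinity>j\<in>{1..}. \<tau> j * \<tau> (j + k) * p ^ j) = \<tau> k * (\<Sum>j\<in>{1..k}. L j)" by (rule infsumI)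
  have 3: "(\<Sum>j\<in>{1..k}. L j) = (\<Sum>j\<in>{1..<k}. L j) + L k"
    using k by (simp add: sum.last_plus add.commute)
  have "(1 + p ^ k) / (1 - p ^ k)\<^sup>2 = \<tau> k * (1 + 2 * L k)"
    using nz[OF k] by (simp add: \<tau>_def L_def divide_simps power2_eq_square) 
  then show ?thesis unfolding 1 2 3 by (simp add: algebra_simps)
qed

text \<open>The convolution contributes 2 Q and twice the correlation - 2 Q, so the partial sums
  cancel; what survives is (k^3 - k) / 6 + 4 k S1, and the full sum S1 is absorbed in
  \<open>lamb_\<alpha>\<close>.\<close>

private lemma coeff_wp: 
  assumes k: "k \<ge> 1"
  shows "6 * ((\<Sum>i\<in>{1..<k}. (of_nat i * \<tau> i) * (of_nat (k - i) * \<tau> (k - i)))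
        + 2 * 1 * (\<Sum>\<^sub>\<infinity>j\<in>{1..}. (of_nat j * \<tau> j) * (of_nat (j + k) * \<tau> (j + k)) * p ^ j))
     = (of_nat k ^ 3 - lamb_\<alpha> p * of_nat k) * \<tau> k"
proof -
  define S1 where "S1 = (\<Sum>\<^sub>\<infinity>j\<in>{1..}. of_nat j * L j)"
  define Q where "Q = (\<Sum>i\<in>{1..<k}. of_nat i * (of_nat k - of_nat i) * L i)"
  have "(\<Sum>i\<in>{1..<k}. (of_nat i * \<tau> i) * (of_nat (k - i) * \<tau> (k - i)))
     = (\<Sum>i\<in>{1..<k}. of_nat i * (of_nat k - of_nat i) * (\<tau> i * \<tau> (k - i)))"
    by (intro sum.cong refl) (auto simp: of_nat_diff mult_ac)
  also have "\<dots> = (\<Sum>i\<in>{1..<k}. of_nat i * (of_nat k - of_nat i) * (\<tau> k * (1 + L i + L (k - i))))"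
    by (intro sum.cong refl, subst \<tau>_mult) auto
  also have "\<dots> = \<tau> k * ((\<Sum>i\<in>{1..<k}. of_nat i * (of_nat k - of_nat i)) + Q
                    + (\<Sum>i\<in>{1..<k}. of_nat i * (of_nat k - of_nat i) * L (k - i)))"
    by (simp add: sum_distrib_left sum.distrib algebra_simps Q_def sum_subtractf)
  also have "(\<Sum>i\<in>{1..<k}. of_nat i * (of_nat k - of_nat i) * L (k - i)) = Q"
    unfolding Q_def
    by (rule sum.reindex_bij_witness[of _ "\<lambda>i. k - i" "\<lambda>i. k - i"]) (auto simp: of_nat_diff)
  finally have 1: "(\<Sum>i\<in>{1..<k}. (of_nat i * \<tau> i) * (of_nat (k - i) * \<tau> (k - i)))
     = \<tau> k * ((\<Sum>i\<in>{1..<k}. of_nat i * (of_nat k - of_nat i)) + 2 * Q)" by simp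
  \<comment> \<open>g1 j is j (j + k) L j and g2 j is j (j - k) L j, so that g2 (j + k) carries the
    same weight j (j + k). They differ by a linear weight only, which leaves a multiple of S1, and
    g2 k = 0.\<close>
  define g1 g2 where "g1 = (\<lambda>j. (of_nat k * of_nat j + 1 * of_nat j ^ 2) * L j)"
    and "g2 = (\<lambda>j. (- of_nat k * of_nat j + 1 * of_nat j ^ 2) * L j)"
  have g: "g1 summable_on {1..}" "g2 summable_on {1..}"
    unfolding g1_def g2_def by (rule L_summable_quadratic)+
  have "((\<lambda>j. g1 j - g2 (j + k)) has_sum (infsum g1 {1..} - (infsum g2 {1..} - (\<Sum>j\<in>{1..k}. g2 j)))) {1..}"
    by (intro has_sum_diff has_sum_infsum g lambert_telescope)
  moreover have "infsum g1 {1..} - infsum g2 {1..} = 2 * of_nat k * S1"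
  proof -
    have "((\<lambda>j. g1 j - g2 j) has_sum (infsum g1 {1..} - infsum g2 {1..})) {1..}"
      by (intro has_sum_diff has_sum_infsum g)
    then have "infsum g1 {1..} - infsum g2 {1..} = (\<Sum>\<^sub>\<infinity>j\<in>{1..}. g1 j - g2 j)" by (rule infsumI[symmetric])
    also have "(\<lambda>j. g1 j - g2 j) = (\<lambda>j. (2 * of_nat k) * (of_nat j * L j))"
    proof
      have "(c * x + 1 * x ^ 2) * l - (- c * x + 1 * x ^ 2) * l = 2 * c * (x * l)" for c x l :: complex
        by (simp add: algebra_simps)
      then show "g1 j - g2 j = (2 * of_nat k) * (of_nat j * L j)" for j by (simp add: g1_def g2_def)
    qed
    finally show ?thesis by (simp add: S1_def infsum_cmult_right')
  qed
  moreover have "(\<Sum>j\<in>{1..k}. g2 j) = - Q"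
  proof -
    have "(\<Sum>j\<in>{1..k}. g2 j) = (\<Sum>j\<in>{1..<k}. g2 j) + g2 k"
      using k by (simp add: sum.last_plus add.commute)
    also have "g2 k = 0" by (simp add: g2_def power2_eq_square)
    also have "(\<Sum>j\<in>{1..<k}. g2 j) = - Q" unfolding Q_def sum_negf[symmetric]
      by (intro sum.cong refl) (simp add: g2_def power2_eq_square algebra_simps)
    finally show ?thesis by simp
  qed
  ultimately have "((\<lambda>j. g1 j - g2 (j + k)) has_sum (2 * of_nat k * S1 - Q)) {1..}"
    by (simp add: algebra_simps)
  then have "((\<lambda>j. \<tau> k * (g1 j - g2 (j + k))) has_sum (\<tau> k * (2 * of_nat k * S1 - Q))) {1..}"
    by (rule has_sum_cmult_right)
  also have "?this \<longleftrightarrow> ((\<lambda>j. (of_nat j * \<tau> j) * (of_nat (j + k) * \<tau> (j + k)) * p ^ j) has_sum (\<tau> k * (2 * of_nat k * S1 - Q))) {1..}"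
  proof (intro has_sum_cong)
    fix j :: nat assume j: "j \<in> {1..}"
    have "(of_nat j * \<tau> j) * (of_nat (j + k) * \<tau> (j + k)) * p ^ j = of_nat j * of_nat (j + k) * (\<tau> j * \<tau> (j + k) * p ^ j)"
      by simp
    also have "\<dots> = of_nat j * of_nat (j + k) * (\<tau> k * (L j - L (j + k)))" using j k by (subst \<tau>_mult') auto
    also have "\<dots> = \<tau> k * (g1 j - g2 (j + k))"
    proof -
      have "x * (x + n) * (T * (l - l')) = T * ((n * x + 1 * x ^ 2) * l - (- n * (x + n) + 1 * (x + n) ^ 2) * l')" for x n T l l' :: complex
        by (simp add: algebra_simps power2_eq_square)
      then show ?thesis unfolding g1_def g2_def of_nat_add .
    qed
    finally show "\<tau> k * (g1 j - g2 (j + k)) = (of_nat j * \<tau> j) * (of_nat (j + k) * \<tau> (j + k)) * p ^ j" ..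
  qed
  finally have 2: "(\<Sum>\<^sub>\<infinity>j\<in>{1..}. (of_nat j * \<tau> j) * (of_nat (j + k) * \<tau> (j + k)) * p ^ j) = \<tau> k * (2 * of_nat k * S1 - Q)"
    by (rule infsumI)
  have \<alpha>: "lamb_\<alpha> p = 1 - 24 * S1" by (simp add: lamb_\<alpha>_def S1_def L_def)
  have "6 * (T * ((n * (n * (n - 1)) / 2 - n * (n - 1) * (2 * n - 1) / 6) + 2 * R) + 2 * 1 * (T * (2 * n * S - R)))
     = (n ^ 3 - (1 - 24 * S) * n) * T" for T n R S :: complex
    by (simp add: field_simps power3_eq_cube)
  then show ?thesis unfolding 1 2 sum_int_parabola \<alpha> .
qed

private lemma \<tau>_summable: "(\<lambda>k. norm (of_nat k ^ m * \<tau> k) * max (norm Z) (norm W) ^ k) summable_on {1..}"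
proof -
  define \<rho> where "\<rho> = max (norm Z) (norm W)"
  have \<rho>: "0 \<le> \<rho>" "\<rho> < 1" "norm p \<le> \<rho>"
    unfolding p_def using Z W by (auto simp: \<rho>_def le_max_iff_disj intro!: norm_mult_le_bound)
  have "(\<lambda>k. norm (norm (of_nat k ^ m * \<tau> k) * \<rho> ^ k)) summable_on {1..}"
  proof (rule Infinite_Sum.abs_summable_on_comparison_test'[OF summable_on_cmult_right[OF summable_on_power_mult_geometric[OF \<rho>(1,2), of m]]])
    fix k :: nat assume k: "k \<in> {1..}"
    have "norm (\<tau> k) \<le> 1 / (1 - \<rho>)"
      unfolding \<tau>_def norm_divide using norm_one_minus_power_ge[OF \<rho>(3,2), of k] k \<rho> nz[of k]
      by (simp add: frac_le)
    then have "norm (of_nat k ^ m * \<tau> k) * \<rho> ^ k \<le> real k ^ m * (1 / (1 - \<rho>)) * \<rho> ^ k"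
      unfolding norm_mult using \<rho> by (intro mult_mono) (auto simp: norm_power)
    then show "norm (norm (of_nat k ^ m * \<tau> k) * \<rho> ^ k) \<le> 1 / (1 - \<rho>) * (real k ^ m * \<rho> ^ k)"
      using \<rho> by (simp add: abs_mult)
  qed
  then show ?thesis using \<rho> by (simp add: \<rho>_def abs_mult)
qed

text \<open>For f with ln f = - (sum over k of (Z^k + W^k) / (k (1 - p^k))), the logarithm of a
  theta product, this is the heat equation up to a factor depending on p alone: the square of the
  first logarithmic derivative minus \<open>X 1 1\<close> is the second derivative of f over f, and
  \<open>Y 0 1\<close> is minus the nome derivative of ln f.\<close>

lemma X_zeta_square:
  "(X 0 (- 1) Z W)\<^sup>2 = X 1 1 Z W - Y 0 1 Z W - 2 * (\<Sum>\<^sub>\<infinity>k\<in>{1..}. (1 / (1 - (Z * W) ^ k))\<^sup>2 * (Z * W) ^ k)"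
proof -
  have H: "(\<Sum>\<^sub>\<infinity>k\<in>{1..}. \<tau> k * (Z ^ k + (- 1) * W ^ k)) = X 0 (- 1) Z W"
    by (simp add: X_def Xt_def \<tau>_def p_def)
  have "((\<lambda>k. (Z ^ k + W ^ k) * ((\<Sum>i\<in>{1..<k}. \<tau> i * \<tau> (k - i)) + 2 * (- 1) * (\<Sum>\<^sub>\<infinity>j\<in>{1..}. \<tau> j * \<tau> (j + k) * p ^ j)))
          has_sum ((X 0 (- 1) Z W)\<^sup>2 - 2 * (- 1) * (\<Sum>\<^sub>\<infinity>j\<in>{1..}. (\<tau> j)\<^sup>2 * p ^ j))) {1..}"
    unfolding H[symmetric] unfolding p_def
    by (rule square_even_odd_series[where \<rho> = "max (norm Z) (norm W)"]) (use \<tau>_summable[of 0] Z W in auto)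
  also have "?this \<longleftrightarrow> ((\<lambda>k. Xt 1 1 Z W k - Yt 0 1 Z W k) has_sum ((X 0 (- 1) Z W)\<^sup>2 - 2 * (- 1) * (\<Sum>\<^sub>\<infinity>j\<in>{1..}. (\<tau> j)\<^sup>2 * p ^ j))) {1..}"
  proof (intro has_sum_cong)
    fix k :: nat assume "k \<in> {1..}"
    then have k: "k \<ge> 1" by simp
    show "(Z ^ k + W ^ k) * ((\<Sum>i\<in>{1..<k}. \<tau> i * \<tau> (k - i)) + 2 * (- 1) * (\<Sum>\<^sub>\<infinity>j\<in>{1..}. \<tau> j * \<tau> (j + k) * p ^ j))
        = Xt 1 1 Z W k - Yt 0 1 Z W k"
      unfolding coeff_zeta[OF k] by (simp add: Xt_def Yt_def \<tau>_def p_def algebra_simps)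
  qed
  finally have "(X 0 (- 1) Z W)\<^sup>2 - 2 * (- 1) * (\<Sum>\<^sub>\<infinity>j\<in>{1..}. (\<tau> j)\<^sup>2 * p ^ j) = (\<Sum>\<^sub>\<infinity>k\<in>{1..}. Xt 1 1 Z W k - Yt 0 1 Z W k)"
    by (rule infsumI[symmetric])
  also have "\<dots> = X 1 1 Z W - Y 0 1 Z W"
    unfolding X_def Y_def
    using has_sum_diff[OF has_sum_infsum[OF Xt_summable(1)[OF Z W, of 1 1]] has_sum_infsum[OF Yt_summable[OF Z W, of 1 0]]]
    by (simp add: infsumI)
  finally show ?thesis by (simp add: \<tau>_def p_def algebra_simps)
qed

text \<open>The equation \<wp>'' = 6 \<wp>^2 - g2 / 2 up to scaling. The linear term is there
  because \<open>X 1 1\<close> differs from the scaled \<wp> by the constant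
  \<open>lamb_\<alpha>\<close> / 12.\<close>

lemma X_weierstrass_second_order:
  "X 3 1 Z W = 6 * (X 1 1 Z W)\<^sup>2 + lamb_\<alpha> (Z * W) * X 1 1 Z W + lamb_\<beta> (Z * W)"
proof -
  have H: "(\<Sum>\<^sub>\<infinity>k\<in>{1..}. (of_nat k * \<tau> k) * (Z ^ k + 1 * W ^ k)) = X 1 1 Z W"
    by (simp add: X_def Xt_def \<tau>_def p_def)
  have "((\<lambda>k. (Z ^ k + W ^ k) * ((\<Sum>i\<in>{1..<k}. (of_nat i * \<tau> i) * (of_nat (k - i) * \<tau> (k - i))) + 2 * 1 * (\<Sum>\<^sub>\<infinity>j\<in>{1..}. (of_nat j * \<tau> j) * (of_nat (j + k) * \<tau> (j + k)) * p ^ j)))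
          has_sum ((X 1 1 Z W)\<^sup>2 - 2 * 1 * (\<Sum>\<^sub>\<infinity>j\<in>{1..}. (of_nat j * \<tau> j)\<^sup>2 * p ^ j))) {1..}"
    unfolding H[symmetric] unfolding p_def
    by (rule square_even_odd_series[where \<rho> = "max (norm Z) (norm W)"]) (use \<tau>_summable[of 1] Z W in auto)
  from has_sum_cmult_right[OF this, of 6]
  have "((\<lambda>k. 6 * ((Z ^ k + W ^ k) * ((\<Sum>i\<in>{1..<k}. (of_nat i * \<tau> i) * (of_nat (k - i) * \<tau> (k - i))) + 2 * 1 * (\<Sum>\<^sub>\<infinity>j\<in>{1..}. (of_nat j * \<tau> j) * (of_nat (j + k) * \<tau> (j + k)) * p ^ j))))
          has_sum 6 * ((X 1 1 Z W)\<^sup>2 - 2 * 1 * (\<Sum>\<^sub>\<infinity>j\<in>{1..}. (of_nat j * \<tau> j)\<^sup>2 * p ^ j))) {1..}" .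
  also have "?this \<longleftrightarrow> ((\<lambda>k. Xt 3 1 Z W k - lamb_\<alpha> p * Xt 1 1 Z W k) has_sum 6 * ((X 1 1 Z W)\<^sup>2 - 2 * 1 * (\<Sum>\<^sub>\<infinity>j\<in>{1..}. (of_nat j * \<tau> j)\<^sup>2 * p ^ j))) {1..}"
  proof (intro has_sum_cong)
    fix k :: nat assume "k \<in> {1..}"
    then have k: "k \<ge> 1" by simp
    show "6 * ((Z ^ k + W ^ k) * ((\<Sum>i\<in>{1..<k}. (of_nat i * \<tau> i) * (of_nat (k - i) * \<tau> (k - i))) + 2 * 1 * (\<Sum>\<^sub>\<infinity>j\<in>{1..}. (of_nat j * \<tau> j) * (of_nat (j + k) * \<tau> (j + k)) * p ^ j)))
        = Xt 3 1 Z W k - lamb_\<alpha> p * Xt 1 1 Z W k"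
      unfolding mult.left_commute[of 6] coeff_wp[OF k] by (simp add: Xt_def \<tau>_def p_def algebra_simps diff_divide_distrib)
  qed
  finally have "6 * ((X 1 1 Z W)\<^sup>2 - 2 * 1 * (\<Sum>\<^sub>\<infinity>j\<in>{1..}. (of_nat j * \<tau> j)\<^sup>2 * p ^ j)) = (\<Sum>\<^sub>\<infinity>k\<in>{1..}. Xt 3 1 Z W k - lamb_\<alpha> p * Xt 1 1 Z W k)"
    by (rule infsumI[symmetric])
  also have "\<dots> = X 3 1 Z W - lamb_\<alpha> p * X 1 1 Z W"
    unfolding X_def 
    using has_sum_diff[OF has_sum_infsum[OF Xt_summable(1)[OF Z W, of 1 3]] has_sum_cmult_right[OF has_sum_infsum[OF Xt_summable(1)[OF Z W, of 1 1]]]]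
    by (simp add: infsumI)
  finally show ?thesis by (simp add: lamb_\<beta>_def \<tau>_def p_def algebra_simps)
qed

end

section \<open>Differentiating the identities at fixed nome\<close>

lemma DERIV_unique_local:
  fixes f g :: "complex \<Rightarrow> complex"
  assumes "(f has_field_derivative f') (at z)" "(g has_field_derivative g') (at z)"
    and "open S" "z \<in> S" "\<And>u. u \<in> S \<Longrightarrow> f u = g u"
  shows "f' = g'"
  using has_field_derivative_transform_within_open[OF assms(1,3,4,5)] assms(2) DERIV_unique by blast

text \<open>The parameters u for which the point, moved along its fibre of fixed nome, stays in the
  bidisc. Identities that hold on the whole bidisc are differentiated along this curve at u =
  0.\<close>

definition bidisc_curve :: "complex \<Rightarrow> complex \<Rightarrow> complex set" where
  "bidisc_curve Z W = {u. norm (Z * exp u) < 1 \<and> norm (W * exp (- u)) < 1}"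

lemma open_bidisc_curve: "open (bidisc_curve Z W)"
  unfolding bidisc_curve_def by (intro open_Collect_conj open_Collect_less continuous_intros)

lemma X_fixed_nome_derivative:
  assumes "norm Z < 1" "norm W < 1" "norm e \<le> 1"
  shows "((\<lambda>u. X m e (Z * exp u) (W * exp (- u))) has_field_derivative X (Suc m) (- e) Z W) (at 0)"
proof -
  have "((\<lambda>u. X m e (Z * exp u) (W * exp (- u))) has_field_derivative
     (1 * X (Suc m) (- e) (Z * exp 0) (W * exp (- 0)) + 0 * Y (Suc m) e (Z * exp 0) (W * exp (- 0)))) (at 0)"
    by (rule X_has_field_derivative[where S = UNIV and c = "\<lambda>_. 0" and d = "\<lambda>_. 1"])
       (use assms in \<open>auto intro!: derivative_eq_intros\<close>)
  then show ?thesis by simp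
qed

lemma Y_fixed_nome_derivative:
  assumes "norm Z < 1" "norm W < 1" "norm e \<le> 1"
  shows "((\<lambda>u. Y m e (Z * exp u) (W * exp (- u))) has_field_derivative Y (Suc m) (- e) Z W) (at 0)"
proof -
  have "((\<lambda>u. Y m e (Z * exp u) (W * exp (- u))) has_field_derivative
     (Y (Suc m) (- e) (Z * exp 0) (W * exp (- 0)))) (at 0)"
    by (rule Y_has_field_derivative_fixed_nome[where S = UNIV and p = "Z * W"])
       (use assms in \<open>auto intro!: derivative_eq_intros simp: exp_minus\<close>)
  then show ?thesis by simp
qed

lemma nome_curve: "(Z * exp u) * (W * exp (- u)) = Z * (W :: complex)"
  by (simp add: exp_minus)

context
  fixes Z W :: complex
  assumes Z: "norm Z < 1" and W: "norm W < 1"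
begin

private lemma curve0: "0 \<in> bidisc_curve Z W"
  using Z W by (simp add: bidisc_curve_def)

private lemmas dX = X_fixed_nome_derivative[OF Z W] and dY = Y_fixed_nome_derivative[OF Z W]

text \<open>Derivative of \<open>X_zeta_square\<close> at fixed nome. Its last term depends on Z W
  only and disappears.\<close>

lemma Y1_eq: "Y 1 (- 1) Z W = X 2 (- 1) Z W - 2 * X 0 (- 1) Z W * X 1 1 Z W"
proof -
  define cc where "cc = 2 * (\<Sum>\<^sub>\<infinity>k\<in>{1..}. (1 / (1 - (Z * W) ^ k))\<^sup>2 * (Z * W) ^ k)"
  have "2 * X 0 (- 1) Z W * X (Suc 0) (- (- 1)) Z W = X (Suc 1) (- 1) Z W - Y (Suc 0) (- 1) Z W"
  proof (rule DERIV_unique_local[OF _ _ open_bidisc_curve curve0])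
    show "((\<lambda>u. (X 0 (- 1) (Z * exp u) (W * exp (- u)))\<^sup>2) has_field_derivative
        2 * X 0 (- 1) Z W * X (Suc 0) (- (- 1)) Z W) (at 0)"
      using DERIV_power[OF dX[of "-1" 0], of 2] by (simp add: mult_ac)
    show "((\<lambda>u. X 1 1 (Z * exp u) (W * exp (- u)) - Y 0 1 (Z * exp u) (W * exp (- u)) - cc) has_field_derivative
        X (Suc 1) (- 1) Z W - Y (Suc 0) (- 1) Z W) (at 0)"
      using DERIV_diff[OF DERIV_diff[OF dX[of 1 1] dY[of 1 0]] DERIV_const[of cc]] by simp
  qed (auto simp: bidisc_curve_def X_zeta_square nome_curve cc_def)
  then show ?thesis by (simp add: numeral_2_eq_2 algebra_simps)
qed

lemma X4_eq: "X 4 (- 1) Z W = (12 * X 1 1 Z W + lamb_\<alpha> (Z * W)) * X 2 (- 1) Z W"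
proof -
  have "X (Suc 3) (- 1) Z W = 12 * X 1 1 Z W * X (Suc 1) (- 1) Z W + lamb_\<alpha> (Z * W) * X (Suc 1) (- 1) Z W"
  proof (rule DERIV_unique_local[OF _ _ open_bidisc_curve curve0])
    show "((\<lambda>u. X 3 1 (Z * exp u) (W * exp (- u))) has_field_derivative X (Suc 3) (- 1) Z W) (at 0)"
      by (rule dX) simp
    show "((\<lambda>u. 6 * (X 1 1 (Z * exp u) (W * exp (- u)))\<^sup>2 + lamb_\<alpha> (Z * W) * X 1 1 (Z * exp u) (W * exp (- u)) + lamb_\<beta> (Z * W)) has_field_derivative
        12 * X 1 1 Z W * X (Suc 1) (- 1) Z W + lamb_\<alpha> (Z * W) * X (Suc 1) (- 1) Z W) (at 0)"
      using DERIV_add[OF DERIV_add[OF DERIV_cmult[OF DERIV_power[OF dX[of 1 1], of 2], of 6] DERIV_cmult[OF dX[of 1 1]]] DERIV_const[of "lamb_\<beta> (Z * W)"]]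
      by (simp add: mult_ac)
  qed (auto simp: bidisc_curve_def X_weierstrass_second_order nome_curve)
  then show ?thesis by (simp add: numeral_2_eq_2 algebra_simps)
qed

end

text \<open>Derivative of \<open>Y1_eq\<close> at fixed nome. With its neighbours it expresses every
  nome derivative that the Painleve curve will need through the series \<open>X\<close>.\<close>

lemma Y2_eq:
  assumes Z: "norm Z < 1" and W: "norm W < 1"
  shows "Y 2 1 Z W = X 3 1 Z W - 2 * (X 1 1 Z W)\<^sup>2 - 2 * X 0 (- 1) Z W * X 2 (- 1) Z W"
proof -
  note dX = X_fixed_nome_derivative[OF Z W] and dY = Y_fixed_nome_derivative[OF Z W]
  have "Y (Suc 1) (- (- 1)) Z W = X (Suc 2) (- (- 1)) Z W - 2 * (X (Suc 0) (- (- 1)) Z W * X 1 1 Z W + X (Suc 1) (- 1) Z W * X 0 (- 1) Z W)"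
  proof (rule DERIV_unique_local[OF _ _ open_bidisc_curve])
    show "((\<lambda>u. Y 1 (- 1) (Z * exp u) (W * exp (- u))) has_field_derivative Y (Suc 1) (- (- 1)) Z W) (at 0)"
      by (rule dY) simp
    show "((\<lambda>u. X 2 (- 1) (Z * exp u) (W * exp (- u)) - 2 * (X 0 (- 1) (Z * exp u) (W * exp (- u)) * X 1 1 (Z * exp u) (W * exp (- u)))) has_field_derivative
        X (Suc 2) (- (- 1)) Z W - 2 * (X (Suc 0) (- (- 1)) Z W * X 1 1 Z W + X (Suc 1) (- 1) Z W * X 0 (- 1) Z W)) (at 0)"
      using DERIV_diff[OF dX[of "-1" 2] DERIV_cmult[OF DERIV_mult[OF dX[of "-1" 0] dX[of 1 1]], of 2]] by simp
    show "Y 1 (- 1) (Z * exp u) (W * exp (- u)) = X 2 (- 1) (Z * exp u) (W * exp (- u)) - 2 * (X 0 (- 1) (Z * exp u) (W * exp (- u)) * X 1 1 (Z * exp u) (W * exp (- u)))"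
      if "u \<in> bidisc_curve Z W" for u
      using Y1_eq[of "Z * exp u" "W * exp (- u)"] that by (simp add: bidisc_curve_def)
  qed (use Z W in \<open>simp add: bidisc_curve_def\<close>)
  then show ?thesis by (simp add: numeral_2_eq_2 numeral_3_eq_3 power2_eq_square algebra_simps)
qed

text \<open>Derivative of \<open>Y2_eq\<close>, with \<open>X4_eq\<close> removing the fourth-order
  series.\<close>

lemma Y3_eq:
  assumes Z: "norm Z < 1" and W: "norm W < 1"
  shows "Y 3 (- 1) Z W = (6 * X 1 1 Z W + lamb_\<alpha> (Z * W)) * X 2 (- 1) Z W - 2 * X 0 (- 1) Z W * X 3 1 Z W"
proof -
  note dX = X_fixed_nome_derivative[OF Z W] and dY = Y_fixed_nome_derivative[OF Z W]
  have "Y (Suc 2) (- 1) Z W = X (Suc 3) (- 1) Z W - 2 * (2 * X 1 1 Z W * X (Suc 1) (- 1) Z W) - 2 * (X (Suc 0) (- (- 1)) Z W * X 2 (- 1) Z W + X (Suc 2) (- (- 1)) Z W * X 0 (- 1) Z W)"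
  proof (rule DERIV_unique_local[OF _ _ open_bidisc_curve])
    show "((\<lambda>u. Y 2 1 (Z * exp u) (W * exp (- u))) has_field_derivative Y (Suc 2) (- 1) Z W) (at 0)"
      by (rule dY) simp
    show "((\<lambda>u. X 3 1 (Z * exp u) (W * exp (- u)) - 2 * (X 1 1 (Z * exp u) (W * exp (- u)))\<^sup>2 - 2 * (X 0 (- 1) (Z * exp u) (W * exp (- u)) * X 2 (- 1) (Z * exp u) (W * exp (- u)))) has_field_derivative
        X (Suc 3) (- 1) Z W - 2 * (2 * X 1 1 Z W * X (Suc 1) (- 1) Z W) - 2 * (X (Suc 0) (- (- 1)) Z W * X 2 (- 1) Z W + X (Suc 2) (- (- 1)) Z W * X 0 (- 1) Z W)) (at 0)"
      using DERIV_diff[OF DERIV_diff[OF dX[of 1 3] DERIV_cmult[OF DERIV_power[OF dX[of 1 1], of 2], of 2]] DERIV_cmult[OF DERIV_mult[OF dX[of "-1" 0] dX[of "-1" 2]], of 2]]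
      by (simp add: mult_ac)
    show "Y 2 1 (Z * exp u) (W * exp (- u)) = X 3 1 (Z * exp u) (W * exp (- u)) - 2 * (X 1 1 (Z * exp u) (W * exp (- u)))\<^sup>2 - 2 * (X 0 (- 1) (Z * exp u) (W * exp (- u)) * X 2 (- 1) (Z * exp u) (W * exp (- u)))"
      if "u \<in> bidisc_curve Z W" for u
      using Y2_eq[of "Z * exp u" "W * exp (- u)"] that by (simp add: bidisc_curve_def)
  qed (use Z W in \<open>simp add: bidisc_curve_def\<close>)
  then have "Y 3 (- 1) Z W = X 4 (- 1) Z W - 2 * (2 * X 1 1 Z W * X 2 (- 1) Z W) - 2 * (X 1 1 Z W * X 2 (- 1) Z W + X 3 1 Z W * X 0 (- 1) Z W)"
    by (simp add: eval_nat_numeral)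
  then show ?thesis unfolding X4_eq[OF Z W] by (simp add: algebra_simps)
qed

section \<open>Half-period values and the Weierstrass cubic\<close>

text \<open>Exchanging Z and W is the reflection of the torus, under which these series are odd; Z =
  W is one of its fixed points, a half-period.\<close>

lemma X_self_odd: "X m (- 1) Z Z = 0"
  by (simp add: X_def Xt_def)

text \<open>The root at the half-period \<omega>2, where Z = W = q, in the normalisation of
  \<open>X\<close>; \<open>s3\<close> belongs to \<omega>1 + \<omega>2, where Z = W = - q.\<close>

definition s2 :: "complex \<Rightarrow> complex" where "s2 q = X 1 1 q q"
definition s3 :: "complex \<Rightarrow> complex" where "s3 q = s2 (- q)"
text \<open>The third root, fixed by prescribing the sum of the roots of the cubic 4 X^3 + \<alpha>
  X^2 + 2 \<beta> X + const.\<close>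

definition s1 :: "complex \<Rightarrow> complex" where "s1 q = - lamb_\<alpha> (q\<^sup>2) / 4 - s2 q - s3 q"

lemma lamb_\<alpha>_eq: "lamb_\<alpha> (q\<^sup>2) = - 4 * (s1 q + s2 q + s3 q)"
  by (simp add: s1_def field_simps)

text \<open>At fixed nome the left-hand side has derivative 2 X2 (X3 - 6 X1^2 - \<alpha> X1 -
  \<beta>) = 0. The parameters u form a strip, so it is constant, and the value is read off at u =
  0, where Z = W = q kills the odd series.\<close>

lemma weierstrass_first_integral:
  assumes q: "norm q < 1" "q \<noteq> 0" and Z: "norm Z < 1" and W: "norm W < 1" and ZW: "Z * W = q\<^sup>2"
  shows "(X 2 (- 1) Z W)\<^sup>2 - 4 * (X 1 1 Z W) ^ 3 - lamb_\<alpha> (q\<^sup>2) * (X 1 1 Z W)\<^sup>2 - 2 * lamb_\<beta> (q\<^sup>2) * X 1 1 Z W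
     = - 4 * s2 q ^ 3 - lamb_\<alpha> (q\<^sup>2) * (s2 q)\<^sup>2 - 2 * lamb_\<beta> (q\<^sup>2) * s2 q"
proof -
  define U where "U = {u. Re u < - ln (norm q)} \<inter> {u. Re u > ln (norm q)}"
  define a b where "a = lamb_\<alpha> (q\<^sup>2)" and "b = lamb_\<beta> (q\<^sup>2)"
  have U: "open U" "convex U"
    unfolding U_def by (auto intro!: open_Int convex_Int open_halfspace_Re_lt open_halfspace_Re_gt convex_halfspace_Re_lt convex_halfspace_Re_gt)
  have Ulm: "norm (q * exp u) < 1 \<and> norm (q * exp (- u)) < 1 \<longleftrightarrow> u \<in> U" for u
  proof -
    have "norm (q * exp v) < 1 \<longleftrightarrow> Re v < - ln (norm q)" for v
    proof -
      have "norm (q * exp v) = exp (ln (norm q) + Re v)"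
        using q by (simp add: norm_mult norm_exp_eq_Re exp_add)
      then show ?thesis by auto
    qed
    from this[of u] this[of "- u"] show ?thesis by (auto simp: U_def)
  qed
  define D where "D = (\<lambda>u. (X 2 (- 1) (q * exp u) (q * exp (- u)))\<^sup>2 - 4 * (X 1 1 (q * exp u) (q * exp (- u))) ^ 3
     - a * (X 1 1 (q * exp u) (q * exp (- u)))\<^sup>2 - 2 * b * X 1 1 (q * exp u) (q * exp (- u)))"
  have dD: "(D has_field_derivative 0) (at u)" if u: "u \<in> U" for u
  proof -
    define Z' W' where "Z' = q * exp u" and "W' = q * exp (- u)"
    have ZW': "norm Z' < 1" "norm W' < 1" "Z' * W' = q\<^sup>2"
      using u Ulm[of u] by (auto simp: Z'_def W'_def exp_minus power2_eq_square)
    have dX: "((\<lambda>u. X m e (q * exp u) (q * exp (- u))) has_field_derivative X (Suc m) (- e) Z' W') (at u)" if "norm e \<le> 1" for m e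
    proof -
      have "((\<lambda>u. X m e (q * exp u) (q * exp (- u))) has_field_derivative
         (1 * X (Suc m) (- e) (q * exp u) (q * exp (- u)) + 0 * Y (Suc m) e (q * exp u) (q * exp (- u)))) (at u)"
        by (rule X_has_field_derivative[where S = UNIV and c = "\<lambda>_. 0" and d = "\<lambda>_. 1"])
           (use that ZW' in \<open>auto intro!: derivative_eq_intros simp: Z'_def W'_def\<close>)
      then show ?thesis by (simp add: Z'_def W'_def)
    qed
    have d2: "((\<lambda>u. X 2 (- 1) (q * exp u) (q * exp (- u))) has_field_derivative X 3 1 Z' W') (at u)"
      using dX[of "-1" 2] by simp
    have d1: "((\<lambda>u. X 1 1 (q * exp u) (q * exp (- u))) has_field_derivative X 2 (- 1) Z' W') (at u)"
      using dX[of 1 1, unfolded Suc_1] by simp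
    have "(D has_field_derivative (2 * X 2 (- 1) Z' W' * X 3 1 Z' W' - 12 * (X 1 1 Z' W')\<^sup>2 * X 2 (- 1) Z' W'
       - a * (2 * X 1 1 Z' W' * X 2 (- 1) Z' W') - 2 * b * X 2 (- 1) Z' W')) (at u)"
      unfolding D_def
      by (rule DERIV_cong[OF DERIV_diff[OF DERIV_diff[OF DERIV_diff[OF DERIV_power[OF d2] DERIV_cmult[OF DERIV_power[OF d1]]]
            DERIV_cmult[OF DERIV_power[OF d1]]] DERIV_cmult[OF d1]]])
         (simp add: Z'_def W'_def)
    also have "2 * X 2 (- 1) Z' W' * X 3 1 Z' W' - 12 * (X 1 1 Z' W')\<^sup>2 * X 2 (- 1) Z' W'
       - a * (2 * X 1 1 Z' W' * X 2 (- 1) Z' W') - 2 * b * X 2 (- 1) Z' W' = 0"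
      unfolding X_weierstrass_second_order[OF ZW'(1,2)] ZW'(3) a_def[symmetric] b_def[symmetric] by algebra
    finally show ?thesis .
  qed
  obtain cc where cc: "\<And>u. u \<in> U \<Longrightarrow> D u = cc"
    using has_field_derivative_zero_constant[OF U(2), of D] dD by (meson has_field_derivative_at_within)
  have "Z \<noteq> 0" using ZW q by auto
  \<comment> \<open>Every point of the fibre lies on the curve through (q, q). Any logarithm would
    serve, as the strip restricts only Re u.\<close>
  define u where "u = Ln (Z / q)"
  have Zu: "Z = q * exp u" using \<open>Z \<noteq> 0\<close> q by (simp add: u_def)
  then have Wu: "W = q * exp (- u)" using ZW q by (simp add: exp_minus power2_eq_square field_simps)
  have "u \<in> U" using Ulm[of u] Z W Zu Wu by simp
  moreover have "0 \<in> U" using Ulm[of 0] q by simp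
  ultimately have "D u = D 0" using cc by simp
  then show ?thesis
    by (simp add: D_def Zu[symmetric] Wu[symmetric] X_self_odd s2_def a_def b_def)
qed

lemma s3_eq: "s3 q = X 1 1 (- q) (- q)"
  by (simp add: s3_def s2_def)

text \<open>The first integral at Z = W = - q says that the cubic takes equal values at s2 and s3;
  dividing the difference by s3 - s2 leaves \<beta>.\<close>

lemma lamb_\<beta>_eq:
  assumes q: "norm q < 1" "q \<noteq> 0" and ne: "s2 q \<noteq> s3 q"
  shows "lamb_\<beta> (q\<^sup>2) = 2 * (s1 q * s2 q + s1 q * s3 q + s2 q * s3 q)"
proof -
  have "0 - 4 * s3 q ^ 3 - lamb_\<alpha> (q\<^sup>2) * (s3 q)\<^sup>2 - 2 * lamb_\<beta> (q\<^sup>2) * s3 q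
     = - 4 * s2 q ^ 3 - lamb_\<alpha> (q\<^sup>2) * (s2 q)\<^sup>2 - 2 * lamb_\<beta> (q\<^sup>2) * s2 q"
    using weierstrass_first_integral[OF q, of "- q" "- q"] q by (simp add: X_self_odd s3_eq power2_eq_square)
  then have "(s3 q - s2 q) * (lamb_\<beta> (q\<^sup>2) - 2 * (s1 q * s2 q + s1 q * s3 q + s2 q * s3 q)) = 0"
    unfolding lamb_\<alpha>_eq by algebra
  then show ?thesis using ne by simp
qed

lemma weierstrass_cubic:
  assumes q: "norm q < 1" "q \<noteq> 0" and ne: "s2 q \<noteq> s3 q" 
    and Z: "norm Z < 1" and W: "norm W < 1" and ZW: "Z * W = q\<^sup>2"
  shows "(X 2 (- 1) Z W)\<^sup>2 = 4 * (X 1 1 Z W - s1 q) * (X 1 1 Z W - s2 q) * (X 1 1 Z W - s3 q)"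
  using weierstrass_first_integral[OF q Z W ZW] unfolding lamb_\<alpha>_eq lamb_\<beta>_eq[OF q ne] by algebra

section \<open>The Halphen system\<close>

text \<open>The value is given through p D so that p = 0 is included; the whole disc is wanted for
  holomorphy of \<open>s1\<close>.\<close>

lemma lamb_\<alpha>_has_field_derivative:
  assumes p: "norm p < 1"
  obtains D where "(lamb_\<alpha> has_field_derivative D) (at p)" "p * D = 2 * lamb_\<beta> p"
proof
  obtain \<rho> where \<rho>: "norm p < \<rho>" "\<rho> < 1" using dense[of "norm p" 1] p by auto
  then have \<rho>0: "0 \<le> \<rho>" using norm_ge_zero[of p] by linarith
  define f f' where "f = (\<lambda>(k::nat) p. of_nat k * (p ^ k / (1 - p ^ k)) :: complex)"
    and "f' = (\<lambda>(k::nat) p. of_nat k ^ 2 * p ^ (k - 1) / (1 - p ^ k)\<^sup>2 :: complex)"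
  have "((\<lambda>z. \<Sum>\<^sub>\<infinity>k\<in>{1..}. f k z) has_field_derivative (\<Sum>\<^sub>\<infinity>k\<in>{1..}. f' k p)) (at p)"
    and s: "(\<lambda>k. f' k p) summable_on {1..}"
  proof -
    have der: "(f k has_field_derivative f' k z) (at z)" if "k \<in> {1..}" "z \<in> ball 0 \<rho>" for k z
    proof -
      have nz: "1 - z ^ k \<noteq> 0" using norm_one_minus_power_ge(3)[of z \<rho> k] that \<rho> by auto
      have "(f k has_field_derivative of_nat k * ((of_nat k * z ^ (k - 1) * (1 - z ^ k) - z ^ k * (0 - of_nat k * z ^ (k - 1))) / ((1 - z ^ k) * (1 - z ^ k)))) (at z)"
        unfolding f_def
        by (intro DERIV_cmult DERIV_divide DERIV_diff DERIV_const nz) (auto intro!: derivative_eq_intros)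
      also have "of_nat k * ((of_nat k * z ^ (k - 1) * (1 - z ^ k) - z ^ k * (0 - of_nat k * z ^ (k - 1))) / ((1 - z ^ k) * (1 - z ^ k))) = f' k z"
        unfolding f'_def using nz by (simp add: field_simps power2_eq_square)
      finally show ?thesis .
    qed
    have le: "norm (f k z) \<le> 1 / (1 - \<rho>) * (real k ^ 1 * \<rho> ^ k)" if "k \<in> {1..}" "z \<in> ball 0 \<rho>" for k z
    proof -
      have "norm (f k z) = real k * norm z ^ k / norm (1 - z ^ k)"
        by (simp add: f_def norm_mult norm_divide norm_power)
      also have "\<dots> \<le> real k * \<rho> ^ k / (1 - \<rho>)"
        by (intro frac_le mult_left_mono power_mono norm_one_minus_power_ge(1)) (use that \<rho> \<rho>0 in auto)
      finally show ?thesis by simp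
    qed
    note * = has_field_derivative_infsum[of "ball 0 \<rho>" p "{1..}" f f', OF _ _ der le
       summable_on_cmult_right[OF summable_on_power_mult_geometric[OF \<rho>0 \<rho>(2)]]]
    show "((\<lambda>z. \<Sum>\<^sub>\<infinity>k\<in>{1..}. f k z) has_field_derivative (\<Sum>\<^sub>\<infinity>k\<in>{1..}. f' k p)) (at p)"
      by (rule *(1)) (use \<rho> in auto)
    show "(\<lambda>k. f' k p) summable_on {1..}" by (rule *(2)) (use \<rho> in auto)
  qed
  from DERIV_diff[OF DERIV_const DERIV_cmult[OF this(1), of 24], of 1]
  show "(lamb_\<alpha> has_field_derivative (0 - 24 * (\<Sum>\<^sub>\<infinity>k\<in>{1..}. f' k p))) (at p)"
    by (simp add: lamb_\<alpha>_def[abs_def] f_def)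
  have "p * (\<Sum>\<^sub>\<infinity>k\<in>{1..}. f' k p) = (\<Sum>\<^sub>\<infinity>k\<in>{1..}. p * f' k p)"
    by (simp add: infsum_cmult_right')
  also have "\<dots> = (\<Sum>\<^sub>\<infinity>k\<in>{1..}. (of_nat k / (1 - p ^ k))\<^sup>2 * p ^ k)"
  proof (intro infsum_cong)
    fix k :: nat assume "k \<in> {1..}"
    then obtain j where j: "k = Suc j" by (cases k) auto
    show "p * f' k p = (of_nat k / (1 - p ^ k))\<^sup>2 * p ^ k"
      by (simp add: f'_def j power_divide mult_ac)
  qed
  finally show "p * (0 - 24 * (\<Sum>\<^sub>\<infinity>k\<in>{1..}. f' k p)) = 2 * lamb_\<beta> p"
    by (simp add: lamb_\<beta>_def)
qed

text \<open>Along Z = W = e q only the nome moves, with c = 1 / q and d = 0, so the derivative is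
  \<open>Y 2 1\<close> / q. The odd series vanish there and \<open>Y2_eq\<close> makes it quadratic
  in the root. The signs e = 1 and e = -1 give the two roots.\<close>

lemma s2_s3_has_field_derivative:
  assumes q: "norm q < 1" "q \<noteq> 0"
  shows "(s2 has_field_derivative (4 * (s2 q)\<^sup>2 + lamb_\<alpha> (q\<^sup>2) * s2 q + lamb_\<beta> (q\<^sup>2)) / q) (at q)"
    and "(s3 has_field_derivative (4 * (s3 q)\<^sup>2 + lamb_\<alpha> (q\<^sup>2) * s3 q + lamb_\<beta> (q\<^sup>2)) / q) (at q)"
proof -
  have gen: "((\<lambda>q. X 1 1 (e * q) (e * q)) has_field_derivative
     (4 * (X 1 1 (e * q) (e * q))\<^sup>2 + lamb_\<alpha> (q\<^sup>2) * X 1 1 (e * q) (e * q) + lamb_\<beta> (q\<^sup>2)) / q) (at q)"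
    if e: "e\<^sup>2 = 1" "norm e = 1" for e
  proof -
    have n: "norm (e * q) < 1" using q e by (simp add: norm_mult)
    have "((\<lambda>q. X 1 1 (e * q) (e * q)) has_field_derivative
      (0 * X (Suc 1) (- 1) (e * q) (e * q) + 1 / q * Y (Suc 1) 1 (e * q) (e * q))) (at q)"
      by (rule X_has_field_derivative[where S = "- {0}" and c = "\<lambda>q. 1 / q" and d = "\<lambda>_. 0"])
         (use q n in \<open>auto intro!: derivative_eq_intros\<close>)
    also have "0 * X (Suc 1) (- 1) (e * q) (e * q) + 1 / q * Y (Suc 1) 1 (e * q) (e * q) = Y 2 1 (e * q) (e * q) / q"
      by (simp add: numeral_2_eq_2)
    also have "Y 2 1 (e * q) (e * q) = 4 * (X 1 1 (e * q) (e * q))\<^sup>2 + lamb_\<alpha> (q\<^sup>2) * X 1 1 (e * q) (e * q) + lamb_\<beta> (q\<^sup>2)"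
    proof -
      have "(e * q) * (e * q) = q\<^sup>2" using e(1) by (simp add: power2_eq_square algebra_simps)
      then show ?thesis unfolding Y2_eq[OF n n] X_weierstrass_second_order[OF n n] X_self_odd by simp
    qed
    finally show ?thesis .
  qed
  show "(s2 has_field_derivative (4 * (s2 q)\<^sup>2 + lamb_\<alpha> (q\<^sup>2) * s2 q + lamb_\<beta> (q\<^sup>2)) / q) (at q)"
    using gen[of 1] by (simp add: s2_def[abs_def])
  show "(s3 has_field_derivative (4 * (s3 q)\<^sup>2 + lamb_\<alpha> (q\<^sup>2) * s3 q + lamb_\<beta> (q\<^sup>2)) / q) (at q)"
    using gen[of "-1"] by (simp add: s3_def[abs_def] s2_def)
qed

text \<open>The equations for s2 and s3 become symmetric once \<alpha> and \<beta> are written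
  through the roots; the one for s1 comes from the derivative of \<alpha>, since s1 is defined by
  the sum.\<close>

lemma halphen_system:
  assumes q: "norm q < 1" "q \<noteq> 0" and ne: "s2 q \<noteq> s3 q"
  shows "(s1 has_field_derivative 2 * (s2 q * s3 q - s1 q * s2 q - s1 q * s3 q) / q) (at q)"
    and "(s2 has_field_derivative 2 * (s1 q * s3 q - s1 q * s2 q - s2 q * s3 q) / q) (at q)"
    and "(s3 has_field_derivative 2 * (s1 q * s2 q - s1 q * s3 q - s2 q * s3 q) / q) (at q)"
proof -
  have b: "lamb_\<beta> (q\<^sup>2) = 2 * (s1 q * s2 q + s1 q * s3 q + s2 q * s3 q)"
    by (rule lamb_\<beta>_eq[OF q ne])
  have e2: "4 * (s2 q)\<^sup>2 + lamb_\<alpha> (q\<^sup>2) * s2 q + lamb_\<beta> (q\<^sup>2) = 2 * (s1 q * s3 q - s1 q * s2 q - s2 q * s3 q)"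
    and e3: "4 * (s3 q)\<^sup>2 + lamb_\<alpha> (q\<^sup>2) * s3 q + lamb_\<beta> (q\<^sup>2) = 2 * (s1 q * s2 q - s1 q * s3 q - s2 q * s3 q)"
    unfolding b lamb_\<alpha>_eq by algebra+
  show d2: "(s2 has_field_derivative 2 * (s1 q * s3 q - s1 q * s2 q - s2 q * s3 q) / q) (at q)"
    and d3: "(s3 has_field_derivative 2 * (s1 q * s2 q - s1 q * s3 q - s2 q * s3 q) / q) (at q)"
    using s2_s3_has_field_derivative[OF q] unfolding e2 e3 .
  obtain D where D: "(lamb_\<alpha> has_field_derivative D) (at (q\<^sup>2))" "q\<^sup>2 * D = 2 * lamb_\<beta> (q\<^sup>2)"
    using lamb_\<alpha>_has_field_derivative[of "q\<^sup>2"] q by (metis norm_power power_less_one_iff norm_ge_zero zero_less_numeral)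
  have "((\<lambda>q. lamb_\<alpha> (q\<^sup>2)) has_field_derivative D * (2 * q)) (at q)"
    by (rule DERIV_chain2[where f = lamb_\<alpha> and g = "\<lambda>q. q\<^sup>2", OF D(1)]) (auto intro!: derivative_eq_intros)
  also have "D * (2 * q) = 4 * lamb_\<beta> (q\<^sup>2) / q" using D(2) q by (simp add: field_simps power2_eq_square)
  finally have "(s1 has_field_derivative (- (4 * lamb_\<beta> (q\<^sup>2) / q) / 4 - 2 * (s1 q * s3 q - s1 q * s2 q - s2 q * s3 q) / q
       - 2 * (s1 q * s2 q - s1 q * s3 q - s2 q * s3 q) / q)) (at q)"
    unfolding s1_def[abs_def] by (intro DERIV_diff DERIV_cdivide DERIV_minus d2[unfolded s1_def] d3[unfolded s1_def])
  also have "- (4 * lamb_\<beta> (q\<^sup>2) / q) / 4 - 2 * (s1 q * s3 q - s1 q * s2 q - s2 q * s3 q) / q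
       - 2 * (s1 q * s2 q - s1 q * s3 q - s2 q * s3 q) / q = 2 * (s2 q * s3 q - s1 q * s2 q - s1 q * s3 q) / q"
    unfolding b by (simp add: field_simps q) 
  finally show "(s1 has_field_derivative 2 * (s2 q * s3 q - s1 q * s2 q - s1 q * s3 q) / q) (at q)" .
qed

text \<open>The formula for nonzero q contains 1 / q, so the origin is done by hand: only k = 1
  contributes, through q + q.\<close>

lemma s2_has_field_derivative_0: "(s2 has_field_derivative 2) (at 0)"
proof -
  define f where "f = (\<lambda>(k::nat) q. Xt 1 1 q q k)"
  have diff: "f k field_differentiable (at z)" if "k \<in> {1..}" "z \<in> ball 0 (1/2)" for k z
  proof -
    have "norm (z * z) \<le> 1/2" by (rule norm_mult_le_bound) (use that in auto)
    then have "1 - (z * z) ^ k \<noteq> 0" using norm_one_minus_power_ge(3)[of "z * z" "1/2" k] that by auto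
    then show ?thesis unfolding f_def Xt_def by (auto intro!: derivative_intros)
  qed
  have "((\<lambda>z. \<Sum>\<^sub>\<infinity>k\<in>{1..}. f k z) has_field_derivative (\<Sum>\<^sub>\<infinity>k\<in>{1..}. deriv (f k) 0)) (at 0)"
  proof (rule has_field_derivative_infsum(1)[of "ball 0 (1/2)"])
    fix k :: nat and z :: complex assume k: "k \<in> {1..}" "z \<in> ball 0 (1/2)"
    show "(f k has_field_derivative deriv (f k) z) (at z)" using diff[OF k] by (simp add: DERIV_deriv_iff_field_differentiable)
    show "norm (f k z) \<le> 2 / (1 - 1/2) * (real k ^ 1 * (1/2) ^ k)"
      unfolding f_def by (rule norm_Xt_le) (use k in auto)
  next
    show "(\<lambda>k. 2 / (1 - 1/2) * (real k ^ 1 * (1/2) ^ k)) summable_on {1..}"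
      by (intro summable_on_cmult_right summable_on_power_mult_geometric) auto
  qed auto
  also have "(\<lambda>z. \<Sum>\<^sub>\<infinity>k\<in>{1..}. f k z) = s2"
    by (simp add: f_def s2_def[abs_def] X_def)
  also have "(\<Sum>\<^sub>\<infinity>k\<in>{1..}. deriv (f k) 0) = (\<Sum>\<^sub>\<infinity>k\<in>{1::nat..}. if k = 1 then 2 else 0)"
  proof (intro infsum_cong)
    fix k :: nat assume k: "k \<in> {1..}"
    define C where "C = (\<lambda>q::complex. of_nat k ^ 1 / (1 - (q * q) ^ k))"
    have "C field_differentiable (at 0)" unfolding C_def using k by (auto intro!: derivative_intros simp: power_0_left)
    then obtain c' where c': "(C has_field_derivative c') (at 0)" by (auto simp: field_differentiable_def)
    have "((\<lambda>q. C q * (q ^ k + 1 * q ^ k)) has_field_derivative (c' * (0 ^ k + 1 * 0 ^ k) + (of_nat k * 0 ^ (k - 1) + 1 * (of_nat k * 0 ^ (k - 1))) * C 0)) (at 0)"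
      by (intro DERIV_mult c' DERIV_add DERIV_cmult) (auto intro!: derivative_eq_intros)
    also have "(\<lambda>q. C q * (q ^ k + 1 * q ^ k)) = f k" by (simp add: C_def f_def Xt_def)
    finally have "deriv (f k) 0 = c' * (0 ^ k + 1 * 0 ^ k) + (of_nat k * 0 ^ (k - 1) + 1 * (of_nat k * 0 ^ (k - 1))) * C 0"
      by (rule DERIV_imp_deriv)
    also have "\<dots> = (if k = 1 then 2 else 0)" using k by (auto simp: C_def power_0_left)
    finally show "deriv (f k) 0 = (if k = 1 then 2 else 0)" .
  qed
  also have "\<dots> = (\<Sum>\<^sub>\<infinity>k\<in>{1::nat}. 2)"
    by (rule infsum_cong_neutral) auto
  finally show ?thesis by simp
qed

lemma s_at_0: "s2 0 = 0" "s3 0 = 0" "s1 0 = - 1 / 4"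
proof -
  have "X 1 1 0 0 = (\<Sum>\<^sub>\<infinity>k\<in>{1::nat..}. 0)"
    unfolding X_def by (intro infsum_cong) (auto simp: Xt_def power_0_left)
  then show a: "s2 0 = 0" by (simp add: s2_def)
  then show b: "s3 0 = 0" by (simp add: s3_def)
  have "lamb_\<alpha> 0 = 1 - 24 * (\<Sum>\<^sub>\<infinity>k\<in>{1::nat..}. 0)"
    unfolding lamb_\<alpha>_def by (intro arg_cong2[where f = "(-)"] arg_cong2[where f = "(*)"] refl infsum_cong) (auto simp: power_0_left)
  then show "s1 0 = - 1 / 4" using a b by (simp add: s1_def)
qed

lemma s_holomorphic: "s1 holomorphic_on ball 0 1" "s2 holomorphic_on ball 0 1" "s3 holomorphic_on ball 0 1"
proof -
  have d: "s2 field_differentiable (at q)" if "q \<in> ball 0 1" for q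
    using that s2_s3_has_field_derivative(1)[of q] s2_has_field_derivative_0
    by (cases "q = 0") (auto simp: field_differentiable_def)
  then show 2: "s2 holomorphic_on ball 0 1"
    by (auto simp: holomorphic_on_def intro: field_differentiable_at_within)
  have "(s2 \<circ> uminus) holomorphic_on ball 0 1"
    by (rule holomorphic_on_compose_gen[OF _ 2]) (auto intro!: holomorphic_intros)
  then show 3: "s3 holomorphic_on ball 0 1" by (simp add: s3_def[abs_def] o_def)
  have "lamb_\<alpha> holomorphic_on ball 0 1"
    unfolding holomorphic_on_def
    by (metis field_differentiable_def field_differentiable_at_within lamb_\<alpha>_has_field_derivative mem_ball_0)
  then have "(lamb_\<alpha> \<circ> (\<lambda>q. q\<^sup>2)) holomorphic_on ball 0 1"
    by (rule holomorphic_on_compose_gen[rotated]) (auto intro!: holomorphic_intros simp: norm_power power_less_one_iff)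
  then show "s1 holomorphic_on ball 0 1"
    unfolding s1_def[abs_def] using 2 3 by (auto intro!: holomorphic_intros simp: o_def)
qed

section \<open>The modular lambda function and its local inverse\<close>

text \<open>The modular lambda function, 16 q + ... at the origin; it expresses the Painleve
  variable x through the nome.\<close>

definition lam :: "complex \<Rightarrow> complex" where "lam q = (s3 q - s2 q) / (s1 q - s2 q)"

text \<open>Obtained from the Halphen system. The factor 4 (s2 - s1) is later identified with
  F(x)^2.\<close>

lemma lam_has_field_derivative:
  assumes q: "norm q < 1" "q \<noteq> 0" and ne: "s2 q \<noteq> s3 q" "s1 q \<noteq> s2 q"
  shows "(lam has_field_derivative 4 * (s2 q - s1 q) * lam q * (1 - lam q) / q) (at q)"
proof -
  note h = halphen_system[OF q ne(1)]
  have "(lam has_field_derivative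
    (((2 * (s1 q * s2 q - s1 q * s3 q - s2 q * s3 q) / q - 2 * (s1 q * s3 q - s1 q * s2 q - s2 q * s3 q) / q) * (s1 q - s2 q) -
      (s3 q - s2 q) * (2 * (s2 q * s3 q - s1 q * s2 q - s1 q * s3 q) / q - 2 * (s1 q * s3 q - s1 q * s2 q - s2 q * s3 q) / q)) /
      ((s1 q - s2 q) * (s1 q - s2 q)))) (at q)"
    unfolding lam_def[abs_def] by (intro DERIV_divide DERIV_diff h) (use ne in auto)
  also have "(((2 * (s1 q * s2 q - s1 q * s3 q - s2 q * s3 q) / q - 2 * (s1 q * s3 q - s1 q * s2 q - s2 q * s3 q) / q) * (s1 q - s2 q) -
      (s3 q - s2 q) * (2 * (s2 q * s3 q - s1 q * s2 q - s1 q * s3 q) / q - 2 * (s1 q * s3 q - s1 q * s2 q - s2 q * s3 q) / q)) /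
      ((s1 q - s2 q) * (s1 q - s2 q))) = 4 * (s2 q - s1 q) * lam q * (1 - lam q) / q"
  proof -
    have "((2 * (a * b - a * c - b * c) / q - 2 * (a * c - a * b - b * c) / q) * (a - b) -
      (c - b) * (2 * (b * c - a * b - a * c) / q - 2 * (a * c - a * b - b * c) / q)) / ((a - b) * (a - b))
      = 4 * (b - a) * ((c - b) / (a - b)) * (1 - (c - b) / (a - b)) / q" if ab: "a - b \<noteq> 0" for a b c :: complex
    proof -
      have "1 - (c - b) / (a - b) = (a - c) / (a - b)" using ab by (simp add: field_simps)
      then show ?thesis using ab q(2) by (simp add: divide_simps) (simp add: algebra_simps)
    qed
    then show ?thesis using ne by (simp add: lam_def)
  qed
  finally show ?thesis .
qed

text \<open>\<open>lam\<close> has derivative 16 at the origin and is locally invertible; G is the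
  inverse, so G x is the nome belonging to x, and the differential equation of \<open>lam\<close>
  becomes one for G.\<close>

lemma lam_local_inverse:
  obtains R G where "0 < R" "R \<le> 1" "G holomorphic_on ball 0 R" "G 0 = 0"
    "\<And>x. x \<in> ball 0 R \<Longrightarrow> norm (G x) < 1"
    "\<And>x. x \<in> ball 0 R \<Longrightarrow> x \<noteq> 0 \<Longrightarrow> G x \<noteq> 0"
    "\<And>x. x \<in> ball 0 R \<Longrightarrow> s1 (G x) \<noteq> s2 (G x)"
    "\<And>x. x \<in> ball 0 R \<Longrightarrow> x \<noteq> 0 \<Longrightarrow> s2 (G x) \<noteq> s3 (G x)"
    "\<And>x. x \<in> ball 0 R \<Longrightarrow> s3 (G x) - s2 (G x) = x * (s1 (G x) - s2 (G x))"
    "\<And>x. x \<in> ball 0 R \<Longrightarrow> 4 * (s2 (G x) - s1 (G x)) * x * (1 - x) * deriv G x = G x"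
    "deriv G 0 = 1 / 16"
proof -
  have "(\<lambda>q. s1 q - s2 q) holomorphic_on ball 0 1" by (intro holomorphic_intros s_holomorphic)
  then have "continuous (at 0) (\<lambda>q. s1 q - s2 q)"
    by (intro field_differentiable_imp_continuous_at holomorphic_on_imp_differentiable_at[OF _ open_ball]) auto
  then obtain \<rho>1 where \<rho>1: "\<rho>1 > 0" "\<And>q. norm q < \<rho>1 \<Longrightarrow> s1 q - s2 q \<noteq> 0"
    using continuous_at_avoid[of 0 "\<lambda>q. s1 q - s2 q" 0] s_at_0 by (auto simp: dist_norm)
  define \<rho> where "\<rho> = min \<rho>1 1"
  have \<rho>: "\<rho> > 0" "\<rho> \<le> 1" "\<And>q. q \<in> ball 0 \<rho> \<Longrightarrow> s1 q - s2 q \<noteq> 0" using \<rho>1 by (auto simp: \<rho>_def)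
  have sub: "ball 0 \<rho> \<subseteq> (ball 0 1 :: complex set)" using \<rho> by auto
  have lamh: "lam holomorphic_on ball 0 \<rho>"
    unfolding lam_def[abs_def] using s_holomorphic[THEN holomorphic_on_subset, OF sub] \<rho>(3)
    by (auto intro!: holomorphic_intros)
  have lam0: "lam 0 = 0" by (simp add: lam_def s_at_0)
  have dlam0: "(lam has_field_derivative 16) (at 0)"
  proof -
    have "s1 field_differentiable (at 0)" using s_holomorphic(1) by (simp add: holomorphic_on_imp_differentiable_at)
    then obtain d1 where d1: "(s1 has_field_derivative d1) (at 0)" by (auto simp: field_differentiable_def)
    have d3: "(s3 has_field_derivative - 2) (at 0)"
    proof -
      have "((\<lambda>q. s2 (- q)) has_field_derivative 2 * (- 1)) (at 0)"
        by (rule DERIV_chain2[where f = s2 and g = uminus]) (use s2_has_field_derivative_0 in \<open>auto intro!: derivative_eq_intros\<close>)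
      then show ?thesis by (simp add: s3_def[abs_def])
    qed
    \<comment> \<open>The unknown derivative d1 is multiplied by s3 - s2, which vanishes at 0; what
      remains is (-4) (-1/4) / (1/16).\<close>
    have "(lam has_field_derivative (((- 2 - 2) * (s1 0 - s2 0) - (s3 0 - s2 0) * (d1 - 2)) / ((s1 0 - s2 0) * (s1 0 - s2 0)))) (at 0)"
      unfolding lam_def[abs_def] by (intro DERIV_divide DERIV_diff d1 d3 s2_has_field_derivative_0) (simp add: s_at_0)
    then show ?thesis by (simp add: s_at_0)
  qed
  have z0: "0 \<in> ball (0::complex) \<rho>" and d0: "deriv lam 0 \<noteq> 0" using \<rho> DERIV_imp_deriv[OF dlam0] by auto
  obtain r where r: "r > 0" "ball (0::complex) r \<subseteq> ball 0 \<rho>" "open (lam ` ball 0 r)" "inj_on lam (ball 0 r)"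
    by (rule has_complex_derivative_locally_invertible[OF lamh z0 open_ball d0])
  obtain G where G: "G holomorphic_on (lam ` ball 0 r)"
    "\<And>z. z \<in> ball 0 r \<Longrightarrow> deriv lam z * deriv G (lam z) = 1" "\<And>z. z \<in> ball 0 r \<Longrightarrow> G (lam z) = z"
    using holomorphic_has_inverse[OF holomorphic_on_subset[OF lamh r(2)] open_ball r(4)] by metis
  have "0 \<in> lam ` ball 0 r" using r lam0 by (intro image_eqI[of _ _ 0]) auto
  then obtain R1 where R1: "R1 > 0" "ball 0 R1 \<subseteq> lam ` ball 0 r" using r(3) open_contains_ball by metis
  define R where "R = min R1 1"
  have R: "R > 0" "R \<le> 1" "ball 0 R \<subseteq> lam ` ball 0 r" using R1 by (auto simp: R_def)
  have Gr: "G x \<in> ball 0 r" "lam (G x) = x" if "x \<in> ball 0 R" for x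
    using that R(3) G(3) by auto
  have G\<rho>: "G x \<in> ball 0 \<rho>" if "x \<in> ball 0 R" for x using Gr[OF that] r by auto
  have G0: "G 0 = 0" using G(3)[of 0] lam0 r by simp
  have Gnz: "G x \<noteq> 0" if "x \<in> ball 0 R" "x \<noteq> 0" for x using Gr[OF that(1)] that(2) lam0 by auto
  have ne1: "s1 (G x) \<noteq> s2 (G x)" if "x \<in> ball 0 R" for x using \<rho>(3)[OF G\<rho>[OF that]] by auto
  have rel: "s3 (G x) - s2 (G x) = x * (s1 (G x) - s2 (G x))" if "x \<in> ball 0 R" for x
    using Gr(2)[OF that] ne1[OF that] by (simp add: lam_def field_simps)
  have ne2: "s2 (G x) \<noteq> s3 (G x)" if "x \<in> ball 0 R" "x \<noteq> 0" for x
    using rel[OF that(1)] ne1[OF that(1)] that(2) by auto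
  have dG: "4 * (s2 (G x) - s1 (G x)) * x * (1 - x) * deriv G x = G x" if x: "x \<in> ball 0 R" for x
  proof (cases "x = 0")
    case False
    define C where "C = 4 * (s2 (G x) - s1 (G x)) * x * (1 - x)"
    have "norm (G x) < 1" using G\<rho>[OF x] \<rho> by auto
    then have dl: "deriv lam (G x) = C / G x" unfolding C_def
      using lam_has_field_derivative[OF _ Gnz[OF x False] ne2[OF x False] ne1[OF x]] Gr(2)[OF x] DERIV_imp_deriv by metis
    have "deriv lam (G x) * deriv G x = 1" using G(2)[OF Gr(1)[OF x]] Gr(2)[OF x] by simp
    then have "C * deriv G x / G x = 1" by (simp add: dl)
    then have "C * deriv G x = G x" using Gnz[OF x False] by simp
    then show ?thesis by (simp only: C_def)
  qed (simp add: G0)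
  have "deriv lam 0 * deriv G 0 = 1" using G(2)[of 0] r lam0 by simp
  then have dG0: "deriv G 0 = 1 / 16" using DERIV_imp_deriv[OF dlam0] by (simp add: field_simps)
  show ?thesis
    by (rule that[OF R(1,2) holomorphic_on_subset[OF G(1) R(3)] G0 _ Gnz ne1 ne2 rel dG dG0])
       (use G\<rho> \<rho> in force)+
qed

section \<open>The nome as a function of the modulus\<close>

definition hyp_coeff :: "nat \<Rightarrow> complex" where
  "hyp_coeff n = (pochhammer (1/2) n)\<^sup>2 / (fact n)\<^sup>2"

lemma hyp_coeff_Suc: "of_nat (Suc n) ^ 2 * hyp_coeff (Suc n) = (of_nat n + 1/2)\<^sup>2 * hyp_coeff n"
proof -
  have "(of_nat (Suc n) :: complex) \<noteq> 0" by (simp del: of_nat_Suc)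
  then show ?thesis
    by (simp add: hyp_coeff_def pochhammer_Suc fact_Suc power_mult_distrib add.commute del: of_nat_Suc)
qed

lemma hyp_coeff_0 [simp]: "hyp_coeff 0 = 1"
  by (simp add: hyp_coeff_def)

lemma isCont_eqI:
  fixes f g :: "complex \<Rightarrow> complex"
  assumes "isCont f z" "isCont g z" "open S" "z \<in> S" "\<And>x. x \<in> S \<Longrightarrow> x \<noteq> z \<Longrightarrow> f x = g x"
  shows "f z = g z"
proof -
  have "\<forall>\<^sub>F x in at z. f x = g x"
    unfolding eventually_at_topological using assms(3-5) by blast
  then have "f \<midarrow>z\<rightarrow> g z" using assms(2) by (simp add: isCont_def filterlim_cong)
  then show ?thesis using assms(1) LIM_unique by (auto simp: isCont_def)
qed

text \<open>The self-adjoint form of x (1 - x) f'' + (1 - 2 x) f'; the hypergeometric equation with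
  parameters 1/2, 1/2, 1 reads \<open>hyp_op\<close> f = f / 4.\<close>

definition hyp_op :: "complex fps \<Rightarrow> complex fps" where
  "hyp_op f = fps_deriv (fps_X * (1 - fps_X) * fps_deriv f)"

lemma hyp_op_nth: "hyp_op f $ n = of_nat (Suc n) ^ 2 * f $ Suc n - of_nat n * of_nat (Suc n) * (f :: complex fps) $ n"
proof -
  have "fps_X * (1 - fps_X) * fps_deriv f = fps_X * (fps_deriv f - fps_X * fps_deriv f)"
    by (simp add: algebra_simps)
  then have "hyp_op f $ n = of_nat (Suc n) * (fps_X * (fps_deriv f - fps_X * fps_deriv f)) $ Suc n"
    by (simp only: hyp_op_def fps_deriv_nth Suc_eq_plus1)
  also have "\<dots> = of_nat (Suc n) * (fps_deriv f - fps_X * fps_deriv f) $ n"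
    by (simp only: fps_X_mult_nth) simp
  also have "\<dots> = of_nat (Suc n) * (of_nat (Suc n) * f $ Suc n - of_nat n * f $ n)"
    by (cases n) simp_all
  finally show ?thesis by (simp add: algebra_simps power2_eq_square)
qed

text \<open>The equation is the recurrence (n + 1)^2 f(n + 1) = (n (n + 1) + 1/4) f(n), and n (n +
  1) + 1/4 is the square of n + 1/2.\<close>

lemma hypergeometric_fps_unique:
  fixes f :: "complex fps"
  assumes "hyp_op f = fps_const (1/4) * f" "f $ 0 = 1"
  shows "f $ n = hyp_coeff n"
proof (induction n)
  case (Suc n)
  have "hyp_op f $ n = 1/4 * f $ n" using assms by simp
  then have "of_nat (Suc n) ^ 2 * f $ Suc n = 1/4 * f $ n + of_nat n * of_nat (Suc n) * f $ n"
    unfolding hyp_op_nth by (simp only: diff_eq_eq)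
  also have "\<dots> = (of_nat n + 1/2)\<^sup>2 * f $ n"
    by (simp add: field_simps power2_eq_square)
  also have "\<dots> = of_nat (Suc n) ^ 2 * hyp_coeff (Suc n)" unfolding Suc.IH hyp_coeff_Suc ..
  finally show ?case by (simp del: of_nat_Suc)
qed (simp add: assms)

text \<open>The equation for k is what remains of the hypergeometric equation for f ln x + k once
  the logarithm cancels. Its recurrence is that of Digamma at n + 1/2 and n + 1, with the initial
  value 2 (\<psi>(1/2) - \<psi>(1)) = - 4 ln 2.\<close>

lemma hypergeometric_log_fps_unique:
  fixes f k :: "complex fps"
  assumes f: "\<And>n. f $ n = hyp_coeff n"
    and k: "hyp_op k = fps_const (1/4) * k + f - 2 * (1 - fps_X) * fps_deriv f" "k $ 0 = - 4 * of_real (ln 2)"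
  shows "k $ n = hyp_coeff n * (2 * (Digamma (of_nat n + 1/2) - Digamma (of_nat n + 1)))"
proof (induction n)
  case 0
  show ?case using k(2) Digamma_one_half[where 'a = complex] by simp
next
  case (Suc n)
  define d where "d = 2 * (Digamma (of_nat n + 1/2) - Digamma (of_nat n + 1) :: complex)"
  define N :: complex where "N = of_nat n"
  have N1: "N + 1 \<noteq> 0" "N + 1/2 \<noteq> 0"
  proof -
    have "Re (N + 1) > 0" "Re (N + 1/2) > 0" by (simp_all add: N_def)
    then show "N + 1 \<noteq> 0" "N + 1/2 \<noteq> 0" by force+
  qed
  have dS: "2 * (Digamma (of_nat (Suc n) + 1/2) - Digamma (of_nat (Suc n) + 1)) = d + 2 / (N + 1/2) - 2 / (N + 1)"
    using Digamma_plus1[of "N + 1/2"] Digamma_plus1[of "N + 1"] N1 by (simp add: d_def N_def algebra_simps)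
  have cS: "hyp_coeff (Suc n) = (N + 1/2)\<^sup>2 * hyp_coeff n / (N + 1)\<^sup>2"
    using hyp_coeff_Suc[of n] N1 by (simp add: N_def field_simps)
  have "(2 * (1 - fps_X) * fps_deriv f) $ n = 2 * (fps_deriv f - fps_X * fps_deriv f) $ n"
    by (simp add: algebra_simps numeral_fps_const)
  also have "\<dots> = 2 * ((N + 1) * f $ Suc n - N * f $ n)"
    by (cases n) (simp_all add: N_def algebra_simps)
  finally have rhs: "(2 * (1 - fps_X) * fps_deriv f) $ n = 2 * ((N + 1) * f $ Suc n - N * f $ n)" .
  have "hyp_op k $ n = 1/4 * k $ n + f $ n - 2 * ((N + 1) * f $ Suc n - N * f $ n)"
    unfolding k(1) fps_sub_nth rhs by simp
  then have "(N + 1)\<^sup>2 * k $ Suc n - N * (N + 1) * (hyp_coeff n * d) = 1/4 * (hyp_coeff n * d) + hyp_coeff n - 2 * ((N + 1) * hyp_coeff (Suc n) - N * hyp_coeff n)"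
    unfolding hyp_op_nth Suc.IH f d_def[symmetric] by (simp add: N_def add.commute)
  then have "(N + 1)\<^sup>2 * k $ Suc n = (N * (N + 1) + 1/4) * (hyp_coeff n * d) + hyp_coeff n - 2 * ((N + 1) * hyp_coeff (Suc n) - N * hyp_coeff n)"
    by (simp only: diff_eq_eq) (simp add: algebra_simps)
  also have "\<dots> = (N + 1)\<^sup>2 * (hyp_coeff (Suc n) * (d + 2 / (N + 1/2) - 2 / (N + 1)))"
  proof -
    have "(N * (N + 1) + 1/4) * (c * d) + c - 2 * ((N + 1) * ((N + 1/2)\<^sup>2 * c / (N + 1)\<^sup>2) - N * c)
       = (N + 1)\<^sup>2 * ((N + 1/2)\<^sup>2 * c / (N + 1)\<^sup>2 * (d + 2 / (N + 1/2) - 2 / (N + 1)))" for c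
    proof -
      define A1 B1 where "A1 = N + 1" and "B1 = N + 1/2"
      have ab: "N = A1 - 1" "B1 = A1 - 1/2" "A1 \<noteq> 0" "B1 \<noteq> 0" using N1 by (auto simp: A1_def B1_def)
      have "A1\<^sup>2 * (B1\<^sup>2 * c / A1\<^sup>2 * (d + 2 / B1 - 2 / A1)) = B1\<^sup>2 * c * d + 2 * B1 * c - 2 * B1\<^sup>2 * c / A1"
        using ab(3,4) by (simp add: field_simps power2_eq_square)
      moreover have "A1 * (B1\<^sup>2 * c / A1\<^sup>2) = B1\<^sup>2 * c / A1" using ab(3) by (simp add: power2_eq_square)
      moreover have "N * A1 + 1/4 = B1\<^sup>2" "2 * B1 * c = c + 2 * (N * c)" unfolding ab(2) by (simp_all add: ab(1) power2_eq_square algebra_simps)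
      moreover have "(N * A1 + 1/4) * (c * d) + c - 2 * (A1 * (B1\<^sup>2 * c / A1\<^sup>2) - N * c)
         = (N * A1 + 1/4) * (c * d) + (c + 2 * (N * c)) - 2 * (A1 * (B1\<^sup>2 * c / A1\<^sup>2))"
        by (simp only: right_diff_distrib) simp
      ultimately show ?thesis unfolding A1_def[symmetric] B1_def[symmetric] by (simp add: mult.assoc)
    qed
    then show ?thesis unfolding cS .
  qed
  finally show ?case unfolding dS using N1 by simp
qed

lemma F_F1_of_holomorphic:
  fixes \<Phi> :: "complex fps"
  assumes "f holomorphic_on ball 0 R" "f has_fps_expansion \<Phi>" "x \<in> ball 0 R"
  shows "(\<And>n. \<Phi> $ n = hyp_coeff n) \<Longrightarrow> F x = f x"
    and "(\<And>n. \<Phi> $ n = hyp_coeff n * (2 * (Digamma (of_nat n + 1/2) - Digamma (of_nat n + 1)))) \<Longrightarrow> F1 x = f x"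
proof -
  have "(\<lambda>n. \<Phi> $ n * x ^ n) sums f x"
    by (rule has_fps_expansion_imp_sums_complex[OF assms(2), of "ereal R"]) (use assms in auto)
  then have s: "(\<Sum>n. \<Phi> $ n * x ^ n) = f x" by (rule sums_unique[symmetric])
  show "(\<And>n. \<Phi> $ n = hyp_coeff n) \<Longrightarrow> F x = f x"
    "(\<And>n. \<Phi> $ n = hyp_coeff n * (2 * (Digamma (of_nat n + 1/2) - Digamma (of_nat n + 1)))) \<Longrightarrow> F1 x = f x"
    using s by (simp_all add: F_def F1_def hyp_coeff_def)
qed

text \<open>Supplies a disc on which the principal square root and logarithm of h are
  holomorphic.\<close>

lemma holomorphic_ball_nonpos_free:
  fixes h :: "complex \<Rightarrow> complex"
  assumes "h holomorphic_on ball 0 R" "h 0 = 1" "0 < R"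
  obtains r where "0 < r" "r \<le> R" "\<And>x. x \<in> ball 0 r \<Longrightarrow> h x \<notin> \<real>\<^sub>\<le>\<^sub>0"
proof -
  have "isCont h 0"
    by (rule field_differentiable_imp_continuous_at, rule holomorphic_on_imp_differentiable_at[OF assms(1) open_ball])
       (use assms in auto)
  then obtain d where d: "d > 0" "\<And>x. dist x 0 < d \<Longrightarrow> dist (h x) (h 0) < 1"
    unfolding continuous_at_eps_delta by (metis zero_less_one)
  show ?thesis
  proof (rule that[of "min d R"])
    fix x :: complex assume "x \<in> ball 0 (min d R)"
    then have "norm (h x - 1) < 1" using d(2)[of x] assms by (simp add: dist_norm)
    then have "\<bar>Re (h x) - 1\<bar> < 1" using abs_Re_le_cmod[of "h x - 1"] by simp
    then show "h x \<notin> \<real>\<^sub>\<le>\<^sub>0" by (auto simp: complex_nonpos_Reals_iff)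
  qed (use d assms in auto)
qed

text \<open>The two Frobenius solutions of the hypergeometric equation at \<open>x = 0\<close> are \<open>f\<close> and \<open>f * ln q\<close>
  composed with the local inverse of \<open>lam\<close>, where \<open>f\<^sup>2 = 4 * (s2 - s1)\<close>.\<close>

theorem nome_of_x:
  obtains R G where "0 < R" "R \<le> 1" "G holomorphic_on ball 0 R"
    "F holomorphic_on ball 0 R" "F1 holomorphic_on ball 0 R" "F 0 = 1" "F1 0 = - 4 * of_real (ln 2)"
    "\<And>x. x \<in> ball 0 R \<Longrightarrow> norm (G x) < 1"
    "\<And>x. x \<in> ball 0 R \<Longrightarrow> F x \<noteq> 0"
    "\<And>x. x \<in> ball 0 R \<Longrightarrow> G x = x * exp (F1 x / F x)"
    "\<And>x. x \<in> ball 0 R \<Longrightarrow> (F x)\<^sup>2 = 4 * (s2 (G x) - s1 (G x))"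
    "\<And>x. x \<in> ball 0 R \<Longrightarrow> x \<noteq> 0 \<Longrightarrow> s2 (G x) \<noteq> s3 (G x)"
    "\<And>x. x \<in> ball 0 R \<Longrightarrow> s3 (G x) - s2 (G x) = x * (s1 (G x) - s2 (G x))"
    "\<And>x. x \<in> ball 0 R \<Longrightarrow> (F x)\<^sup>2 * x * (1 - x) * deriv G x = G x"
proof -
  obtain R0 G where R0: "0 < R0" "R0 \<le> 1" and G: "G holomorphic_on ball 0 R0" "G 0 = 0"
    "\<And>x. x \<in> ball 0 R0 \<Longrightarrow> norm (G x) < 1"
    "\<And>x. x \<in> ball 0 R0 \<Longrightarrow> x \<noteq> 0 \<Longrightarrow> G x \<noteq> 0"
    "\<And>x. x \<in> ball 0 R0 \<Longrightarrow> s1 (G x) \<noteq> s2 (G x)"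
    "\<And>x. x \<in> ball 0 R0 \<Longrightarrow> x \<noteq> 0 \<Longrightarrow> s2 (G x) \<noteq> s3 (G x)"
    "\<And>x. x \<in> ball 0 R0 \<Longrightarrow> s3 (G x) - s2 (G x) = x * (s1 (G x) - s2 (G x))"
    "\<And>x. x \<in> ball 0 R0 \<Longrightarrow> 4 * (s2 (G x) - s1 (G x)) * x * (1 - x) * deriv G x = G x"
    "deriv G 0 = 1 / 16"
    using lam_local_inverse by blast
  define th where "th = (\<lambda>x. 4 * (s2 (G x) - s1 (G x)))"
  have sG: "(\<lambda>x. s1 (G x)) holomorphic_on ball 0 R0" "(\<lambda>x. s2 (G x)) holomorphic_on ball 0 R0" "(\<lambda>x. s3 (G x)) holomorphic_on ball 0 R0"
  proof -
    have im: "G ` ball 0 R0 \<subseteq> ball 0 1" using G(3) by auto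
    show "(\<lambda>x. s1 (G x)) holomorphic_on ball 0 R0" "(\<lambda>x. s2 (G x)) holomorphic_on ball 0 R0" "(\<lambda>x. s3 (G x)) holomorphic_on ball 0 R0"
      using s_holomorphic[THEN holomorphic_on_compose_gen[OF G(1) _ im, unfolded o_def]] by blast+
  qed
  have thh: "th holomorphic_on ball 0 R0" unfolding th_def by (intro holomorphic_intros sG)
  have th0: "th 0 = 1" by (simp add: th_def G s_at_0)
  \<comment> \<open>G vanishes at 0, so G x / x extends holomorphically with the value 1 /
    16.\<close>
  define k where "k = (\<lambda>x. if x = 0 then deriv G 0 else G x / x)"
  have kh: "k holomorphic_on ball 0 R0"
    by (rule pole_theorem_open_0[OF G(1) open_ball, of 0]) (auto simp: k_def G)
  have Gk: "G x = x * k x" for x by (simp add: k_def G)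
  have k16h: "(\<lambda>x. 16 * k x) holomorphic_on ball 0 R0" by (intro holomorphic_intros kh)
  obtain r1 where r1: "0 < r1" "r1 \<le> R0" "\<And>x. x \<in> ball 0 r1 \<Longrightarrow> th x \<notin> \<real>\<^sub>\<le>\<^sub>0"
    using holomorphic_ball_nonpos_free[OF thh th0 R0(1)] by blast
  obtain r2 where r2: "0 < r2" "r2 \<le> R0" "\<And>x. x \<in> ball 0 r2 \<Longrightarrow> 16 * k x \<notin> \<real>\<^sub>\<le>\<^sub>0"
    using holomorphic_ball_nonpos_free[OF k16h _ R0(1)] by (auto simp: k_def G)
  define R where "R = min r1 r2"
  have R: "0 < R" "R \<le> R0" "R \<le> 1" using r1 r2 R0 by (auto simp: R_def)
  have sub: "ball 0 R \<subseteq> (ball 0 R0 :: complex set)" using R by auto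
  have thn: "th x \<notin> \<real>\<^sub>\<le>\<^sub>0" and kn: "16 * k x \<notin> \<real>\<^sub>\<le>\<^sub>0" if "x \<in> ball 0 R" for x
    using that r1 r2 by (auto simp: R_def)
  define f where "f = (\<lambda>x. csqrt (th x))"
  \<comment> \<open>A branch of ln (G x / x). The rescaling makes 16 k(0) = 1, so the principal
    logarithm gives l(0) = - 4 ln 2, without an ambiguity of 2 pi i.\<close>
  define l where "l = (\<lambda>x. Ln (16 * k x) - 4 * of_real (ln 2))"
  define K where "K = (\<lambda>x. f x * l x)"
  have fh: "f holomorphic_on ball 0 R" unfolding f_def
    by (intro holomorphic_intros holomorphic_on_subset[OF thh sub] thn)
  have lh: "l holomorphic_on ball 0 R" unfolding l_def
    by (intro holomorphic_intros holomorphic_on_subset[OF k16h sub] kn)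
  have Kh: "K holomorphic_on ball 0 R" unfolding K_def by (intro holomorphic_intros fh lh)
  have f2: "(f x)\<^sup>2 = th x" for x by (simp add: f_def)
  have fnz: "f x \<noteq> 0" if "x \<in> ball 0 R" for x using thn[OF that] by (auto simp: f_def)
  have f0: "f 0 = 1" by (simp add: f_def th0)
  have dG: "(f x)\<^sup>2 * x * (1 - x) * deriv G x = G x" if "x \<in> ball 0 R" for x
    using G(8)[of x] that sub by (auto simp: f2 th_def)
  have hd: "(h has_field_derivative deriv h x) (at x)" if "h holomorphic_on ball 0 R" "x \<in> ball 0 R" for h x
    using holomorphic_derivI[OF that(1) open_ball that(2)] by simp
  note fd = hd[OF fh] and ld = hd[OF lh] and Gd = hd[OF holomorphic_on_subset[OF G(1) sub]]
  have x1: "1 - x \<noteq> (0::complex)" if "x \<in> ball 0 R" for x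
  proof
    assume "1 - x = 0"
    then have "x = 1" by algebra
    then show False using that R by simp
  qed
  have halph: "\<And>x. x \<in> ball 0 R \<Longrightarrow> x \<noteq> 0 \<Longrightarrow> norm (G x) < 1 \<and> G x \<noteq> 0 \<and> s2 (G x) \<noteq> s3 (G x)"
    using G sub by blast
  \<comment> \<open>By the Halphen system s2 - s1 = f^2 / 4 has logarithmic derivative - 4 s3 / q in
    q; the equation for G' converts this to x.\<close>
  have eqf: "x * (1 - x) * deriv f x = - 2 * s3 (G x) / f x" if x: "x \<in> ball 0 R" for x
  proof (cases "x = 0")
    case True then show ?thesis by (simp add: G s_at_0)
  next
    case False
    note q = halph[OF x False]
    define a b c where "a = s1 (G x)" and "b = s2 (G x)" and "c = s3 (G x)"
    note h = halphen_system[of "G x", folded a_def b_def c_def]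
    have "(th has_field_derivative 4 * (2 * (a * c - a * b - b * c) / G x * deriv G x - 2 * (b * c - a * b - a * c) / G x * deriv G x)) (at x)"
      unfolding th_def by (intro DERIV_cmult DERIV_diff DERIV_chain2[OF h(1) Gd[OF x]] DERIV_chain2[OF h(2) Gd[OF x]])
        (use q b_def c_def in auto)
    moreover have "(th has_field_derivative 2 * f x * deriv f x) (at x)"
      using DERIV_power[OF fd[OF x], of 2] by (simp add: f2 mult_ac)
    ultimately have "2 * f x * deriv f x = 4 * (2 * (a * c - a * b - b * c) / G x * deriv G x - 2 * (b * c - a * b - a * c) / G x * deriv G x)"
      using DERIV_unique by blast
    also have "\<dots> = - 4 * c * (4 * (b - a)) * (deriv G x / G x)" by (simp add: algebra_simps add_divide_distrib[symmetric] diff_divide_distrib[symmetric])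
    also have "4 * (b - a) = (f x)\<^sup>2" by (simp add: f2 th_def a_def b_def)
    finally have e: "2 * f x * deriv f x = - 4 * c * (f x)\<^sup>2 * (deriv G x / G x)" .
    define u where "u = deriv G x / G x"
    have uG: "deriv G x = u * G x" using q by (simp add: u_def)
    have "2 * (x * (1 - x) * (f x * deriv f x)) * G x = x * (1 - x) * (2 * f x * deriv f x) * G x"
      by (simp only: mult_ac)
    then have "2 * (x * (1 - x) * (f x * deriv f x)) * G x = - 4 * c * ((f x)\<^sup>2 * x * (1 - x) * deriv G x)"
      unfolding e[folded u_def] uG by (simp only: mult_ac)
    then have "2 * (x * (1 - x) * (f x * deriv f x)) * G x = - 4 * c * G x" by (simp only: dG[OF x])
    then have "2 * (x * (1 - x) * (f x * deriv f x)) = - 4 * c" using q mult_right_cancel by blast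
    moreover have "a = - 2 * b" if "2 * a = - 4 * b" for a b :: complex using that by simp
    ultimately have "x * (1 - x) * (f x * deriv f x) = - 2 * c" by blast
    then show ?thesis using fnz[OF x] by (simp add: c_def field_simps)
  qed
  \<comment> \<open>The equation for G' with G = x exp l inserted: x G' / G = 1 + x l'.\<close>
  have eql: "(1 - x) * (f x)\<^sup>2 * (1 + x * deriv l x) = 1" if x: "x \<in> ball 0 R" for x
  proof (cases "x = 0")
    case True then show ?thesis by (simp add: f0)
  next
    case False
    have kd: "(k has_field_derivative deriv k x) (at x)" by (rule hd[OF holomorphic_on_subset[OF kh sub] x])
    have knz: "k x \<noteq> 0" using kn[OF x] by auto
    have "(l has_field_derivative inverse (16 * k x) * (16 * deriv k x)) (at x)"
      unfolding l_def by (rule derivative_eq_intros kd kn[OF x] refl | simp)+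
    then have dl: "deriv l x = deriv k x / k x" using knz by (simp add: DERIV_imp_deriv field_simps)
    have "((\<lambda>x. x * k x) has_field_derivative (1 * k x + deriv k x * x)) (at x)"
      by (intro DERIV_mult DERIV_ident kd)
    then have "deriv G x = k x + x * deriv k x" using Gk DERIV_imp_deriv by (metis (no_types, lifting) ext mult.commute mult_1)
    with dG[OF x] have "(f x)\<^sup>2 * x * (1 - x) * (k x + x * deriv k x) = x * k x" by (simp add: Gk)
    moreover have "(f x)\<^sup>2 * x * (1 - x) * (k x + x * deriv k x) = x * k x * ((1 - x) * (f x)\<^sup>2 * (1 + x * deriv l x))"
    proof -
      have "t * x * y * (k + x * d) = x * k * (y * t * (1 + x * (d / k)))" if "k \<noteq> 0" for t y k d :: complex
        using that by (simp add: field_simps)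
      then show ?thesis unfolding dl using knz by blast
    qed
    ultimately have "x * k x * ((1 - x) * (f x)\<^sup>2 * (1 + x * deriv l x)) = x * k x * 1" by simp
    then show ?thesis using False knz by (simp only: mult_cancel_left) simp
  qed
  have deriv_h: "deriv h holomorphic_on ball 0 R" if "h holomorphic_on ball 0 R" for h
    using that by (intro holomorphic_deriv) auto
  define m where "m = (\<lambda>x. x * (1 - x) * deriv f x)"
  define n where "n = (\<lambda>x. x * (1 - x) * deriv K x)"
  have mh: "m holomorphic_on ball 0 R" and nh: "n holomorphic_on ball 0 R"
    unfolding m_def n_def by (intro holomorphic_intros deriv_h fh Kh)+
  \<comment> \<open>By \<open>eqf\<close> the function m equals - 2 s3 / f, so the second-order
    equation for f needs only one more use of the Halphen system; the numerator collapses to (s3 -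
    s1) (s3 - s2).\<close>
  have dm': "deriv m x = f x / 4" if x: "x \<in> ball 0 R" "x \<noteq> 0" for x
  proof -
    note q = halph[OF x]
    define a b c where "a = s1 (G x)" and "b = s2 (G x)" and "c = s3 (G x)"
    note h = halphen_system[of "G x", folded a_def b_def c_def]
    have "((\<lambda>x. - 2 * s3 (G x) / f x) has_field_derivative
        ((- 2 * (2 * (a * b - a * c - b * c) / G x * deriv G x)) * f x - (- 2 * s3 (G x)) * deriv f x) / (f x * f x)) (at x)"
      by (intro DERIV_divide DERIV_cmult DERIV_chain2[OF h(3) Gd[OF x(1)]] fd x fnz) (use q b_def c_def in auto)
    then have "(m has_field_derivative
        ((- 2 * (2 * (a * b - a * c - b * c) / G x * deriv G x)) * f x - (- 2 * s3 (G x)) * deriv f x) / (f x * f x)) (at x)"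
      by (rule has_field_derivative_transform_within_open[OF _ open_ball x(1)]) (simp add: m_def eqf)
    then have e: "deriv m x = ((- 2 * (2 * (a * b - a * c - b * c) / G x * deriv G x)) * f x - (- 2 * c) * deriv f x) / (f x * f x)"
      by (simp add: DERIV_imp_deriv c_def)
    define t where "t = f x"
    have t: "t \<noteq> 0" "x \<noteq> 0" "1 - x \<noteq> 0" using fnz[OF x(1)] x x1 by (auto simp: t_def)
    define w where "w = 1 / (x * (1 - x))"
    have w: "x * (1 - x) * w = 1" using t by (simp add: w_def)
    have d1: "deriv f x = - 2 * c * w / t"
    proof -
      have "deriv f x = (x * (1 - x) * deriv f x) * w" using w by (simp add: mult_ac)
      then show ?thesis unfolding eqf[OF x(1)] by (simp add: t_def c_def)
    qed
    have d2: "deriv G x / G x = w / t\<^sup>2"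
    proof -
      have "w / t\<^sup>2 * G x = (x * (1 - x) * w) * deriv G x * (t\<^sup>2 / t\<^sup>2)"
        by (subst dG[OF x(1), symmetric]) (simp add: t_def mult_ac)
      also have "\<dots> = deriv G x" using w t by simp
      finally show ?thesis using q by (simp add: eq_divide_eq divide_eq_eq)
    qed
    have ab: "a = b - t\<^sup>2 / 4" "c = b - x * t\<^sup>2 / 4"
    proof -
      have 1: "4 * (b - a) = t\<^sup>2" by (simp add: t_def f2 th_def a_def b_def)
      then show "a = b - t\<^sup>2 / 4" by (simp add: field_simps)
      have "c - b = x * (a - b)" unfolding a_def b_def c_def using G(7)[of x] x sub by blast
      moreover have "a - b = - (t\<^sup>2 / 4)" using 1 by (simp add: field_simps)
      ultimately show "c = b - x * t\<^sup>2 / 4" by (simp add: algebra_simps)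
    qed
    have "deriv m x = ((- 2 * (2 * (a * b - a * c - b * c) * (deriv G x / G x))) * t - (- 2 * c) * deriv f x) / (t * t)"
      unfolding e t_def by simp
    also have "\<dots> = - 4 * ((a * b - a * c - b * c) + c * c) * w / t ^ 3"
    proof -
      have "((- 2 * (2 * s * (w / t\<^sup>2))) * t - (- 2 * c) * (- 2 * c * w / t)) / (t * t) = - 4 * (s + c * c) * w / t ^ 3" for s
        using t by (simp add: field_simps power2_eq_square power3_eq_cube)
      then show ?thesis unfolding d1 d2 .
    qed
    also have "(a * b - a * c - b * c) + c * c = (c - a) * (c - b)" by (simp add: algebra_simps)
    also have "\<dots> = - (x * (1 - x) * t ^ 4 / 16)" unfolding ab by (simp add: field_simps power2_eq_square power4_eq_xxxx)
    also have "- 4 * (- (x * (1 - x) * t ^ 4 / 16)) * w / t ^ 3 = (x * (1 - x) * w) * (t ^ 4 / t ^ 3) / 4" by (simp add: mult_ac)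
    also have "\<dots> = t / 4" unfolding w using t by (simp add: power3_eq_cube power4_eq_xxxx)
    finally show ?thesis by (simp add: t_def)
  qed
  \<comment> \<open>The Halphen system requires q nonzero; the value at x = 0 follows by
    continuity.\<close>
  have dm: "deriv m x = f x / 4" if x: "x \<in> ball 0 R" for x
  proof (cases "x = 0")
    case True
    have c: "isCont h 0" if "h holomorphic_on ball 0 R" for h
      using hd[OF that, of 0] R by (auto intro: DERIV_isCont)
    have "deriv m 0 = (\<lambda>x. f x / 4) 0"
      by (rule isCont_eqI[of _ _ _ "ball 0 R"]) (use R dm' in \<open>auto intro!: c deriv_h mh holomorphic_intros fh\<close>)
    then show ?thesis using True by simp
  qed (rule dm'[OF x])
  have l': "x * (1 - x) * deriv l x = 1 / (f x * f x) - (1 - x)"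
      "x * (1 - x) * f x * deriv l x = 1 / f x - (1 - x) * f x" if x: "x \<in> ball 0 R" for x
  proof -
    have gen: "y * (1 - y) * d = 1 / (t * t) - (1 - y) \<and> y * (1 - y) * t * d = 1 / t - (1 - y) * t"
      if "(1 - y) * t\<^sup>2 * (1 + y * d) = 1" "t \<noteq> 0" for y t d :: complex
    proof -
      have "y * (1 - y) * d * (t * t) = (1 - y) * t\<^sup>2 * (1 + y * d) - (1 - y) * t\<^sup>2"
        by (simp add: algebra_simps power2_eq_square)
      then have 1: "y * (1 - y) * d * (t * t) = 1 - (1 - y) * t\<^sup>2" by (simp only: that(1))
      have 2: "1 / (t * t) - (1 - y) = (1 - (1 - y) * t\<^sup>2) / (t * t)"
        using that(2) by (simp add: diff_divide_distrib power2_eq_square)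
      have 3: "y * (1 - y) * d = 1 / (t * t) - (1 - y)"
        unfolding 2 1[symmetric] using that(2) by simp
      have "y * (1 - y) * t * d = t * (y * (1 - y) * d)" by (simp only: mult_ac)
      also have "\<dots> = 1 / t - (1 - y) * t" unfolding 3 using that(2) by (simp add: algebra_simps)
      finally show ?thesis using 3 by blast
    qed
    show "x * (1 - x) * deriv l x = 1 / (f x * f x) - (1 - x)"
      "x * (1 - x) * f x * deriv l x = 1 / f x - (1 - x) * f x"
      using gen[OF eql[OF x] fnz[OF x]] by blast+
  qed
  \<comment> \<open>K = f l satisfies the equation which the solution f ln x + K imposes on its
    regular part.\<close>
  have dn: "deriv n x = K x / 4 + f x - 2 * (1 - x) * deriv f x" if x: "x \<in> ball 0 R" for x
  proof -
    have neq: "n y = m y * l y + 1 / f y - (1 - y) * f y" if y: "y \<in> ball 0 R" for y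
    proof -
      have "deriv K y = deriv f y * l y + deriv l y * f y"
        unfolding K_def by (intro DERIV_imp_deriv DERIV_mult fd ld y)
      then have "n y = m y * l y + y * (1 - y) * f y * deriv l y"
        by (simp add: n_def m_def algebra_simps)
      then show ?thesis unfolding l'(2)[OF y] by simp
    qed
    have md: "(m has_field_derivative f x / 4) (at x)" using hd[OF mh x] dm[OF x] by simp
    have "((\<lambda>y. m y * l y + 1 / f y - (1 - y) * f y) has_field_derivative
       (f x / 4 * l x + deriv l x * m x + (0 * f x - 1 * deriv f x) / (f x * f x) - ((0 - 1) * f x + deriv f x * (1 - x)))) (at x)"
      by (intro DERIV_diff DERIV_add DERIV_mult DERIV_divide DERIV_const DERIV_ident md ld fd x fnz)
    then have "(n has_field_derivative
       (f x / 4 * l x + deriv l x * m x + (0 * f x - 1 * deriv f x) / (f x * f x) - ((0 - 1) * f x + deriv f x * (1 - x)))) (at x)"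
      by (rule has_field_derivative_transform_within_open[OF _ open_ball x]) (simp add: neq)
    then have d1: "deriv n x = f x / 4 * l x + deriv l x * m x + (0 * f x - 1 * deriv f x) / (f x * f x) - ((0 - 1) * f x + deriv f x * (1 - x))"
      by (rule DERIV_imp_deriv)
    have d2: "deriv l x * m x = deriv f x * (1 / (f x * f x) - (1 - x))"
      unfolding l'(1)[OF x, symmetric] by (simp add: m_def mult_ac)
    show ?thesis unfolding d1 d2 by (simp add: K_def algebra_simps)
  qed
  define \<Phi> \<Psi> where "\<Phi> = fps_expansion f 0" and "\<Psi> = fps_expansion K 0"
  have \<Phi>: "f has_fps_expansion \<Phi>" and \<Psi>: "K has_fps_expansion \<Psi>"
    unfolding \<Phi>_def \<Psi>_def using R by (auto intro!: has_fps_expansion_fps_expansion[OF open_ball] fh Kh)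
  have near: "h1 has_fps_expansion H" if "h2 has_fps_expansion H" "\<And>x. x \<in> ball 0 R \<Longrightarrow> h1 x = h2 x" for h1 h2 :: "complex \<Rightarrow> complex" and H
  proof -
    have "eventually (\<lambda>x. x \<in> ball 0 R) (nhds (0::complex))" using R by (intro eventually_nhds_in_open) auto
    then have "eventually (\<lambda>x. h1 x = h2 x) (nhds 0)" by eventually_elim (rule that(2))
    then show ?thesis using that(1) by (subst has_fps_expansion_cong[OF _ refl])
  qed
  have "hyp_op \<Phi> = fps_const (1/4) * \<Phi>"
  proof (rule fps_expansion_unique_complex[of "deriv m"])
    show "deriv m has_fps_expansion hyp_op \<Phi>"
      unfolding m_def hyp_op_def by (intro fps_expansion_intros \<Phi>)
    have "(\<lambda>x. 1/4 * f x) has_fps_expansion fps_const (1/4) * \<Phi>" by (intro fps_expansion_intros \<Phi>)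
    then show "deriv m has_fps_expansion fps_const (1/4) * \<Phi>" by (rule near) (simp add: dm)
  qed
  moreover have "\<Phi> $ 0 = 1" using has_fps_expansion_imp_0_eq_fps_nth_0[OF \<Phi>] f0 by simp
  ultimately have \<Phi>n: "\<Phi> $ n = hyp_coeff n" for n by (rule hypergeometric_fps_unique)
  have "hyp_op \<Psi> = fps_const (1/4) * \<Psi> + \<Phi> - 2 * (1 - fps_X) * fps_deriv \<Phi>"
  proof (rule fps_expansion_unique_complex[of "deriv n"])
    show "deriv n has_fps_expansion hyp_op \<Psi>"
      unfolding n_def hyp_op_def by (intro fps_expansion_intros \<Psi>)
    have "(\<lambda>x. 1/4 * K x + f x - 2 * (1 - x) * deriv f x) has_fps_expansion fps_const (1/4) * \<Psi> + \<Phi> - 2 * (1 - fps_X) * fps_deriv \<Phi>"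
      by (intro fps_expansion_intros \<Phi> \<Psi>)
    then show "deriv n has_fps_expansion fps_const (1/4) * \<Psi> + \<Phi> - 2 * (1 - fps_X) * fps_deriv \<Phi>"
      by (rule near) (simp add: dn)
  qed
  moreover have K0: "K 0 = - 4 * of_real (ln 2)" by (simp add: K_def f0 l_def k_def G)
  then have "\<Psi> $ 0 = - 4 * of_real (ln 2)" using has_fps_expansion_imp_0_eq_fps_nth_0[OF \<Psi>] by simp
  ultimately have \<Psi>n: "\<Psi> $ n = hyp_coeff n * (2 * (Digamma (of_nat n + 1/2) - Digamma (of_nat n + 1)))" for n
    by (rule hypergeometric_log_fps_unique[OF \<Phi>n])
  have Ff: "F x = f x" and F1K: "F1 x = K x" if "x \<in> ball 0 R" for x
    using F_F1_of_holomorphic(1)[OF fh \<Phi> that \<Phi>n] F_F1_of_holomorphic(2)[OF Kh \<Psi> that \<Psi>n] by auto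
  show ?thesis
  proof (rule that[of R G])
    show "F holomorphic_on ball 0 R" by (rule holomorphic_transform[OF fh]) (simp add: Ff)
    show "F1 holomorphic_on ball 0 R" by (rule holomorphic_transform[OF Kh]) (simp add: F1K)
    show "F 0 = 1" "F1 0 = - 4 * of_real (ln 2)" using Ff[of 0] F1K[of 0] R f0 K0 by auto
    fix x :: complex assume x: "x \<in> ball 0 R"
    have "exp (l x) = k x"
    proof -
      have "exp (4 * of_real (ln 2) :: complex) = 16"
      proof -
        have "exp (4 * of_real (ln 2) :: complex) = exp (of_real (ln 2)) ^ 4"
          by (simp add: exp_of_nat_mult[symmetric])
        also have "exp (of_real (ln 2) :: complex) = 2" by (subst exp_of_real) simp
        finally show ?thesis by simp
      qed
      moreover have "k x \<noteq> 0" using kn[OF x] by auto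
      ultimately show ?thesis by (simp add: l_def exp_diff)
    qed
    then show "G x = x * exp (F1 x / F x)" using fnz[OF x] by (simp add: Ff[OF x] F1K[OF x] K_def Gk)
    show "(F x)\<^sup>2 = 4 * (s2 (G x) - s1 (G x))" by (simp add: Ff[OF x] f2 th_def)
    show "(F x)\<^sup>2 * x * (1 - x) * deriv G x = G x" using dG[OF x] by (simp add: Ff[OF x])
    show "F x \<noteq> 0" using fnz[OF x] by (simp add: Ff[OF x])
    show "norm (G x) < 1" "x \<noteq> 0 \<Longrightarrow> s2 (G x) \<noteq> s3 (G x)" "s3 (G x) - s2 (G x) = x * (s1 (G x) - s2 (G x))"
      using G(3,6,7)[of x] x sub by auto
  qed (use R holomorphic_on_subset[OF G(1) sub] in auto)
qed

section \<open>The Weierstrass function as a Lambert series\<close>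

lemma sin_pi_Ints_iff: "sin (of_real pi * z) = 0 \<longleftrightarrow> (z :: complex) \<in> \<int>"
proof
  assume "sin (of_real pi * z) = 0"
  then obtain n :: int where "of_real pi * z = of_real (n * pi)" by (auto simp: sin_eq_0)
  then have "of_real pi * z = of_real pi * of_int n" by simp
  then have "z = of_int n" by (simp only: mult_cancel_left) simp
  then show "z \<in> \<int>" by simp
next
  assume "z \<in> \<int>"
  then obtain n :: int where "z = of_int n" by (auto elim: Ints_cases)
  then have "of_real pi * z = of_real (n * pi)" by simp
  then show "sin (of_real pi * z) = 0" unfolding sin_eq_0 by blast
qed

lemma not_Int_imp_not_nonpos:
  fixes z :: complex
  assumes "z \<notin> \<int>"
  shows "z \<notin> \<int>\<^sub>\<le>\<^sub>0" "1 - z \<notin> \<int>\<^sub>\<le>\<^sub>0"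
proof -
  show "z \<notin> \<int>\<^sub>\<le>\<^sub>0" using assms nonpos_Ints_Int by blast
  show "1 - z \<notin> \<int>\<^sub>\<le>\<^sub>0"
  proof
    assume "1 - z \<in> \<int>\<^sub>\<le>\<^sub>0"
    then have "1 - (1 - z) \<in> \<int>" using Ints_diff[OF Ints_1 nonpos_Ints_Int] by blast
    then show False using assms by simp
  qed
qed

text \<open>Logarithmic derivative of Gamma(z) Gamma(1 - z) = pi / sin (pi z).\<close>

lemma Digamma_reflection:
  fixes z :: complex
  assumes z: "z \<notin> \<int>"
  shows "Digamma z - Digamma (1 - z) = - of_real pi * cot (of_real pi * z)"
proof -
  note z' = not_Int_imp_not_nonpos[OF z]
  have s: "sin (of_real pi * z) \<noteq> 0" using z by (simp add: sin_pi_Ints_iff)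
  have "((\<lambda>z. Gamma z * Gamma (1 - z)) has_field_derivative
     (Gamma z * Digamma z * Gamma (1 - z) + (Gamma (1 - z) * Digamma (1 - z) * (0 - 1)) * Gamma z)) (at z)"
    by (intro DERIV_mult has_field_derivative_Gamma DERIV_chain2[of Gamma] DERIV_diff DERIV_const DERIV_ident z')
  moreover have "((\<lambda>z. of_real pi / sin (of_real pi * z)) has_field_derivative
      ((0 * sin (of_real pi * z) - of_real pi * (cos (of_real pi * z) * of_real pi)) / (sin (of_real pi * z) * sin (of_real pi * z)))) (at z)"
    by (intro DERIV_divide DERIV_const s DERIV_chain2[of sin] DERIV_sin) (auto intro!: derivative_eq_intros)
  ultimately have "Gamma z * Digamma z * Gamma (1 - z) + (Gamma (1 - z) * Digamma (1 - z) * (0 - 1)) * Gamma z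
     = (0 * sin (of_real pi * z) - of_real pi * (cos (of_real pi * z) * of_real pi)) / (sin (of_real pi * z) * sin (of_real pi * z))"
    unfolding Gamma_reflection_complex by (rule DERIV_unique)
  then have "(Gamma z * Gamma (1 - z)) * (Digamma z - Digamma (1 - z)) = (of_real pi / sin (of_real pi * z)) * (- of_real pi * cot (of_real pi * z))"
    by (simp add: algebra_simps cot_def)
  moreover have "of_real pi / sin (of_real pi * z) \<noteq> 0" using s by simp
  ultimately show ?thesis unfolding Gamma_reflection_complex using mult_left_cancel by blast
qed

lemma trigamma_reflection:
  fixes z :: complex
  assumes z: "z \<notin> \<int>"
  shows "Polygamma 1 z + Polygamma 1 (1 - z) = (of_real pi)\<^sup>2 / (sin (of_real pi * z))\<^sup>2"
proof -
  note z' = not_Int_imp_not_nonpos[OF z]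
  have s: "sin (of_real pi * z) \<noteq> 0" using z by (simp add: sin_pi_Ints_iff)
  have "((\<lambda>z. Digamma z - Digamma (1 - z)) has_field_derivative
     (Polygamma (Suc 0) z - Polygamma (Suc 0) (1 - z) * (0 - 1))) (at z)"
    by (intro DERIV_diff has_field_derivative_Polygamma DERIV_chain2[of "Polygamma 0"] DERIV_const DERIV_ident z')
  moreover have "((\<lambda>z. - of_real pi * cot (of_real pi * z)) has_field_derivative
      - of_real pi * (- inverse ((sin (of_real pi * z))\<^sup>2) * of_real pi)) (at z)"
    by (intro DERIV_cmult DERIV_chain2[of cot] DERIV_cot s) (auto intro!: derivative_eq_intros)
  ultimately have "Polygamma (Suc 0) z - Polygamma (Suc 0) (1 - z) * (0 - 1) = - of_real pi * (- inverse ((sin (of_real pi * z))\<^sup>2) * of_real pi)"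
    by (rule DERIV_unique_local[of _ _ _ _ _ "- \<int>"]) (use z in \<open>auto simp: Digamma_reflection open_Compl closed_Ints\<close>)
  then show ?thesis by (simp add: field_simps power2_eq_square)
qed

text \<open>The two halves of the sum of 1 / (z + m)^2 over the integers are trigamma values at z
  and at 1 - z. They stay separate series so that they can be compared with the halves of an
  unconditional sum.\<close>

lemma inverse_square_shift_sums:
  fixes z :: complex
  assumes z: "z \<notin> \<int>"
  obtains P Q where "(\<lambda>k. 1 / (z + of_nat k)\<^sup>2) sums P" "(\<lambda>k. 1 / (z - 1 - of_nat k)\<^sup>2) sums Q"
    "P + Q = (of_real pi)\<^sup>2 / (sin (of_real pi * z))\<^sup>2"
proof
  have nz: "z \<noteq> 0" "1 - z \<noteq> 0" using z by auto
  show "(\<lambda>k. 1 / (z + of_nat k)\<^sup>2) sums Polygamma 1 z"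
    using Polygamma_LIMSEQ[of z 1] nz by (simp add: inverse_eq_divide power2_eq_square)
  have "(\<lambda>k. 1 / ((1 - z) + of_nat k)\<^sup>2) sums Polygamma 1 (1 - z)"
    using Polygamma_LIMSEQ[of "1 - z" 1] nz by (simp add: inverse_eq_divide power2_eq_square)
  moreover have "((1 - z) + of_nat k)\<^sup>2 = (z - 1 - of_nat k)\<^sup>2" for k
    by (simp add: power2_eq_square algebra_simps)
  ultimately show "(\<lambda>k. 1 / (z - 1 - of_nat k)\<^sup>2) sums Polygamma 1 (1 - z)" by simp
qed (rule trigamma_reflection[OF z])

section \<open>Summation over the integers and over the lattice\<close>

text \<open>The integers are cut into m <= 0 and m >= 1, so that each half of an unconditional sum
  can be read off from an ordinary series.\<close>

lemma infsum_int_eq_sums: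
  fixes f :: "int \<Rightarrow> complex"
  assumes "f summable_on UNIV" "(\<lambda>k. f (- int k)) sums P" "(\<lambda>k. f (1 + int k)) sums Q"
  shows "infsum f UNIV = P + Q"
proof -
  have inj: "inj (\<lambda>k. - int k)" "inj (\<lambda>k. 1 + int k)" by (auto simp: inj_def)
  have eq: "infsum f (range g) = P'" if "inj g" "(\<lambda>k. f (g k)) sums P'" for g :: "nat \<Rightarrow> int" and P'
  proof -
    have "(f \<circ> g) summable_on UNIV"
      using summable_on_subset[OF assms(1), of "range g"] that(1) by (subst summable_on_reindex[symmetric]) auto
    then have "(f \<circ> g) sums infsum (f \<circ> g) UNIV" by (intro has_sum_imp_sums has_sum_infsum)
    then have "infsum (f \<circ> g) UNIV = P'" using that(2) sums_unique2 by (auto simp: o_def)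
    then show ?thesis using that(1) by (simp add: infsum_reindex)
  qed
  have U: "(UNIV :: int set) = range (\<lambda>k. - int k) \<union> range (\<lambda>k. 1 + int k)"
  proof -
    have "m \<in> range (\<lambda>k. - int k) \<union> range (\<lambda>k. 1 + int k)" for m :: int
    proof (cases "m \<le> 0")
      case True
      then have "m = - int (nat (- m))" by simp
      then show ?thesis by blast
    next
      case False
      then have "m = 1 + int (nat (m - 1))" by simp
      then show ?thesis by blast
    qed
    then show ?thesis by blast
  qed
  have "infsum f UNIV = infsum f (range (\<lambda>k. - int k)) + infsum f (range (\<lambda>k. 1 + int k))"
    by (subst U, rule infsum_Un_disjoint) (auto intro: summable_on_subset[OF assms(1)])
  then show ?thesis using eq[OF inj(1) assms(2)] eq[OF inj(2) assms(3)] by simp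
qed

text \<open>The coordinate n is controlled by the imaginary part of the lattice point, and then m by
  subtracting n \<tau>.\<close>

lemma lattice_norm_ge:
  fixes \<tau> :: complex
  assumes "Im \<tau> > 0"
  shows "\<bar>real_of_int m\<bar> + \<bar>real_of_int n\<bar> \<le> (1 + norm \<tau> / Im \<tau> + 1 / Im \<tau>) * norm (of_int m + of_int n * \<tau>)"
proof -
  define l where "l = of_int m + of_int n * \<tau>"
  have 1: "\<bar>real_of_int n\<bar> * Im \<tau> \<le> norm l"
  proof -
    have "Im l = real_of_int n * Im \<tau>" by (simp add: l_def)
    then show ?thesis using abs_Im_le_cmod[of l] assms by (simp add: abs_mult)
  qed
  then have 2: "\<bar>real_of_int n\<bar> \<le> norm l / Im \<tau>" using assms by (simp add: field_simps)
  have "of_int m = l - of_int n * \<tau>" by (simp add: l_def)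
  then have "\<bar>real_of_int m\<bar> \<le> norm l + \<bar>real_of_int n\<bar> * norm \<tau>"
    by (metis norm_mult norm_of_int norm_triangle_ineq4)
  also have "\<dots> \<le> norm l + norm l / Im \<tau> * norm \<tau>" by (intro add_left_mono mult_right_mono 2) auto
  finally show ?thesis using 2 by (simp add: l_def algebra_simps)
qed

text \<open>The exponent 3/2 exceeds 1, and the product of two such factors dominates the inverse
  cube of |m| + |n|, which is the decay of the Weierstrass terms.\<close>

lemma summable_on_int_powr: "(\<lambda>m::int. (1 + \<bar>real_of_int m\<bar>) powr (- 3 / 2)) summable_on UNIV"
proof -
  have "summable (\<lambda>k. real (Suc k) powr (- 3 / 2))"
    by (subst summable_Suc_iff) (simp add: summable_real_powr_iff)
  then have s: "(\<lambda>k. (1 + real k) powr (- 3 / 2)) summable_on UNIV"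
    by (subst summable_on_UNIV_nonneg_real_iff) auto
  let ?f = "\<lambda>m::int. (1 + \<bar>real_of_int m\<bar>) powr (- 3 / 2)"
  have "?f summable_on range int"
    using s by (subst summable_on_reindex) (auto simp: o_def)
  moreover have "?f summable_on range (\<lambda>k. - int k)"
    using s by (subst summable_on_reindex) (auto simp: o_def inj_def)
  ultimately have "?f summable_on (range int \<union> range (\<lambda>k. - int k))" by (rule summable_on_union)
  moreover have "range int \<union> range (\<lambda>k. - int k) = UNIV"
  proof -
    have "m \<in> range int \<union> range (\<lambda>k. - int k)" for m
      by (cases m rule: int_cases2) auto
    then show ?thesis by blast
  qed
  ultimately show ?thesis by simp
qed

text \<open>Away from finitely many lattice points l the two inverse squares cancel to order |z| /
  |l|^3, and (|m| + |n|)^(-3) is dominated by a product of two summable functions of n and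
  m.\<close>

lemma weierstrass_lattice_summable:
  fixes z \<tau> :: complex
  assumes \<tau>: "Im \<tau> > 0"
  shows "(\<lambda>(n, m). 1 / (z - (of_int m + of_int n * \<tau>))\<^sup>2 - 1 / (of_int m + of_int n * \<tau>)\<^sup>2) summable_on (UNIV :: (int \<times> int) set)"
proof -
  define K where "K = 1 + norm \<tau> / Im \<tau> + 1 / Im \<tau>"
  have K: "K > 0" using \<tau> by (simp add: K_def add_pos_nonneg)
  \<comment> \<open>Outside \<open>T\<close> this forces |l| >= 2 |z|, hence |z - l| >= |l| / 2; the
    lower bound 1 puts the origin into \<open>T\<close>.\<close>
  define N where "N = max 1 (2 * norm z * K)"
  define T where "T = {(n :: int, m :: int). \<bar>real_of_int m\<bar> + \<bar>real_of_int n\<bar> < N}"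
  let ?f = "\<lambda>(n :: int, m :: int). 1 / (z - (of_int m + of_int n * \<tau>))\<^sup>2 - 1 / (of_int m + of_int n * \<tau>)\<^sup>2"
  have "finite T"
  proof (rule finite_subset)
    show "T \<subseteq> {- \<lceil>N\<rceil>..\<lceil>N\<rceil>} \<times> {- \<lceil>N\<rceil>..\<lceil>N\<rceil>}"
    proof
      fix x assume "x \<in> T"
      then obtain n m where x: "x = (n, m)" "\<bar>real_of_int m\<bar> + \<bar>real_of_int n\<bar> < N" by (auto simp: T_def)
      then have "\<bar>real_of_int m\<bar> \<le> real_of_int \<lceil>N\<rceil>" "\<bar>real_of_int n\<bar> \<le> real_of_int \<lceil>N\<rceil>" by linarith+
      then have "\<bar>m\<bar> \<le> \<lceil>N\<rceil>" "\<bar>n\<bar> \<le> \<lceil>N\<rceil>" by linarith+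
      then show "x \<in> {- \<lceil>N\<rceil>..\<lceil>N\<rceil>} \<times> {- \<lceil>N\<rceil>..\<lceil>N\<rceil>}" using x by auto
    qed
  qed auto
  then have T: "?f summable_on T" by simp
  have "(\<lambda>(n, m). norm ((1 + \<bar>real_of_int n\<bar>) powr (- 3 / 2) * (1 + \<bar>real_of_int m\<bar>) powr (- 3 / 2) :: complex)) summable_on (UNIV :: int set) \<times> (UNIV :: int set)"
    using has_sum_times(1)[of "\<lambda>n. of_real ((1 + \<bar>real_of_int n\<bar>) powr (- 3 / 2))" UNIV "\<lambda>n. of_real ((1 + \<bar>real_of_int n\<bar>) powr (- 3 / 2))" UNIV]
      summable_on_int_powr by (simp add: norm_mult)
  then have b: "(\<lambda>(n :: int, m :: int). (1 + \<bar>real_of_int n\<bar>) powr (- 3 / 2) * (1 + \<bar>real_of_int m\<bar>) powr (- 3 / 2)) summable_on UNIV"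
    by (simp add: norm_mult case_prod_unfold)
  have "(\<lambda>x. norm (?f x)) summable_on (- T)"
  proof (rule Infinite_Sum.abs_summable_on_comparison_test'[OF summable_on_cmult_right[OF summable_on_subset[OF b]]])
    fix x assume "x \<in> - T"
    then obtain n m where x: "x = (n, m)" and ge: "\<bar>real_of_int m\<bar> + \<bar>real_of_int n\<bar> \<ge> N"
      by (cases x) (auto simp: T_def)
    define l where "l = of_int m + of_int n * \<tau>"
    define s where "s = \<bar>real_of_int m\<bar> + \<bar>real_of_int n\<bar>"
    have sK: "s \<le> K * norm l" unfolding s_def l_def K_def by (rule lattice_norm_ge[OF \<tau>])
    have s1: "s \<ge> 1" "s \<ge> 2 * norm z * K" using ge by (auto simp: N_def s_def)
    have "2 * norm z * K \<le> norm l * K" using sK s1 by (simp add: mult.commute)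
    then have lz: "2 * norm z \<le> norm l" using K by simp
    have lpos: "norm l > 0" using sK s1 K by (smt (verit) mult_nonneg_nonpos zero_less_mult_iff)
    have "norm l \<le> norm (z - l) + norm z" using norm_triangle_ineq4[of z "z - l"] by simp
    then have zl: "norm (z - l) \<ge> norm l / 2" using lz by linarith
    then have nz: "z - l \<noteq> 0" "l \<noteq> 0" using lpos by auto
    have "1 / (z - l)\<^sup>2 - 1 / l\<^sup>2 = z * (2 * l - z) / (l\<^sup>2 * (z - l)\<^sup>2)"
      using nz by (simp add: divide_simps) (simp add: power2_eq_square algebra_simps)
    then have "norm (1 / (z - l)\<^sup>2 - 1 / l\<^sup>2) = norm z * norm (2 * l - z) / ((norm l)\<^sup>2 * (norm (z - l))\<^sup>2)"
      by (simp add: norm_mult norm_divide norm_power)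
    also have "\<dots> \<le> norm z * (3 * norm l) / ((norm l)\<^sup>2 * (norm l / 2)\<^sup>2)"
    proof (intro frac_le mult_left_mono power_mono zl mult_pos_pos)
      have "norm (2 * l - z) \<le> norm (2 * l) + norm z" by (rule norm_triangle_ineq4)
      also have "norm (2 * l) = 2 * norm l" by (simp add: norm_mult)
      finally show "norm (2 * l - z) \<le> 3 * norm l" using lz norm_ge_zero[of z] by linarith
    qed (use lpos in auto)
    also have "\<dots> = 12 * norm z / norm l ^ 3" using lpos by (simp add: field_simps power2_eq_square power3_eq_cube)
    also have "\<dots> \<le> 12 * norm z / (s / K) ^ 3"
      using sK K s1 by (intro divide_left_mono power_mono mult_pos_pos zero_less_power) (auto simp: field_simps)
    also have "\<dots> = 12 * norm z * K ^ 3 * (1 / s ^ 3)" using K by (simp add: power_divide)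
    also have "\<dots> \<le> 12 * norm z * K ^ 3 * (8 * ((1 + \<bar>real_of_int n\<bar>) powr (- 3 / 2) * (1 + \<bar>real_of_int m\<bar>) powr (- 3 / 2)))"
    proof (rule mult_left_mono)
      define a b where "a = 1 + \<bar>real_of_int n\<bar>" and "b = 1 + \<bar>real_of_int m\<bar>"
      have ab: "a \<ge> 1" "b \<ge> 1" "a + b = s + 2" by (auto simp: a_def b_def s_def)
      have "a * b \<le> (1 + s)\<^sup>2"
      proof -
        have "a \<le> 1 + s" "b \<le> 1 + s" using ab by linarith+
        then show ?thesis unfolding power2_eq_square using ab by (intro mult_mono) auto
      qed
      also have "\<dots> \<le> (2 * s)\<^sup>2" using s1 by (intro power_mono) auto
      finally have "(a * b) powr (3 / 2) \<le> ((2 * s)\<^sup>2) powr (3 / 2)" using ab by (intro powr_mono2) auto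
      also have "((2 * s)\<^sup>2) powr (3 / 2) = (2 * s) ^ 3"
      proof -
        have t: "(2 * s)\<^sup>2 = (2 * s) powr 2" "(2 * s) ^ 3 = (2 * s) powr 3"
          using s1 by (simp_all only: powr_numeral)
        show ?thesis unfolding t powr_powr by simp
      qed
      finally have le: "(a * b) powr (3 / 2) \<le> 8 * s ^ 3" by (simp add: power_mult_distrib)
      have "1 / s ^ 3 = 8 / (8 * s ^ 3)" by simp
      also have "\<dots> \<le> 8 / (a * b) powr (3 / 2)" using le ab s1 by (intro divide_left_mono) auto
      also have "\<dots> = 8 * (a powr (- 3 / 2) * b powr (- 3 / 2))"
        using ab by (simp add: powr_mult powr_minus field_simps)
      finally show "1 / s ^ 3 \<le> 8 * ((1 + \<bar>real_of_int n\<bar>) powr (- 3 / 2) * (1 + \<bar>real_of_int m\<bar>) powr (- 3 / 2))"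
        by (simp add: a_def b_def)
    qed (use K in auto)
    finally show "norm (?f x) \<le> 12 * norm z * K ^ 3 * 8 * (case x of (n, m) \<Rightarrow> (1 + \<bar>real_of_int n\<bar>) powr (- 3 / 2) * (1 + \<bar>real_of_int m\<bar>) powr (- 3 / 2))"
      by (simp add: x l_def mult_ac)
  qed auto
  then have "?f summable_on (- T)" by (rule abs_summable_summable)
  from summable_on_union[OF this T] show ?thesis by simp
qed

section \<open>From the lattice sum to the Lambert series\<close>

text \<open>Both sides sum the double series k (x p^n)^k. Over k first it gives the Koebe function y
  / (1 - y)^2 at y = x p^n, over n first the Lambert terms.\<close>

lemma lambert_koebe_has_sum:
  fixes x p :: complex
  assumes x: "norm x < 1" and p: "norm p < 1"
  shows "((\<lambda>n. x * p ^ n / (1 - x * p ^ n)\<^sup>2) has_sum (\<Sum>\<^sub>\<infinity>k\<in>{1..}. of_nat k / (1 - p ^ k) * x ^ k)) UNIV"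
    and "(\<lambda>k. of_nat k / (1 - p ^ k) * x ^ k) summable_on {1..}"
proof -
  define f where "f = (\<lambda>(k :: nat, n :: nat). of_nat k * (x * p ^ n) ^ k)"
  have geo: "((\<lambda>n. (norm p ^ k) ^ n) has_sum 1 / (1 - norm p ^ k)) UNIV" if "k \<ge> 1" for k
  proof -
    have l: "norm p ^ k < 1" using p that by (simp add: power_less_one_iff)
    have "(\<lambda>n. (norm p ^ k) ^ n) sums (1 / (1 - norm p ^ k))"
      using geometric_sums[of "norm p ^ k"] l by simp
    then show ?thesis using l by (intro norm_summable_imp_has_sum) (auto intro: summable_geometric)
  qed
  have sf: "(\<lambda>z. norm (f z)) summable_on {1..} \<times> UNIV"
  proof (rule summable_on_SigmaI)
    fix k :: nat assume "k \<in> {1..}"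
    then have k: "k \<ge> 1" by simp
    have "((\<lambda>n. real k * norm x ^ k * (norm p ^ k) ^ n) has_sum (real k * norm x ^ k * (1 / (1 - norm p ^ k)))) UNIV"
      by (intro has_sum_cmult_right geo k)
    moreover have "norm (f (k, n)) = real k * norm x ^ k * (norm p ^ k) ^ n" for n
      by (simp add: f_def norm_mult norm_power power_mult_distrib power_mult[symmetric] mult_ac)
    ultimately show "((\<lambda>n. norm (f (k, n))) has_sum (real k * norm x ^ k * (1 / (1 - norm p ^ k)))) UNIV"
      by simp
  next
    have "(\<lambda>k. norm (real k * norm x ^ k * (1 / (1 - norm p ^ k)))) summable_on {1..}"
    proof (rule Infinite_Sum.abs_summable_on_comparison_test'[OF summable_on_cmult_right[OF summable_on_power_mult_geometric[of "norm x" 1]]])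
      fix k :: nat assume "k \<in> {1..}"
      then have k: "k \<ge> 1" by simp
      have "norm p ^ k \<le> norm p ^ 1" using p k by (intro power_decreasing) auto
      then have "1 / (1 - norm p ^ k) \<le> 1 / (1 - norm p)" "1 - norm p ^ k > 0" using p by (auto intro!: frac_le)
      then show "norm (real k * norm x ^ k * (1 / (1 - norm p ^ k))) \<le> 1 / (1 - norm p) * (real k ^ 1 * norm x ^ k)"
        using mult_left_mono[of "1 / (1 - norm p ^ k)" "1 / (1 - norm p)" "real k * norm x ^ k"] by (simp add: abs_mult mult.commute)
    qed (use x in auto)
    then show "(\<lambda>k. real k * norm x ^ k * (1 / (1 - norm p ^ k))) summable_on {1..}" by (rule abs_summable_summable)
  qed auto
  then have sf': "f summable_on {1..} \<times> UNIV" by (rule abs_summable_summable)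
  have row: "((\<lambda>n. f (k, n)) has_sum of_nat k / (1 - p ^ k) * x ^ k) UNIV" if k: "k \<in> {1..}" for k
  proof -
    have k1: "k \<ge> 1" using k by simp
    have l: "norm (p ^ k) < 1" using p k by (simp add: norm_power power_less_one_iff)
    have "((\<lambda>n. (p ^ k) ^ n) has_sum (1 / (1 - p ^ k))) UNIV"
    proof (rule norm_summable_imp_has_sum)
      show "summable (\<lambda>n. norm ((p ^ k) ^ n))" using l by (simp add: norm_power summable_geometric)
      show "(\<lambda>n. (p ^ k) ^ n) sums (1 / (1 - p ^ k))" using geometric_sums[OF l] by simp
    qed
    then have "((\<lambda>n. of_nat k * x ^ k * (p ^ k) ^ n) has_sum (of_nat k * x ^ k * (1 / (1 - p ^ k)))) UNIV"
      by (rule has_sum_cmult_right)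
    moreover have "of_nat k * x ^ k * (p ^ k) ^ n = f (k, n)" for n
      by (simp add: f_def power_mult_distrib power_mult[symmetric] mult_ac)
    ultimately show ?thesis by simp
  qed
  have tot: "((\<lambda>k. of_nat k / (1 - p ^ k) * x ^ k) has_sum infsum f ({1..} \<times> UNIV)) {1..}"
    by (rule has_sum_SigmaD[OF has_sum_infsum[OF sf'] row])
  then show "(\<lambda>k. of_nat k / (1 - p ^ k) * x ^ k) summable_on {1..}" by (rule has_sum_imp_summable)
  have col: "((\<lambda>k. f (k, n)) has_sum x * p ^ n / (1 - x * p ^ n)\<^sup>2) {1..}" for n
  proof -
    define y where "y = x * p ^ n"
    have y: "norm y < 1"
    proof -
      have "norm y \<le> norm x * 1" unfolding y_def norm_mult norm_power using p by (intro mult_left_mono power_le_one) auto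
      then show ?thesis using x by simp
    qed
    have "((\<lambda>k. of_nat k * y ^ k) has_sum (y / (1 - y)\<^sup>2)) UNIV"
    proof (rule norm_summable_imp_has_sum)
      have "(\<lambda>k. real k ^ 1 * norm y ^ k) summable_on UNIV" using y by (intro summable_on_power_mult_geometric) auto
      then show "summable (\<lambda>n. norm (of_nat n * y ^ n))"
        by (simp add: norm_mult norm_power summable_on_UNIV_nonneg_real_iff)
      show "(\<lambda>k. of_nat k * y ^ k) sums (y / (1 - y)\<^sup>2)"
        using sums_mult[OF geometric_deriv_sums[OF y], of y] sums_Suc_iff[of "\<lambda>k. of_nat k * y ^ k" "y / (1 - y)\<^sup>2"]
        by (simp add: mult_ac)
    qed
    also have "?this \<longleftrightarrow> ((\<lambda>k. of_nat k * y ^ k) has_sum (y / (1 - y)\<^sup>2)) {1..}"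
    proof (rule has_sum_cong_neutral)
      fix k :: nat assume "k \<in> UNIV - {1..}"
      then have "k = 0" by simp
      then show "of_nat k * y ^ k = 0" by simp
    qed auto
    finally show ?thesis by (simp add: f_def y_def)
  qed
  have "((\<lambda>(n, k). f (k, n)) has_sum infsum f ({1..} \<times> UNIV)) (UNIV \<times> {1..})"
    using has_sum_infsum[OF sf']
    by (subst has_sum_reindex_bij_witness[where T = "{1..} \<times> UNIV" and i = prod.swap and j = prod.swap and h = f]) auto
  from has_sum_SigmaD[OF this, of "\<lambda>n. x * p ^ n / (1 - x * p ^ n)\<^sup>2"] col
  have "((\<lambda>n. x * p ^ n / (1 - x * p ^ n)\<^sup>2) has_sum infsum f ({1..} \<times> UNIV)) UNIV" by simp
  then show "((\<lambda>n. x * p ^ n / (1 - x * p ^ n)\<^sup>2) has_sum (\<Sum>\<^sub>\<infinity>k\<in>{1..}. of_nat k / (1 - p ^ k) * x ^ k)) UNIV"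
    using infsumI[OF tot] by simp
qed

lemma sin_square_exp:
  fixes z :: complex
  shows "(of_real pi)\<^sup>2 / (sin (of_real pi * z))\<^sup>2 =
     - 4 * (of_real pi)\<^sup>2 * (exp (2 * of_real pi * \<i> * z) / (1 - exp (2 * of_real pi * \<i> * z))\<^sup>2)"
proof -
  define e where "e = exp (\<i> * (of_real pi * z))"
  have e0: "e \<noteq> 0" by (simp add: e_def)
  have ei: "exp (- (\<i> * (of_real pi * z))) = 1 / e" by (simp only: e_def exp_minus inverse_eq_divide)
  have e2: "exp (2 * of_real pi * \<i> * z) = e\<^sup>2" by (simp add: e_def power2_eq_square mult_ac flip: exp_add)
  have "sin (of_real pi * z) = (e - 1 / e) / (2 * \<i>)" unfolding ei[symmetric] unfolding e_def by (rule sin_exp_eq)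
  also have "e - 1 / e = - ((1 - e\<^sup>2) / e)" using e0 by (simp add: field_simps power2_eq_square)
  finally have "sin (of_real pi * z) = - ((1 - e\<^sup>2) / e) / (2 * \<i>)" .
  then have "(sin (of_real pi * z))\<^sup>2 = - (1 - e\<^sup>2)\<^sup>2 / (4 * e\<^sup>2)"
    by (simp add: power_divide power_mult_distrib)
  then show ?thesis unfolding e2 using e0 by simp
qed

text \<open>The lattice is summed by rows parallel to w1. Each row is a cosecant square, hence a
  Koebe function of an exponential; the rows n <= 0 add up to the Lambert series in Z, the rows n >=
  1 to the one in p / Z, and the subtracted constants to \<open>lamb_\<alpha>\<close>.\<close>

theorem wp_eq_lambert:
  fixes u w1 w2 :: complex
  assumes w1: "w1 \<noteq> 0" and \<tau>: "Im (w2 / w1) > 0"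
  defines "Z \<equiv> exp (of_real pi * \<i> * u / w1)"
  defines "p \<equiv> exp (2 * of_real pi * \<i> * w2 / w1)"
  assumes Z: "norm Z < 1" and W: "norm (p / Z) < 1"
  shows "wp u w1 w2 = - (of_real pi / w1)\<^sup>2 * (X 1 1 Z (p / Z) + lamb_\<alpha> p / 12)"
proof -
  define z \<tau> where "z = u / (2 * w1)" and "\<tau> = w2 / w1"
  have \<tau>0: "Im \<tau> > 0" using \<tau> by (simp add: \<tau>_def)
  have Zz: "Z = exp (2 * of_real pi * \<i> * z)" using w1 by (simp add: Z_def z_def mult_ac)
  have p\<tau>: "p = exp (2 * of_real pi * \<i> * \<tau>)" by (simp add: p_def \<tau>_def)
  have p1: "norm p < 1" unfolding p\<tau> norm_exp_eq_Re using \<tau>0 by simp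
  have nz: "Z \<noteq> 0" "p \<noteq> 0" by (auto simp: Z_def p_def)
  define W' where "W' = p / Z"
  define l where "l = (\<lambda>n m :: int. of_int m + of_int n * \<tau>)"
  define g where "g = (\<lambda>(n :: int, m :: int). 1 / (z - l n m)\<^sup>2 - 1 / (l n m)\<^sup>2)"
  have gs: "g summable_on UNIV" unfolding g_def l_def by (rule weierstrass_lattice_summable[OF \<tau>0])
  have l00: "l 0 0 = 0" by (simp add: l_def)
  \<comment> \<open>Since \<open>1 / 0 = 0\<close>, the term of \<open>g\<close> at the origin is the principal part \<open>1 / z\<^sup>2\<close>.\<close>
  have wpg: "wp u w1 w2 = infsum g UNIV / (4 * w1\<^sup>2)"
  proof -
    have t: "1 / (u - (2 * of_int m * w1 + 2 * of_int n * w2))\<^sup>2 - 1 / (2 * of_int m * w1 + 2 * of_int n * w2)\<^sup>2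
       = g (n, m) / (4 * w1\<^sup>2)" for m n
    proof -
      have a: "2 * of_int m * w1 + 2 * of_int n * w2 = 2 * w1 * l n m" using w1 by (simp add: l_def \<tau>_def field_simps)
      have b: "u - 2 * w1 * l n m = 2 * w1 * (z - l n m)" using w1 by (simp add: z_def field_simps)
      have "1 / (2 * w1 * y)\<^sup>2 - 1 / (2 * w1 * v)\<^sup>2 = (1 / y\<^sup>2 - 1 / v\<^sup>2) / (4 * w1\<^sup>2)" for y v
        by (simp add: power_mult_distrib diff_divide_distrib mult_ac)
      then show ?thesis unfolding a b g_def by simp
    qed
    have "infsum g UNIV = infsum g ({(0, 0)} \<union> (UNIV - {(0, 0)}))" by (rule arg_cong[where f = "infsum g"]) auto
    also have "\<dots> = infsum g {(0, 0)} + infsum g (UNIV - {(0, 0)})"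
      by (rule infsum_Un_disjoint) (auto intro: summable_on_subset[OF gs])
    also have "infsum g (UNIV - {(0, 0)}) = (\<Sum>\<^sub>\<infinity>(m, n) \<in> UNIV - {(0, 0)}. g (n, m))"
      by (rule infsum_reindex_bij_witness[of _ "\<lambda>(m, n). (n, m)" "\<lambda>(n, m). (m, n)"]) auto
    finally have "infsum g UNIV / (4 * w1\<^sup>2) = 1 / (4 * w1\<^sup>2 * z\<^sup>2) + (\<Sum>\<^sub>\<infinity>(m, n) \<in> UNIV - {(0, 0)}. g (n, m)) / (4 * w1\<^sup>2)"
      by (simp add: g_def l00 add_divide_distrib)
    also have "(\<Sum>\<^sub>\<infinity>(m, n) \<in> UNIV - {(0, 0)}. g (n, m)) / (4 * w1\<^sup>2) = (\<Sum>\<^sub>\<infinity>(m, n) \<in> UNIV - {(0, 0)}. g (n, m) / (4 * w1\<^sup>2))"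
      unfolding divide_inverse case_prod_unfold by (rule infsum_cmult_left'[symmetric])
    also have "4 * w1\<^sup>2 * z\<^sup>2 = u\<^sup>2" using w1 by (simp add: z_def power_divide power_mult_distrib)
    finally show ?thesis unfolding wp_def t by simp
  qed
  \<comment> \<open>A pole on row n would force |Z| = |p|^n, while |p| < |Z| < 1 leaves no integer
    n.\<close>
  have notint: "z - of_int n * \<tau> \<notin> \<int>" for n
  proof
    assume "z - of_int n * \<tau> \<in> \<int>"
    then obtain m where "z = of_int m + of_int n * \<tau>" by (auto elim!: Ints_cases simp: algebra_simps)
    then have "2 * of_real pi * \<i> * z = 2 * of_real pi * \<i> * of_int m + of_int n * (2 * of_real pi * \<i> * \<tau>)"
      by (simp add: algebra_simps)
    then have "Z = exp (2 * of_real pi * \<i> * of_int m) * exp (of_int n * (2 * of_real pi * \<i> * \<tau>))"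
      by (simp only: Zz exp_add)
    also have "exp (2 * of_real pi * \<i> * of_int m) = 1"
      unfolding exp_eq_1 by (auto intro!: exI[of _ m])
    finally have Zn: "norm Z = exp (of_int n * Re (2 * of_real pi * \<i> * \<tau>))"
      by (simp add: norm_exp_eq_Re)
    moreover have pn: "norm p = exp (Re (2 * of_real pi * \<i> * \<tau>))" by (simp add: p\<tau> norm_exp_eq_Re)
    define c where "c = Re (2 * of_real pi * \<i> * \<tau>)"
    have c: "c < 0" using \<tau>0 by (simp add: c_def)
    have Zn': "norm Z = exp (of_int n * c)" and pn': "norm p = exp c" using Zn pn by (simp_all only: c_def)
    have 1: "of_int n * c < 0" using Z by (simp add: Zn')
    have "norm (p / Z) = exp (c - of_int n * c)" by (simp add: norm_divide Zn' pn' exp_diff)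
    then have "c - of_int n * c < 0" using W by simp
    then have 2: "(1 - of_int n) * c < 0" by (simp add: algebra_simps)
    show False
    proof (cases "n \<le> 0")
      case True
      then have "of_int n * c \<ge> 0" using c by (intro mult_nonpos_nonpos) auto
      then show False using 1 by simp
    next
      case False
      then have "(1 - of_int n) * c \<ge> 0" using c by (intro mult_nonpos_nonpos) auto
      then show False using 2 by simp
    qed
  qed
  have ntau: "of_int n * \<tau> \<notin> \<int>" if "n \<noteq> 0" for n
  proof
    assume "of_int n * \<tau> \<in> \<int>"
    then obtain m where "of_int n * \<tau> = of_int m" by (rule Ints_cases)
    then have "Im (of_int n * \<tau>) = Im (of_int m)" by (rule arg_cong)
    then show False using that \<tau>0 by simp
  qed
  define \<phi> where "\<phi> = (\<lambda>x :: complex. x / (1 - x)\<^sup>2)"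
  \<comment> \<open>Row 0 has its own constant: there the subtracted terms are 1 / m^2 over nonzero
    m, with sum pi^2 / 3, instead of a cosecant.\<close>
  define R where "R = (\<lambda>n :: int. if n = 0 then - 4 * (of_real pi)\<^sup>2 * \<phi> Z - (of_real pi)\<^sup>2 / 3
      else - 4 * (of_real pi)\<^sup>2 * (\<phi> (exp (2 * of_real pi * \<i> * (z - of_int n * \<tau>))) - \<phi> (exp (2 * of_real pi * \<i> * (- of_int n * \<tau>)))) :: complex)"
  have rowsum: "((\<lambda>m. g (n, m)) has_sum R n) UNIV" for n
  proof -
    have sr: "(\<lambda>m. g (n, m)) summable_on UNIV"
    proof -
      have "(\<lambda>(n, m). g (n, m)) summable_on Sigma UNIV (\<lambda>_. UNIV)" using gs by simp
      from summable_on_SigmaD1[OF this, of n] show ?thesis by simp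
    qed
    obtain P Q where PQ: "(\<lambda>k. 1 / (z - of_int n * \<tau> + of_nat k)\<^sup>2) sums P" "(\<lambda>k. 1 / (z - of_int n * \<tau> - 1 - of_nat k)\<^sup>2) sums Q"
      "P + Q = (of_real pi)\<^sup>2 / (sin (of_real pi * (z - of_int n * \<tau>)))\<^sup>2"
      using inverse_square_shift_sums[OF notint] by blast
    have "infsum (\<lambda>m. g (n, m)) UNIV = R n"
    proof (cases "n = 0")
      case True
      have s1: "(\<lambda>k. 1 / (of_nat (Suc k))\<^sup>2 :: complex) sums (of_real (pi\<^sup>2 / 6))"
        using sums_of_real[OF inverse_squares_sums, where 'a = complex] by (simp add: add.commute)
      then have s0: "(\<lambda>k. 1 / (of_nat k)\<^sup>2 :: complex) sums (of_real (pi\<^sup>2 / 6))"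
        using sums_Suc[OF s1] by simp
      have "infsum (\<lambda>m. g (n, m)) UNIV = (P - of_real (pi\<^sup>2 / 6)) + (Q - of_real (pi\<^sup>2 / 6))"
      proof (rule infsum_int_eq_sums[OF sr])
        show "(\<lambda>k. g (n, - int k)) sums (P - of_real (pi\<^sup>2 / 6))"
          using sums_diff[OF PQ(1) s0] True by (simp add: g_def l_def)
        show "(\<lambda>k. g (n, 1 + int k)) sums (Q - of_real (pi\<^sup>2 / 6))"
          using sums_diff[OF PQ(2) s1] True by (simp add: g_def l_def diff_diff_eq)
      qed
      also have "\<dots> = (P + Q) - (of_real pi)\<^sup>2 / 3" by simp
      finally show ?thesis using True unfolding PQ(3) sin_square_exp by (simp add: R_def \<phi>_def Zz)
    next
      case False
      then have "of_int (- n) * \<tau> \<notin> \<int>" by (intro ntau) auto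
      from inverse_square_shift_sums[OF this] obtain P' Q' where
        PQ': "(\<lambda>k. 1 / (of_int (- n) * \<tau> + of_nat k)\<^sup>2) sums P'" "(\<lambda>k. 1 / (of_int (- n) * \<tau> - 1 - of_nat k)\<^sup>2) sums Q'"
      "P' + Q' = (of_real pi)\<^sup>2 / (sin (of_real pi * (of_int (- n) * \<tau>)))\<^sup>2" by blast
      have "infsum (\<lambda>m. g (n, m)) UNIV = (P - P') + (Q - Q')"
      proof (rule infsum_int_eq_sums[OF sr])
        show "(\<lambda>k. g (n, - int k)) sums (P - P')"
        proof -
          have "z - l n (- int k) = z - of_int n * \<tau> + of_nat k" "l n (- int k) = - (of_int (- n) * \<tau> + of_nat k)" for k
            by (simp_all add: l_def)
          then have "g (n, - int k) = 1 / (z - of_int n * \<tau> + of_nat k)\<^sup>2 - 1 / (of_int (- n) * \<tau> + of_nat k)\<^sup>2" for k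
            unfolding g_def split by (simp only: power2_minus)
          then show ?thesis using sums_diff[OF PQ(1) PQ'(1)] by simp
        qed
        show "(\<lambda>k. g (n, 1 + int k)) sums (Q - Q')"
        proof -
          have "z - l n (1 + int k) = z - of_int n * \<tau> - 1 - of_nat k" "l n (1 + int k) = - (of_int (- n) * \<tau> - 1 - of_nat k)" for k
            by (simp_all add: l_def)
          then have "g (n, 1 + int k) = 1 / (z - of_int n * \<tau> - 1 - of_nat k)\<^sup>2 - 1 / (of_int (- n) * \<tau> - 1 - of_nat k)\<^sup>2" for k
            unfolding g_def split by (simp only: power2_minus)
          then show ?thesis using sums_diff[OF PQ(2) PQ'(2)] by simp
        qed
      qed
      also have "\<dots> = (P + Q) - (P' + Q')" by simp
      finally show ?thesis using False unfolding PQ(3) PQ'(3) sin_square_exp by (simp add: R_def \<phi>_def algebra_simps)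
    qed
    then show ?thesis using has_sum_infsum[OF sr] by simp
  qed
  have Rs: "(R has_sum infsum g UNIV) UNIV"
    by (rule has_sum_SigmaD[where B = "\<lambda>_. UNIV", OF _ rowsum]) (use has_sum_infsum[OF gs] in simp)
  \<comment> \<open>the Koebe function is invariant under inversion, which folds both half-lines into the unit disc\<close>
  have \<phi>inv: "\<phi> (1 / x) = \<phi> x" if "x \<noteq> 0" for x
  proof -
    have "1 - 1 / x = - ((1 - x) / x)" using that by (simp add: field_simps)
    then have "\<phi> (1 / x) = 1 / x / ((1 - x) / x)\<^sup>2" by (simp only: \<phi>_def power2_minus)
    then show ?thesis using that by (simp add: \<phi>_def power_divide power2_eq_square)
  qed
  have pk: "exp (2 * of_real pi * \<i> * (of_nat k * \<tau>)) = p ^ k" for k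
    by (simp add: p\<tau> exp_of_nat_mult[symmetric] mult_ac)
  have Rneg: "R (- int (Suc k)) = - 4 * (of_real pi)\<^sup>2 * (\<phi> (Z * p ^ Suc k) - \<phi> (p * p ^ k))" for k
  proof -
    have "exp (2 * of_real pi * \<i> * (z - of_int (- int (Suc k)) * \<tau>)) = exp (2 * of_real pi * \<i> * z) * exp (2 * of_real pi * \<i> * (of_nat (Suc k) * \<tau>))"
      by (subst exp_add[symmetric]) (simp add: algebra_simps)
    moreover have "- of_int (- int (Suc k)) * \<tau> = of_nat (Suc k) * \<tau>" by simp
    ultimately show ?thesis unfolding R_def pk Zz[symmetric] by (simp only: pk) simp
  qed
  have Rpos: "R (1 + int k) = - 4 * (of_real pi)\<^sup>2 * (\<phi> (W' * p ^ k) - \<phi> (p * p ^ k))" for k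
  proof -
    have "exp (2 * of_real pi * \<i> * (z - of_int (1 + int k) * \<tau>)) = exp (2 * of_real pi * \<i> * z) / exp (2 * of_real pi * \<i> * (of_nat (Suc k) * \<tau>))"
      by (subst exp_diff[symmetric]) (simp add: algebra_simps)
    also have "\<dots> = 1 / (W' * p ^ k)" unfolding pk Zz[symmetric] W'_def using nz by (simp add: field_simps)
    finally have "\<phi> (exp (2 * of_real pi * \<i> * (z - of_int (1 + int k) * \<tau>))) = \<phi> (1 / (W' * p ^ k))"
      by (rule arg_cong)
    also have "\<dots> = \<phi> (W' * p ^ k)" by (rule \<phi>inv) (use nz in \<open>simp add: W'_def\<close>)
    finally have 1: "\<phi> (exp (2 * of_real pi * \<i> * (z - of_int (1 + int k) * \<tau>))) = \<phi> (W' * p ^ k)" .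
    have "2 * of_real pi * \<i> * (- of_int (1 + int k) * \<tau>) = - (2 * of_real pi * \<i> * (of_nat (Suc k) * \<tau>))"
      by (simp add: algebra_simps)
    then have "exp (2 * of_real pi * \<i> * (- of_int (1 + int k) * \<tau>)) = 1 / p ^ Suc k"
      by (simp only: exp_minus pk inverse_eq_divide)
    then have "\<phi> (exp (2 * of_real pi * \<i> * (- of_int (1 + int k) * \<tau>))) = \<phi> (1 / p ^ Suc k)" by (rule arg_cong)
    also have "\<dots> = \<phi> (p ^ Suc k)" by (rule \<phi>inv) (use nz in simp)
    finally have 2: "\<phi> (exp (2 * of_real pi * \<i> * (- of_int (1 + int k) * \<tau>))) = \<phi> (p * p ^ k)" by simp
    show ?thesis unfolding R_def 1 2 by simp
  qed
  define LZ LW Lp where "LZ = (\<Sum>\<^sub>\<infinity>k\<in>{1..}. of_nat k / (1 - p ^ k) * Z ^ k)"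
    and "LW = (\<Sum>\<^sub>\<infinity>k\<in>{1..}. of_nat k / (1 - p ^ k) * W' ^ k)"
    and "Lp = (\<Sum>\<^sub>\<infinity>k\<in>{1..}. of_nat k / (1 - p ^ k) * p ^ k)"
  have W1: "norm W' < 1" using W by (simp add: W'_def)
  have sums: "(\<lambda>n. \<phi> (Z * p ^ n)) sums LZ" "(\<lambda>n. \<phi> (W' * p ^ n)) sums LW" "(\<lambda>n. \<phi> (p * p ^ n)) sums Lp"
    unfolding \<phi>_def LZ_def LW_def Lp_def
    by (intro has_sum_imp_sums lambert_koebe_has_sum Z W1 p1)+
  \<comment> \<open>The nonpositive rows start with \<open>\<phi> Z\<close>, which has no matching
    subtracted Koebe value; it is split off and comes back with R 0.\<close>
  have IR: "infsum R UNIV = (- 4 * (of_real pi)\<^sup>2 * (LZ - Lp) - (of_real pi)\<^sup>2 / 3) + (- 4 * (of_real pi)\<^sup>2 * (LW - Lp))"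
  proof (rule infsum_int_eq_sums[OF has_sum_imp_summable[OF Rs]])
    show "(\<lambda>k. R (1 + int k)) sums (- 4 * (of_real pi)\<^sup>2 * (LW - Lp))"
      unfolding Rpos by (intro sums_mult sums_diff sums)
    have "(\<lambda>k. \<phi> (Z * p ^ Suc k)) sums (LZ - \<phi> Z)"
      using sums(1) by (subst sums_Suc_iff) simp
    then have "(\<lambda>k. R (- int (Suc k))) sums (- 4 * (of_real pi)\<^sup>2 * ((LZ - \<phi> Z) - Lp))"
      unfolding Rneg by (intro sums_mult sums_diff sums)
    then have "(\<lambda>k. R (- int k)) sums (- 4 * (of_real pi)\<^sup>2 * ((LZ - \<phi> Z) - Lp) + R (- int 0))"
      by (rule sums_Suc)
    then show "(\<lambda>k. R (- int k)) sums (- 4 * (of_real pi)\<^sup>2 * (LZ - Lp) - (of_real pi)\<^sup>2 / 3)"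
      by (simp add: R_def algebra_simps)
  qed
  have IRg: "infsum R UNIV = infsum g UNIV" using Rs by (rule infsumI)
  have XW: "X 1 1 Z W' = LZ + LW"
  proof -
    have "X 1 1 Z W' = (\<Sum>\<^sub>\<infinity>k\<in>{1..}. of_nat k / (1 - p ^ k) * Z ^ k + of_nat k / (1 - p ^ k) * W' ^ k)"
      unfolding X_def Xt_def using nz by (intro infsum_cong) (simp add: W'_def distrib_left)
    then show ?thesis unfolding LZ_def LW_def
      using infsum_add[OF lambert_koebe_has_sum(2)[OF Z p1] lambert_koebe_has_sum(2)[OF W1 p1]] by simp
  qed
  have al: "lamb_\<alpha> p = 1 - 24 * Lp" by (simp add: lamb_\<alpha>_def Lp_def)
  have gX: "infsum g UNIV = - 4 * (of_real pi)\<^sup>2 * (X 1 1 Z W' + lamb_\<alpha> p / 12)"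
    unfolding IRg[symmetric] IR XW al by (simp add: field_simps)
  show ?thesis unfolding wpg gX W'_def[symmetric] using w1 by (simp add: power_divide)
qed

section \<open>The Painleve equation in the uniformising variable\<close>

text \<open>N stands for the second derivative of y with the change of time built in. It contains h,
  which is no function of x and y. But h enters only through m = h \<sigma> / D, the remaining part
  of g, and through h^2, which \<sigma>^2 = 4 D^3 E converts into m^2; then a polynomial identity is
  left.\<close>

lemma PVI_algebra_t:
  fixes D y x g h \<sigma> \<kappa> s2 N Ey E :: complex
  assumes D: "D \<noteq> 0"
    and E: "E = y * (y - 1) * (y - x)" and Ey: "Ey = (y - 1) * (y - x) + y * (y - x) + y * (y - 1)"
    and \<sigma>: "\<sigma>\<^sup>2 = 4 * D ^ 3 * E" and g: "g = 4 * D * y * (y - 1) + h * \<sigma> / D"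
    and N: "N = - 16 * (s2 + D * x) * D * y * (y - 1) + 4 * D * (2 * y - 1) * g
       + ((\<kappa> * \<sigma> - 2 * h * (s2 + D * y) - 2 * \<sigma>) * \<sigma>
          + h * (h * (2 * D\<^sup>2 * Ey) + (6 * (s2 + D * y) - 4 * (s2 + D + s2 + (s2 + D * x))) * \<sigma>)) / D
       + 4 * (s2 + D * x) * (h * \<sigma>) / D + g * (4 * (s2 + D * x) + 4 * D * (1 - 2 * x))"
  shows "E * N = 1/2 * Ey * g\<^sup>2 + 4 * D * (1 - 2 * x) * E * g + 4 * D * x * (1 - x) * y * (y - 1) * g
      + 8 * D\<^sup>2 * y\<^sup>2 * (y - 1)\<^sup>2 * (\<kappa> / 2 * (y - x)\<^sup>2 + x * (x - 1))"
proof -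
  define m where "m = h * \<sigma> / D"
  have hs: "h * \<sigma> = D * m" using D by (simp add: m_def)
  have gm: "g = 4 * D * y * (y - 1) + m" unfolding g m_def ..
  have br: "((\<kappa> * \<sigma> - 2 * h * (s2 + D * y) - 2 * \<sigma>) * \<sigma>
          + h * (h * (2 * D\<^sup>2 * Ey) + (6 * (s2 + D * y) - 4 * (s2 + D + s2 + (s2 + D * x))) * \<sigma>)) / D
     = 4 * (\<kappa> - 2) * D\<^sup>2 * E + 2 * h\<^sup>2 * D * Ey + m * (4 * (s2 + D * y) - 4 * (s2 + D + s2 + (s2 + D * x)))"
  proof -
    have "(\<kappa> * \<sigma> - 2 * h * (s2 + D * y) - 2 * \<sigma>) * \<sigma>
          + h * (h * (2 * D\<^sup>2 * Ey) + (6 * (s2 + D * y) - 4 * (s2 + D + s2 + (s2 + D * x))) * \<sigma>)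
      = D * (4 * (\<kappa> - 2) * D\<^sup>2 * E + 2 * h\<^sup>2 * D * Ey + m * (4 * (s2 + D * y) - 4 * (s2 + D + s2 + (s2 + D * x))))"
      using \<sigma> hs by algebra
    then show ?thesis using D by simp
  qed
  have last: "4 * (s2 + D * x) * (h * \<sigma>) / D = 4 * (s2 + D * x) * m" unfolding hs using D by simp
  have N2: "N = 4 * D * (2 * y - 1) * g + 4 * D * (1 - 2 * x) * g + 4 * (\<kappa> - 2) * D\<^sup>2 * E + 2 * h\<^sup>2 * D * Ey + 4 * D * m * (x + y - 1)"
    unfolding N br last gm by algebra
  \<comment> \<open>Here the Weierstrass cubic is used: m^2 = h^2 \<sigma>^2 / D^2 = 4 h^2 D
    E.\<close>
  have Eh: "2 * h\<^sup>2 * D * E = m\<^sup>2 / 2"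
  proof -
    have "D\<^sup>2 * (2 * (2 * h\<^sup>2 * D * E)) = D\<^sup>2 * m\<^sup>2" using \<sigma> hs by algebra
    then show ?thesis using D by simp
  qed
  have "E * N = 4 * D * (2 * y - 2 * x) * g * E + 4 * (\<kappa> - 2) * D\<^sup>2 * E\<^sup>2 + (2 * h\<^sup>2 * D * E) * Ey + 4 * D * m * (x + y - 1) * E"
    unfolding N2 by algebra
  also have "\<dots> = 4 * D * (2 * y - 2 * x) * g * E + 4 * (\<kappa> - 2) * D\<^sup>2 * E\<^sup>2 + m\<^sup>2 / 2 * Ey + 4 * D * m * (x + y - 1) * E"
    unfolding Eh ..
  also have "\<dots> = 1/2 * Ey * g\<^sup>2 + 4 * D * (1 - 2 * x) * E * g + 4 * D * x * (1 - x) * y * (y - 1) * g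
      + 8 * D\<^sup>2 * y\<^sup>2 * (y - 1)\<^sup>2 * (\<kappa> / 2 * (y - x)\<^sup>2 + x * (x - 1))"
  proof -
    have "2 * (4 * D * (2 * y - 2 * x) * g * E + 4 * (\<kappa> - 2) * D\<^sup>2 * E\<^sup>2 + 4 * D * m * (x + y - 1) * E) + m\<^sup>2 * Ey
       = Ey * g\<^sup>2 + 2 * (4 * D * (1 - 2 * x) * E * g + 4 * D * x * (1 - x) * y * (y - 1) * g)
      + 8 * D\<^sup>2 * y\<^sup>2 * (y - 1)\<^sup>2 * (\<kappa> * (y - x)\<^sup>2 + 2 * (x * (x - 1)))"
      unfolding gm E Ey by algebra
    moreover have "a1 + a2 + m2 / 2 * e + a3 = 1/2 * e * g2 + b1 + b2 + 8 * d * (k / 2 * w + v)"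
      if "2 * (a1 + a2 + a3) + m2 * e = e * g2 + 2 * (b1 + b2) + 8 * d * (k * w + 2 * v)" for a1 a2 a3 m2 e g2 b1 b2 d k w v :: complex
      using that by (simp add: field_simps)
    ultimately show ?thesis unfolding mult.assoc[of 8] by blast
  qed
  finally show ?thesis .
qed

text \<open>The change of time from t to x. P is dt/dx, and 4 D P x (1 - x) = -1 rewrites the
  coefficients 1/x + 1/(x - 1) and 1 / (x^2 (x - 1)^2) through D and P.\<close>

lemma PVI_cleared_of_t:
  fixes D y x g N Ey E \<mu> P :: complex
  assumes x: "x \<noteq> 0" "x \<noteq> 1" and D: "D \<noteq> 0"
    and E: "E = y * (y - 1) * (y - x)" and Ey: "Ey = (y - 1) * (y - x) + y * (y - x) + y * (y - 1)"
    and P: "4 * D * P * x * (1 - x) = - 1"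
    and EN: "E * N = 1/2 * Ey * g\<^sup>2 + 4 * D * (1 - 2 * x) * E * g + 4 * D * x * (1 - x) * y * (y - 1) * g
      + 8 * D\<^sup>2 * y\<^sup>2 * (y - 1)\<^sup>2 * ((2 * \<mu> - 1)\<^sup>2 * (y - x)\<^sup>2 + x * (x - 1))"
  shows "PVI_cleared \<mu> x y (g * P) (P\<^sup>2 * N)"
proof -
  have x1: "x - 1 \<noteq> 0" "1 - x \<noteq> 0" using x by auto
  have f1: "1/x + 1/(x - 1) = - 4 * D * P * (1 - 2 * x)"
  proof -
    have "1/x + 1/(x - 1) = (1 - 2 * x) / (x * (1 - x))" using x x1 by (simp add: divide_simps) (simp add: algebra_simps)
    also have "\<dots> = - (4 * D * P * x * (1 - x)) * ((1 - 2 * x) / (x * (1 - x)))" unfolding P by simp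
    also have "\<dots> = - 4 * D * P * (1 - 2 * x)" using x x1 by simp
    finally show ?thesis .
  qed
  have f2: "1 / (x\<^sup>2 * (x - 1)\<^sup>2) = 16 * D\<^sup>2 * P\<^sup>2"
  proof -
    have "16 * D\<^sup>2 * P\<^sup>2 * (x\<^sup>2 * (x - 1)\<^sup>2) = (4 * D * P * x * (1 - x))\<^sup>2" by algebra
    also have "\<dots> = 1" unfolding P by simp
    finally show ?thesis using x x1 by (simp add: eq_divide_eq divide_eq_eq)
  qed
  have "P\<^sup>2 * (E * N) = 1/2 * Ey * (g * P)\<^sup>2 - ((- 4 * D * P * (1 - 2 * x)) * E + y * (y - 1)) * (g * P)
      + 1/2 * (y\<^sup>2 * (y - 1)\<^sup>2 * (16 * D\<^sup>2 * P\<^sup>2)) * ((2 * \<mu> - 1)\<^sup>2 * (y - x)\<^sup>2 + x * (x - 1))"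
  proof -
    have "y * (y - 1) * g * P * (4 * D * P * x * (1 - x)) = - (y * (y - 1) * g * P)" unfolding P by simp
    then have 1: "P\<^sup>2 * (4 * D * x * (1 - x) * y * (y - 1) * g) = - (y * (y - 1) * (g * P))" by algebra
    have 2: "P\<^sup>2 * (E * N) = 1/2 * Ey * (g * P)\<^sup>2 + 4 * D * P * (1 - 2 * x) * E * (g * P) + P\<^sup>2 * (4 * D * x * (1 - x) * y * (y - 1) * g)
      + 8 * y\<^sup>2 * (y - 1)\<^sup>2 * (D\<^sup>2 * P\<^sup>2) * ((2 * \<mu> - 1)\<^sup>2 * (y - x)\<^sup>2 + x * (x - 1))"
      unfolding EN by (simp add: distrib_left power_mult_distrib power2_eq_square mult_ac)
    have "K + 4 * D * P * (1 - 2 * x) * E * u + - (y * (y - 1) * u) + 8 * y\<^sup>2 * (y - 1)\<^sup>2 * (D\<^sup>2 * P\<^sup>2) * M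
       = K - ((- 4 * D * P * (1 - 2 * x)) * E + y * (y - 1)) * u + 1/2 * (y\<^sup>2 * (y - 1)\<^sup>2 * (16 * D\<^sup>2 * P\<^sup>2)) * M" for K u M
      by (simp add: algebra_simps)
    then show ?thesis unfolding 2 1 .
  qed
  then show ?thesis
    unfolding PVI_cleared_def f1 E[symmetric] Ey[symmetric]
    unfolding divide_inverse[of "y\<^sup>2 * (y - 1)\<^sup>2"] f2[unfolded divide_inverse mult_1_left]
    by (simp only: mult_ac)
qed

section \<open>Derivatives along the curve\<close>

text \<open>lz1 is the derivative of lz with respect to t, so the hypotheses state the second-order
  equation for lz. All derivatives are taken in s and carry the factor t'; the series, the roots and
  h then form a closed system of first-order equations, from which y'' is computed.\<close>

theorem PVI_of_second_order:
  fixes t t' lz lz1 :: "complex \<Rightarrow> complex" and \<mu> :: complex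
  defines "q \<equiv> \<lambda>s. exp (t s)" and "Z \<equiv> \<lambda>s. exp (lz s)" and "W \<equiv> \<lambda>s. exp (2 * t s - lz s)"
  assumes S: "open S"
    and dt: "\<And>s. s \<in> S \<Longrightarrow> (t has_field_derivative t' s) (at s)"
    and dlz: "\<And>s. s \<in> S \<Longrightarrow> (lz has_field_derivative lz1 s * t' s) (at s)"
    and dlz1: "\<And>s. s \<in> S \<Longrightarrow> (lz1 has_field_derivative 2 * (2 * \<mu> - 1)\<^sup>2 * X 2 (- 1) (Z s) (W s) * t' s) (at s)"
    and lt: "\<And>s. s \<in> S \<Longrightarrow> norm (Z s) < 1" "\<And>s. s \<in> S \<Longrightarrow> norm (W s) < 1" "\<And>s. s \<in> S \<Longrightarrow> norm (q s) < 1"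
    and ne: "\<And>s. s \<in> S \<Longrightarrow> s2 (q s) \<noteq> s3 (q s)" "\<And>s. s \<in> S \<Longrightarrow> s1 (q s) \<noteq> s2 (q s)"
    and x1: "\<And>s. s \<in> S \<Longrightarrow> exp s \<noteq> 1"
    and rel: "\<And>s. s \<in> S \<Longrightarrow> s3 (q s) - s2 (q s) = exp s * (s1 (q s) - s2 (q s))"
    and t': "\<And>s. s \<in> S \<Longrightarrow> 4 * (s1 (q s) - s2 (q s)) * t' s * (1 - exp s) = - 1"
  shows "PVI_solution_on \<mu> S (\<lambda>s. (X 1 1 (Z s) (W s) - s2 (q s)) / (s1 (q s) - s2 (q s)))"
proof -
  define \<kappa> where "\<kappa> = 2 * (2 * \<mu> - 1)\<^sup>2"
  define a b c D where "a s = s1 (q s)" and "b s = s2 (q s)" and "c s = s3 (q s)" and "D s = a s - b s" for s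
  define SS \<sigma> T0 where "SS s = X 1 1 (Z s) (W s)" and "\<sigma> s = X 2 (- 1) (Z s) (W s)" and "T0 s = X 0 (- 1) (Z s) (W s)" for s
  \<comment> \<open>In \<open>Y1_eq\<close>, \<open>Y2_eq\<close> and \<open>Y3_eq\<close> the term
    with - 2 T0 multiplies the very series that also occurs with the factor lz1 - 1. Only this
    combination survives in the derivatives.\<close>
  define h where "h s = lz1 s - 1 - 2 * T0 s" for s
  define y where "y s = (SS s - b s) / D s" for s
  define g where "g s = 4 * D s * y s * (y s - 1) + h s * \<sigma> s / D s" for s
  define Ey where "Ey s = (y s - 1) * (y s - exp s) + y s * (y s - exp s) + y s * (y s - 1)" for s
  have D0: "D s \<noteq> 0" if "s \<in> S" for s using ne(2)[OF that] by (simp add: D_def a_def b_def)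
  have ab: "a s = b s + D s" for s by (simp add: D_def)
  have cb: "c s = b s + D s * exp s" if "s \<in> S" for s
    using rel[OF that] by (simp add: D_def a_def b_def c_def algebra_simps)
  have SSy: "SS s = b s + D s * y s" if "s \<in> S" for s using D0[OF that] by (simp add: y_def)
  have q0: "q s \<noteq> 0" for s by (simp add: q_def)
  have ZW: "Z s * W s = (q s)\<^sup>2" for s by (simp add: Z_def W_def q_def power2_eq_square flip: exp_add)
  have dq: "(q has_field_derivative q s * t' s) (at s)" if "s \<in> S" for s
    unfolding q_def by (rule derivative_eq_intros dt that refl)+
  have chain: "((\<lambda>s. f (q s)) has_field_derivative k * t' s) (at s)"
    if "s \<in> S" "(f has_field_derivative k / q s) (at (q s))" for f k s
    using DERIV_chain2[OF that(2) dq[OF that(1)]] q0[of s] by simp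
  note halph = halphen_system[OF lt(3) q0 ne(1)]
  have da: "(a has_field_derivative 2 * (b s * c s - a s * b s - a s * c s) * t' s) (at s)"
    and db: "(b has_field_derivative 2 * (a s * c s - a s * b s - b s * c s) * t' s) (at s)" if "s \<in> S" for s
    unfolding a_def b_def c_def by (intro chain halph that)+
  \<comment> \<open>With respect to t the logarithmic derivatives of Z and W are lz1 and 2 - lz1,
    that is, c = 1 and d = lz1 - 1.\<close>
  have dX: "((\<lambda>s. X m e (Z s) (W s)) has_field_derivative
      ((lz1 s - 1) * t' s * X (Suc m) (- e) (Z s) (W s) + t' s * Y (Suc m) e (Z s) (W s))) (at s)"
    if s: "s \<in> S" and e: "norm e \<le> 1" for s m e
  proof (rule X_has_field_derivative[OF S s])
    show "(Z has_field_derivative Z s * (t' s + (lz1 s - 1) * t' s)) (at s)" if "s \<in> S" for s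
      unfolding Z_def by (rule derivative_eq_intros dlz that refl)+ (simp add: algebra_simps)
    show "(W has_field_derivative W s * (t' s - (lz1 s - 1) * t' s)) (at s)" if "s \<in> S" for s
      unfolding W_def by (rule derivative_eq_intros dlz dt that refl)+ (simp add: algebra_simps)
  qed (use lt s e in auto)
  have al: "lamb_\<alpha> (Z s * W s) = - 4 * (a s + b s + c s)" for s
    by (simp add: ZW lamb_\<alpha>_eq a_def b_def c_def)
  have be: "lamb_\<beta> (Z s * W s) = 2 * (a s * b s + a s * c s + b s * c s)" if "s \<in> S" for s
    using lamb_\<beta>_eq[OF lt(3)[OF that] q0 ne(1)[OF that]] by (simp add: ZW a_def b_def c_def)
  have X3: "X 3 1 (Z s) (W s) = 6 * (SS s)\<^sup>2 - 4 * (a s + b s + c s) * SS s + 2 * (a s * b s + a s * c s + b s * c s)" if "s \<in> S" for s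
  proof -
    have "x + - 4 * u * v + w = x - 4 * u * v + w" for x u v w :: complex by simp
    then show ?thesis unfolding X_weierstrass_second_order[OF lt(1,2)[OF that]] al be[OF that] SS_def .
  qed
  have X3E: "X 3 1 (Z s) (W s) = 2 * (D s)\<^sup>2 * Ey s" if "s \<in> S" for s
    unfolding X3[OF that] SSy[OF that] cb[OF that] ab Ey_def by algebra
  have dSS: "(SS has_field_derivative (h s * \<sigma> s + 4 * (SS s)\<^sup>2 - 4 * (a s + b s + c s) * SS s + 2 * (a s * b s + a s * c s + b s * c s)) * t' s) (at s)"
    if "s \<in> S" for s
    unfolding SS_def[abs_def]
    by (rule DERIV_cong[OF dX[OF that, of 1 1, unfolded Suc_1]])
       (simp_all add: Y2_eq[OF lt(1,2)[OF that]] X3[OF that] SS_def[symmetric] \<sigma>_def[symmetric] T0_def[symmetric] h_def algebra_simps del: One_nat_def)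
  have dT0: "(T0 has_field_derivative (h s * SS s + \<sigma> s) * t' s) (at s)" if "s \<in> S" for s
    unfolding T0_def[abs_def]
    by (rule DERIV_cong[OF dX[OF that, of "-1" 0, folded One_nat_def]])
       (simp_all add: Y1_eq[OF lt(1,2)[OF that]] SS_def[symmetric] \<sigma>_def[symmetric] T0_def[symmetric] h_def algebra_simps del: One_nat_def)
  have d\<sigma>: "(\<sigma> has_field_derivative (h s * (2 * (D s)\<^sup>2 * Ey s) + (6 * SS s - 4 * (a s + b s + c s)) * \<sigma> s) * t' s) (at s)"
    if "s \<in> S" for s
    unfolding \<sigma>_def[abs_def] X3E[OF that, symmetric]
    by (rule DERIV_cong[OF dX[OF that, of "-1" 2]])
       (simp_all add: Y3_eq[OF lt(1,2)[OF that], unfolded al] SS_def[symmetric] \<sigma>_def[symmetric] T0_def[symmetric] h_def algebra_simps del: One_nat_def)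
  have dh: "(h has_field_derivative (\<kappa> * \<sigma> s - 2 * h s * SS s - 2 * \<sigma> s) * t' s) (at s)" if "s \<in> S" for s
    unfolding h_def[abs_def]
    by (rule DERIV_cong[OF DERIV_diff[OF DERIV_diff[OF dlz1[OF that] DERIV_const] DERIV_cmult[OF dT0[OF that]]]])
       (simp add: \<kappa>_def \<sigma>_def h_def algebra_simps)
  have dD: "(D has_field_derivative - 4 * c s * D s * t' s) (at s)" if "s \<in> S" for s
    unfolding D_def[abs_def]
    by (rule DERIV_cong[OF DERIV_diff[OF da[OF that] db[OF that]]]) (simp add: algebra_simps)
  have dy: "(y has_field_derivative g s * t' s) (at s)" if s: "s \<in> S" for s
  proof -
    have dy1: "(y has_field_derivative (((h s * \<sigma> s + 4 * (SS s)\<^sup>2 - 4 * (a s + b s + c s) * SS s + 2 * (a s * b s + a s * c s + b s * c s)) * t' s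
        - 2 * (a s * c s - a s * b s - b s * c s) * t' s) * D s - (SS s - b s) * (- 4 * c s * D s * t' s)) / (D s * D s)) (at s)"
      unfolding y_def[abs_def] by (intro DERIV_divide DERIV_diff dSS db dD D0 s)
    have alg: "((k + 4 * S\<^sup>2 - 4 * (a + b + c) * S + 2 * (a * b + a * c + b * c)) * t
        - 2 * (a * c - a * b - b * c) * t) * D - (S - b) * (- 4 * c * D * t) = (D * D) * ((4 * D * y * (y - 1) + k / D) * t)"
      if "D \<noteq> 0" "S = b + D * y" "a = b + D" for k S a b c t D y :: complex
    proof -
      have "((k + 4 * S\<^sup>2 - 4 * (a + b + c) * S + 2 * (a * b + a * c + b * c)) * t
        - 2 * (a * c - a * b - b * c) * t) * D - (S - b) * (- 4 * c * D * t) = (D * D) * (4 * D * y * (y - 1) * t) + D * k * t"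
        unfolding that(2,3) by algebra
      also have "D * k * t = (D * D) * (k / D * t)" using that(1) by simp
      finally show ?thesis by (simp add: algebra_simps)
    qed
    show ?thesis using dy1 unfolding alg[OF D0[OF s] SSy[OF s] ab] g_def using D0[OF s] by simp
  qed
  define g1 where "g1 s = - 16 * c s * D s * y s * (y s - 1) + 4 * D s * (2 * y s - 1) * g s
       + ((\<kappa> * \<sigma> s - 2 * h s * SS s - 2 * \<sigma> s) * \<sigma> s
          + h s * (h s * (2 * (D s)\<^sup>2 * Ey s) + (6 * SS s - 4 * (a s + b s + c s)) * \<sigma> s)) / D s
       + 4 * c s * (h s * \<sigma> s) / D s" for s
  have dg: "(g has_field_derivative g1 s * t' s) (at s)" if s: "s \<in> S" for s
  proof -
    define h1 \<sigma>1 where "h1 = \<kappa> * \<sigma> s - 2 * h s * SS s - 2 * \<sigma> s"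
      and "\<sigma>1 = h s * (2 * (D s)\<^sup>2 * Ey s) + (6 * SS s - 4 * (a s + b s + c s)) * \<sigma> s"
    have "(g has_field_derivative
       (((4 * (- 4 * c s * D s * t' s)) * y s + g s * t' s * (4 * D s)) * (y s - 1) + (g s * t' s - 0) * (4 * D s * y s)
         + ((h1 * t' s * \<sigma> s + \<sigma>1 * t' s * h s) * D s - h s * \<sigma> s * (- 4 * c s * D s * t' s)) / (D s * D s))) (at s)"
      unfolding g_def[abs_def] h1_def \<sigma>1_def
      by (intro DERIV_add DERIV_mult DERIV_cmult DERIV_diff DERIV_const DERIV_divide dy[unfolded g_def] dD dh d\<sigma> D0 s)
    moreover have "((4 * (- 4 * c * D * t)) * y + g * t * (4 * D)) * (y - 1) + (g * t - 0) * (4 * D * y)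
         + ((h1 * t * \<sigma> + \<sigma>1 * t * h) * D - h * \<sigma> * (- 4 * c * D * t)) / (D * D)
      = (- 16 * c * D * y * (y - 1) + 4 * D * (2 * y - 1) * g + (h1 * \<sigma> + h * \<sigma>1) / D + 4 * c * (h * \<sigma>) / D) * t"
      if "D \<noteq> 0" for c D t y g h1 \<sigma> \<sigma>1 h :: complex
    proof -
      have "((h1 * t * \<sigma> + \<sigma>1 * t * h) * D - h * \<sigma> * (- 4 * c * D * t)) = D * ((h1 * \<sigma> + h * \<sigma>1) * t + 4 * c * (h * \<sigma>) * t)"
        by (simp add: algebra_simps)
      moreover have "D * (u * t + 4 * c * w * t) / (D * D) = u / D * t + 4 * c * w / D * t" for u w
        using that by (simp add: add_divide_distrib)
      ultimately have "((h1 * t * \<sigma> + \<sigma>1 * t * h) * D - h * \<sigma> * (- 4 * c * D * t)) / (D * D) = (h1 * \<sigma> + h * \<sigma>1) / D * t + 4 * c * (h * \<sigma>) / D * t"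
        by presburger
      then show ?thesis by (simp add: algebra_simps)
    qed
    ultimately show ?thesis unfolding g1_def h1_def[symmetric] \<sigma>1_def[symmetric] using D0[OF s] by simp
  qed
  \<comment> \<open>This is dt/dx, obtained by solving the assumption on t' for t' / exp s.\<close>
  define P where "P s = - 1 / (4 * D s * exp s * (1 - exp s))" for s
  have xn: "1 - exp s \<noteq> 0" if "s \<in> S" for s using x1[OF that] by simp
  have Pt: "t' s = P s * exp s" if s: "s \<in> S" for s
  proof -
    have "t' s * (4 * D s * (1 - exp s)) = - 1"
      using t'[OF s] unfolding D_def a_def b_def by (simp only: mult_ac)
    moreover have "4 * D s * (1 - exp s) \<noteq> 0" using D0[OF s] xn[OF s] by simp
    ultimately have "t' s = - 1 / (4 * D s * (1 - exp s))" using nonzero_mult_div_cancel_right by metis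
    then show ?thesis by (simp add: P_def)
  qed
  have Px: "4 * D s * P s * exp s * (1 - exp s) = - 1" if s: "s \<in> S" for s
    using D0[OF s] xn[OF s] by (simp add: P_def)
  have dP: "(P has_field_derivative P s * P s * exp s * (4 * c s + 4 * D s * (1 - 2 * exp s))) (at s)" if s: "s \<in> S" for s
  proof -
    define x d where "x = exp s" and "d = D s"
    define Q where "Q = 4 * d * x * (1 - x)"
    have Q: "Q \<noteq> 0" using D0[OF s] xn[OF s] by (simp add: Q_def x_def d_def)
    have "((\<lambda>s. 4 * D s * exp s * (1 - exp s)) has_field_derivative
       ((4 * (- 4 * c s * D s * t' s)) * exp s + exp s * (4 * D s)) * (1 - exp s) + (0 - exp s) * (4 * D s * exp s)) (at s)"
      by (intro DERIV_mult DERIV_cmult DERIV_diff DERIV_const DERIV_exp dD s)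
    moreover have "4 * D s * exp s * (1 - exp s) \<noteq> 0" using Q by (simp add: Q_def x_def d_def)
    ultimately have "((\<lambda>s. (- 1) / (4 * D s * exp s * (1 - exp s))) has_field_derivative
      ((0 * (4 * D s * exp s * (1 - exp s)) - (- 1) * (((4 * (- 4 * c s * D s * t' s)) * exp s + exp s * (4 * D s)) * (1 - exp s) + (0 - exp s) * (4 * D s * exp s)))
        / ((4 * D s * exp s * (1 - exp s)) * (4 * D s * exp s * (1 - exp s))))) (at s)"
      by (intro DERIV_divide DERIV_const)
    then have "(P has_field_derivative ((0 * Q - (- 1) * (((4 * (- 4 * c s * D s * t' s)) * exp s + exp s * (4 * D s)) * (1 - exp s) + (0 - exp s) * (4 * D s * exp s))) / (Q * Q))) (at s)"
      unfolding P_def[abs_def] Q_def x_def d_def .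
    moreover have "(0 * Q - (- 1) * (((4 * (- 4 * c s * D s * t' s)) * exp s + exp s * (4 * D s)) * (1 - exp s) + (0 - exp s) * (4 * D s * exp s))) / (Q * Q)
      = P s * P s * exp s * (4 * c s + 4 * D s * (1 - 2 * exp s))"
    proof -
      have Pq: "P s = - 1 / Q" by (simp add: P_def Q_def x_def d_def)
      have t4: "4 * d * t' s * (1 - x) = - 1"
        using t'[OF s] by (simp add: d_def x_def D_def a_def b_def)
      have "0 * Q - (- 1) * (((4 * (- 4 * c s * D s * t' s)) * exp s + exp s * (4 * D s)) * (1 - exp s) + (0 - exp s) * (4 * D s * exp s))
         = - 4 * c s * x * (4 * d * t' s * (1 - x)) + x * (4 * d * (1 - 2 * x))"
        unfolding x_def[symmetric] d_def[symmetric] by (simp add: algebra_simps)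
      also have "\<dots> = x * (4 * c s + 4 * d * (1 - 2 * x))" unfolding t4 by (simp add: algebra_simps)
      finally show ?thesis unfolding Pq by (simp add: x_def d_def)
    qed
    ultimately show ?thesis by simp
  qed
  define N where "N s = g1 s + g s * (4 * c s + 4 * D s * (1 - 2 * exp s))" for s
  have cd1: "cover_deriv y s = g s * P s" if s: "s \<in> S" for s
    using DERIV_imp_deriv[OF dy[OF s]] Pt[OF s] by (simp add: cover_deriv_def)
  have cd2: "cover_deriv (cover_deriv y) s = (P s)\<^sup>2 * N s" if s: "s \<in> S" for s
  proof -
    have "((\<lambda>s. g s * P s) has_field_derivative g1 s * t' s * P s + P s * P s * exp s * (4 * c s + 4 * D s * (1 - 2 * exp s)) * g s) (at s)"
      by (intro DERIV_mult dg dP s)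
    then have "(cover_deriv y has_field_derivative g1 s * t' s * P s + P s * P s * exp s * (4 * c s + 4 * D s * (1 - 2 * exp s)) * g s) (at s)"
      by (rule has_field_derivative_transform_within_open[OF _ S s]) (simp add: cd1)
    then have "cover_deriv (cover_deriv y) s = (g1 s * t' s * P s + P s * P s * exp s * (4 * c s + 4 * D s * (1 - 2 * exp s)) * g s) / exp s"
      by (simp add: cover_deriv_def[of "cover_deriv y"] DERIV_imp_deriv)
    also have "\<dots> = (P s)\<^sup>2 * N s"
      unfolding Pt[OF s] N_def by (simp add: field_simps power2_eq_square)
    finally show ?thesis .
  qed
  \<comment> \<open>The form without denominators is proved at every point of S, zeros of E
    included; the divided form follows wherever it makes sense.\<close>
  have cleared: "PVI_cleared \<mu> (exp s) (y s) (cover_deriv y s) (cover_deriv (cover_deriv y) s)" if s: "s \<in> S" for s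
  proof -
    define E where "E = y s * (y s - 1) * (y s - exp s)"
    have \<sigma>2: "(\<sigma> s)\<^sup>2 = 4 * (D s) ^ 3 * E"
    proof -
      have "(\<sigma> s)\<^sup>2 = 4 * (SS s - a s) * (SS s - b s) * (SS s - c s)"
        using weierstrass_cubic[OF lt(3)[OF s] q0 ne(1)[OF s] lt(1,2)[OF s] ZW]
        by (simp add: \<sigma>_def SS_def a_def b_def c_def)
      also have "\<dots> = 4 * (D s) ^ 3 * E" unfolding SSy[OF s] cb[OF s] ab E_def by algebra
      finally show ?thesis .
    qed
    have "E * N s = 1/2 * Ey s * (g s)\<^sup>2 + 4 * D s * (1 - 2 * exp s) * E * g s + 4 * D s * exp s * (1 - exp s) * y s * (y s - 1) * g s
      + 8 * (D s)\<^sup>2 * (y s)\<^sup>2 * (y s - 1)\<^sup>2 * (\<kappa> / 2 * (y s - exp s)\<^sup>2 + exp s * (exp s - 1))"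
    proof (rule PVI_algebra_t[OF D0[OF s] E_def Ey_def \<sigma>2 g_def])
      show "N s = - 16 * (b s + D s * exp s) * D s * y s * (y s - 1) + 4 * D s * (2 * y s - 1) * g s
       + ((\<kappa> * \<sigma> s - 2 * h s * (b s + D s * y s) - 2 * \<sigma> s) * \<sigma> s
          + h s * (h s * (2 * (D s)\<^sup>2 * Ey s) + (6 * (b s + D s * y s) - 4 * (b s + D s + b s + (b s + D s * exp s))) * \<sigma> s)) / D s
       + 4 * (b s + D s * exp s) * (h s * \<sigma> s) / D s + g s * (4 * (b s + D s * exp s) + 4 * D s * (1 - 2 * exp s))"
        unfolding N_def g1_def SSy[OF s] cb[OF s] ab ..
    qed
    then have "E * N s = 1/2 * Ey s * (g s)\<^sup>2 + 4 * D s * (1 - 2 * exp s) * E * g s + 4 * D s * exp s * (1 - exp s) * y s * (y s - 1) * g s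
      + 8 * (D s)\<^sup>2 * (y s)\<^sup>2 * (y s - 1)\<^sup>2 * ((2 * \<mu> - 1)\<^sup>2 * (y s - exp s)\<^sup>2 + exp s * (exp s - 1))"
      by (simp add: \<kappa>_def)
    from PVI_cleared_of_t[OF _ x1[OF s] D0[OF s] E_def Ey_def Px[OF s] this]
    show ?thesis unfolding cd1[OF s] cd2[OF s] by simp
  qed
  have "y holomorphic_on S"
    using dy S by (auto simp: holomorphic_on_open)
  moreover have "cover_deriv (cover_deriv y) s = PVI_rhs \<mu> (exp s) (y s) (cover_deriv y s)"
    if "s \<in> S" "y s \<notin> {0, 1, exp s}" for s
    using cleared[OF that(1)] PVI_cleared_iff[of "y s" "exp s"] that(2) by blast
  ultimately have "PVI_solution_on \<mu> S y"
    unfolding PVI_solution_on_def using cleared by blast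
  moreover have "y = (\<lambda>s. (X 1 1 (Z s) (W s) - s2 (q s)) / (s1 (q s) - s2 (q s)))"
    by (simp add: fun_eq_iff y_def SS_def b_def D_def a_def)
  ultimately show ?thesis by simp
qed

section \<open>Picard iteration on double power series\<close>

text \<open>Series in two variables are nested, the outer index being the exponent of Z and the
  inner one that of W; ring operations and powers are then inherited.\<close>

abbreviation cf :: "complex fps fps \<Rightarrow> nat \<Rightarrow> nat \<Rightarrow> complex" where
  "cf f i j \<equiv> fps_nth (fps_nth f i) j"

definition fps2 :: "(nat \<Rightarrow> nat \<Rightarrow> complex) \<Rightarrow> complex fps fps" where
  "fps2 c = Abs_fps (\<lambda>i. Abs_fps (c i))"

lemma cf_fps2 [simp]: "cf (fps2 c) i j = c i j"
  by (simp add: fps2_def)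

lemma cf_mult: "cf (f * g) i j = (\<Sum>k\<le>i. \<Sum>l\<le>j. cf f k l * cf g (i - k) (j - l))"
  by (simp add: fps_mult_nth fps_sum_nth atLeast0AtMost)

definition zero_const :: "complex fps fps \<Rightarrow> bool" where "zero_const f \<longleftrightarrow> cf f 0 0 = 0"

text \<open>Agreement in all total degrees below n: the filtration in which the Picard map gains one
  degree per step.\<close>

definition eq_below :: "nat \<Rightarrow> complex fps fps \<Rightarrow> complex fps fps \<Rightarrow> bool" where
  "eq_below n f g \<longleftrightarrow> (\<forall>i j. i + j < n \<longrightarrow> cf f i j = cf g i j)"

lemma eq_below_refl: "eq_below n f f" by (simp add: eq_below_def)

lemma eq_below_mult: "eq_below n f f' \<Longrightarrow> eq_below n g g' \<Longrightarrow> eq_below n (f * g) (f' * g')"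
  unfolding eq_below_def cf_mult by (intro allI impI sum.cong refl) auto

lemma eq_below_power: "eq_below n f g \<Longrightarrow> eq_below n (f ^ m) (g ^ m)"
  by (induction m) (auto intro: eq_below_mult eq_below_refl)

text \<open>A factor without constant term raises each total degree by at least one, whence the gain
  from n to n + 1.\<close>

lemma eq_below_mult_zero_const:
  assumes G: "zero_const G" and fg: "eq_below n f g"
  shows "eq_below (Suc n) (G * f) (G * g)"
  unfolding eq_below_def cf_mult
proof (intro allI impI sum.cong refl)
  fix i j k l assume ij: "i + j < Suc n" and k: "k \<in> {..i}" and l: "l \<in> {..j}"
  show "cf G k l * cf f (i - k) (j - l) = cf G k l * cf g (i - k) (j - l)"
  proof (cases "k + l = 0")
    case True
    then show ?thesis using G by (simp add: zero_const_def)
  next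
    case False
    then have "(i - k) + (j - l) < n" using ij k l by auto
    then show ?thesis using fg by (simp add: eq_below_def)
  qed
qed

lemma cf_power_eq_0: "zero_const f \<Longrightarrow> i + j < m \<Longrightarrow> cf (f ^ m) i j = 0"
proof (induction m arbitrary: i j)
  case (Suc m)
  have "eq_below (Suc m) (f * f ^ m) (f * 0)"
    by (rule eq_below_mult_zero_const[OF Suc.prems(1)]) (use Suc in \<open>simp add: eq_below_def\<close>)
  then show ?case using Suc.prems(2) by (simp add: eq_below_def)
qed simp

lemma cf_mult_power_eq_0:
  assumes "zero_const G" "zero_const f" "i + j < Suc m"
  shows "cf (G * f ^ m) i j = 0"
proof -
  have "eq_below (Suc m) (G * f ^ m) (G * 0)"
    by (rule eq_below_mult_zero_const[OF assms(1)]) (use assms cf_power_eq_0 in \<open>simp add: eq_below_def\<close>)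
  then show ?thesis using assms(3) by (simp add: eq_below_def)
qed

section \<open>The weighted norm and evaluation\<close>

text \<open>Finiteness is a predicate of its own because \<open>wnorm\<close> takes the default
  value 0 on families that are not summable.\<close>

definition wnorm_finite :: "real \<Rightarrow> complex fps fps \<Rightarrow> bool" where
  "wnorm_finite \<rho> f \<longleftrightarrow> (\<lambda>(i, j). norm (cf f i j) * \<rho> ^ (i + j)) summable_on UNIV"

definition wnorm :: "real \<Rightarrow> complex fps fps \<Rightarrow> real" where
  "wnorm \<rho> f = (\<Sum>\<^sub>\<infinity>(i, j). norm (cf f i j) * \<rho> ^ (i + j))"

definition eval2 :: "complex fps fps \<Rightarrow> complex \<Rightarrow> complex \<Rightarrow> complex" where
  "eval2 f a b = (\<Sum>\<^sub>\<infinity>(i, j). cf f i j * a ^ i * b ^ j)"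

lemma has_sum_cauchy_product2:
  fixes u v :: "nat \<times> nat \<Rightarrow> complex"
  assumes u: "(\<lambda>z. norm (u z)) summable_on UNIV" and v: "(\<lambda>z. norm (v z)) summable_on UNIV"
  shows "((\<lambda>(i, j). \<Sum>k\<le>i. \<Sum>l\<le>j. u (k, l) * v (i - k, j - l)) has_sum (infsum u UNIV * infsum v UNIV)) UNIV"
proof -
  define B where "B = (\<lambda>(i :: nat, j :: nat). {..i} \<times> {..j})"
  define h where "h = (\<lambda>((i, j), (k, l)). u (k, l) * v (i - k, j - l))"
  have "((\<lambda>(x, y). u x * v y) has_sum (infsum u UNIV * infsum v UNIV)) (UNIV \<times> UNIV)"
    by (rule has_sum_times(2)[OF u v])
  also have "?this \<longleftrightarrow> (h has_sum (infsum u UNIV * infsum v UNIV)) (Sigma UNIV B)"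
    by (rule has_sum_reindex_bij_witness[where
          j = "\<lambda>((k, l), (k', l')). ((k + k', l + l'), (k, l))" and i = "\<lambda>((i, j), (k, l)). ((k, l), (i - k, j - l))"])
       (auto simp: B_def h_def)
  finally have "(h has_sum (infsum u UNIV * infsum v UNIV)) (Sigma UNIV B)" .
  then show ?thesis
  proof (rule has_sum_SigmaD)
    fix z :: "nat \<times> nat"
    show "((\<lambda>y. h (z, y)) has_sum (case z of (i, j) \<Rightarrow> \<Sum>k\<le>i. \<Sum>l\<le>j. u (k, l) * v (i - k, j - l))) (B z)"
      by (intro has_sum_finiteI) (auto simp: B_def h_def sum.cartesian_product split: prod.splits)
  qed
qed

lemma wnorm_finite_eval2_summable:
  assumes "wnorm_finite \<rho> f" "norm a \<le> \<rho>" "norm b \<le> \<rho>"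
  shows "(\<lambda>(i, j). norm (cf f i j * a ^ i * b ^ j)) summable_on UNIV"
    and "norm (cf f i j * a ^ i * b ^ j) \<le> norm (cf f i j) * \<rho> ^ (i + j)"
proof -
  have le: "norm (cf f i j * a ^ i * b ^ j) \<le> norm (cf f i j) * \<rho> ^ (i + j)" for i j
  proof -
    have "\<rho> \<ge> 0" using assms(2) norm_ge_zero[of a] by linarith
    then have "norm a ^ i * norm b ^ j \<le> \<rho> ^ i * \<rho> ^ j" using assms by (intro mult_mono power_mono) auto
    then show ?thesis by (simp add: norm_mult norm_power power_add mult.assoc mult_left_mono)
  qed
  then show "norm (cf f i j * a ^ i * b ^ j) \<le> norm (cf f i j) * \<rho> ^ (i + j)" .
  show "(\<lambda>(i, j). norm (cf f i j * a ^ i * b ^ j)) summable_on UNIV"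
    using Infinite_Sum.abs_summable_on_comparison_test'[OF assms(1)[unfolded wnorm_finite_def], of "\<lambda>(i, j). cf f i j * a ^ i * b ^ j"] le
    by (simp add: case_prod_unfold)
qed

lemma eval2_has_sum:
  assumes "wnorm_finite \<rho> f" "norm a \<le> \<rho>" "norm b \<le> \<rho>"
  shows "((\<lambda>(i, j). cf f i j * a ^ i * b ^ j) has_sum eval2 f a b) UNIV"
proof -
  have "(\<lambda>z. norm (case z of (i, j) \<Rightarrow> cf f i j * a ^ i * b ^ j)) summable_on UNIV"
    using wnorm_finite_eval2_summable(1)[OF assms] by (simp add: case_prod_unfold)
  then show ?thesis unfolding eval2_def by (rule has_sum_infsum[OF abs_summable_summable])
qed

lemma eval2_mult:
  assumes f: "wnorm_finite \<rho> f" and g: "wnorm_finite \<rho> g" and a: "norm a \<le> \<rho>" and b: "norm b \<le> \<rho>"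
  shows "eval2 (f * g) a b = eval2 f a b * eval2 g a b"
proof -
  define u where "u = (\<lambda>(i, j). cf f i j * a ^ i * b ^ j)"
  define v where "v = (\<lambda>(i, j). cf g i j * a ^ i * b ^ j)"
  have s: "(\<lambda>z. norm (u z)) summable_on UNIV" "(\<lambda>z. norm (v z)) summable_on UNIV"
    using wnorm_finite_eval2_summable(1)[OF f a b] wnorm_finite_eval2_summable(1)[OF g a b] by (simp_all add: u_def v_def case_prod_unfold)
  have "(\<Sum>k\<le>i. \<Sum>l\<le>j. u (k, l) * v (i - k, j - l)) = cf (f * g) i j * a ^ i * b ^ j" for i j
    unfolding cf_mult sum_distrib_right
  proof (intro sum.cong refl)
    fix k l assume "k \<in> {..i}" "l \<in> {..j}"
    then have "a ^ i = a ^ k * a ^ (i - k)" "b ^ j = b ^ l * b ^ (j - l)" by (simp_all flip: power_add)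
    then show "u (k, l) * v (i - k, j - l) = cf f k l * cf g (i - k) (j - l) * a ^ i * b ^ j"
      by (simp add: u_def v_def mult_ac)
  qed
  then have "((\<lambda>(i, j). cf (f * g) i j * a ^ i * b ^ j) has_sum (infsum u UNIV * infsum v UNIV)) UNIV"
    using has_sum_cauchy_product2[OF s] by simp
  then show ?thesis by (simp add: eval2_def u_def v_def infsumI)
qed

text \<open>Coefficientwise the product is dominated by the Cauchy product of the two families of
  norms, whose sum is the product of the norms.\<close>

lemma wnorm_finite_mult:
  assumes \<rho>: "\<rho> \<ge> 0" and f: "wnorm_finite \<rho> f" and g: "wnorm_finite \<rho> g"
  shows "wnorm_finite \<rho> (f * g)" and "wnorm \<rho> (f * g) \<le> wnorm \<rho> f * wnorm \<rho> g"
proof -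
  define u where "u = (\<lambda>(i, j). norm (cf f i j) * \<rho> ^ (i + j))"
  define v where "v = (\<lambda>(i, j). norm (cf g i j) * \<rho> ^ (i + j))"
  have uv: "u z \<ge> 0" "v z \<ge> 0" for z using \<rho> by (auto simp: u_def v_def split: prod.splits)
  have s: "u summable_on UNIV" "v summable_on UNIV" using f g by (auto simp: wnorm_finite_def u_def v_def)
  \<comment> \<open>The Cauchy product is stated for complex families, so the real ones are embedded
    and the result is taken back.\<close>
  have su: "(\<lambda>z. norm (of_real (u z) :: complex)) summable_on UNIV" "(\<lambda>z. norm (of_real (v z) :: complex)) summable_on UNIV"
    using s uv by simp_all
  have is_uv: "infsum (\<lambda>z. of_real (u z) :: complex) UNIV = of_real (infsum u UNIV)"
     "infsum (\<lambda>z. of_real (v z) :: complex) UNIV = of_real (infsum v UNIV)"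
    using s by (auto intro!: infsumI has_sum_of_real has_sum_infsum)
  define w where "w = (\<lambda>(i, j). \<Sum>k\<le>i. \<Sum>l\<le>j. u (k, l) * v (i - k, j - l))"
  have w: "(w has_sum (infsum u UNIV * infsum v UNIV)) UNIV"
  proof -
    have "((\<lambda>z. of_real (w z) :: complex) has_sum of_real (infsum u UNIV * infsum v UNIV)) UNIV"
      using has_sum_cauchy_product2[OF su] unfolding is_uv by (simp add: w_def case_prod_unfold)
    then show ?thesis by (simp only: has_sum_of_real_iff)
  qed
  have le: "norm (cf (f * g) i j) * \<rho> ^ (i + j) \<le> w (i, j)" for i j
  proof -
    have "norm (cf (f * g) i j) \<le> (\<Sum>k\<le>i. \<Sum>l\<le>j. norm (cf f k l) * norm (cf g (i - k) (j - l)))"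
      unfolding cf_mult by (intro order.trans[OF norm_sum] sum_mono) (simp add: norm_mult)
    then have "norm (cf (f * g) i j) * \<rho> ^ (i + j) \<le> (\<Sum>k\<le>i. \<Sum>l\<le>j. norm (cf f k l) * norm (cf g (i - k) (j - l))) * \<rho> ^ (i + j)"
      using \<rho> by (intro mult_right_mono) auto
    also have "\<dots> = w (i, j)"
      unfolding w_def split sum_distrib_right
    proof (intro sum.cong refl)
      fix k l assume "k \<in> {..i}" "l \<in> {..j}"
      then have "i + j = (k + l) + (i - k + (j - l))" by auto
      then have "\<rho> ^ (i + j) = \<rho> ^ (k + l) * \<rho> ^ (i - k + (j - l))" by (metis power_add)
      then show "norm (cf f k l) * norm (cf g (i - k) (j - l)) * \<rho> ^ (i + j) = u (k, l) * v (i - k, j - l)"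
        by (simp add: u_def v_def mult_ac)
    qed
    finally show ?thesis .
  qed
  show n: "wnorm_finite \<rho> (f * g)"
    unfolding wnorm_finite_def
    by (rule summable_on_comparison_test[OF has_sum_imp_summable[OF w]]) (use le \<rho> in auto)
  have "wnorm \<rho> (f * g) \<le> infsum w UNIV"
    unfolding wnorm_def by (rule infsum_mono[OF n[unfolded wnorm_finite_def] has_sum_imp_summable[OF w]]) (use le in auto)
  also have "\<dots> = wnorm \<rho> f * wnorm \<rho> g"
    using infsumI[OF w] by (simp add: wnorm_def u_def v_def)
  finally show "wnorm \<rho> (f * g) \<le> wnorm \<rho> f * wnorm \<rho> g" .
qed

lemma wnorm_nonneg: "\<rho> \<ge> 0 \<Longrightarrow> wnorm \<rho> f \<ge> 0"
  unfolding wnorm_def by (intro infsum_nonneg) auto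

lemma cf_one: "cf 1 i j = (if i = 0 \<and> j = 0 then 1 else 0)"
  by simp

lemma wnorm_finite_one: "wnorm_finite \<rho> 1" "wnorm \<rho> 1 = 1" and eval2_one: "eval2 1 a b = 1"
proof -
  have "((\<lambda>(i, j). norm (cf 1 i j) * \<rho> ^ (i + j)) has_sum 1) UNIV \<longleftrightarrow> ((\<lambda>(i, j). norm (cf 1 i j) * \<rho> ^ (i + j)) has_sum 1) {(0, 0)}"
    by (rule has_sum_cong_neutral) (auto simp: cf_one split: if_splits)
  moreover have "((\<lambda>(i, j). norm (cf 1 i j) * \<rho> ^ (i + j)) has_sum 1) {(0 :: nat, 0 :: nat)}"
    by (rule has_sum_finiteI) (auto simp: cf_one)
  ultimately have "((\<lambda>(i, j). norm (cf 1 i j) * \<rho> ^ (i + j)) has_sum 1) UNIV" by blast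
  then show "wnorm_finite \<rho> 1" "wnorm \<rho> 1 = 1" unfolding wnorm_finite_def wnorm_def by (auto intro: has_sum_imp_summable infsumI)
  have "((\<lambda>(i, j). cf 1 i j * a ^ i * b ^ j) has_sum 1) UNIV \<longleftrightarrow> ((\<lambda>(i, j). cf 1 i j * a ^ i * b ^ j) has_sum 1) {(0, 0)}"
    by (rule has_sum_cong_neutral) (auto simp: cf_one split: if_splits)
  moreover have "((\<lambda>(i, j). cf 1 i j * a ^ i * b ^ j) has_sum 1) {(0 :: nat, 0 :: nat)}"
    by (rule has_sum_finiteI) (auto simp: cf_one)
  ultimately show "eval2 1 a b = 1" unfolding eval2_def by (intro infsumI) blast
qed

lemma wnorm_finite_power:
  assumes "\<rho> \<ge> 0" "wnorm_finite \<rho> f"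
  shows "wnorm_finite \<rho> (f ^ m)" "wnorm \<rho> (f ^ m) \<le> wnorm \<rho> f ^ m"
proof -
  have "wnorm_finite \<rho> (f ^ m) \<and> wnorm \<rho> (f ^ m) \<le> wnorm \<rho> f ^ m"
  proof (induction m)
    case 0 then show ?case using wnorm_finite_one by simp
  next
    case (Suc m)
    then show ?case
      using wnorm_finite_mult[OF assms(1) assms(2), of "f ^ m"] mult_left_mono[of "wnorm \<rho> (f ^ m)" "wnorm \<rho> f ^ m" "wnorm \<rho> f"] wnorm_nonneg[OF assms(1), of f]
      by auto
  qed
  then show "wnorm_finite \<rho> (f ^ m)" "wnorm \<rho> (f ^ m) \<le> wnorm \<rho> f ^ m" by auto
qed

lemma eval2_power:
  assumes "\<rho> \<ge> 0" "wnorm_finite \<rho> f" "norm a \<le> \<rho>" "norm b \<le> \<rho>"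
  shows "eval2 (f ^ m) a b = eval2 f a b ^ m"
  by (induction m) (simp_all add: eval2_one eval2_mult[OF assms(2) wnorm_finite_power(1)[OF assms(1,2)] assms(3,4)])

section \<open>The source term as a double power series\<close>

text \<open>The coefficients of \<open>X 2 (- 1)\<close> as a series in Z and W: k^2 Z^k / (1 - (Z
  W)^k) contributes k^2 at the exponents (k (n + 1), k n), so k is the difference i - j and must
  divide j; the part in W is the mirror image with opposite sign.\<close>

definition phi :: "nat \<Rightarrow> nat \<Rightarrow> complex" where
  "phi i j = (if j < i \<and> (i - j) dvd j then of_nat (i - j) ^ 2 else if i < j \<and> (j - i) dvd i then - (of_nat (j - i) ^ 2) else 0)"

lemma norm_phi_le: "norm (phi i j) \<le> real (i + j) ^ 2"
proof -
  have le: "real (i - j) ^ 2 \<le> real (i + j) ^ 2" "real (j - i) ^ 2 \<le> real (i + j) ^ 2"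
    by (intro power_mono of_nat_mono; simp)+
  have N: "norm (of_nat n ^ 2 :: complex) = real n ^ 2" for n by (simp only: norm_power norm_of_nat)
  consider "phi i j = of_nat (i - j) ^ 2" | "phi i j = - (of_nat (j - i) ^ 2)" | "phi i j = 0"
    unfolding phi_def by meson
  then show ?thesis
  proof cases
    case 1 then show ?thesis by (simp only: N le)
  next
    case 2 then show ?thesis by (simp only: N norm_minus_cancel le)
  next
    case 3 then show ?thesis by simp
  qed
qed

lemma phi_0_0 [simp]: "phi 0 0 = 0" by (simp add: phi_def)

text \<open>The coefficient of V^m in \<open>X 2 (- 1)\<close> at (Z exp V, W exp (- V)), since this
  substitution multiplies Z^i W^j by exp ((i - j) V).\<close>

definition source_fps :: "nat \<Rightarrow> complex fps fps" where
  "source_fps m = fps2 (\<lambda>i j. phi i j * (of_nat i - of_nat j) ^ m / fact m)"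

lemma zero_const_source_fps: "zero_const (source_fps m)" by (simp add: zero_const_def source_fps_def)

text \<open>Sorted by total degree n there are n + 1 monomials, which costs only one more power of
  n.\<close>

lemma summable_on_degree_power:
  fixes x :: real
  assumes "0 \<le> x" "x < 1"
  shows "(\<lambda>(i :: nat, j :: nat). real (i + j) ^ m * x ^ (i + j)) summable_on UNIV"
proof -
  have "(\<lambda>(n, i). real n ^ m * x ^ n) summable_on (SIGMA n:UNIV. {..n :: nat})"
  proof (rule summable_on_SigmaI)
    show "((\<lambda>i. case (n, i) of (n, i) \<Rightarrow> real n ^ m * x ^ n) has_sum (real n + 1) * (real n ^ m * x ^ n)) {..n}" for n :: nat
      by (intro has_sum_finiteI) auto
    show "(\<lambda>n. (real n + 1) * (real n ^ m * x ^ n)) summable_on UNIV"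
      using summable_on_add[OF summable_on_power_mult_geometric[OF assms, of "Suc m" UNIV] summable_on_power_mult_geometric[OF assms, of m UNIV]]
      by (simp add: algebra_simps)
  qed (use assms in auto)
  also have "?this \<longleftrightarrow> ?thesis"
    by (rule summable_on_reindex_bij_witness[of _ "\<lambda>(i, j). (i + j, i)" "\<lambda>(n, i). (i, n - i)"]) auto
  finally show ?thesis .
qed

lemma phi_summable:
  assumes "0 \<le> x" "x < 1"
  shows "(\<lambda>(i, j). norm (phi i j) * x ^ (i + j)) summable_on UNIV"
proof (rule summable_on_comparison_test[OF summable_on_degree_power[OF assms, of 2]])
  fix z :: "nat \<times> nat"
  obtain i j where z: "z = (i, j)" by (cases z)
  show "(case z of (i, j) \<Rightarrow> norm (phi i j) * x ^ (i + j)) \<le> (case z of (i, j) \<Rightarrow> real (i + j) ^ 2 * x ^ (i + j))"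
    unfolding z split by (intro mult_right_mono norm_phi_le zero_le_power assms)
  show "0 \<le> (case z of (i, j) \<Rightarrow> norm (phi i j) * x ^ (i + j))"
    unfolding z split by (intro mult_nonneg_nonneg norm_ge_zero zero_le_power assms)
qed

text \<open>Geometric expansion of 1 / (1 - (Z W)^k). The pairs (k, n) parametrise the support of
  \<open>phi\<close> bijectively on each side of the diagonal.\<close>

lemma X2_eq_phi:
  assumes Z: "norm Z < 1" and W: "norm W < 1"
  shows "((\<lambda>(i, j). phi i j * Z ^ i * W ^ j) has_sum X 2 (- 1) Z W) UNIV"
proof -
  define p where "p = Z * W"
  define x where "x = max (norm Z) (norm W)"
  have x: "0 \<le> x" "x < 1" "norm Z \<le> x" "norm W \<le> x" using Z W by (auto simp: x_def le_max_iff_disj)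
  define f where "f = (\<lambda>(i, j). phi i j * Z ^ i * W ^ j)"
  have s: "f summable_on UNIV"
  proof -
    have le: "norm (f z) \<le> (case z of (i, j) \<Rightarrow> norm (phi i j) * x ^ (i + j))" for z
    proof -
      obtain i j where z: "z = (i, j)" by (cases z)
      have "norm Z ^ i * norm W ^ j \<le> x ^ i * x ^ j" using x by (intro mult_mono power_mono) auto
      then show ?thesis by (simp add: f_def z norm_mult norm_power power_add mult.assoc mult_left_mono)
    qed
    show ?thesis
      by (rule abs_summable_summable[OF Infinite_Sum.abs_summable_on_comparison_test'[OF phi_summable[OF x(1,2)] le]])
  qed
  define Pz Pw where "Pz = (\<lambda>(k :: nat, n :: nat). (k * (n + 1), k * n)) ` ({1..} \<times> UNIV)"
    and "Pw = (\<lambda>(k :: nat, n :: nat). (k * n, k * (n + 1))) ` ({1..} \<times> UNIV)"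
  have injz: "inj_on (\<lambda>(k :: nat, n :: nat). (k * (n + 1), k * n)) ({1..} \<times> UNIV)"
    and injw: "inj_on (\<lambda>(k :: nat, n :: nat). (k * n, k * (n + 1))) ({1..} \<times> UNIV)"
    by (auto simp: inj_on_def)
  have supp: "f (i, j) = 0" if "(i, j) \<notin> Pz \<union> Pw" for i j
  proof -
    have n1: "\<not> (j < i \<and> (i - j) dvd j)"
    proof
      assume h: "j < i \<and> (i - j) dvd j"
      then obtain n where n: "j = (i - j) * n" by (auto elim: dvdE)
      have "i = (i - j) * (n + 1)" using n h by (simp add: distrib_left)
      then have "(i, j) = (\<lambda>(k, n). (k * (n + 1), k * n)) (i - j, n)" "(i - j, n) \<in> {1..} \<times> UNIV" using n h by auto
      then show False using that unfolding Pz_def by blast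
    qed
    have n2: "\<not> (i < j \<and> (j - i) dvd i)"
    proof
      assume h: "i < j \<and> (j - i) dvd i"
      then obtain n where n: "i = (j - i) * n" by (auto elim: dvdE)
      have "j = (j - i) * (n + 1)" using n h by (simp add: distrib_left)
      then have "(i, j) = (\<lambda>(k, n). (k * n, k * (n + 1))) (j - i, n)" "(j - i, n) \<in> {1..} \<times> UNIV" using n h by auto
      then show False using that unfolding Pw_def by blast
    qed
    have "phi i j = 0" unfolding phi_def if_not_P[OF n1] if_not_P[OF n2] ..
    then show ?thesis by (simp add: f_def)
  qed
  have "(f has_sum infsum f UNIV) UNIV" by (rule has_sum_infsum[OF s])
  also have "?this \<longleftrightarrow> (f has_sum infsum f UNIV) (Pz \<union> Pw)"
    by (rule has_sum_cong_neutral) (use supp in auto)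
  finally have "infsum f UNIV = infsum f (Pz \<union> Pw)" by (rule infsumI[symmetric])
  also have "\<dots> = infsum f Pz + infsum f Pw"
  proof (rule infsum_Un_disjoint)
    show "Pz \<inter> Pw = {}"
    proof (rule equals0I)
      fix y assume "y \<in> Pz \<inter> Pw"
      then obtain k n k' n' where "y = (k * (n + 1), k * n)" "k \<ge> 1" "y = (k' * n', k' * (n' + 1))" "k' \<ge> 1"
        by (auto simp: Pz_def Pw_def)
      then have "snd y < fst y" "fst y < snd y" by simp_all
      then show False by simp
    qed
  qed (auto intro: summable_on_subset[OF s])
  finally have tot: "infsum f UNIV = infsum f Pz + infsum f Pw" .
  have geo: "((\<lambda>n. (p ^ k) ^ n) has_sum (1 / (1 - p ^ k))) UNIV" if k: "k \<ge> 1" for k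
  proof (rule norm_summable_imp_has_sum)
    have "norm p \<le> x" unfolding p_def by (rule norm_mult_le_bound) (use x in auto)
    then have l: "norm (p ^ k) < 1" using norm_one_minus_power_ge(2)[of p x k] x k by auto
    show "summable (\<lambda>n. norm ((p ^ k) ^ n))" using l by (simp add: norm_power summable_geometric)
    show "(\<lambda>n. (p ^ k) ^ n) sums (1 / (1 - p ^ k))" using geometric_sums[OF l] by simp
  qed
  have part: "((\<lambda>k. c k / (1 - p ^ k)) has_sum infsum f (g ` ({1..} \<times> UNIV))) {1..}"
    if inj: "inj_on g ({1..} \<times> UNIV)" and fg: "\<And>k n. k \<ge> 1 \<Longrightarrow> f (g (k, n)) = c k * (p ^ k) ^ n" for g :: "nat \<times> nat \<Rightarrow> nat \<times> nat" and c
  proof -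
    have "(f \<circ> g) summable_on ({1..} \<times> UNIV)"
      using summable_on_subset[OF s, of "g ` ({1..} \<times> UNIV)"] inj by (subst summable_on_reindex[symmetric]) auto
    then have "((f \<circ> g) has_sum infsum f (g ` ({1..} \<times> UNIV))) ({1..} \<times> UNIV)"
      using has_sum_infsum[of "f \<circ> g"] infsum_reindex[OF inj, of f] by simp
    then show ?thesis
    proof (rule has_sum_SigmaD)
      fix k :: nat assume k: "k \<in> {1..}"
      have "((\<lambda>n. c k * (p ^ k) ^ n) has_sum (c k * (1 / (1 - p ^ k)))) UNIV"
        using k by (intro has_sum_cmult_right geo) auto
      then show "((\<lambda>y. (f \<circ> g) (k, y)) has_sum c k / (1 - p ^ k)) UNIV" using fg k by (simp add: o_def)
    qed
  qed
  have z: "((\<lambda>k. of_nat k ^ 2 * Z ^ k / (1 - p ^ k)) has_sum infsum f Pz) {1..}"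
    unfolding Pz_def
  proof (rule part[OF injz])
    fix k n :: nat assume k: "k \<ge> 1"
    have "k * (n + 1) - k * n = k" "k * n < k * (n + 1)" using k by (auto simp: algebra_simps)
    then have "phi (k * (n + 1)) (k * n) = of_nat k ^ 2" by (simp add: phi_def del: mult_Suc_right add_Suc_right)
    then show "f ((\<lambda>(k, n). (k * (n + 1), k * n)) (k, n)) = of_nat k ^ 2 * Z ^ k * (p ^ k) ^ n"
      by (simp add: f_def p_def power_add power_mult power_mult_distrib mult_ac)
  qed
  have w: "((\<lambda>k. - (of_nat k ^ 2) * W ^ k / (1 - p ^ k)) has_sum infsum f Pw) {1..}"
    unfolding Pw_def
  proof (rule part[OF injw])
    fix k n :: nat assume k: "k \<ge> 1"
    have "k * (n + 1) - k * n = k" "k * n < k * (n + 1)" "\<not> k * (n + 1) < k * n" using k by (auto simp: algebra_simps)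
    then have "phi (k * n) (k * (n + 1)) = - (of_nat k ^ 2)" by (simp add: phi_def del: mult_Suc_right add_Suc_right)
    then show "f ((\<lambda>(k, n). (k * n, k * (n + 1))) (k, n)) = - (of_nat k ^ 2) * W ^ k * (p ^ k) ^ n"
      by (simp add: f_def p_def power_add power_mult power_mult_distrib mult_ac)
  qed
  have "((\<lambda>k. of_nat k ^ 2 * Z ^ k / (1 - p ^ k) + - (of_nat k ^ 2) * W ^ k / (1 - p ^ k)) has_sum infsum f UNIV) {1..}"
    unfolding tot by (rule has_sum_add[OF z w])
  also have "(\<lambda>k. of_nat k ^ 2 * Z ^ k / (1 - p ^ k) + - (of_nat k ^ 2) * W ^ k / (1 - p ^ k)) = (\<lambda>k. Xt 2 (- 1) Z W k)"
    by (simp add: fun_eq_iff Xt_def p_def diff_divide_distrib[symmetric] right_diff_distrib)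
  finally have "X 2 (- 1) Z W = infsum f UNIV" unfolding X_def by (rule infsumI)
  then show ?thesis using has_sum_infsum[OF s] by (simp add: f_def)
qed

text \<open>Along \<open>Z \<propto> exp (\<nu> * t)\<close>, \<open>W \<propto> exp ((2 - \<nu>) * t)\<close> the monomial \<open>Z ^ i * W ^ j\<close> is an eigenfunction of
  \<open>d\<^sup>2/dt\<^sup>2\<close> with eigenvalue \<open>(rate \<nu> i j)\<^sup>2\<close>, so \<open>picard_op\<close> inverts \<open>d\<^sup>2/dt\<^sup>2\<close> on the power series of
  \<open>\<kappa> * X 2 (-1) (Z * exp V) (W * exp (- V))\<close>.\<close>

definition rate :: "complex \<Rightarrow> nat \<Rightarrow> nat \<Rightarrow> complex" where
  "rate \<nu> i j = of_nat i * \<nu> + of_nat j * (2 - \<nu>)"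

text \<open>The sum is cut at the degree so that it is finite; for f without constant term the
  larger m contribute nothing to this coefficient.\<close>

definition source_coeff :: "complex \<Rightarrow> complex fps fps \<Rightarrow> nat \<Rightarrow> nat \<Rightarrow> complex" where
  "source_coeff \<kappa> f i j = \<kappa> * (\<Sum>m\<le>i + j. cf (source_fps m * f ^ m) i j)"

definition picard_op :: "complex \<Rightarrow> complex \<Rightarrow> complex fps fps \<Rightarrow> complex fps fps" where
  "picard_op \<kappa> \<nu> f = fps2 (\<lambda>i j. if i + j = 0 then 0 else source_coeff \<kappa> f i j / (rate \<nu> i j)\<^sup>2)"

definition picard_iter :: "complex \<Rightarrow> complex \<Rightarrow> nat \<Rightarrow> complex fps fps" where
  "picard_iter \<kappa> \<nu> n = (picard_op \<kappa> \<nu> ^^ n) 0"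

text \<open>The iterates stabilise degree by degree.\<close>

definition picard_sol :: "complex \<Rightarrow> complex \<Rightarrow> complex fps fps" where
  "picard_sol \<kappa> \<nu> = fps2 (\<lambda>i j. cf (picard_iter \<kappa> \<nu> (Suc (i + j))) i j)"

section \<open>Stabilisation of the Picard iterates\<close>

lemma picard_iter_Suc: "picard_iter \<kappa> \<nu> (Suc n) = picard_op \<kappa> \<nu> (picard_iter \<kappa> \<nu> n)" by (simp add: picard_iter_def)

lemma cf_picard_op: "i + j > 0 \<Longrightarrow> cf (picard_op \<kappa> \<nu> f) i j = source_coeff \<kappa> f i j / (rate \<nu> i j)\<^sup>2"
  by (auto simp: picard_op_def)

lemma zero_const_picard_op: "zero_const (picard_op \<kappa> \<nu> f)" by (simp add: zero_const_def picard_op_def)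

lemma zero_const_picard_iter: "zero_const (picard_iter \<kappa> \<nu> n)"
  by (cases n) (simp_all add: picard_iter_Suc zero_const_picard_op, simp add: picard_iter_def zero_const_def)

lemma zero_const_picard_sol: "zero_const (picard_sol \<kappa> \<nu>)"
  using zero_const_picard_iter[of \<kappa> \<nu> "Suc 0"] by (simp add: zero_const_def picard_sol_def)

text \<open>The source has no constant term, so agreement of f and g below n determines one degree
  more; this makes the iteration converge coefficientwise.\<close>

lemma source_coeff_cong:
  assumes "eq_below n f g" "i + j < Suc n"
  shows "source_coeff \<kappa> f i j = source_coeff \<kappa> g i j"
proof -
  have "cf (source_fps m * f ^ m) i j = cf (source_fps m * g ^ m) i j" for m
    using eq_below_mult_zero_const[OF zero_const_source_fps eq_below_power[OF assms(1), of m], of m] assms(2) by (simp add: eq_below_def)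
  then show ?thesis by (simp add: source_coeff_def)
qed

lemma eq_below_picard_op: "eq_below n f g \<Longrightarrow> eq_below (Suc n) (picard_op \<kappa> \<nu> f) (picard_op \<kappa> \<nu> g)"
  by (subst eq_below_def) (auto simp: picard_op_def source_coeff_cong)

lemma eq_below_picard_iter: "eq_below n (picard_iter \<kappa> \<nu> n) (picard_iter \<kappa> \<nu> (n + k))"
proof (induction n)
  case (Suc n)
  then show ?case using eq_below_picard_op[OF Suc] by (simp add: picard_iter_Suc)
qed (simp add: eq_below_def)

lemma eq_below_picard_sol: "eq_below n (picard_sol \<kappa> \<nu>) (picard_iter \<kappa> \<nu> n)"
proof -
  have "cf (picard_sol \<kappa> \<nu>) i j = cf (picard_iter \<kappa> \<nu> n) i j" if "i + j < n" for i j
  proof -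
    have "n = Suc (i + j) + (n - Suc (i + j))" using that by simp
    then have "eq_below (Suc (i + j)) (picard_iter \<kappa> \<nu> (Suc (i + j))) (picard_iter \<kappa> \<nu> n)" by (metis eq_below_picard_iter)
    then show ?thesis by (simp add: eq_below_def picard_sol_def)
  qed
  then show ?thesis by (simp add: eq_below_def)
qed

lemma picard_sol_fixed_point: "i + j > 0 \<Longrightarrow> cf (picard_sol \<kappa> \<nu>) i j = source_coeff \<kappa> (picard_sol \<kappa> \<nu>) i j / (rate \<nu> i j)\<^sup>2"
proof -
  assume ij: "i + j > 0"
  have "cf (picard_sol \<kappa> \<nu>) i j = cf (picard_iter \<kappa> \<nu> (Suc (i + j))) i j"
    using eq_below_picard_sol[of "Suc (i + j)"] by (simp add: eq_below_def)
  also have "\<dots> = source_coeff \<kappa> (picard_iter \<kappa> \<nu> (i + j)) i j / (rate \<nu> i j)\<^sup>2" unfolding picard_iter_Suc by (rule cf_picard_op[OF ij])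
  also have "source_coeff \<kappa> (picard_iter \<kappa> \<nu> (i + j)) i j = source_coeff \<kappa> (picard_sol \<kappa> \<nu>) i j"
    by (rule source_coeff_cong[OF eq_below_picard_sol, symmetric]) simp
  finally show ?thesis .
qed

lemma source_coeff_0_0: "source_coeff \<kappa> f 0 0 = 0"
  by (simp add: source_coeff_def cf_mult source_fps_def)

section \<open>Estimates for the Picard map\<close>

definition phi_majorant :: "real \<Rightarrow> real" where
  "phi_majorant x = (\<Sum>\<^sub>\<infinity>(i, j). norm (phi i j) * x ^ (i + j))"

text \<open>\<open>phi\<close> vanishes at (0, 0), so one factor x can be taken out of each monomial
  while the others are bounded by powers of 1/2.\<close>

lemma phi_majorant_le:
  assumes "0 \<le> x" "x \<le> 1/2"
  shows "phi_majorant x \<le> 2 * x * phi_majorant (1/2)"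
proof -
  have "phi_majorant x \<le> (\<Sum>\<^sub>\<infinity>z. 2 * x * (case z of (i, j) \<Rightarrow> norm (phi i j) * (1/2) ^ (i + j)))"
    unfolding phi_majorant_def
  proof (rule infsum_mono)
    show "(\<lambda>(i, j). norm (phi i j) * x ^ (i + j)) summable_on UNIV" by (rule phi_summable) (use assms in auto)
    show "(\<lambda>z. 2 * x * (case z of (i, j) \<Rightarrow> norm (phi i j) * (1/2) ^ (i + j))) summable_on UNIV"
      by (intro summable_on_cmult_right phi_summable) auto
    fix z :: "nat \<times> nat"
    obtain i j where z: "z = (i, j)" by (cases z)
    show "(case z of (i, j) \<Rightarrow> norm (phi i j) * x ^ (i + j)) \<le> 2 * x * (case z of (i, j) \<Rightarrow> norm (phi i j) * (1/2) ^ (i + j))"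
    proof (cases "i + j")
      case 0 then show ?thesis by (simp add: z)
    next
      case (Suc n)
      have "x ^ n \<le> (1/2) ^ n" using assms by (intro power_mono) auto
      then have "x * x ^ n \<le> x * (2 * (1/2) * (1/2) ^ n)" using assms by (intro mult_left_mono) auto
      then have "x ^ (i + j) \<le> 2 * x * (1/2) ^ (i + j)" by (simp add: Suc)
      then have "norm (phi i j) * x ^ (i + j) \<le> norm (phi i j) * (2 * x * (1/2) ^ (i + j))" by (intro mult_left_mono) auto
      then show ?thesis by (simp add: z mult_ac)
    qed
  qed
  also have "\<dots> = 2 * x * phi_majorant (1/2)" unfolding phi_majorant_def by (rule infsum_cmult_right')
  finally show ?thesis .
qed

lemma phi_majorant_nonneg: "x \<ge> 0 \<Longrightarrow> phi_majorant x \<ge> 0"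
  unfolding phi_majorant_def by (intro infsum_nonneg) auto

lemma norm_cf_source_fps: "norm (cf (source_fps m) i j) = norm (phi i j) * \<bar>real i - real j\<bar> ^ m / fact m"
proof -
  have "norm (of_nat i - of_nat j :: complex) = \<bar>real i - real j\<bar>"
    by (metis norm_of_real of_real_diff of_real_of_nat_eq)
  then show ?thesis by (simp add: source_fps_def norm_mult norm_divide norm_power)
qed

context
  fixes \<rho> :: real
  assumes \<rho>: "0 \<le> \<rho>" "\<rho> * exp 1 < 1"
begin

text \<open>Summing |i - j|^m / m! over m gives exp |i - j| <= exp (i + j). Passing from \<rho> to
  \<rho> e thus pays for every V of norm at most 1, which is where \<rho> e < 1 comes from.\<close>

lemma source_fps_double_summable:
  shows "(\<lambda>(m, (i, j)). norm (cf (source_fps m) i j) * \<rho> ^ (i + j)) summable_on UNIV"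
    and "(\<Sum>\<^sub>\<infinity>(m, (i, j)). norm (cf (source_fps m) i j) * \<rho> ^ (i + j)) \<le> phi_majorant (\<rho> * exp 1)"
proof -
  define K where "K = (\<lambda>((i, j), m). norm (cf (source_fps m) i j) * \<rho> ^ (i + j))"
  define g where "g = (\<lambda>(i, j). norm (phi i j) * \<rho> ^ (i + j) * exp \<bar>real i - real j\<bar>)"
  have row: "((\<lambda>m. K (z, m)) has_sum g z) UNIV" for z
  proof -
    obtain i j where z: "z = (i, j)" by (cases z)
    define d where "d = \<bar>real i - real j\<bar>"
    have "((\<lambda>m. d ^ m / fact m) has_sum exp d) UNIV"
    proof (rule norm_summable_imp_has_sum)
      show "(\<lambda>m. d ^ m / fact m) sums exp d" using exp_converges[of d] by (simp add: divide_inverse mult.commute)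
      then have "summable (\<lambda>m. d ^ m / fact m)" by (rule sums_summable)
      then show "summable (\<lambda>m. norm (d ^ m / fact m))" by (simp add: d_def)
    qed
    then have "((\<lambda>m. norm (phi i j) * \<rho> ^ (i + j) * (d ^ m / fact m)) has_sum (norm (phi i j) * \<rho> ^ (i + j) * exp d)) UNIV"
      by (rule has_sum_cmult_right)
    then show ?thesis by (simp add: K_def g_def z norm_cf_source_fps d_def mult_ac)
  qed
  have gle: "g z \<le> (case z of (i, j) \<Rightarrow> norm (phi i j) * (\<rho> * exp 1) ^ (i + j))" and g0: "g z \<ge> 0" for z
  proof -
    obtain i j where z: "z = (i, j)" by (cases z)
    have "exp \<bar>real i - real j\<bar> \<le> exp (real (i + j) * 1)" by simp
    also have "\<dots> = exp 1 ^ (i + j)" by (rule exp_of_nat_mult)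
    finally have "exp \<bar>real i - real j\<bar> \<le> exp 1 ^ (i + j)" .
    then have "norm (phi i j) * \<rho> ^ (i + j) * exp \<bar>real i - real j\<bar> \<le> norm (phi i j) * \<rho> ^ (i + j) * exp 1 ^ (i + j)"
      using \<rho> by (intro mult_left_mono) auto
    then show "g z \<le> (case z of (i, j) \<Rightarrow> norm (phi i j) * (\<rho> * exp 1) ^ (i + j))"
      by (simp add: g_def z power_mult_distrib mult.assoc)
    show "g z \<ge> 0" using \<rho> by (simp add: g_def z)
  qed
  have ps: "(\<lambda>(i, j). norm (phi i j) * (\<rho> * exp 1) ^ (i + j)) summable_on UNIV"
    by (rule phi_summable) (use \<rho> in auto)
  have gs: "g summable_on UNIV" by (rule summable_on_comparison_test[OF ps]) (use gle g0 in auto)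
  have Ks: "K summable_on (UNIV \<times> UNIV)"
    by (rule summable_on_SigmaI[OF row gs]) (use \<rho> in \<open>auto simp: K_def\<close>)
  have Kg: "infsum K (UNIV \<times> UNIV) = infsum g UNIV"
    using has_sum_SigmaD[OF has_sum_infsum[OF Ks] row] by (simp add: infsumI)
  have sw: "((\<lambda>(m, (i, j)). norm (cf (source_fps m) i j) * \<rho> ^ (i + j)) has_sum infsum K (UNIV \<times> UNIV)) (UNIV \<times> UNIV)"
    using has_sum_infsum[OF Ks] by (subst (asm) has_sum_swap) (simp add: K_def case_prod_unfold)
  then show "(\<lambda>(m, (i, j)). norm (cf (source_fps m) i j) * \<rho> ^ (i + j)) summable_on UNIV"
    by (auto intro: has_sum_imp_summable)
  have "(\<Sum>\<^sub>\<infinity>(m, (i, j)). norm (cf (source_fps m) i j) * \<rho> ^ (i + j)) = infsum g UNIV"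
    using infsumI[OF sw] Kg by simp
  also have "\<dots> \<le> phi_majorant (\<rho> * exp 1)" unfolding phi_majorant_def by (rule infsum_mono[OF gs ps]) (rule gle)
  finally show "(\<Sum>\<^sub>\<infinity>(m, (i, j)). norm (cf (source_fps m) i j) * \<rho> ^ (i + j)) \<le> phi_majorant (\<rho> * exp 1)" .
qed

lemma source_fps_norms:
  shows "wnorm_finite \<rho> (source_fps m)" and "(\<lambda>m. wnorm \<rho> (source_fps m)) summable_on UNIV" and "(\<Sum>\<^sub>\<infinity>m. wnorm \<rho> (source_fps m)) \<le> phi_majorant (\<rho> * exp 1)"
proof -
  define K where "K = (\<lambda>(m, (i, j)). norm (cf (source_fps m) i j) * \<rho> ^ (i + j))"
  have Ks: "K summable_on Sigma UNIV (\<lambda>_. UNIV)" using source_fps_double_summable(1) by (simp add: K_def)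
  have row: "(\<lambda>z. K (m, z)) summable_on UNIV" for m
    using summable_on_SigmaD1[of "\<lambda>m z. K (m, z)" UNIV "\<lambda>_. UNIV" m] Ks by simp
  then show n: "wnorm_finite \<rho> (source_fps m)" for m by (simp add: wnorm_finite_def K_def)
  have "((\<lambda>m. wnorm \<rho> (source_fps m)) has_sum infsum K (Sigma UNIV (\<lambda>_. UNIV))) UNIV"
    by (rule has_sum_SigmaD[OF has_sum_infsum[OF Ks]]) (use has_sum_infsum[OF row] in \<open>simp add: wnorm_def K_def\<close>)
  then show "(\<lambda>m. wnorm \<rho> (source_fps m)) summable_on UNIV" "(\<Sum>\<^sub>\<infinity>m. wnorm \<rho> (source_fps m)) \<le> phi_majorant (\<rho> * exp 1)"
    using source_fps_double_summable(2) by (auto intro: has_sum_imp_summable simp: infsumI K_def)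
qed

lemma source_fps_mult_power_norms:
  assumes f: "wnorm_finite \<rho> f" "wnorm \<rho> f \<le> 1"
  shows "wnorm_finite \<rho> (source_fps m * f ^ m)" "wnorm \<rho> (source_fps m * f ^ m) \<le> wnorm \<rho> (source_fps m)"
proof -
  note fm = wnorm_finite_power[OF \<rho>(1) f(1), of m]
  show "wnorm_finite \<rho> (source_fps m * f ^ m)" by (rule wnorm_finite_mult[OF \<rho>(1) source_fps_norms(1) fm(1)])
  have "wnorm \<rho> (f ^ m) \<le> 1" using fm(2) power_le_one[OF wnorm_nonneg[OF \<rho>(1)] f(2), of m] by linarith
  then have "wnorm \<rho> (source_fps m) * wnorm \<rho> (f ^ m) \<le> wnorm \<rho> (source_fps m) * 1"
    by (intro mult_left_mono wnorm_nonneg \<rho>)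
  then show "wnorm \<rho> (source_fps m * f ^ m) \<le> wnorm \<rho> (source_fps m)"
    using wnorm_finite_mult(2)[OF \<rho>(1) source_fps_norms(1)[of m] fm(1)] by linarith
qed

text \<open>Finite sums are estimated so that summability becomes a conclusion. On a finite set of
  monomials one M replaces the cut that depends on the degree.\<close>

lemma source_coeff_finite_sum_le:
  assumes f: "wnorm_finite \<rho> f" "wnorm \<rho> f \<le> 1" and T: "finite T"
  shows "(\<Sum>(i, j)\<in>T. norm (source_coeff \<kappa> f i j) * \<rho> ^ (i + j)) \<le> norm \<kappa> * phi_majorant (\<rho> * exp 1)"
proof -
  define M where "M = Max (insert 0 ((\<lambda>(i, j). i + j) ` T))"
  have M: "i + j \<le> M" if "(i, j) \<in> T" for i j
    unfolding M_def using T that by (intro Max_ge) (auto intro!: image_eqI[of _ _ "(i, j)"])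
  have "(\<Sum>(i, j)\<in>T. norm (source_coeff \<kappa> f i j) * \<rho> ^ (i + j)) \<le> (\<Sum>(i, j)\<in>T. \<Sum>m\<le>M. norm \<kappa> * (norm (cf (source_fps m * f ^ m) i j) * \<rho> ^ (i + j)))"
  proof (rule sum_mono)
    fix z assume z: "z \<in> T"
    obtain i j where ij: "z = (i, j)" by (cases z)
    have "norm (source_coeff \<kappa> f i j) \<le> norm \<kappa> * (\<Sum>m\<le>i + j. norm (cf (source_fps m * f ^ m) i j))"
      unfolding source_coeff_def norm_mult by (intro mult_left_mono norm_sum) auto
    also have "\<dots> \<le> norm \<kappa> * (\<Sum>m\<le>M. norm (cf (source_fps m * f ^ m) i j))"
      using M z ij by (intro mult_left_mono sum_mono2) auto
    finally have "norm (source_coeff \<kappa> f i j) * \<rho> ^ (i + j) \<le> norm \<kappa> * (\<Sum>m\<le>M. norm (cf (source_fps m * f ^ m) i j)) * \<rho> ^ (i + j)"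
      using \<rho> by (intro mult_right_mono) auto
    then show "(case z of (i, j) \<Rightarrow> norm (source_coeff \<kappa> f i j) * \<rho> ^ (i + j)) \<le> (case z of (i, j) \<Rightarrow> \<Sum>m\<le>M. norm \<kappa> * (norm (cf (source_fps m * f ^ m) i j) * \<rho> ^ (i + j)))"
      by (simp add: ij sum_distrib_left sum_distrib_right mult.assoc)
  qed
  also have "\<dots> = (\<Sum>m\<le>M. norm \<kappa> * (\<Sum>(i, j)\<in>T. norm (cf (source_fps m * f ^ m) i j) * \<rho> ^ (i + j)))"
    unfolding case_prod_unfold by (subst sum.swap) (simp add: sum_distrib_left)
  also have "\<dots> \<le> (\<Sum>m\<le>M. norm \<kappa> * wnorm \<rho> (source_fps m))"
  proof (intro sum_mono mult_left_mono)
    fix m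
    have "(\<Sum>(i, j)\<in>T. norm (cf (source_fps m * f ^ m) i j) * \<rho> ^ (i + j)) \<le> wnorm \<rho> (source_fps m * f ^ m)"
      unfolding wnorm_def
      by (rule finite_sum_le_infsum[OF source_fps_mult_power_norms(1)[OF f, unfolded wnorm_finite_def] T]) (use \<rho> in auto)
    then show "(\<Sum>(i, j)\<in>T. norm (cf (source_fps m * f ^ m) i j) * \<rho> ^ (i + j)) \<le> wnorm \<rho> (source_fps m)"
      using source_fps_mult_power_norms(2)[OF f, of m] by linarith
  qed auto
  also have "\<dots> = norm \<kappa> * (\<Sum>m\<le>M. wnorm \<rho> (source_fps m))" by (simp add: sum_distrib_left)
  also have "\<dots> \<le> norm \<kappa> * phi_majorant (\<rho> * exp 1)"
  proof (intro mult_left_mono)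
    have "(\<Sum>m\<le>M. wnorm \<rho> (source_fps m)) \<le> (\<Sum>\<^sub>\<infinity>m. wnorm \<rho> (source_fps m))"
      by (rule finite_sum_le_infsum[OF source_fps_norms(2)]) (auto intro: wnorm_nonneg \<rho>)
    then show "(\<Sum>m\<le>M. wnorm \<rho> (source_fps m)) \<le> phi_majorant (\<rho> * exp 1)" using source_fps_norms(3) by linarith
  qed auto
  finally show ?thesis .
qed

lemma nonneg_finite_sums_bound:
  fixes g :: "nat \<times> nat \<Rightarrow> real"
  assumes "\<And>z. g z \<ge> 0" "\<And>T. finite T \<Longrightarrow> sum g T \<le> C"
  shows "g summable_on UNIV" "infsum g UNIV \<le> C"
proof -
  show s: "g summable_on UNIV"
    by (rule nonneg_bdd_above_summable_on) (use assms in \<open>auto intro!: bdd_aboveI2\<close>)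
  show "infsum g UNIV \<le> C" by (rule infsum_le_finite_sums[OF s]) (use assms in auto)
qed

lemma source_coeff_summable:
  assumes f: "wnorm_finite \<rho> f" "wnorm \<rho> f \<le> 1"
  shows "(\<lambda>(i, j). norm (source_coeff \<kappa> f i j) * \<rho> ^ (i + j)) summable_on UNIV"
  by (rule nonneg_finite_sums_bound(1)[OF _ source_coeff_finite_sum_le[OF f]]) (use \<rho> in auto)

context
  fixes c :: real and \<kappa> \<nu> :: complex
  assumes c_pos: "c > 0" and c_lower: "\<forall>i j. i + j > 0 \<longrightarrow> c \<le> norm (rate \<nu> i j)"
    and small: "norm \<kappa> * phi_majorant (\<rho> * exp 1) \<le> c\<^sup>2"
begin

lemmas rate_bounds = c_pos c_lower[rule_format]

lemma rate_nonzero: "i + j > 0 \<Longrightarrow> rate \<nu> i j \<noteq> 0"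
  using rate_bounds(1) rate_bounds(2)[of i j] by force

text \<open>The divisors are at least c^2 and the source at most c^2 in norm, so the unit ball is
  mapped into itself.\<close>

lemma picard_op_norm:
  assumes f: "wnorm_finite \<rho> f" "wnorm \<rho> f \<le> 1"
  shows "wnorm_finite \<rho> (picard_op \<kappa> \<nu> f)" "wnorm \<rho> (picard_op \<kappa> \<nu> f) \<le> 1"
proof -
  have le: "norm (cf (picard_op \<kappa> \<nu> f) i j) \<le> norm (source_coeff \<kappa> f i j) / c\<^sup>2" for i j
  proof (cases "i + j = 0")
    case False
    have "norm (source_coeff \<kappa> f i j) / (norm (rate \<nu> i j))\<^sup>2 \<le> norm (source_coeff \<kappa> f i j) / c\<^sup>2"
      using rate_bounds(1) rate_bounds(2)[of i j] False by (intro divide_left_mono power_mono mult_pos_pos zero_less_power) auto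
    then show ?thesis using False by (simp add: picard_op_def norm_divide norm_power)
  qed (simp add: picard_op_def)
  have fin: "(\<Sum>(i, j)\<in>T. norm (cf (picard_op \<kappa> \<nu> f) i j) * \<rho> ^ (i + j)) \<le> 1" if T: "finite T" for T
  proof -
    have "(\<Sum>(i, j)\<in>T. norm (cf (picard_op \<kappa> \<nu> f) i j) * \<rho> ^ (i + j)) \<le> (\<Sum>(i, j)\<in>T. norm (source_coeff \<kappa> f i j) / c\<^sup>2 * \<rho> ^ (i + j))"
    proof (rule sum_mono)
      fix z assume "z \<in> T"
      obtain i j where z: "z = (i, j)" by (cases z)
      show "(case z of (i, j) \<Rightarrow> norm (cf (picard_op \<kappa> \<nu> f) i j) * \<rho> ^ (i + j)) \<le> (case z of (i, j) \<Rightarrow> norm (source_coeff \<kappa> f i j) / c\<^sup>2 * \<rho> ^ (i + j))"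
        unfolding z split by (intro mult_right_mono le zero_le_power \<rho>)
    qed
    also have "\<dots> = (\<Sum>(i, j)\<in>T. norm (source_coeff \<kappa> f i j) * \<rho> ^ (i + j)) / c\<^sup>2"
      by (simp add: sum_divide_distrib case_prod_unfold)
    also have "\<dots> \<le> c\<^sup>2 / c\<^sup>2"
      by (intro divide_right_mono order.trans[OF source_coeff_finite_sum_le[OF f T] small]) auto
    also have "\<dots> = 1" using rate_bounds by simp
    finally show ?thesis .
  qed
  show "wnorm_finite \<rho> (picard_op \<kappa> \<nu> f)" "wnorm \<rho> (picard_op \<kappa> \<nu> f) \<le> 1"
    unfolding wnorm_finite_def wnorm_def
    using nonneg_finite_sums_bound[OF _ fin] \<rho> by auto
qed

lemma picard_iter_norm: "wnorm_finite \<rho> (picard_iter \<kappa> \<nu> n) \<and> wnorm \<rho> (picard_iter \<kappa> \<nu> n) \<le> 1"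
proof (induction n)
  case 0
  show ?case by (simp add: picard_iter_def wnorm_finite_def wnorm_def case_prod_unfold)
next
  case (Suc n)
  then show ?case unfolding picard_iter_Suc using picard_op_norm by blast
qed

text \<open>Any finite set of coefficients of the limit belongs to a single iterate, so the bound
  for the iterates holds for every finite partial sum.\<close>

lemma picard_sol_norm: "wnorm_finite \<rho> (picard_sol \<kappa> \<nu>)" "wnorm \<rho> (picard_sol \<kappa> \<nu>) \<le> 1"
proof -
  have fin: "(\<Sum>(i, j)\<in>T. norm (cf (picard_sol \<kappa> \<nu>) i j) * \<rho> ^ (i + j)) \<le> 1" if T: "finite T" for T
  proof -
    define N where "N = Suc (Max (insert 0 ((\<lambda>(i, j). i + j) ` T)))"
    have N: "i + j < N" if "(i, j) \<in> T" for i j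
      unfolding N_def less_Suc_eq_le using T that by (intro Max_ge) (auto intro!: image_eqI[of _ _ "(i, j)"])
    have "(\<Sum>(i, j)\<in>T. norm (cf (picard_sol \<kappa> \<nu>) i j) * \<rho> ^ (i + j)) = (\<Sum>(i, j)\<in>T. norm (cf (picard_iter \<kappa> \<nu> N) i j) * \<rho> ^ (i + j))"
      using eq_below_picard_sol[of N \<kappa> \<nu>] N by (intro sum.cong refl) (auto simp: eq_below_def)
    also have "\<dots> \<le> wnorm \<rho> (picard_iter \<kappa> \<nu> N)"
      unfolding wnorm_def by (rule finite_sum_le_infsum) (use picard_iter_norm[of N] \<rho> T in \<open>auto simp: wnorm_finite_def\<close>)
    finally show ?thesis using picard_iter_norm[of N] by linarith
  qed
  show "wnorm_finite \<rho> (picard_sol \<kappa> \<nu>)" "wnorm \<rho> (picard_sol \<kappa> \<nu>) \<le> 1"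
    unfolding wnorm_finite_def wnorm_def
    using nonneg_finite_sums_bound[OF _ fin] \<rho> by auto
qed

text \<open>Without constant term every monomial contains a or b; pulling out one such factor costs
  1 / \<rho>. The linear bound on v rests on this, the bound 1 keeps exp v under control.\<close>

lemma norm_eval2_picard_sol_le:
  assumes a: "norm a \<le> \<rho>" and b: "norm b \<le> \<rho>" and \<rho>0: "\<rho> > 0"
  shows "norm (eval2 (picard_sol \<kappa> \<nu>) a b) \<le> (norm a + norm b) / \<rho>" "norm (eval2 (picard_sol \<kappa> \<nu>) a b) \<le> 1"
proof -
  define f where "f = picard_sol \<kappa> \<nu>"
  note V = picard_sol_norm[folded f_def]
  have s: "(\<lambda>z. norm (case z of (i, j) \<Rightarrow> cf f i j * a ^ i * b ^ j)) summable_on UNIV"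
    using wnorm_finite_eval2_summable(1)[OF V(1) a b] by (simp add: case_prod_unfold)
  have n1: "norm (eval2 f a b) \<le> (\<Sum>\<^sub>\<infinity>z. norm (case z of (i, j) \<Rightarrow> cf f i j * a ^ i * b ^ j))"
    unfolding eval2_def by (rule norm_infsum_bound[OF s])
  have "(\<Sum>\<^sub>\<infinity>z. norm (case z of (i, j) \<Rightarrow> cf f i j * a ^ i * b ^ j)) \<le> wnorm \<rho> f"
    unfolding wnorm_def by (rule infsum_mono[OF s V(1)[unfolded wnorm_finite_def]]) (use wnorm_finite_eval2_summable(2)[OF V(1) a b] in auto)
  then show "norm (eval2 f a b) \<le> 1" using n1 V(2) by linarith
  define t where "t = (norm a + norm b) / \<rho>"
  have t0: "t \<ge> 0" using \<rho>0 by (simp add: t_def)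
  have "(\<Sum>\<^sub>\<infinity>z. norm (case z of (i, j) \<Rightarrow> cf f i j * a ^ i * b ^ j)) \<le> (\<Sum>\<^sub>\<infinity>z. t * (case z of (i, j) \<Rightarrow> norm (cf f i j) * \<rho> ^ (i + j)))"
  proof (rule infsum_mono[OF s summable_on_cmult_right[OF V(1)[unfolded wnorm_finite_def]]])
    fix z :: "nat \<times> nat"
    obtain i j where z: "z = (i, j)" by (cases z)
    have pw: "norm x ^ n \<le> \<rho> ^ n" if "norm x \<le> \<rho>" for x :: complex and n using that by (intro power_mono) auto
    have key: "norm a ^ i * norm b ^ j \<le> t * \<rho> ^ (i + j)" if ij: "i + j > 0"
    proof (cases i)
      case (Suc k)
      have "norm a ^ i * norm b ^ j = norm a * (norm a ^ k * norm b ^ j)" by (simp add: Suc)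
      also have "\<dots> \<le> (norm a + norm b) * (\<rho> ^ k * \<rho> ^ j)" by (intro mult_mono pw a b) (use \<rho> in auto)
      also have "\<dots> = t * \<rho> ^ (i + j)" using \<rho>0 by (simp add: t_def Suc power_add)
      finally show ?thesis .
    next
      case 0
      then obtain k where k: "j = Suc k" using ij by (cases j) auto
      have "norm a ^ i * norm b ^ j = norm b * norm b ^ k" by (simp add: 0 k)
      also have "\<dots> \<le> (norm a + norm b) * \<rho> ^ k" by (intro mult_mono pw a b) (use \<rho> in auto)
      also have "\<dots> = t * \<rho> ^ (i + j)" using \<rho>0 by (simp add: t_def 0 k)
      finally show ?thesis .
    qed
    show "norm (case z of (i, j) \<Rightarrow> cf f i j * a ^ i * b ^ j) \<le> t * (case z of (i, j) \<Rightarrow> norm (cf f i j) * \<rho> ^ (i + j))"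
    proof (cases "i + j = 0")
      case True
      then show ?thesis using zero_const_picard_sol[of \<kappa> \<nu>] by (simp add: z zero_const_def f_def)
    next
      case False
      then have "norm (cf f i j) * (norm a ^ i * norm b ^ j) \<le> norm (cf f i j) * (t * \<rho> ^ (i + j))"
        by (intro mult_left_mono key) auto
      then show ?thesis by (simp add: z norm_mult norm_power mult_ac)
    qed
  qed
  also have "\<dots> = t * wnorm \<rho> f" unfolding wnorm_def by (rule infsum_cmult_right')
  also have "\<dots> \<le> t * 1" by (intro mult_left_mono V(2) t0)
  finally show "norm (eval2 f a b) \<le> (norm a + norm b) / \<rho>" using n1 by (simp add: t_def)
qed

text \<open>Two interchanges of summation. For H, summing over m first gives
  \<open>source_coeff\<close>, summing over monomials first gives \<open>eval2\<close> of
  \<open>source_fps\<close> m times v^m. H2 has the same row sums, and there summing over m first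
  produces the exponentials that turn a, b into a exp v, b exp (- v).\<close>

lemma eval2_source_coeff:
  assumes a: "norm a \<le> \<rho>" and b: "norm b \<le> \<rho>" and \<rho>0: "\<rho> > 0"
  defines "v \<equiv> eval2 (picard_sol \<kappa> \<nu>) a b"
  shows "((\<lambda>(i, j). source_coeff \<kappa> (picard_sol \<kappa> \<nu>) i j * a ^ i * b ^ j) has_sum (\<kappa> * X 2 (- 1) (a * exp v) (b * exp (- v)))) UNIV"
    and "norm (a * exp v) < 1" "norm (b * exp (- v)) < 1"
proof -
  define f where "f = picard_sol \<kappa> \<nu>"
  note V = picard_sol_norm[folded f_def]
  have v1: "norm v \<le> 1" unfolding v_def by (rule norm_eval2_picard_sol_le(2)[OF a b \<rho>0])
  have small_exp: "norm (x * exp w) < 1" if "norm x \<le> \<rho>" "norm w \<le> 1" for x w :: complex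
  proof -
    have "norm (exp w) \<le> exp (norm w)" by (rule norm_exp)
    also have "\<dots> \<le> exp 1" using that by simp
    finally have "norm x * norm (exp w) \<le> \<rho> * exp 1" using that \<rho> by (intro mult_mono) auto
    then show ?thesis using \<rho> by (simp add: norm_mult)
  qed
  show Z1: "norm (a * exp v) < 1" and W1: "norm (b * exp (- v)) < 1" using small_exp a b v1 by auto
  define H where "H = (\<lambda>(m, (i, j)). cf (source_fps m * f ^ m) i j * a ^ i * b ^ j)"
  have wnorm_finite: "wnorm_finite \<rho> (source_fps m * f ^ m)" for m by (rule source_fps_mult_power_norms(1)[OF V])
  have Hrow: "((\<lambda>z. H (m, z)) has_sum eval2 (source_fps m) a b * v ^ m) UNIV" for m
  proof -
    have "eval2 (source_fps m * f ^ m) a b = eval2 (source_fps m) a b * v ^ m"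
      using eval2_mult[OF source_fps_norms(1) wnorm_finite_power(1)[OF \<rho>(1) V(1)] a b] eval2_power[OF \<rho>(1) V(1) a b]
      by (simp add: v_def f_def)
    then show ?thesis using eval2_has_sum[OF wnorm_finite a b, of m] by (simp add: H_def)
  qed
  have Hs: "H summable_on (UNIV \<times> UNIV)"
  proof -
    have "(\<lambda>z. norm (H z)) summable_on (UNIV \<times> UNIV)"
    proof (rule summable_on_SigmaI)
      fix m :: nat
      have s: "(\<lambda>z. norm (H (m, z))) summable_on UNIV"
        using wnorm_finite_eval2_summable(1)[OF wnorm_finite a b, of m] by (simp add: H_def case_prod_unfold)
      then show "((\<lambda>z. norm (H (m, z))) has_sum (\<Sum>\<^sub>\<infinity>z. norm (H (m, z)))) UNIV" by (rule has_sum_infsum)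
    next
      show "(\<lambda>m. \<Sum>\<^sub>\<infinity>z. norm (H (m, z))) summable_on UNIV"
      proof (rule summable_on_comparison_test[OF source_fps_norms(2)])
        fix m :: nat
        have s: "(\<lambda>z. norm (H (m, z))) summable_on UNIV"
          using wnorm_finite_eval2_summable(1)[OF wnorm_finite a b, of m] by (simp add: H_def case_prod_unfold)
        have "(\<Sum>\<^sub>\<infinity>z. norm (H (m, z))) \<le> wnorm \<rho> (source_fps m * f ^ m)"
          unfolding wnorm_def
          by (rule infsum_mono[OF s wnorm_finite[unfolded wnorm_finite_def]]) (use wnorm_finite_eval2_summable(2)[OF wnorm_finite a b, of m] in \<open>auto simp: H_def\<close>)
        then show "(\<Sum>\<^sub>\<infinity>z. norm (H (m, z))) \<le> wnorm \<rho> (source_fps m)" using source_fps_mult_power_norms(2)[OF V, of m] by linarith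
        show "(\<Sum>\<^sub>\<infinity>z. norm (H (m, z))) \<ge> 0" by (intro infsum_nonneg) auto
      qed
    qed auto
    then show ?thesis by (rule abs_summable_summable)
  qed
  define tot where "tot = infsum H (UNIV \<times> UNIV)"
  have tot1: "((\<lambda>m. eval2 (source_fps m) a b * v ^ m) has_sum tot) UNIV"
    unfolding tot_def by (rule has_sum_SigmaD[OF has_sum_infsum[OF Hs] Hrow])
  \<comment> \<open>The column is finite by the degree count that justifies the cut in
    \<open>source_coeff\<close>.\<close>
  have Hcol: "((\<lambda>m. H (m, z)) has_sum (case z of (i, j) \<Rightarrow> (\<Sum>m\<le>i + j. cf (source_fps m * f ^ m) i j) * a ^ i * b ^ j)) UNIV" for z
  proof -
    obtain i j where z: "z = (i, j)" by (cases z)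
    have "((\<lambda>m. H (m, z)) has_sum (\<Sum>m\<le>i + j. H (m, z))) UNIV"
    proof (rule has_sum_finite_neutralI)
      fix m assume "m \<in> UNIV - {..i + j}"
      then have "cf (source_fps m * f ^ m) i j = 0"
        using zero_const_picard_sol by (intro cf_mult_power_eq_0 zero_const_source_fps) (auto simp: f_def)
      then show "H (m, z) = 0" by (simp add: H_def z)
    qed auto
    then show ?thesis by (simp add: z H_def sum_distrib_right)
  qed
  have tot2: "((\<lambda>(i, j). (\<Sum>m\<le>i + j. cf (source_fps m * f ^ m) i j) * a ^ i * b ^ j) has_sum tot) UNIV"
  proof -
    have "((\<lambda>(z, m). H (m, z)) has_sum tot) (UNIV \<times> UNIV)"
      using has_sum_infsum[OF Hs] unfolding tot_def by (subst (asm) has_sum_swap) (simp add: case_prod_unfold)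
    from has_sum_SigmaD[OF this, of "\<lambda>z. case z of (i, j) \<Rightarrow> (\<Sum>m\<le>i + j. cf (source_fps m * f ^ m) i j) * a ^ i * b ^ j"] Hcol
    show ?thesis by simp
  qed
  \<comment> \<open>Compared with H, the number v replaces the series f inside the powers.\<close>
  define H2 where "H2 = (\<lambda>(m, (i, j)). cf (source_fps m) i j * a ^ i * b ^ j * v ^ m)"
  have H2s: "H2 summable_on (UNIV \<times> UNIV)"
  proof (rule abs_summable_summable[OF Infinite_Sum.abs_summable_on_comparison_test'])
    show "(\<lambda>(m, (i, j)). norm (cf (source_fps m) i j) * \<rho> ^ (i + j)) summable_on UNIV \<times> UNIV"
      using source_fps_double_summable(1) by simp
    fix y :: "nat \<times> nat \<times> nat"
    obtain m i j where y: "y = (m, (i, j))" by (cases y)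
    have "norm (cf (source_fps m) i j * a ^ i * b ^ j) * norm (v ^ m) \<le> norm (cf (source_fps m) i j) * \<rho> ^ (i + j) * 1"
      using wnorm_finite_eval2_summable(2)[OF source_fps_norms(1) a b, of m i j] v1 \<rho> by (intro mult_mono) (auto simp: norm_power power_le_one)
    then show "norm (H2 y) \<le> (case y of (m, (i, j)) \<Rightarrow> norm (cf (source_fps m) i j) * \<rho> ^ (i + j))"
      by (simp add: y H2_def norm_mult)
  qed
  have H2row: "((\<lambda>z. H2 (m, z)) has_sum eval2 (source_fps m) a b * v ^ m) UNIV" for m
    using has_sum_cmult_left[OF eval2_has_sum[OF source_fps_norms(1) a b, of m], of "v ^ m"]
    by (simp add: H2_def case_prod_unfold)
  have "infsum H2 (UNIV \<times> UNIV) = tot"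
    using has_sum_SigmaD[OF has_sum_infsum[OF H2s] H2row] tot1 has_sum_unique by blast
  then have H2tot: "(H2 has_sum tot) (UNIV \<times> UNIV)" using has_sum_infsum[OF H2s] by simp
  have H2col: "((\<lambda>m. H2 (m, z)) has_sum (case z of (i, j) \<Rightarrow> phi i j * (a * exp v) ^ i * (b * exp (- v)) ^ j)) UNIV" for z
  proof -
    obtain i j where z: "z = (i, j)" by (cases z)
    define w where "w = (of_nat i - of_nat j) * v"
    have "((\<lambda>m. w ^ m / fact m) has_sum exp w) UNIV"
    proof (rule norm_summable_imp_has_sum)
      show "(\<lambda>m. w ^ m / fact m) sums exp w" using exp_converges[of w] by (simp add: scaleR_conv_of_real divide_inverse mult.commute)
      show "summable (\<lambda>m. norm (w ^ m / fact m))" using summable_norm_exp[of w] by (simp add: scaleR_conv_of_real divide_inverse mult.commute)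
    qed
    then have "((\<lambda>m. phi i j * a ^ i * b ^ j * (w ^ m / fact m)) has_sum (phi i j * a ^ i * b ^ j * exp w)) UNIV"
      by (rule has_sum_cmult_right)
    moreover have "phi i j * a ^ i * b ^ j * (w ^ m / fact m) = H2 (m, z)" for m
      by (simp add: H2_def z source_fps_def w_def power_mult_distrib)
    moreover have "exp w = exp v ^ i * exp (- v) ^ j"
      by (simp add: w_def exp_of_nat_mult[symmetric] exp_add[symmetric] left_diff_distrib)
    ultimately show ?thesis by (simp add: z power_mult_distrib mult_ac)
  qed
  have "((\<lambda>(i, j). phi i j * (a * exp v) ^ i * (b * exp (- v)) ^ j) has_sum tot) UNIV"
  proof -
    have "((\<lambda>(z, m). H2 (m, z)) has_sum tot) (UNIV \<times> UNIV)"
      using H2tot by (subst (asm) has_sum_swap) (simp add: case_prod_unfold)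
    from has_sum_SigmaD[OF this, of "\<lambda>z. case z of (i, j) \<Rightarrow> phi i j * (a * exp v) ^ i * (b * exp (- v)) ^ j"] H2col
    show ?thesis by simp
  qed
  then have "tot = X 2 (- 1) (a * exp v) (b * exp (- v))"
    using X2_eq_phi[OF Z1 W1] has_sum_unique by blast
  then show "((\<lambda>(i, j). source_coeff \<kappa> (picard_sol \<kappa> \<nu>) i j * a ^ i * b ^ j) has_sum (\<kappa> * X 2 (- 1) (a * exp v) (b * exp (- v)))) UNIV"
    using has_sum_cmult_right[OF tot2, of \<kappa>] by (simp add: source_coeff_def f_def case_prod_unfold mult_ac)
qed

text \<open>Each monomial is an exponential in t with exponent \<open>rate\<close>, so two termwise
  differentiations multiply its coefficient by the square of \<open>rate\<close>, and the fixed
  point equation turns this into the source coefficient.\<close>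

lemma eval2_picard_sol_second_derivative:
  assumes \<rho>0: "\<rho> > 0" and U: "open U"
    and ab: "\<And>t. t \<in> U \<Longrightarrow> norm (a0 * exp (\<nu> * t)) \<le> \<rho>" "\<And>t. t \<in> U \<Longrightarrow> norm (b0 * exp ((2 - \<nu>) * t)) \<le> \<rho>"
  defines "v \<equiv> \<lambda>t. eval2 (picard_sol \<kappa> \<nu>) (a0 * exp (\<nu> * t)) (b0 * exp ((2 - \<nu>) * t))"
  obtains v1 where "\<And>t. t \<in> U \<Longrightarrow> (v has_field_derivative v1 t) (at t)"
    "\<And>t. t \<in> U \<Longrightarrow> (v1 has_field_derivative \<kappa> * X 2 (- 1) (a0 * exp (\<nu> * t) * exp (v t)) (b0 * exp ((2 - \<nu>) * t) * exp (- v t))) (at t)"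
proof
  define f where "f = picard_sol \<kappa> \<nu>"
  note V = picard_sol_norm[folded f_def]
  define mon where "mon = (\<lambda>(i, j) t. (a0 * exp (\<nu> * t)) ^ i * (b0 * exp ((2 - \<nu>) * t)) ^ j)"
  define CC where "CC = (\<lambda>(i, j). cf f i j)"
  define EE where "EE = (\<lambda>(i, j). rate \<nu> i j)"
  define SS where "SS = (\<lambda>(i, j). source_coeff \<kappa> f i j)"
  define w where "w = (\<lambda>(i :: nat, j :: nat). \<rho> ^ (i + j))"
  have dmon: "(mon z has_field_derivative EE z * mon z t) (at t)" for z t
  proof -
    obtain i j where z: "z = (i, j)" by (cases z)
    have mexp: "mon z = (\<lambda>t. a0 ^ i * b0 ^ j * exp (rate \<nu> i j * t))"
      by (auto simp: fun_eq_iff mon_def z rate_def power_mult_distrib exp_of_nat_mult[symmetric] exp_add[symmetric] algebra_simps)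
    have "((\<lambda>t. a0 ^ i * b0 ^ j * exp (rate \<nu> i j * t)) has_field_derivative a0 ^ i * b0 ^ j * (exp (rate \<nu> i j * t) * (rate \<nu> i j * 1))) (at t)"
      by (rule derivative_eq_intros refl)+ simp
    then show ?thesis unfolding mexp by (simp add: EE_def z mult_ac)
  qed
  have lemon: "norm (mon z t) \<le> w z" if "t \<in> U" for z t
  proof -
    obtain i j where z: "z = (i, j)" by (cases z)
    show ?thesis unfolding z mon_def w_def split norm_mult[of "_ ^ _"] norm_power power_add
      by (intro mult_mono power_mono ab that) (use \<rho> in auto)
  qed
  have SC: "EE z * (EE z * CC z) = SS z" for z
  proof -
    obtain i j where z: "z = (i, j)" by (cases z)
    show ?thesis
    proof (cases "i + j > 0")
      case True
      then show ?thesis using picard_sol_fixed_point[OF True, of \<kappa> \<nu>] rate_nonzero[OF True]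
        by (simp add: z EE_def CC_def SS_def f_def power2_eq_square)
    next
      case False
      then show ?thesis by (simp add: z SS_def source_coeff_0_0 EE_def rate_def)
    qed
  qed
  \<comment> \<open>The second differentiation needs a majorant for the once differentiated series:
    its coefficient is the source coefficient divided by one factor \<open>rate\<close>.\<close>
  have EC: "norm (EE z * CC z) \<le> norm (SS z) / c" for z
  proof (cases "EE z = 0")
    case True then show ?thesis using rate_bounds by simp
  next
    case False
    obtain i j where z: "z = (i, j)" by (cases z)
    have "c \<le> norm (EE z)" using False rate_bounds(2)[of i j] by (cases "i + j > 0") (auto simp: z EE_def rate_def)
    then have "c * norm (EE z * CC z) \<le> norm (EE z) * norm (EE z * CC z)" by (intro mult_right_mono) auto
    also have "\<dots> = norm (SS z)" by (simp add: SC[symmetric] norm_mult)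
    finally show ?thesis using rate_bounds(1) by (simp add: field_simps)
  qed
  have sC: "(\<lambda>z. norm (CC z) * w z) summable_on UNIV"
    using V(1) by (simp add: wnorm_finite_def CC_def w_def case_prod_unfold)
  have sS: "(\<lambda>z. norm (SS z) / c * w z) summable_on UNIV"
    using summable_on_cmult_right[OF source_coeff_summable[OF V, of \<kappa>], of "1 / c"] by (simp add: SS_def w_def case_prod_unfold)
  define v1 where "v1 = (\<lambda>t. \<Sum>\<^sub>\<infinity>z. EE z * CC z * mon z t)"
  have veq: "v = (\<lambda>t. \<Sum>\<^sub>\<infinity>z. CC z * mon z t)"
    by (simp add: v_def eval2_def CC_def mon_def f_def case_prod_unfold mult.assoc)
  show "(v has_field_derivative v1 t) (at t)" if t: "t \<in> U" for t
  proof -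
    have "((\<lambda>t. \<Sum>\<^sub>\<infinity>z. CC z * mon z t) has_field_derivative (\<Sum>\<^sub>\<infinity>z. CC z * (EE z * mon z t))) (at t)"
    proof (rule has_field_derivative_infsum(1)[OF U t _ _ sC])
      show "((\<lambda>t. CC z * mon z t) has_field_derivative CC z * (EE z * mon z t)) (at t)" for z t
        by (rule DERIV_cmult[OF dmon])
      show "norm (CC z * mon z t) \<le> norm (CC z) * w z" if "t \<in> U" for z t
        unfolding norm_mult by (intro mult_left_mono lemon that) auto
    qed
    then show ?thesis by (simp add: veq v1_def mult_ac)
  qed
  show "(v1 has_field_derivative \<kappa> * X 2 (- 1) (a0 * exp (\<nu> * t) * exp (v t)) (b0 * exp ((2 - \<nu>) * t) * exp (- v t))) (at t)" if t: "t \<in> U" for t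
  proof -
    have "(v1 has_field_derivative (\<Sum>\<^sub>\<infinity>z. EE z * CC z * (EE z * mon z t))) (at t)"
      unfolding v1_def
    proof (rule has_field_derivative_infsum(1)[OF U t _ _ sS])
      show "((\<lambda>t. EE z * CC z * mon z t) has_field_derivative EE z * CC z * (EE z * mon z t)) (at t)" for z t
        by (rule DERIV_cmult[OF dmon])
      show "norm (EE z * CC z * mon z t) \<le> norm (SS z) / c * w z" if "t \<in> U" for z t
        unfolding norm_mult[of "EE z * CC z"]
        using EC[of z] lemon[OF that, of z] by (intro mult_mono) (auto simp: w_def c_pos less_imp_le split: prod.splits)
    qed
    also have "(\<Sum>\<^sub>\<infinity>z. EE z * CC z * (EE z * mon z t)) = (\<Sum>\<^sub>\<infinity>z. SS z * mon z t)"
      by (intro infsum_cong) (simp add: SC[symmetric] mult_ac)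
    also have "\<dots> = \<kappa> * X 2 (- 1) (a0 * exp (\<nu> * t) * exp (v t)) (b0 * exp ((2 - \<nu>) * t) * exp (- v t))"
      using infsumI[OF eval2_source_coeff(1)[OF ab(1)[OF t] ab(2)[OF t] \<rho>0]]
      by (simp add: SS_def mon_def f_def v_def case_prod_unfold mult.assoc)
    finally show ?thesis .
  qed
qed

end
end

section \<open>Lower bound for the divisors\<close>

text \<open>\<open>rate\<close> / (i + j) is a convex combination of \<nu> and 2 - \<nu>. For
  admissible \<nu> the segment between them misses 0, and compactness gives a positive distance that
  serves all i, j.\<close>

lemma admissible_rate_lower_bound:
  assumes "\<nu> \<in> admissible"
  obtains c where "c > 0" "\<And>i j. i + j > 0 \<Longrightarrow> c \<le> norm (rate \<nu> i j)"
proof -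
  have "0 \<notin> closed_segment \<nu> (2 - \<nu>)"
  proof
    assume "0 \<in> closed_segment \<nu> (2 - \<nu>)"
    then obtain u where u: "0 \<le> u" "u \<le> 1" "0 = (1 - u) *\<^sub>R \<nu> + u *\<^sub>R (2 - \<nu>)"
      by (auto simp: closed_segment_def)
    \<comment> \<open>Solved for \<nu> this gives - 2 u / (1 - 2 u), which is at most 0 for u < 1/2
      and at least 2 for u > 1/2.\<close>
    then have e: "of_real (1 - 2 * u) * \<nu> = - of_real (2 * u)"
      by (simp add: scaleR_conv_of_real algebra_simps eq_neg_iff_add_eq_0)
    have u2: "1 - 2 * u \<noteq> 0"
    proof
      assume "1 - 2 * u = 0"
      then have "2 * u = 1" by simp
      with e show False by simp
    qed
    have "of_real (1 - 2 * u) * \<nu> = of_real (1 - 2 * u) * of_real (- 2 * u / (1 - 2 * u))"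
    proof -
      have "- (2 * u) = (1 - 2 * u) * (- 2 * u / (1 - 2 * u))" using u2 by simp
      then have "of_real (- (2 * u)) = (of_real ((1 - 2 * u) * (- 2 * u / (1 - 2 * u))) :: complex)" by (rule arg_cong)
      then show ?thesis unfolding e of_real_mult of_real_minus .
    qed
    then have nu: "\<nu> = of_real (- 2 * u / (1 - 2 * u))" using u2 by (metis mult_left_cancel of_real_eq_0_iff)
    have "- 2 * u / (1 - 2 * u) \<in> {..0} \<union> {2..}"
    proof (cases "1 - 2 * u > 0")
      case True then show ?thesis using u by (simp add: divide_nonpos_pos)
    next
      case False
      then have n: "1 - 2 * u < 0" using u2 by simp
      have "(- 2 * u) \<le> 2 * (1 - 2 * u)" using u by simp
      then have "2 \<le> - 2 * u / (1 - 2 * u)" using n by (subst neg_le_divide_eq) auto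
      then show ?thesis by simp
    qed
    then show False using assms nu unfolding admissible_def by blast
  qed
  then obtain c where c: "c > 0" "\<And>z. z \<in> closed_segment \<nu> (2 - \<nu>) \<Longrightarrow> c \<le> dist 0 z"
    using separate_point_closed[of "closed_segment \<nu> (2 - \<nu>)" 0] by auto
  show ?thesis
  proof (rule that[OF c(1)])
    fix i j :: nat assume ij: "i + j > 0"
    define u where "u = real j / real (i + j)"
    have s: "real (i + j) > 0" using ij by (simp only: of_nat_0_less_iff)
    have "real (i + j) * u = real j" using s by (simp add: u_def del: of_nat_add)
    then have ru: "of_nat (i + j) * of_real u = (of_nat j :: complex)"
      by (metis of_real_mult of_real_of_nat_eq)
    have "real j \<le> real (i + j)" by simp
    then have u01: "0 \<le> u" "u \<le> 1" using s unfolding u_def by (auto simp del: of_nat_add)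
    have "rate \<nu> i j = of_nat (i + j) * ((1 - u) *\<^sub>R \<nu> + u *\<^sub>R (2 - \<nu>))"
    proof -
      note ru
      moreover have "of_nat (i + j) * ((1 - u) *\<^sub>R \<nu> + u *\<^sub>R (2 - \<nu>)) = of_nat (i + j) * \<nu> + (of_nat (i + j) * of_real u) * (2 - 2 * \<nu>)"
        by (simp add: scaleR_conv_of_real algebra_simps)
      ultimately show ?thesis by (simp add: rate_def algebra_simps)
    qed
    moreover have "(1 - u) *\<^sub>R \<nu> + u *\<^sub>R (2 - \<nu>) \<in> closed_segment \<nu> (2 - \<nu>)"
      unfolding closed_segment_def using u01 by blast
    then have "c \<le> norm ((1 - u) *\<^sub>R \<nu> + u *\<^sub>R (2 - \<nu>))" using c(2) by force
    then have "1 * c \<le> real (i + j) * norm ((1 - u) *\<^sub>R \<nu> + u *\<^sub>R (2 - \<nu>))"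
      using ij c(1) by (intro mult_mono) auto
    ultimately show "c \<le> norm (rate \<nu> i j)" by (simp add: norm_mult del: of_nat_add)
  qed
qed

section \<open>Rationality of the coefficients\<close>

lemma rational_const: "rational_function_on S (\<lambda>_. k)"
  unfolding rational_function_on_def by (rule exI[of _ "[:k:]"], rule exI[of _ "[:1:]"]) simp

lemma rational_add:
  assumes "rational_function_on S f" "rational_function_on S g"
  shows "rational_function_on S (\<lambda>z. f z + g z)"
proof -
  from assms obtain p q p' q' where "\<forall>z\<in>S. poly q z \<noteq> 0 \<and> f z = poly p z / poly q z"
    "\<forall>z\<in>S. poly q' z \<noteq> 0 \<and> g z = poly p' z / poly q' z" unfolding rational_function_on_def by blast
  then show ?thesis unfolding rational_function_on_def
    by (intro exI[of _ "p * q' + p' * q"] exI[of _ "q * q'"]) (auto simp: add_frac_eq)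
qed

lemma rational_mult:
  assumes "rational_function_on S f" "rational_function_on S g"
  shows "rational_function_on S (\<lambda>z. f z * g z)"
proof -
  from assms obtain p q p' q' where "\<forall>z\<in>S. poly q z \<noteq> 0 \<and> f z = poly p z / poly q z"
    "\<forall>z\<in>S. poly q' z \<noteq> 0 \<and> g z = poly p' z / poly q' z" unfolding rational_function_on_def by blast
  then show ?thesis unfolding rational_function_on_def
    by (intro exI[of _ "p * p'"] exI[of _ "q * q'"]) auto
qed

lemma rational_sum: "(\<And>x. x \<in> T \<Longrightarrow> rational_function_on S (f x)) \<Longrightarrow> rational_function_on S (\<lambda>z. \<Sum>x\<in>T. f x z)"
  by (induction T rule: infinite_finite_induct) (auto intro: rational_const rational_add)

lemma rational_poly: "rational_function_on S (poly p)"
  unfolding rational_function_on_def by (rule exI[of _ p], rule exI[of _ "[:1:]"]) simp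

lemma rational_inverse_poly: "(\<And>z. z \<in> S \<Longrightarrow> poly p z \<noteq> 0) \<Longrightarrow> rational_function_on S (\<lambda>z. 1 / poly p z)"
  unfolding rational_function_on_def by (rule exI[of _ "[:1:]"], rule exI[of _ p]) simp

lemma rate_eq_poly: "rate \<nu> i j = poly [:of_nat (2 * j), of_nat i - of_nat j:] \<nu>"
  by (simp add: rate_def algebra_simps)

lemma rational_cf_power:
  assumes "\<And>i j. rational_function_on S (\<lambda>\<nu>. cf (f \<nu>) i j)"
  shows "rational_function_on S (\<lambda>\<nu>. cf (f \<nu> ^ m) i j)"
proof (induction m arbitrary: i j)
  case 0
  show ?case by (simp add: rational_const)
next
  case (Suc m)
  show ?case unfolding power_Suc cf_mult by (intro rational_sum rational_mult assms Suc)
qed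

text \<open>A step of the iteration uses finite sums and products of earlier coefficients and a
  division by the square of 2 j + (i - j) \<nu>, which has no zero in the admissible set.\<close>

lemma rational_picard_iter: "rational_function_on admissible (\<lambda>\<nu>. cf (picard_iter \<kappa> \<nu> n) i j)"
proof (induction n arbitrary: i j)
  case 0
  show ?case by (simp add: picard_iter_def rational_const)
next
  case (Suc n)
  show ?case
  proof (cases "i + j = 0")
    case True
    then show ?thesis by (simp add: picard_iter_Suc picard_op_def rational_const)
  next
    case False
    have ex: "rational_function_on admissible (\<lambda>\<nu>. 1 / rate \<nu> i j)"
      unfolding rate_eq_poly
    proof (rule rational_inverse_poly)
      fix \<nu> assume \<nu>: "\<nu> \<in> admissible"
      from admissible_rate_lower_bound[OF this] obtain c where "c > 0" "\<And>i j. i + j > 0 \<Longrightarrow> c \<le> norm (rate \<nu> i j)" by blast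
      then have "rate \<nu> i j \<noteq> 0" using False by (metis gr0I norm_zero not_less)
      then show "poly [:of_nat (2 * j), of_nat i - of_nat j:] \<nu> \<noteq> 0" by (simp only: rate_eq_poly not_False_eq_True)
    qed
    have "(\<lambda>\<nu>. cf (picard_iter \<kappa> \<nu> (Suc n)) i j) = (\<lambda>\<nu>. (\<kappa> * (\<Sum>m\<le>i + j. cf (source_fps m * picard_iter \<kappa> \<nu> n ^ m) i j)) * (1 / rate \<nu> i j * (1 / rate \<nu> i j)))"
    proof
      fix \<nu>
      have "cf (picard_iter \<kappa> \<nu> (Suc n)) i j = source_coeff \<kappa> (picard_iter \<kappa> \<nu> n) i j / (rate \<nu> i j)\<^sup>2"
        unfolding picard_iter_Suc by (rule cf_picard_op) (use False in simp)
      then show "cf (picard_iter \<kappa> \<nu> (Suc n)) i j = (\<kappa> * (\<Sum>m\<le>i + j. cf (source_fps m * picard_iter \<kappa> \<nu> n ^ m) i j)) * (1 / rate \<nu> i j * (1 / rate \<nu> i j))"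
        by (simp add: source_coeff_def power2_eq_square)
    qed
    moreover have "rational_function_on admissible \<dots>"
      unfolding cf_mult by (intro rational_mult rational_const rational_sum ex rational_cf_power Suc)
    ultimately show ?thesis by simp
  qed
qed

lemma rational_picard_sol: "rational_function_on admissible (\<lambda>\<nu>. cf (picard_sol \<kappa> \<nu>) i j)"
  by (simp add: picard_sol_def rational_picard_iter)

lemma exists_small_radius:
  fixes \<kappa> :: complex
  assumes "c > 0"
  obtains \<rho> where "\<rho> > 0" "\<rho> * exp 1 < 1" "norm \<kappa> * phi_majorant (\<rho> * exp 1) \<le> c\<^sup>2"
proof -
  \<comment> \<open>The majorant is linear in \<rho> by \<open>phi_majorant_le\<close>, with slope L
    - 1; the summand 1 makes L positive.\<close>
  define L where "L = 2 * exp 1 * (norm \<kappa> * phi_majorant (1/2)) + 1"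
  have L: "L > 0" using phi_majorant_nonneg[of "1/2"] by (simp add: L_def add_nonneg_pos)
  define \<rho> where "\<rho> = min (1 / (2 * exp 1)) (c\<^sup>2 / L)"
  have p: "\<rho> > 0" using assms L by (simp add: \<rho>_def)
  have "\<rho> * exp 1 \<le> 1 / (2 * exp 1) * exp 1" by (intro mult_right_mono) (auto simp: \<rho>_def)
  then have h: "\<rho> * exp 1 \<le> 1/2" by simp
  have "norm \<kappa> * phi_majorant (\<rho> * exp 1) \<le> norm \<kappa> * (2 * (\<rho> * exp 1) * phi_majorant (1/2))"
    using p h by (intro mult_left_mono phi_majorant_le) auto
  also have "\<dots> = \<rho> * (L - 1)" by (simp add: L_def)
  also have "\<dots> \<le> \<rho> * L" using p by simp
  also have "\<dots> \<le> c\<^sup>2 / L * L" using L by (intro mult_right_mono) (auto simp: \<rho>_def)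
  also have "\<dots> = c\<^sup>2" using L by simp
  finally show ?thesis using that p h by force
qed

section \<open>The family of elliptic solutions\<close>

lemma PVI_solution_on_cong:
  assumes S: "open S" and eq: "\<And>s. s \<in> S \<Longrightarrow> y s = y' s" and y: "PVI_solution_on \<mu> S y"
  shows "PVI_solution_on \<mu> S y'"
proof -
  have near: "eventually (\<lambda>z. z \<in> S) (nhds s)" if "s \<in> S" for s using S that by (rule eventually_nhds_in_open)
  have d1: "cover_deriv y s = cover_deriv y' s" if s: "s \<in> S" for s
    unfolding cover_deriv_def using eventually_mono[OF near[OF s], of "\<lambda>z. y z = y' z"] eq by (simp add: deriv_cong_ev)
  have d2: "cover_deriv (cover_deriv y) s = cover_deriv (cover_deriv y') s" if s: "s \<in> S" for s
    unfolding cover_deriv_def[of "cover_deriv y"] cover_deriv_def[of "cover_deriv y'"]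
    using eventually_mono[OF near[OF s], of "\<lambda>z. cover_deriv y z = cover_deriv y' z"] d1 by (simp add: deriv_cong_ev)
  have "y' holomorphic_on S" using y eq unfolding PVI_solution_on_def by (metis holomorphic_transform)
  then show ?thesis using y eq d1 d2 unfolding PVI_solution_on_def by simp
qed

text \<open>Converts the constant F1(0) / F(0) = - 4 ln 2 in the logarithm of the nome into the
  powers of 16 in \<open>A\<close> and \<open>B\<close>.\<close>

lemma exp_ln_16: "exp (4 * of_real (ln 2) * z) = 16 powr (z :: complex)"
proof -
  have "ln (16 :: real) = ln (2 ^ 4)" by simp
  also have "\<dots> = 4 * ln 2" by (subst ln_realpow) auto
  finally have "Ln 16 = of_real (4 * ln 2)" using Ln_of_real[of 16] by simp
  then show ?thesis by (simp add: powr_def mult_ac)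
qed

lemma fps_exp_coeff_bound:
  fixes f :: "complex \<Rightarrow> complex" and \<Phi> :: "complex fps"
  assumes f: "f holomorphic_on ball 0 R" "f has_fps_expansion \<Phi>" and r: "0 < r" "r < R"
    and B: "\<And>x. norm x = r \<Longrightarrow> norm (f x) \<le> C"
  shows "norm (fps_nth \<Phi> n) \<le> C / r ^ n"
proof -
  have "norm ((deriv ^^ n) f 0) \<le> fact n * C / r ^ n"
  proof (rule Cauchy_inequality)
    show "f holomorphic_on ball 0 r" using f(1) r by (auto intro: holomorphic_on_subset)
    show "continuous_on (cball 0 r) f"
      using holomorphic_on_imp_continuous_on[OF f(1)] r by (auto intro: continuous_on_subset)
  qed (use r B in auto)
  then have "norm ((deriv ^^ n) f 0) / fact n \<le> (fact n * C / r ^ n) / fact n" by (rule divide_right_mono) simp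
  then show ?thesis
    unfolding fps_nth_fps_expansion[OF f(2)] by (simp add: norm_divide)
qed

text \<open>In terms of \<open>x\<close> the monomials of the Picard solution are those in \<open>B\<close>, \<open>A\<close> times
  \<open>exp (l * nome_shift x)\<close>, and \<open>v\<close> is the solution times \<open>F x / (2\<i>)\<close>.\<close>

definition nome_shift :: "complex \<Rightarrow> complex" where "nome_shift x = F1 x / F x + 4 * of_real (ln 2)"

definition transition_fps :: "complex \<Rightarrow> complex fps" where
  "transition_fps l = fps_const (1 / (2 * \<i>)) * fps_expansion F 0 * fps_compose (fps_exp l) (fps_expansion nome_shift 0)"

text \<open>Only the outer exponential series depends on \<nu>, and a coefficient of the composition
  involves finitely many of its terms; the result is a polynomial in \<open>rate\<close>.\<close>

lemma rational_transition_fps: "rational_function_on S (\<lambda>\<nu>. fps_nth (transition_fps (rate \<nu> i j)) n)"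
proof -
  have pw: "rational_function_on S (\<lambda>\<nu>. rate \<nu> i j ^ k)" for k
    unfolding rate_eq_poly poly_power[symmetric] by (rule rational_poly)
  have e: "rational_function_on S (\<lambda>\<nu>. fps_nth (fps_exp (rate \<nu> i j)) k)" for k
    unfolding fps_exp_nth divide_inverse by (intro rational_mult pw rational_const)
  show ?thesis
    unfolding transition_fps_def fps_mult_nth[of "_ * _" "fps_compose _ _"] fps_compose_nth
    by (intro rational_sum rational_mult rational_const e)
qed

section \<open>Regrouping into the three series\<close>

text \<open>The coefficient of x^n B^i A^j in the triple expansion of v.\<close>

definition mixed_coeff :: "complex \<Rightarrow> complex \<Rightarrow> nat \<Rightarrow> nat \<Rightarrow> nat \<Rightarrow> complex" where
  "mixed_coeff \<kappa> \<nu> i j n = cf (picard_sol \<kappa> \<nu>) i j * fps_nth (transition_fps (rate \<nu> i j)) n"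

text \<open>Since \<open>A B = x\<^sup>2 / 256\<close>, a monomial \<open>B ^ i * A ^ j\<close> reduces to a power of \<open>x\<close> times a pure
  power of \<open>A\<close> or of \<open>B\<close>.\<close>

definition coeff_a :: "complex \<Rightarrow> nat \<Rightarrow> complex \<Rightarrow> complex" where
  "coeff_a \<kappa> N \<nu> = (\<Sum>k\<le>N div 2. mixed_coeff \<kappa> \<nu> k k (N - 2 * k) / 256 ^ k)"
definition coeff_b :: "complex \<Rightarrow> nat \<Rightarrow> nat \<Rightarrow> complex \<Rightarrow> complex" where
  "coeff_b \<kappa> N m \<nu> = (\<Sum>k\<le>N div 2. mixed_coeff \<kappa> \<nu> k (m + k) (N - 2 * k) / 256 ^ k)"
definition coeff_c :: "complex \<Rightarrow> nat \<Rightarrow> nat \<Rightarrow> complex \<Rightarrow> complex" where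
  "coeff_c \<kappa> N m \<nu> = (\<Sum>k\<le>N div 2. mixed_coeff \<kappa> \<nu> (m + k) k (N - 2 * k) / 256 ^ k)"

lemma rational_mixed_coeff: "rational_function_on admissible (\<lambda>\<nu>. mixed_coeff \<kappa> \<nu> i j n / 256 ^ k)"
  unfolding mixed_coeff_def divide_inverse by (intro rational_mult rational_const rational_picard_sol rational_transition_fps)

lemma rational_coeffs:
  "rational_function_on admissible (coeff_a \<kappa> N)" "rational_function_on admissible (coeff_b \<kappa> N m)"
  "rational_function_on admissible (coeff_c \<kappa> N m)"
  unfolding coeff_a_def[abs_def] coeff_b_def[abs_def] coeff_c_def[abs_def] by (intro rational_sum rational_mixed_coeff)+

lemma AB_eq: "A \<nu>1 \<nu> s * B \<nu>1 \<nu> s = exp s ^ 2 / 256"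
proof -
  have n: "(16 :: complex) powr (2 - \<nu>) * 16 powr \<nu> = 256"
    by (simp add: powr_add[symmetric])
  have "A \<nu>1 \<nu> s * B \<nu>1 \<nu> s = (exp (- \<i> * of_real pi * \<nu>1) * exp (\<i> * of_real pi * \<nu>1)) * (exp ((2 - \<nu>) * s) * exp (\<nu> * s)) / (16 powr (2 - \<nu>) * 16 powr \<nu>)"
    by (simp add: A_def B_def)
  also have "exp (- \<i> * of_real pi * \<nu>1) * exp (\<i> * of_real pi * \<nu>1) = 1"
    by (simp flip: exp_add)
  also have "exp ((2 - \<nu>) * s) * exp (\<nu> * s) = exp s ^ 2"
    by (simp add: power2_eq_square algebra_simps flip: exp_add)
  finally show ?thesis unfolding n by simp
qed

text \<open>The triple sum is split into i = j, i < j and j < i. The common power k, the minimum of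
  i and j, of A B becomes x^(2 k) / 256^k, so the new exponent of x is N = n + 2 k.\<close>

lemma regroup_has_sums:
  fixes a b x :: complex
  assumes ab: "a * b = x\<^sup>2 / 256"
    and T: "(\<lambda>((i, j), n). mixed_coeff \<kappa> \<nu> i j n * x ^ n * b ^ i * a ^ j) summable_on UNIV"
  obtains Sa Sb Sc where
    "((\<lambda>n. coeff_a \<kappa> n \<nu> * x ^ n) has_sum Sa) {1..}"
    "((\<lambda>(n, m). coeff_b \<kappa> n m \<nu> * x ^ n * a ^ m) has_sum Sb) (UNIV \<times> {1..})"
    "((\<lambda>(n, m). coeff_c \<kappa> n m \<nu> * x ^ n * b ^ m) has_sum Sc) (UNIV \<times> {1..})"
    "(\<Sum>\<^sub>\<infinity>((i, j), n). mixed_coeff \<kappa> \<nu> i j n * x ^ n * b ^ i * a ^ j) = Sa + Sb + Sc"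
proof -
  define h where "h = (\<lambda>((i, j), n). mixed_coeff \<kappa> \<nu> i j n * x ^ n * b ^ i * a ^ j)"
  define De Db Dc where "De = {((i :: nat, j :: nat), n :: nat). i = j}" and "Db = {((i :: nat, j :: nat), n :: nat). i < j}"
    and "Dc = {((i :: nat, j :: nat), n :: nat). j < i}"
  have hs: "h summable_on D" for D using T summable_on_subset[of h UNIV D] by (simp add: h_def)
  have red: "x ^ (N - 2 * k) * b ^ k * a ^ k = x ^ N / 256 ^ k" if "k \<le> N div 2" for N k
  proof -
    have "x ^ N = x ^ (N - 2 * k) * (x\<^sup>2) ^ k" using that by (simp flip: power_mult power_add)
    moreover have "b ^ k * a ^ k = (x\<^sup>2 / 256) ^ k" by (simp flip: ab power_mult_distrib add: mult.commute)
    ultimately show ?thesis by (simp add: power_divide mult.assoc)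
  qed
  have "(h has_sum infsum h De) De" by (rule has_sum_infsum[OF hs])
  also have "?this \<longleftrightarrow> ((\<lambda>(N, k). mixed_coeff \<kappa> \<nu> k k (N - 2 * k) / 256 ^ k * x ^ N) has_sum infsum h De) (SIGMA N:UNIV. {..N div 2})"
  proof (rule has_sum_reindex_bij_witness[where j = "\<lambda>((i, j), n). (n + 2 * i, i)" and i = "\<lambda>(N, k). ((k, k), N - 2 * k)"])
    show "(\<lambda>(N, k). mixed_coeff \<kappa> \<nu> k k (N - 2 * k) / 256 ^ k * x ^ N) ((\<lambda>((i, j), n). (n + 2 * i, i)) z) = h z" if zD: "z \<in> De" for z
    proof -
      obtain i n where z: "z = ((i, i), n)" using zD by (auto simp: De_def)
      show ?thesis using red[of i "n + 2 * i"] by (simp add: z h_def mult.assoc)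
    qed
  qed (auto simp: De_def)
  finally have "((\<lambda>(N, k). mixed_coeff \<kappa> \<nu> k k (N - 2 * k) / 256 ^ k * x ^ N) has_sum infsum h De) (SIGMA N:UNIV. {..N div 2})" .
  then have "((\<lambda>N. coeff_a \<kappa> N \<nu> * x ^ N) has_sum infsum h De) UNIV"
    by (rule has_sum_SigmaD) (auto simp: coeff_a_def sum_distrib_right intro!: has_sum_finiteI)
  \<comment> \<open>The coefficient at N = 0 contains the constant term of the Picard solution,
    which is zero; hence the first series starts at 1.\<close>
  also have "?this \<longleftrightarrow> ((\<lambda>N. coeff_a \<kappa> N \<nu> * x ^ N) has_sum infsum h De) {1..}"
  proof (rule has_sum_cong_neutral)
    fix N :: nat assume "N \<in> UNIV - {1..}"
    then have "N = 0" by simp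
    then show "coeff_a \<kappa> N \<nu> * x ^ N = 0" using zero_const_picard_sol[of \<kappa> \<nu>] by (simp add: coeff_a_def mixed_coeff_def zero_const_def)
  qed auto
  finally have 1: "((\<lambda>n. coeff_a \<kappa> n \<nu> * x ^ n) has_sum infsum h De) {1..}" .
  have "(h has_sum infsum h Dc) Dc" by (rule has_sum_infsum[OF hs])
  also have "?this \<longleftrightarrow> ((\<lambda>((N, m), k). mixed_coeff \<kappa> \<nu> (m + k) k (N - 2 * k) / 256 ^ k * x ^ N * b ^ m) has_sum infsum h Dc) (SIGMA (N, m):UNIV \<times> {1..}. {..N div 2})"
  proof (rule has_sum_reindex_bij_witness[where j = "\<lambda>((i, j), n). ((n + 2 * j, i - j), j)" and i = "\<lambda>((N, m), k). ((m + k, k), N - 2 * k)"])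
    show "(\<lambda>((N, m), k). mixed_coeff \<kappa> \<nu> (m + k) k (N - 2 * k) / 256 ^ k * x ^ N * b ^ m) ((\<lambda>((i, j), n). ((n + 2 * j, i - j), j)) z) = h z" if zD: "z \<in> Dc" for z
    proof -
      obtain i j n where z: "z = ((i, j), n)" "j < i" using zD by (auto simp: Dc_def)
      have "b ^ i = b ^ (i - j) * b ^ j" using z(2) by (simp flip: power_add)
      then have "h z = mixed_coeff \<kappa> \<nu> i j n * (x ^ n * b ^ j * a ^ j) * b ^ (i - j)" by (simp add: z h_def mult_ac)
      also have "x ^ n * b ^ j * a ^ j = x ^ (n + 2 * j) / 256 ^ j" using red[of j "n + 2 * j"] by simp
      finally show ?thesis using z(2) by (simp add: z(1))
    qed
  qed (auto simp: Dc_def)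
  finally have "((\<lambda>((N, m), k). mixed_coeff \<kappa> \<nu> (m + k) k (N - 2 * k) / 256 ^ k * x ^ N * b ^ m) has_sum infsum h Dc) (SIGMA (N, m):UNIV \<times> {1..}. {..N div 2})" .
  then have 3: "((\<lambda>(n, m). coeff_c \<kappa> n m \<nu> * x ^ n * b ^ m) has_sum infsum h Dc) (UNIV \<times> {1..})"
    by (rule has_sum_SigmaD) (auto simp: coeff_c_def sum_distrib_right intro!: has_sum_finiteI)
  have "(h has_sum infsum h Db) Db" by (rule has_sum_infsum[OF hs])
  also have "?this \<longleftrightarrow> ((\<lambda>((N, m), k). mixed_coeff \<kappa> \<nu> k (m + k) (N - 2 * k) / 256 ^ k * x ^ N * a ^ m) has_sum infsum h Db) (SIGMA (N, m):UNIV \<times> {1..}. {..N div 2})"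
  proof (rule has_sum_reindex_bij_witness[where j = "\<lambda>((i, j), n). ((n + 2 * i, j - i), i)" and i = "\<lambda>((N, m), k). ((k, m + k), N - 2 * k)"])
    show "(\<lambda>((N, m), k). mixed_coeff \<kappa> \<nu> k (m + k) (N - 2 * k) / 256 ^ k * x ^ N * a ^ m) ((\<lambda>((i, j), n). ((n + 2 * i, j - i), i)) z) = h z" if zD: "z \<in> Db" for z
    proof -
      obtain i j n where z: "z = ((i, j), n)" "i < j" using zD by (auto simp: Db_def)
      have "a ^ j = a ^ (j - i) * a ^ i" using z(2) by (simp flip: power_add)
      then have "h z = mixed_coeff \<kappa> \<nu> i j n * (x ^ n * b ^ i * a ^ i) * a ^ (j - i)" by (simp add: z h_def mult_ac)
      also have "x ^ n * b ^ i * a ^ i = x ^ (n + 2 * i) / 256 ^ i" using red[of i "n + 2 * i"] by simp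
      finally show ?thesis using z(2) by (simp add: z(1))
    qed
  qed (auto simp: Db_def)
  finally have "((\<lambda>((N, m), k). mixed_coeff \<kappa> \<nu> k (m + k) (N - 2 * k) / 256 ^ k * x ^ N * a ^ m) has_sum infsum h Db) (SIGMA (N, m):UNIV \<times> {1..}. {..N div 2})" .
  then have 2: "((\<lambda>(n, m). coeff_b \<kappa> n m \<nu> * x ^ n * a ^ m) has_sum infsum h Db) (UNIV \<times> {1..})"
    by (rule has_sum_SigmaD) (auto simp: coeff_b_def sum_distrib_right intro!: has_sum_finiteI)
  have U: "(UNIV :: ((nat \<times> nat) \<times> nat) set) = De \<union> (Db \<union> Dc)" by (auto simp: De_def Db_def Dc_def)
  have "infsum h UNIV = infsum h De + (infsum h Db + infsum h Dc)"
  proof -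
    have "infsum h (Db \<union> Dc) = infsum h Db + infsum h Dc"
      by (rule infsum_Un_disjoint[OF hs hs]) (auto simp: Db_def Dc_def)
    moreover have "infsum h (De \<union> (Db \<union> Dc)) = infsum h De + infsum h (Db \<union> Dc)"
      by (rule infsum_Un_disjoint[OF hs hs]) (auto simp: De_def Db_def Dc_def)
    ultimately show ?thesis unfolding U by simp
  qed
  then have eq: "infsum h UNIV = infsum h De + infsum h Db + infsum h Dc" by simp
  show ?thesis by (rule that[OF 1 2 3]) (use eq in \<open>simp add: h_def[symmetric]\<close>)
qed

section \<open>Construction of the solution\<close>

text \<open>All claims for one choice of parameters under one name, so that r and M can be
  quantified before \<nu>1.\<close>

definition elliptic_solution :: "complex \<Rightarrow> complex \<Rightarrow> real \<Rightarrow> real \<Rightarrow> complex \<Rightarrow> (complex \<Rightarrow> complex) \<Rightarrow> bool" where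
  "elliptic_solution \<mu> \<nu> r M \<nu>1 v \<longleftrightarrow>
     (let \<kappa> = 2 * (2 * \<mu> - 1)\<^sup>2; S = PVI_domain r \<nu>1 \<nu> in
       PVI_solution_on \<mu> S (\<lambda>s. wp (\<nu>1 * \<omega>1 s + \<nu> * \<omega>2 s + v s) (\<omega>1 s) (\<omega>2 s) + (1 + exp s) / 3) \<and>
       v holomorphic_on S \<and>
       (\<forall>s\<in>S. \<exists>Sa Sb Sc.
          ((\<lambda>n. coeff_a \<kappa> n \<nu> * exp s ^ n) has_sum Sa) {1..} \<and>
          ((\<lambda>(n, m). coeff_b \<kappa> n m \<nu> * exp s ^ n * A \<nu>1 \<nu> s ^ m) has_sum Sb) (UNIV \<times> {1..}) \<and>
          ((\<lambda>(n, m). coeff_c \<kappa> n m \<nu> * exp s ^ n * B \<nu>1 \<nu> s ^ m) has_sum Sc) (UNIV \<times> {1..}) \<and>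
          v s = Sa + Sb + Sc) \<and>
       (\<forall>s\<in>S. norm (v s) \<le> M * (norm (exp s) + norm (A \<nu>1 \<nu> s) + norm (B \<nu>1 \<nu> s))))"

text \<open>\<nu>1 occurs only in the factors exp (i pi \<nu>1) and its inverse, which are contained
  in \<open>B\<close> and \<open>A\<close>; as the domain bounds these two, r and M are fixed
  first.\<close>

theorem elliptic_PVI_family:
  assumes \<nu>: "\<nu> \<in> admissible"
  obtains r M where "0 < r" "r < 1" "\<And>\<nu>1. \<exists>v. elliptic_solution \<mu> \<nu> r M \<nu>1 v"
proof -
  define \<kappa> where "\<kappa> = 2 * (2 * \<mu> - 1)\<^sup>2"
  obtain R G where R: "0 < R" "R \<le> 1" and Gh: "G holomorphic_on ball 0 R"
    and Fh: "F holomorphic_on ball 0 R" and F1h: "F1 holomorphic_on ball 0 R"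
    and F0: "F 0 = 1" and F10: "F1 0 = - 4 * of_real (ln 2)"
    and G1: "\<And>x. x \<in> ball 0 R \<Longrightarrow> norm (G x) < 1"
    and Fnz: "\<And>x. x \<in> ball 0 R \<Longrightarrow> F x \<noteq> 0"
    and Gexp: "\<And>x. x \<in> ball 0 R \<Longrightarrow> G x = x * exp (F1 x / F x)"
    and F2: "\<And>x. x \<in> ball 0 R \<Longrightarrow> (F x)\<^sup>2 = 4 * (s2 (G x) - s1 (G x))"
    and s23: "\<And>x. x \<in> ball 0 R \<Longrightarrow> x \<noteq> 0 \<Longrightarrow> s2 (G x) \<noteq> s3 (G x)"
    and srel: "\<And>x. x \<in> ball 0 R \<Longrightarrow> s3 (G x) - s2 (G x) = x * (s1 (G x) - s2 (G x))"
    and dG: "\<And>x. x \<in> ball 0 R \<Longrightarrow> (F x)\<^sup>2 * x * (1 - x) * deriv G x = G x"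
    using nome_of_x by blast
  obtain c where c: "c > 0" "\<forall>i j. i + j > 0 \<longrightarrow> c \<le> norm (rate \<nu> i j)"
    using admissible_rate_lower_bound[OF \<nu>] by metis
  obtain \<rho> where \<rho>: "\<rho> > 0" "\<rho> * exp 1 < 1" and small: "norm \<kappa> * phi_majorant (\<rho> * exp 1) \<le> c\<^sup>2"
    using exists_small_radius[OF c(1)] by blast
  have \<rho>0: "0 \<le> \<rho>" using \<rho> by simp
  note picard_sol_norm' = picard_sol_norm[OF \<rho>0 \<rho>(2) c small]
    and norm_ev' = norm_eval2_picard_sol_le[OF \<rho>0 \<rho>(2) c small]
    and eval2_Src' = eval2_source_coeff[OF \<rho>0 \<rho>(2) c small]
    and eval2_deriv' = eval2_picard_sol_second_derivative[OF \<rho>0 \<rho>(2) c small \<rho>(1)]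
  have gh: "nome_shift holomorphic_on ball 0 R"
    unfolding nome_shift_def[abs_def] by (intro holomorphic_intros F1h Fh Fnz)
  have g0: "nome_shift 0 = 0" by (simp add: nome_shift_def F0 F10)
  define r1 where "r1 = R / 2"
  have r1: "0 < r1" "r1 < R" using R by (auto simp: r1_def)
  have bdd: "\<exists>C. \<forall>x\<in>cball 0 r1. norm (h x) \<le> C" if "h holomorphic_on ball 0 R" for h :: "complex \<Rightarrow> complex"
  proof -
    have "continuous_on (cball 0 r1) h"
      using holomorphic_on_imp_continuous_on[OF that] r1 by (auto intro: continuous_on_subset)
    then have "bounded (h ` cball 0 r1)" by (intro compact_imp_bounded compact_continuous_image) auto
    then show ?thesis by (auto simp: bounded_iff)
  qed
  obtain CF where CF: "\<And>x. x \<in> cball 0 r1 \<Longrightarrow> norm (F x) \<le> CF" using bdd[OF Fh] by blast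
  obtain Cg where Cg: "\<And>x. x \<in> cball 0 r1 \<Longrightarrow> norm (nome_shift x) \<le> Cg" using bdd[OF gh] by blast
  have CF0: "CF \<ge> 0" by (rule order_trans[OF norm_ge_zero CF[of 0]]) (use r1 in auto)
  have Cg0: "Cg \<ge> 0" by (rule order_trans[OF norm_ge_zero Cg[of 0]]) (use r1 in auto)
  define L where "L = max (norm \<nu>) (norm (2 - \<nu>))"
  \<comment> \<open>K bounds what a monomial gains, per degree, when \<open>B\<close> and
    \<open>A\<close> are replaced by their counterparts Z0 and W0 in the nome.\<close>
  define K where "K = exp (L * Cg)"
  have K1: "K \<ge> 1" using Cg0 norm_ge_zero[of \<nu>] by (simp add: K_def L_def le_max_iff_disj)
  \<comment> \<open>The first bound lets the powers of x / r1 decay like 2^(-n); the second keeps Z0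
    and W0 within the radius \<rho> of the Picard solution.\<close>
  define r where "r = min (r1 / 2) (\<rho> / K)"
  have "0 < r" using r1 \<rho>(1) K1 by (simp add: r_def)
  have r2: "r \<le> r1 / 2" "r \<le> \<rho> / K" unfolding r_def by (rule min.cobounded1 min.cobounded2)+
  have "r * K \<le> \<rho> / K * K" by (rule mult_right_mono[OF r2(2)]) (use K1 in auto)
  with r2 \<open>0 < r\<close> have r: "0 < r" "r < 1" "r \<le> r1 / 2" "r * K \<le> \<rho>"
    using R K1 by (auto simp: r1_def)
  have ExL: "norm (rate \<nu> i j) \<le> real (i + j) * L" for i j
  proof -
    have "norm (rate \<nu> i j) \<le> real i * norm \<nu> + real j * norm (2 - \<nu>)"
      unfolding rate_def using norm_triangle_ineq[of "of_nat i * \<nu>" "of_nat j * (2 - \<nu>)"] by (simp add: norm_mult)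
    also have "\<dots> \<le> real i * L + real j * L" by (intro add_mono mult_left_mono) (auto simp: L_def)
    finally show ?thesis by (simp add: distrib_right)
  qed
  have expK: "norm (exp (rate \<nu> i j * nome_shift x)) \<le> K ^ (i + j)" if "x \<in> cball 0 r1" for i j x
  proof -
    have "norm (exp (rate \<nu> i j * nome_shift x)) \<le> exp (norm (rate \<nu> i j * nome_shift x))" by (rule norm_exp)
    also have "norm (rate \<nu> i j * nome_shift x) \<le> real (i + j) * L * Cg"
      unfolding norm_mult by (intro mult_mono ExL Cg that mult_nonneg_nonneg) (auto simp: L_def le_max_iff_disj)
    finally show ?thesis by (simp add: K_def exp_of_nat_mult[symmetric] mult.assoc)
  qed
  have Hexp: "(\<lambda>x. F x / (2 * \<i>) * exp (l * nome_shift x)) has_fps_expansion transition_fps l"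
    and Hhol: "(\<lambda>x. F x / (2 * \<i>) * exp (l * nome_shift x)) holomorphic_on ball 0 R" for l
  proof -
    have Fe: "F has_fps_expansion fps_expansion F 0" and ge: "nome_shift has_fps_expansion fps_expansion nome_shift 0"
      using R by (auto intro!: has_fps_expansion_fps_expansion[OF open_ball] Fh gh)
    have "fps_nth (fps_expansion nome_shift 0) 0 = 0" using has_fps_expansion_imp_0_eq_fps_nth_0[OF ge] g0 by simp
    then have "((\<lambda>x. exp (l * x)) \<circ> nome_shift) has_fps_expansion fps_compose (fps_exp l) (fps_expansion nome_shift 0)"
      by (intro has_fps_expansion_compose has_fps_expansion_exp ge)
    then have "(\<lambda>x. 1 / (2 * \<i>) * F x * ((\<lambda>x. exp (l * x)) \<circ> nome_shift) x) has_fps_expansion transition_fps l"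
      unfolding transition_fps_def by (intro has_fps_expansion_mult has_fps_expansion_const Fe)
    then show "(\<lambda>x. F x / (2 * \<i>) * exp (l * nome_shift x)) has_fps_expansion transition_fps l" by (simp add: o_def)
    show "(\<lambda>x. F x / (2 * \<i>) * exp (l * nome_shift x)) holomorphic_on ball 0 R"
      by (intro holomorphic_intros Fh gh) auto
  qed
  \<comment> \<open>Cauchy's estimate on the circle of radius r1; the growth K^(i + j) is later
    absorbed by r K <= \<rho>.\<close>
  have Hbound: "norm (fps_nth (transition_fps (rate \<nu> i j)) n) \<le> CF * K ^ (i + j) / r1 ^ n" for i j n
  proof (rule fps_exp_coeff_bound[OF Hhol Hexp r1])
    fix x :: complex assume "norm x = r1"
    then have x: "x \<in> cball 0 r1" by simp
    have "norm (F x / (2 * \<i>)) \<le> CF" using CF[OF x] CF0 by (simp add: norm_divide norm_mult)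
    then show "norm (F x / (2 * \<i>) * exp (rate \<nu> i j * nome_shift x)) \<le> CF * K ^ (i + j)"
      unfolding norm_mult[of "F x / (2 * \<i>)"] by (intro mult_mono expK x) (use CF0 in auto)
  qed
  define M where "M = CF * K / \<rho>"
  have M0: "M \<ge> 0" using CF0 K1 \<rho> by (simp add: M_def)
  have "\<exists>v. elliptic_solution \<mu> \<nu> r M \<nu>1 v" for \<nu>1
  proof -
    define S where "S = PVI_domain r \<nu>1 \<nu>"
    have S: "open S"
      unfolding S_def PVI_domain_def A_def B_def
      by (intro open_Collect_conj open_Collect_less continuous_intros) auto
    have xr: "norm (exp s) < r" "norm (A \<nu>1 \<nu> s) < r" "norm (B \<nu>1 \<nu> s) < r" if "s \<in> S" for s
      using that by (auto simp: S_def PVI_domain_def)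
    have xR: "exp s \<in> ball 0 R" "exp s \<in> cball 0 r1" if "s \<in> S" for s
      using xr(1)[OF that] r r1 by auto
    define t where "t s = s + F1 (exp s) / F (exp s)" for s
    define t' where "t' s = exp s * deriv G (exp s) / G (exp s)" for s
    define a0 b0 where "a0 = exp (\<i> * of_real pi * \<nu>1)" and "b0 = exp (- \<i> * of_real pi * \<nu>1)"
    \<comment> \<open>The curve for V = 0. Up to the factor from \<open>nome_shift\<close>, Z0 is
      \<open>B\<close> and W0 is \<open>A\<close>.\<close>
    define Z0 W0 where "Z0 s = a0 * exp (\<nu> * t s)" and "W0 s = b0 * exp ((2 - \<nu>) * t s)" for s
    have qG: "exp (t s) = G (exp s)" if "s \<in> S" for s
      using Gexp[OF xR(1)[OF that]] by (simp add: t_def exp_add)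
    have Gnz: "G (exp s) \<noteq> 0" if "s \<in> S" for s using qG[OF that] by (metis exp_not_eq_zero)
    have tg: "t s = s + nome_shift (exp s) - 4 * of_real (ln 2)" for s by (simp add: t_def nome_shift_def)
    have Z0B: "Z0 s = B \<nu>1 \<nu> s * exp (\<nu> * nome_shift (exp s))" for s
      unfolding Z0_def tg a0_def B_def exp_ln_16[symmetric]
      by (simp add: exp_add exp_diff exp_minus algebra_simps divide_inverse)
    have W0A: "W0 s = A \<nu>1 \<nu> s * exp ((2 - \<nu>) * nome_shift (exp s))" for s
    proof -
      have "(2 - \<nu>) * t s = (2 - \<nu>) * s + (2 - \<nu>) * nome_shift (exp s) - 4 * of_real (ln 2) * (2 - \<nu>)"
        unfolding tg by (simp add: algebra_simps)
      then show ?thesis unfolding W0_def b0_def A_def exp_ln_16[symmetric] by (simp add: exp_add exp_diff)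
    qed
    have nZ0: "norm (Z0 s) \<le> K * norm (B \<nu>1 \<nu> s)" and nW0: "norm (W0 s) \<le> K * norm (A \<nu>1 \<nu> s)" if s: "s \<in> S" for s
    proof -
      have "norm (exp (\<nu> * nome_shift (exp s))) \<le> K" using expK[OF xR(2)[OF s], of 1 0] by (simp add: rate_def)
      then show "norm (Z0 s) \<le> K * norm (B \<nu>1 \<nu> s)" unfolding Z0B norm_mult[of "B \<nu>1 \<nu> s"] mult.commute[of K] by (rule mult_left_mono) simp
      have "norm (exp ((2 - \<nu>) * nome_shift (exp s))) \<le> K" using expK[OF xR(2)[OF s], of 0 1] by (simp add: rate_def)
      then show "norm (W0 s) \<le> K * norm (A \<nu>1 \<nu> s)" unfolding W0A norm_mult[of "A \<nu>1 \<nu> s"] mult.commute[of K] by (rule mult_left_mono) simp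
    qed
    have lt0: "norm (Z0 s) < \<rho>" "norm (W0 s) < \<rho>" if s: "s \<in> S" for s
    proof -
      have "K * norm (B \<nu>1 \<nu> s) < K * r" "K * norm (A \<nu>1 \<nu> s) < K * r" using xr[OF s] K1 by auto
      then show "norm (Z0 s) < \<rho>" "norm (W0 s) < \<rho>" using nZ0[OF s] nW0[OF s] r(4) by (auto simp: mult.commute)
    qed
    define U where "U = {\<tau>. norm (a0 * exp (\<nu> * \<tau>)) < \<rho> \<and> norm (b0 * exp ((2 - \<nu>) * \<tau>)) < \<rho>}"
    have U: "open U" unfolding U_def by (intro open_Collect_conj open_Collect_less continuous_intros)
    have tU: "t s \<in> U" if "s \<in> S" for s using lt0[OF that] by (simp add: U_def Z0_def W0_def)
    define V where "V \<tau> = eval2 (picard_sol \<kappa> \<nu>) (a0 * exp (\<nu> * \<tau>)) (b0 * exp ((2 - \<nu>) * \<tau>))" for \<tau>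
    obtain v1 where v1: "\<And>\<tau>. \<tau> \<in> U \<Longrightarrow> (V has_field_derivative v1 \<tau>) (at \<tau>)"
      "\<And>\<tau>. \<tau> \<in> U \<Longrightarrow> (v1 has_field_derivative \<kappa> * X 2 (- 1) (a0 * exp (\<nu> * \<tau>) * exp (V \<tau>)) (b0 * exp ((2 - \<nu>) * \<tau>) * exp (- V \<tau>))) (at \<tau>)"
      unfolding V_def by (rule eval2_deriv'[OF U, of a0 b0]) (auto simp: U_def)
    \<comment> \<open>Determined by pi i v / \<omega>1 = V, with \<omega>1 = pi F / 2.\<close>
    define v where "v s = F (exp s) / (2 * \<i>) * V (t s)" for s
    \<comment> \<open>Differentiability comes from the formula for t, the value t' from
      differentiating exp (t s) = G (exp s).\<close>
    have dt: "(t has_field_derivative t' s) (at s)" if s: "s \<in> S" for s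
    proof -
      have "\<exists>d. (t has_field_derivative d) (at s)"
        unfolding t_def[abs_def]
        by (rule exI, rule DERIV_add[OF DERIV_ident DERIV_divide[OF
                DERIV_chain2[OF holomorphic_derivI[OF F1h open_ball xR(1)[OF s]] DERIV_exp]
                DERIV_chain2[OF holomorphic_derivI[OF Fh open_ball xR(1)[OF s]] DERIV_exp] Fnz[OF xR(1)[OF s]]]])
      then obtain d where d: "(t has_field_derivative d) (at s)" by blast
      have "((\<lambda>s. exp (t s)) has_field_derivative exp (t s) * d) (at s)" by (rule DERIV_chain2[OF DERIV_exp d])
      moreover have "((\<lambda>s. G (exp s)) has_field_derivative deriv G (exp s) * exp s) (at s)"
        by (rule DERIV_chain2[OF holomorphic_derivI[OF Gh open_ball xR(1)[OF s]] DERIV_exp])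
      ultimately have "exp (t s) * d = deriv G (exp s) * exp s"
        by (rule DERIV_unique_local[OF _ _ S s qG])
      then have "d = t' s" using Gnz[OF s] by (simp add: t'_def qG[OF s] field_simps)
      then show ?thesis using d by simp
    qed
    define lz where "lz s = \<i> * of_real pi * \<nu>1 + \<nu> * t s + V (t s)" for s
    define lz1 where "lz1 s = \<nu> + v1 (t s)" for s
    have Zeq: "exp (lz s) = Z0 s * exp (V (t s))" for s by (simp add: lz_def exp_add Z0_def a0_def)
    have Weq: "exp (2 * t s - lz s) = W0 s * exp (- V (t s))" for s
      unfolding W0_def b0_def by (simp add: lz_def exp_add[symmetric] algebra_simps)
    have dlz: "(lz has_field_derivative lz1 s * t' s) (at s)" if s: "s \<in> S" for s
      unfolding lz_def[abs_def] lz1_def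
      by (rule DERIV_cong[OF DERIV_add[OF DERIV_add[OF DERIV_const DERIV_cmult[OF dt[OF s]]] DERIV_chain2[OF v1(1)[OF tU[OF s]] dt[OF s]]]])
         (simp add: algebra_simps)
    have dlz1: "(lz1 has_field_derivative 2 * (2 * \<mu> - 1)\<^sup>2 * X 2 (- 1) (exp (lz s)) (exp (2 * t s - lz s)) * t' s) (at s)" if s: "s \<in> S" for s
      unfolding lz1_def[abs_def] Zeq Weq
      by (rule DERIV_cong[OF DERIV_add[OF DERIV_const DERIV_chain2[OF v1(2)[OF tU[OF s]] dt[OF s]]]])
         (simp add: Z0_def W0_def \<kappa>_def)
    have nZ: "norm (exp (lz s)) < 1" and nW: "norm (exp (2 * t s - lz s)) < 1" if s: "s \<in> S" for s
      unfolding Zeq Weq using eval2_Src'(2,3)[of "Z0 s" "W0 s"] lt0[OF s] \<rho> by (auto simp: V_def Z0_def W0_def less_imp_le)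
    have s12: "s1 (G (exp s)) \<noteq> s2 (G (exp s))" if s: "s \<in> S" for s
      using F2[OF xR(1)[OF s]] Fnz[OF xR(1)[OF s]] by auto
    have x1: "exp s \<noteq> 1" if s: "s \<in> S" for s
    proof
      assume "exp s = 1"
      then show False using xr(1)[OF s] r by simp
    qed
    have sol: "PVI_solution_on \<mu> S (\<lambda>s. (X 1 1 (exp (lz s)) (exp (2 * t s - lz s)) - s2 (exp (t s))) / (s1 (exp (t s)) - s2 (exp (t s))))"
    proof (rule PVI_of_second_order[OF S dt dlz dlz1 nZ nW])
      fix s assume s: "s \<in> S"
      show "norm (exp (t s)) < 1" "s2 (exp (t s)) \<noteq> s3 (exp (t s))" "s1 (exp (t s)) \<noteq> s2 (exp (t s))"
         "s3 (exp (t s)) - s2 (exp (t s)) = exp s * (s1 (exp (t s)) - s2 (exp (t s)))" "exp s \<noteq> 1"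
        unfolding qG[OF s] using G1[OF xR(1)[OF s]] s23[OF xR(1)[OF s]] s12[OF s] srel[OF xR(1)[OF s]] x1[OF s] by auto
      have "4 * (s1 (G (exp s)) - s2 (G (exp s))) = - (F (exp s))\<^sup>2" unfolding F2[OF xR(1)[OF s]] by simp
      then have "4 * (s1 (G (exp s)) - s2 (G (exp s))) * t' s * (1 - exp s) = - (((F (exp s))\<^sup>2 * exp s * (1 - exp s) * deriv G (exp s)) / G (exp s))"
        by (simp add: t'_def mult_ac)
      then show "4 * (s1 (exp (t s)) - s2 (exp (t s))) * t' s * (1 - exp s) = - 1"
        unfolding qG[OF s] dG[OF xR(1)[OF s]] using Gnz[OF s] by simp
    qed
    have wpeq: "(X 1 1 (exp (lz s)) (exp (2 * t s - lz s)) - s2 (exp (t s))) / (s1 (exp (t s)) - s2 (exp (t s)))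
        = wp (\<nu>1 * \<omega>1 s + \<nu> * \<omega>2 s + v s) (\<omega>1 s) (\<omega>2 s) + (1 + exp s) / 3" if s: "s \<in> S" for s
    proof -
      note Fn = Fnz[OF xR(1)[OF s]]
      have w1: "\<omega>1 s \<noteq> 0" using Fn by (simp add: \<omega>1_def)
      have w21: "\<omega>2 s / \<omega>1 s = - \<i> / of_real pi * t s"
        using Fn by (simp add: \<omega>1_def \<omega>2_def t_def field_simps)
      have "norm (exp (t s)) < 1" using G1[OF xR(1)[OF s]] by (simp add: qG[OF s])
      then have "Re (t s) < 0" by (simp add: norm_exp_eq_Re)
      \<comment> \<open>The imaginary part of the period ratio is - Re t / pi, positive because the
        nome lies in the unit disc.\<close>
      then have Im: "Im (\<omega>2 s / \<omega>1 s) > 0" unfolding w21 by (simp add: divide_neg_pos)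
      have u: "of_real pi * \<i> * (\<nu>1 * \<omega>1 s + \<nu> * \<omega>2 s + v s) / \<omega>1 s = lz s"
      proof -
        have "of_real pi * \<i> * (\<nu>1 * \<omega>1 s + \<nu> * \<omega>2 s + v s) / \<omega>1 s
          = of_real pi * \<i> * \<nu>1 + \<nu> * (of_real pi * \<i> * (\<omega>2 s / \<omega>1 s)) + of_real pi * \<i> * (v s / \<omega>1 s)"
          using w1 by (simp add: field_simps)
        also have "of_real pi * \<i> * (\<omega>2 s / \<omega>1 s) = t s" unfolding w21 by simp
        also have "of_real pi * \<i> * (v s / \<omega>1 s) = V (t s)" using Fn by (simp add: v_def \<omega>1_def)
        finally show ?thesis by (simp add: lz_def mult_ac)
      qed
      have p: "2 * of_real pi * \<i> * \<omega>2 s / \<omega>1 s = 2 * t s"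
      proof -
        have "2 * of_real pi * \<i> * \<omega>2 s / \<omega>1 s = 2 * of_real pi * \<i> * (\<omega>2 s / \<omega>1 s)" by simp
        then show ?thesis unfolding w21 by simp
      qed
      have W: "exp (2 * t s) / exp (lz s) = exp (2 * t s - lz s)" by (simp add: exp_diff)
      have wpX: "wp (\<nu>1 * \<omega>1 s + \<nu> * \<omega>2 s + v s) (\<omega>1 s) (\<omega>2 s)
         = - (of_real pi / \<omega>1 s)\<^sup>2 * (X 1 1 (exp (lz s)) (exp (2 * t s - lz s)) + lamb_\<alpha> (exp (2 * t s)) / 12)"
        using wp_eq_lambert[OF w1 Im, of "\<nu>1 * \<omega>1 s + \<nu> * \<omega>2 s + v s"] nZ[OF s] nW[OF s] unfolding u p W by simp
      define e1 e2 e3 where "e1 = s1 (exp (t s))" and "e2 = s2 (exp (t s))" and "e3 = s3 (exp (t s))"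
      have al: "lamb_\<alpha> (exp (2 * t s)) = - 4 * (e1 + e2 + e3)"
      proof -
        have "exp (2 * t s) = (exp (t s))\<^sup>2" by (simp add: power2_eq_square flip: exp_add)
        then show ?thesis by (simp add: lamb_\<alpha>_eq e1_def e2_def e3_def)
      qed
      have d: "e1 - e2 \<noteq> 0" using s12[OF s] by (simp add: e1_def e2_def qG[OF s])
      have ex: "exp s = (e3 - e2) / (e1 - e2)"
        using srel[OF xR(1)[OF s]] d by (simp add: e1_def e2_def e3_def qG[OF s] eq_divide_eq)
      \<comment> \<open>The relation between F^2 and s2 - s1 fixes the scale: \<wp> is (X - (e1 + e2
        + e3) / 3) / (e1 - e2). Replacing the mean of the roots by e2 adds (1 + x) / 3, since x is
        the cross ratio of the roots.\<close>
      have "(of_real pi / \<omega>1 s)\<^sup>2 = 4 / (F (exp s))\<^sup>2" using Fn by (simp add: \<omega>1_def power_divide power_mult_distrib)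
      also have "\<dots> = 1 / (e2 - e1)"
      proof -
        have "4 / (4 * z) = 1 / z" for z :: complex by simp
        then show ?thesis unfolding F2[OF xR(1)[OF s]] e1_def e2_def qG[OF s] .
      qed
      also have "\<dots> = - (1 / (e1 - e2))" using minus_divide_right[of 1 "e1 - e2"] by simp
      finally have pw: "- (of_real pi / \<omega>1 s)\<^sup>2 = 1 / (e1 - e2)" by simp
      have "(Y - e2) / (e1 - e2) = 1 / (e1 - e2) * (Y + - 4 * (e1 + e2 + e3) / 12) + (1 + (e3 - e2) / (e1 - e2)) / 3" for Y
        using d by (simp add: divide_simps) (simp add: algebra_simps)
      then show ?thesis unfolding wpX pw al ex e1_def[symmetric] e2_def[symmetric] .
    qed
    have "PVI_solution_on \<mu> S (\<lambda>s. wp (\<nu>1 * \<omega>1 s + \<nu> * \<omega>2 s + v s) (\<omega>1 s) (\<omega>2 s) + (1 + exp s) / 3)"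
      by (rule PVI_solution_on_cong[OF S wpeq sol])
    moreover have "v holomorphic_on S"
    proof -
      have "\<exists>d. (v has_field_derivative d) (at s)" if s: "s \<in> S" for s
        unfolding v_def[abs_def]
        by (rule exI, rule DERIV_mult[OF DERIV_cdivide[OF DERIV_chain2[OF holomorphic_derivI[OF Fh open_ball xR(1)[OF s]] DERIV_exp]]
              DERIV_chain2[OF v1(1)[OF tU[OF s]] dt[OF s]]])
      then show ?thesis using S by (auto simp: holomorphic_on_open)
    qed
    moreover have "\<exists>Sa Sb Sc.
          ((\<lambda>n. coeff_a \<kappa> n \<nu> * exp s ^ n) has_sum Sa) {1..} \<and>
          ((\<lambda>(n, m). coeff_b \<kappa> n m \<nu> * exp s ^ n * A \<nu>1 \<nu> s ^ m) has_sum Sb) (UNIV \<times> {1..}) \<and>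
          ((\<lambda>(n, m). coeff_c \<kappa> n m \<nu> * exp s ^ n * B \<nu>1 \<nu> s ^ m) has_sum Sc) (UNIV \<times> {1..}) \<and>
          v s = Sa + Sb + Sc" if s: "s \<in> S" for s
    proof -
      define x a b where "x = exp s" and "a = A \<nu>1 \<nu> s" and "b = B \<nu>1 \<nu> s"
      have xab: "norm x < r" "norm a < r" "norm b < r" using xr[OF s] by (auto simp: x_def a_def b_def)
      define h where "h = (\<lambda>((i, j), n). mixed_coeff \<kappa> \<nu> i j n * x ^ n * b ^ i * a ^ j)"
      have row: "((\<lambda>n. h (z, n)) has_sum (case z of (i, j) \<Rightarrow> F x / (2 * \<i>) * (cf (picard_sol \<kappa> \<nu>) i j * Z0 s ^ i * W0 s ^ j))) UNIV"
        and rown: "(\<lambda>n. norm (h (z, n))) summable_on UNIV"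
        and rowb: "(\<Sum>\<^sub>\<infinity>n. norm (h (z, n))) \<le> 2 * CF * (case z of (i, j) \<Rightarrow> norm (cf (picard_sol \<kappa> \<nu>) i j) * \<rho> ^ (i + j))" for z
      proof -
        obtain i j where z: "z = (i, j)" by (cases z)
        define D where "D = norm (cf (picard_sol \<kappa> \<nu>) i j) * \<rho> ^ (i + j)"
        have D0: "D \<ge> 0" using \<rho>0 by (simp add: D_def)
        \<comment> \<open>Three bounds combine: the coefficients grow at most like K^(i + j) / r1^n,
          the moduli of \<open>A\<close> and \<open>B\<close> stay below r with r K <= \<rho>, and
          |x| < r <= r1 / 2.\<close>
        have hb: "norm (h (z, n)) \<le> CF * D * (1/2) ^ n" for n
        proof -
          have "norm (h (z, n)) = norm (cf (picard_sol \<kappa> \<nu>) i j) * (norm (fps_nth (transition_fps (rate \<nu> i j)) n) * norm x ^ n) * (norm b ^ i * norm a ^ j)"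
            by (simp add: h_def z mixed_coeff_def norm_mult norm_power mult_ac)
          also have "\<dots> \<le> norm (cf (picard_sol \<kappa> \<nu>) i j) * (CF * K ^ (i + j) / r1 ^ n * r ^ n) * (r ^ i * r ^ j)"
            using xab r CF0 K1 r1 by (intro mult_mono Hbound power_mono order_refl mult_nonneg_nonneg zero_le_power divide_nonneg_nonneg) auto
          also have "\<dots> = CF * norm (cf (picard_sol \<kappa> \<nu>) i j) * (r * K) ^ (i + j) * (r / r1) ^ n"
            by (simp add: power_add power_mult_distrib power_divide mult_ac)
          also have "\<dots> \<le> CF * norm (cf (picard_sol \<kappa> \<nu>) i j) * \<rho> ^ (i + j) * (1/2) ^ n"
            using r r1 CF0 K1 \<rho>0 by (intro mult_mono power_mono order_refl mult_nonneg_nonneg zero_le_power) (auto simp: field_simps)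
          finally show ?thesis by (simp add: D_def mult.assoc)
        qed
        have geo: "((\<lambda>n. CF * D * (1/2) ^ n) has_sum (CF * D * 2)) UNIV"
        proof (rule has_sum_cmult_right)
          have "(\<lambda>n. (1/2 :: real) ^ n) sums 2" using geometric_sums[of "1/2 :: real"] by simp
          then show "((\<lambda>n. (1/2 :: real) ^ n) has_sum 2) UNIV" by (rule norm_summable_imp_has_sum[rotated]) (auto intro: summable_geometric)
        qed
        show n: "(\<lambda>n. norm (h (z, n))) summable_on UNIV"
          by (rule summable_on_comparison_test[OF has_sum_imp_summable[OF geo]]) (use hb in auto)
        have "(\<Sum>\<^sub>\<infinity>n. norm (h (z, n))) \<le> (\<Sum>\<^sub>\<infinity>n. CF * D * (1/2) ^ n)"
          by (rule infsum_mono[OF n has_sum_imp_summable[OF geo]]) (rule hb)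
        also have "\<dots> = CF * D * 2" using geo by (rule infsumI)
        finally show "(\<Sum>\<^sub>\<infinity>n. norm (h (z, n))) \<le> 2 * CF * (case z of (i, j) \<Rightarrow> norm (cf (picard_sol \<kappa> \<nu>) i j) * \<rho> ^ (i + j))"
          by (simp add: z D_def mult_ac)
        have "(\<lambda>n. fps_nth (transition_fps (rate \<nu> i j)) n * x ^ n) sums (F x / (2 * \<i>) * exp (rate \<nu> i j * nome_shift x))"
          by (rule has_fps_expansion_imp_sums_complex[OF Hexp, where r = "ereal R"]) (use Hhol xR(1)[OF s] in \<open>auto simp: x_def\<close>)
        then have "(\<lambda>n. cf (picard_sol \<kappa> \<nu>) i j * b ^ i * a ^ j * (fps_nth (transition_fps (rate \<nu> i j)) n * x ^ n)) sums
            (cf (picard_sol \<kappa> \<nu>) i j * b ^ i * a ^ j * (F x / (2 * \<i>) * exp (rate \<nu> i j * nome_shift x)))" by (rule sums_mult)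
        moreover have "cf (picard_sol \<kappa> \<nu>) i j * b ^ i * a ^ j * (fps_nth (transition_fps (rate \<nu> i j)) n * x ^ n) = h (z, n)" for n
          by (simp add: h_def z mixed_coeff_def mult_ac)
        \<comment> \<open>The exponential of \<open>rate\<close> times \<open>nome_shift\<close>
          supplies exactly the factors that turn B^i A^j into Z0^i W0^j.\<close>
        moreover have "cf (picard_sol \<kappa> \<nu>) i j * b ^ i * a ^ j * (F x / (2 * \<i>) * exp (rate \<nu> i j * nome_shift x)) = F x / (2 * \<i>) * (cf (picard_sol \<kappa> \<nu>) i j * Z0 s ^ i * W0 s ^ j)"
        proof -
          have "exp (rate \<nu> i j * nome_shift x) = exp (\<nu> * nome_shift x) ^ i * exp ((2 - \<nu>) * nome_shift x) ^ j"
            by (simp add: rate_def exp_of_nat_mult[symmetric] exp_add[symmetric] algebra_simps)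
          then show ?thesis by (simp add: Z0B W0A x_def a_def b_def power_mult_distrib mult_ac)
        qed
        ultimately have "(\<lambda>n. h (z, n)) sums (F x / (2 * \<i>) * (cf (picard_sol \<kappa> \<nu>) i j * Z0 s ^ i * W0 s ^ j))" by (simp only:)
        moreover have "summable (\<lambda>n. norm (h (z, n)))" using n by (rule summable_on_imp_summable)
        ultimately show "((\<lambda>n. h (z, n)) has_sum (case z of (i, j) \<Rightarrow> F x / (2 * \<i>) * (cf (picard_sol \<kappa> \<nu>) i j * Z0 s ^ i * W0 s ^ j))) UNIV"
          unfolding z split by (intro norm_summable_imp_has_sum) auto
      qed
      have hs: "h summable_on (UNIV \<times> UNIV)"
      proof -
        have "(\<lambda>y. norm (h y)) summable_on (UNIV \<times> UNIV)"
        proof (rule summable_on_SigmaI)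
          show "((\<lambda>n. norm (h (z, n))) has_sum (\<Sum>\<^sub>\<infinity>n. norm (h (z, n)))) UNIV" for z by (rule has_sum_infsum[OF rown])
          show "(\<lambda>z. \<Sum>\<^sub>\<infinity>n. norm (h (z, n))) summable_on UNIV"
            by (rule summable_on_comparison_test[OF summable_on_cmult_right[OF picard_sol_norm'(1)[unfolded wnorm_finite_def], of "2 * CF"] rowb])
               (intro infsum_nonneg norm_ge_zero)
        qed auto
        then show ?thesis by (rule abs_summable_summable)
      qed
      have "((\<lambda>z. case z of (i, j) \<Rightarrow> F x / (2 * \<i>) * (cf (picard_sol \<kappa> \<nu>) i j * Z0 s ^ i * W0 s ^ j)) has_sum infsum h (UNIV \<times> UNIV)) UNIV"
        by (rule has_sum_SigmaD[OF has_sum_infsum[OF hs] row])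
      moreover have "((\<lambda>z. case z of (i, j) \<Rightarrow> F x / (2 * \<i>) * (cf (picard_sol \<kappa> \<nu>) i j * Z0 s ^ i * W0 s ^ j)) has_sum v s) UNIV"
        using has_sum_cmult_right[OF eval2_has_sum[OF picard_sol_norm'(1), of "Z0 s" "W0 s"], of "F x / (2 * \<i>)"] lt0[OF s]
        by (simp add: v_def V_def Z0_def W0_def x_def case_prod_unfold less_imp_le)
      ultimately have vh: "v s = infsum h UNIV" using has_sum_unique by fastforce
      have hs': "(\<lambda>((i, j), n). mixed_coeff \<kappa> \<nu> i j n * x ^ n * b ^ i * a ^ j) summable_on UNIV" using hs by (simp add: h_def)
      have ab: "a * b = x\<^sup>2 / 256" by (simp add: a_def b_def x_def AB_eq)
      obtain Sa Sb Sc where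
        "((\<lambda>n. coeff_a \<kappa> n \<nu> * x ^ n) has_sum Sa) {1..}"
        "((\<lambda>(n, m). coeff_b \<kappa> n m \<nu> * x ^ n * a ^ m) has_sum Sb) (UNIV \<times> {1..})"
        "((\<lambda>(n, m). coeff_c \<kappa> n m \<nu> * x ^ n * b ^ m) has_sum Sc) (UNIV \<times> {1..})"
        "infsum h UNIV = Sa + Sb + Sc"
        using regroup_has_sums[OF ab hs'] unfolding h_def by blast
      then show ?thesis unfolding vh x_def a_def b_def by blast
    qed
    moreover have "norm (v s) \<le> M * (norm (exp s) + norm (A \<nu>1 \<nu> s) + norm (B \<nu>1 \<nu> s))" if s: "s \<in> S" for s
    proof -
      have "norm (V (t s)) \<le> (norm (Z0 s) + norm (W0 s)) / \<rho>"
        using norm_ev'(1)[of "Z0 s" "W0 s"] lt0[OF s] \<rho>(1) by (simp add: V_def Z0_def W0_def less_imp_le)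
      also have "\<dots> \<le> (K * norm (B \<nu>1 \<nu> s) + K * norm (A \<nu>1 \<nu> s)) / \<rho>"
        using nZ0[OF s] nW0[OF s] \<rho>(1) by (intro divide_right_mono add_mono) auto
      finally have nV: "norm (V (t s)) \<le> (K * norm (B \<nu>1 \<nu> s) + K * norm (A \<nu>1 \<nu> s)) / \<rho>" .
      have "norm (F (exp s) / (2 * \<i>)) \<le> CF"
        using CF[OF xR(2)[OF s]] CF0 by (simp add: norm_divide norm_mult)
      then have "norm (v s) \<le> CF * ((K * norm (B \<nu>1 \<nu> s) + K * norm (A \<nu>1 \<nu> s)) / \<rho>)"
        unfolding v_def norm_mult[of "F (exp s) / (2 * \<i>)"] using nV CF0 by (intro mult_mono) auto
      also have "\<dots> = M * (norm (A \<nu>1 \<nu> s) + norm (B \<nu>1 \<nu> s))" by (simp add: M_def field_simps)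
      also have "\<dots> \<le> M * (norm (exp s) + norm (A \<nu>1 \<nu> s) + norm (B \<nu>1 \<nu> s))"
        using M0 by (intro mult_left_mono) auto
      finally show ?thesis .
    qed
    ultimately show ?thesis
      unfolding elliptic_solution_def Let_def \<kappa>_def[symmetric] S_def[symmetric] by blast
  qed
  then show ?thesis using that r(1,2) by blast
qed

theorem theorem3:
  fixes \<mu> :: complex
  shows "\<exists>(a :: nat \<Rightarrow> complex \<Rightarrow> complex)
          (b :: nat \<Rightarrow> nat \<Rightarrow> complex \<Rightarrow> complex)
          (c :: nat \<Rightarrow> nat \<Rightarrow> complex \<Rightarrow> complex)
          (M :: complex \<Rightarrow> real).
    (\<forall>n\<ge>1. rational_function_on admissible (a n)) \<and>
    (\<forall>n. \<forall>m\<ge>1. rational_function_on admissible (b n m)) \<and>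
    (\<forall>n. \<forall>m\<ge>1. rational_function_on admissible (c n m)) \<and>
    (\<forall>\<nu>1 :: complex. \<forall>\<nu>2 \<in> admissible. \<exists>r v.
       0 < r \<and> r < 1 \<and>
       PVI_solution_on \<mu> (PVI_domain r \<nu>1 \<nu>2)
         (\<lambda>s. wp (\<nu>1 * \<omega>1 s + \<nu>2 * \<omega>2 s + v s) (\<omega>1 s) (\<omega>2 s) + (1 + exp s) / 3) \<and>
       v holomorphic_on PVI_domain r \<nu>1 \<nu>2 \<and>
       (\<forall>s \<in> PVI_domain r \<nu>1 \<nu>2.
          (\<lambda>n. a n \<nu>2 * exp s ^ n) summable_on {1..} \<and>
          (\<lambda>(n, m). b n m \<nu>2 * exp s ^ n * A \<nu>1 \<nu>2 s ^ m) summable_on UNIV \<times> {1..} \<and>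
          (\<lambda>(n, m). c n m \<nu>2 * exp s ^ n * B \<nu>1 \<nu>2 s ^ m) summable_on UNIV \<times> {1..} \<and>
          v s = (\<Sum>\<^sub>\<infinity>n\<in>{1..}. a n \<nu>2 * exp s ^ n)
              + (\<Sum>\<^sub>\<infinity>(n, m)\<in>UNIV \<times> {1..}. b n m \<nu>2 * exp s ^ n * A \<nu>1 \<nu>2 s ^ m)
              + (\<Sum>\<^sub>\<infinity>(n, m)\<in>UNIV \<times> {1..}. c n m \<nu>2 * exp s ^ n * B \<nu>1 \<nu>2 s ^ m)) \<and>
       (\<forall>s \<in> PVI_domain r \<nu>1 \<nu>2.
          norm (v s) \<le> M \<nu>2 * (norm (exp s) + norm (A \<nu>1 \<nu>2 s) + norm (B \<nu>1 \<nu>2 s))))"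
proof -
  define \<kappa> where "\<kappa> = 2 * (2 * \<mu> - 1)\<^sup>2"
  \<comment> \<open>Choice is made over \<nu>2 alone: M has to be a function of \<nu>2, so it is
    selected before \<nu>1 is given.\<close>
  have "\<forall>\<nu>\<in>admissible. \<exists>r M. 0 < r \<and> r < 1 \<and> (\<forall>\<nu>1. \<exists>v. elliptic_solution \<mu> \<nu> r M \<nu>1 v)"
    using elliptic_PVI_family by metis
  then obtain r where "\<forall>\<nu>\<in>admissible. \<exists>M. 0 < r \<nu> \<and> r \<nu> < 1 \<and> (\<forall>\<nu>1. \<exists>v. elliptic_solution \<mu> \<nu> (r \<nu>) M \<nu>1 v)"
    unfolding bchoice_iff by blast
  then obtain M where rM: "\<And>\<nu>. \<nu> \<in> admissible \<Longrightarrow> 0 < r \<nu> \<and> r \<nu> < 1 \<and> (\<forall>\<nu>1. \<exists>v. elliptic_solution \<mu> \<nu> (r \<nu>) (M \<nu>) \<nu>1 v)"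
    unfolding bchoice_iff by blast
  show ?thesis
  \<comment> \<open>The coefficient functions involve \<mu> through \<kappa> but not \<nu>1, which
    is why they can be named in front of all other quantifiers.\<close>
  proof (rule exI[of _ "coeff_a \<kappa>"], rule exI[of _ "coeff_b \<kappa>"], rule exI[of _ "coeff_c \<kappa>"], rule exI[of _ M],
      intro conjI allI impI ballI rational_coeffs)
    fix \<nu>1 \<nu>2 :: complex assume \<nu>2: "\<nu>2 \<in> admissible"
    from rM[OF \<nu>2] obtain v where "elliptic_solution \<mu> \<nu>2 (r \<nu>2) (M \<nu>2) \<nu>1 v" by blast
    then have v:
       "PVI_solution_on \<mu> (PVI_domain (r \<nu>2) \<nu>1 \<nu>2)
         (\<lambda>s. wp (\<nu>1 * \<omega>1 s + \<nu>2 * \<omega>2 s + v s) (\<omega>1 s) (\<omega>2 s) + (1 + exp s) / 3)"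
       "v holomorphic_on PVI_domain (r \<nu>2) \<nu>1 \<nu>2"
       "\<And>s. s \<in> PVI_domain (r \<nu>2) \<nu>1 \<nu>2 \<Longrightarrow> \<exists>Sa Sb Sc.
          ((\<lambda>n. coeff_a \<kappa> n \<nu>2 * exp s ^ n) has_sum Sa) {1..} \<and>
          ((\<lambda>(n, m). coeff_b \<kappa> n m \<nu>2 * exp s ^ n * A \<nu>1 \<nu>2 s ^ m) has_sum Sb) (UNIV \<times> {1..}) \<and>
          ((\<lambda>(n, m). coeff_c \<kappa> n m \<nu>2 * exp s ^ n * B \<nu>1 \<nu>2 s ^ m) has_sum Sc) (UNIV \<times> {1..}) \<and>
          v s = Sa + Sb + Sc"
       "\<And>s. s \<in> PVI_domain (r \<nu>2) \<nu>1 \<nu>2 \<Longrightarrow> norm (v s) \<le> M \<nu>2 * (norm (exp s) + norm (A \<nu>1 \<nu>2 s) + norm (B \<nu>1 \<nu>2 s))"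
      unfolding elliptic_solution_def Let_def \<kappa>_def by blast+
    have sums: "(\<lambda>n. coeff_a \<kappa> n \<nu>2 * exp s ^ n) summable_on {1..} \<and>
          (\<lambda>(n, m). coeff_b \<kappa> n m \<nu>2 * exp s ^ n * A \<nu>1 \<nu>2 s ^ m) summable_on UNIV \<times> {1..} \<and>
          (\<lambda>(n, m). coeff_c \<kappa> n m \<nu>2 * exp s ^ n * B \<nu>1 \<nu>2 s ^ m) summable_on UNIV \<times> {1..} \<and>
          v s = (\<Sum>\<^sub>\<infinity>n\<in>{1..}. coeff_a \<kappa> n \<nu>2 * exp s ^ n)
              + (\<Sum>\<^sub>\<infinity>(n, m)\<in>UNIV \<times> {1..}. coeff_b \<kappa> n m \<nu>2 * exp s ^ n * A \<nu>1 \<nu>2 s ^ m)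
              + (\<Sum>\<^sub>\<infinity>(n, m)\<in>UNIV \<times> {1..}. coeff_c \<kappa> n m \<nu>2 * exp s ^ n * B \<nu>1 \<nu>2 s ^ m)"
      if s: "s \<in> PVI_domain (r \<nu>2) \<nu>1 \<nu>2" for s
    proof -
      obtain Sa Sb Sc where S:
        "((\<lambda>n. coeff_a \<kappa> n \<nu>2 * exp s ^ n) has_sum Sa) {1..}"
        "((\<lambda>(n, m). coeff_b \<kappa> n m \<nu>2 * exp s ^ n * A \<nu>1 \<nu>2 s ^ m) has_sum Sb) (UNIV \<times> {1..})"
        "((\<lambda>(n, m). coeff_c \<kappa> n m \<nu>2 * exp s ^ n * B \<nu>1 \<nu>2 s ^ m) has_sum Sc) (UNIV \<times> {1..})"
        "v s = Sa + Sb + Sc" using v(3)[OF s] by blast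
      show ?thesis
        using S(1-3)[THEN has_sum_imp_summable] unfolding S(4) S(1-3)[THEN infsumI] by blast
    qed
    show "\<exists>r v. 0 < r \<and> r < 1 \<and>
       PVI_solution_on \<mu> (PVI_domain r \<nu>1 \<nu>2)
         (\<lambda>s. wp (\<nu>1 * \<omega>1 s + \<nu>2 * \<omega>2 s + v s) (\<omega>1 s) (\<omega>2 s) + (1 + exp s) / 3) \<and>
       v holomorphic_on PVI_domain r \<nu>1 \<nu>2 \<and>
       (\<forall>s \<in> PVI_domain r \<nu>1 \<nu>2.
          (\<lambda>n. coeff_a \<kappa> n \<nu>2 * exp s ^ n) summable_on {1..} \<and>
          (\<lambda>(n, m). coeff_b \<kappa> n m \<nu>2 * exp s ^ n * A \<nu>1 \<nu>2 s ^ m) summable_on UNIV \<times> {1..} \<and>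
          (\<lambda>(n, m). coeff_c \<kappa> n m \<nu>2 * exp s ^ n * B \<nu>1 \<nu>2 s ^ m) summable_on UNIV \<times> {1..} \<and>
          v s = (\<Sum>\<^sub>\<infinity>n\<in>{1..}. coeff_a \<kappa> n \<nu>2 * exp s ^ n)
              + (\<Sum>\<^sub>\<infinity>(n, m)\<in>UNIV \<times> {1..}. coeff_b \<kappa> n m \<nu>2 * exp s ^ n * A \<nu>1 \<nu>2 s ^ m)
              + (\<Sum>\<^sub>\<infinity>(n, m)\<in>UNIV \<times> {1..}. coeff_c \<kappa> n m \<nu>2 * exp s ^ n * B \<nu>1 \<nu>2 s ^ m)) \<and>
       (\<forall>s \<in> PVI_domain r \<nu>1 \<nu>2.
          norm (v s) \<le> M \<nu>2 * (norm (exp s) + norm (A \<nu>1 \<nu>2 s) + norm (B \<nu>1 \<nu>2 s)))"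
      using rM[OF \<nu>2] v(1,2,4) sums by (intro exI[of _ "r \<nu>2"] exI[of _ v]) blast
  qed
qed

end
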